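(* Let $\bar u$ be a strongly stable solution of the problem of minimising $\mathcal E$ locally over $\dot{\mathcal W}^{1,2}$, i.e. $\bar u\in\dot{\mathcal W}^{1,2}$, $\delta\mathcal E(\bar u)=0$, and $\langle\delta^2\mathcal E(\bar u)v,v\rangle\ge c\|\nabla v\|_{L^2}^2$ for all $v\in\dot{\mathcal W}^{\rm c}$ and some $c>0$. Consider a family, indexed by $R$, of atomistic-to-continuum approximations (atomistic regions $\Omega^{\rm a}_R$, interface regions $\Omega^{\rm i}_R$, domains $\omega_R$, triangulations $\mathcal T_R$ with mesh-size function $h$, energies $\mathcal E_R^{\rm ac}$ on $\dot{\mathcal W}^0(\mathcal T_R)$). Assume that: (a) for some $c_0>0$, $B_R\cap\Lambda\subset\Omega_R^{\rm a}$ and $B_{R_{\rm c}}\subset\omega_R\subset B_{c_0R_{\rm c}}$; (b) there exist $\eta>0$ and $c_1>0$ such that, whenever $\|hD^2\bar u\|_{\ell^2(\Lambda\cap(\omega_R\setminus B_R))}+\|D\bar u\|_{\ell^2(\Lambda\setminus B_{R_{\rm c}/2})}\le\eta$, there exists a strongly stable solution $\bar u_R^{\rm ac}$ of $\bar u^{\rm ac}_R\in\arg\min\{\mathcal E_R^{\rm ac}(u):u\in\dot{\mathcal W}^0(\mathcal T_R)\}$ satisfying $$\|\nabla\bar u_R^{\rm ac}-\nabla\bar u\|_{L^2}\le c_1\big(\|hD^2\bar u\|_{\ell^2(\Lambda\cap(\omega_R\setminus B_R))}+\|D\bar u\|_{\ell^2(\Lambda\setminus B_{R_{\rm c}/2})}\big);$$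 (c) for some constants $c_2,c_3,c_4>0$, $$c_2R^{1+2/d}\le R_{\rm c}\le c_3R^{1+2/d}\quad\text{and}\quad|h(x)|\le c_4\Big(\frac{|x|}{R}\Big)^\beta\ \text{ for } x\in\omega_R\setminus B_R,\ \text{ with }\ \beta<\frac{d+2}{2}.$$ Then there exists a constant $C$, depending on $\eta,c_2,c_3,c_4$ and $\beta$ (and on the fixed data $c_0,c_1$, $\bar u$ and the potentials) but not on $R$, such that for $R$ sufficiently large $$\|\nabla\bar u_R^{\rm ac}-\nabla\bar u\|_{L^2}\le CR^{-d/2-1}.$$
   Context: Setting (point defect). Let $d\in\{2,3\}$, $A\in\mathbb R^{d\times d}$ nonsingular, $B_r$ the ball of radius $r$ centred at $0$. The reference configuration $\Lambda\subset\mathbb R^d$ satisfies, for some $R_{\rm def}>0$, $\Lambda\setminus B_{R_{\rm def}}=A\mathbb Z^d\setminus B_{R_{\rm def}}$ and $\Lambda\cap B_{R_{\rm def}}$ is finite. $\mathcal T_\Lambda$ is a regular (conforming, shape-regular) partition of $\mathbb R^d$ into triangles ($d=2$) or tetrahedra ($d=3$) with node set $\Lambda$, homogeneous outside $B_{R_{\rm def}}$: if $T\in\mathcal T_\Lambda$, $\rho\in A\mathbb Z^d$ and $T,\rho+T\subset\mathbb R^d\setminus B_{R_{\rm def}}$, then $\rho+T\in\mathcal T_\Lambda$. For $u:\Lambda\to\mathbb R^d$, $Iu$ is its continuous piecewise affine interpolant with respect to $\mathcal T_\Lambda$ and $\nabla u:=\nabla Iu$. Define $\dot{\mathcal W}^{\rm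 c}:=\{u:\Lambda\to\mathbb R^d:\ \mathrm{supp}(\nabla u)\text{ compact}\}$ and $\dot{\mathcal W}^{1,2}:=\{u:\Lambda\to\mathbb R^d:\ \nabla u\in L^2\}$ (with semi-norm $\|\nabla u\|_{L^2}$). Stencils: for each $\ell\in\Lambda$ a set $\mathcal R_\ell\subset(B_{r_{\rm cut}}\cap(\Lambda-\ell))\setminus\{0\}$ is given, $r_{\rm cut}>0$ fixed; $D_\rho u(\ell):=u(\ell+\rho)-u(\ell)$, $Du(\ell):=(D_\rho u(\ell))_{\rho\in\mathcal R_\ell}$, $D^2u:=DDu$. If $(\ell,\ell+\rho)$ is an edge of $\mathcal T_\Lambda$ then $\rho\in\mathcal R_\ell$. Energy: $V_\ell\in C^k((\mathbb R^d)^{\mathcal R_\ell})$, $k\ge4$, with $V_\ell(0)=0$. For $|\ell|\ge R_{\rm def}$: $\mathcal R_\ell\equiv\mathcal R$, $V_\ell\equiv V$, and point symmetry holds: $-\mathcal R=\mathcal R$ and $V((-g_{-\rho})_{\rho\in\mathcal R})=V(g)$ for all $g\in(\mathbb R^d)^{\mathcal R}$. Moreover $Ae_n\in\mathcal R$, $n=1,\dots,d$. $\mathcal E(u):=\sum_{\ell\in\Lambda}V_\ell(Du(\ell))$ for $u\in\dot{\mathcal W}^{\rm c}$; $\mathcal E$ has a unique continuous extension to $\dot{\mathcal W}^{1,2}$, also denoted $\mathcal E$, which is of class $C^k$. Atomistic-to-continuum coupling: $\Omega_R^{\rm a}\subset\Lambda$ (atomistic region), $\Omega_R^{\rm i}\subset\Lambda$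 (interface region), $\omega_R\subset\mathbb R^d$ a simply connected domain with $\Omega_R^{\rm a}\cup\Omega_R^{\rm i}\subset\omega_R$; $\mathcal T_R$ is a regular triangulation of $\omega_R$, $h(x):=\max_{T\in\mathcal T_R,\,x\in T}\mathrm{diam}(T)$; $\dot{\mathcal W}^0(\mathcal T_R):=\{u\in C(\mathbb R^d;\mathbb R^d): u|_T\text{ affine for all }T\in\mathcal T_R,\ u=0\text{ on }\mathbb R^d\setminus\omega_R\}$; $$\mathcal E_R^{\rm ac}(u):=\sum_{\ell\in\Omega_R^{\rm a}}V_\ell(Du(\ell))+\sum_{\ell\in\Omega_R^{\rm i}}V_\ell^{\rm i}(Du(\ell))+\sum_{T\in\mathcal T_R}v_T^{\rm eff}\,W(\nabla u|_T),$$ where $v_T^{\rm eff}:=\mathrm{vol}\big(T\setminus\bigcup_{\ell\in\Omega_R^{\rm a}\cup\Omega_R^{\rm i}}\mathrm{vor}(\ell)\big)$, $\mathrm{vor}(\ell)$ is the Voronoi cell of $\ell$, $V_\ell^{\rm i}\in C^k((\mathbb R^d)^{\mathcal R})$ are given interface potentials, and $W(F):=V((F\rho)_{\rho\in\mathcal R})$ is the Cauchy–Born strain energy function. $\arg\min$ denotes local minimisers; "strongly stable solution" means a critical point at which the second variation is bounded below by a positive multiple of $\|\nabla v\|_{L^2}^2$ on $\dot{\mathcal W}^0(\mathcal T_R)$. *)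

theory Defs
  imports "HOL-Analysis.Analysis"
begin

section \<open>Partitions into simplices and piecewise affine functions\<close>

text \<open>Elements are closed simplices of full dimension. Conformity: two elements meet in a common
  (possibly empty) face. Shape regularity: the inscribed balls are comparable to the diameters.\<close>

definition regular_partition :: "(real^'n) set set \<Rightarrow> (real^'n) set \<Rightarrow> bool" where
  "regular_partition \<T> S \<longleftrightarrow>
     (\<forall>T\<in>\<T>. int CARD('n) simplex T) \<and>
     (\<forall>T\<in>\<T>. \<forall>T'\<in>\<T>. (T \<inter> T') face_of T) \<and>
     (\<exists>\<kappa>>0. \<forall>T\<in>\<T>. \<exists>x. cball x (\<kappa> * diameter T) \<subseteq> T) \<and>
     \<Union>\<T> = S"

definition nodes :: "(real^'n) set set \<Rightarrow> (real^'n) set" where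
  "nodes \<T> = (\<Union>T\<in>\<T>. {x. x extreme_point_of T})"

definition piecewise_affine :: "(real^'n) set set \<Rightarrow> (real^'n \<Rightarrow> real^'n) \<Rightarrow> bool" where
  "piecewise_affine \<T> f \<longleftrightarrow> (\<forall>T\<in>\<T>. \<exists>F b. \<forall>x\<in>T. f x = F *v x + b)"

definition gradient_on :: "(real^'n) set \<Rightarrow> (real^'n \<Rightarrow> real^'n) \<Rightarrow> real^'n^'n" where
  "gradient_on T f = (THE F. \<exists>b. \<forall>x\<in>T. f x = F *v x + b)"

definition mesh_size :: "(real^'n) set set \<Rightarrow> real^'n \<Rightarrow> real" where
  "mesh_size \<T> x = Max (diameter ` {T\<in>\<T>. x \<in> T})"


section \<open>Displacements\<close>

text \<open>A displacement on \<open>\<Lambda>\<close> is represented by a total function of which only the values on \<open>\<Lambda>\<close>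
  matter.\<close>

definition interpolant ::
  "(real^'n) set \<Rightarrow> (real^'n) set set \<Rightarrow> (real^'n \<Rightarrow> real^'n) \<Rightarrow> (real^'n \<Rightarrow> real^'n)" where
  "interpolant \<Lambda> \<T> u =
     (THE f. continuous_on UNIV f \<and> piecewise_affine \<T> f \<and> (\<forall>l\<in>\<Lambda>. f l = u l))"

text \<open>The gradient is meaningful off the null set of points where the function is not
  differentiable. The norm on matrices \<^typ>\<open>real^'n^'n\<close> is the Frobenius norm.\<close>

definition gradient :: "(real^'n \<Rightarrow> real^'n) \<Rightarrow> real^'n \<Rightarrow> real^'n^'n" where
  "gradient f x = jacobian f (at x)"

definition square_integrable :: "(real^'n \<Rightarrow> 'b::euclidean_space) \<Rightarrow> bool" where
  "square_integrable g \<longleftrightarrow>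
     g \<in> borel_measurable lebesgue \<and> integrable lebesgue (\<lambda>x. (norm (g x))\<^sup>2)"

definition L2_norm :: "(real^'n \<Rightarrow> 'b::euclidean_space) \<Rightarrow> real" where
  "L2_norm g = sqrt (LINT x|lebesgue. (norm (g x))\<^sup>2)"

text \<open>At a point where a piecewise affine function is not differentiable, some adjacent element
  carries a nonzero gradient; hence the closure below is the support of the a.e. defined gradient,
  whatever value \<^const>\<open>gradient\<close> takes at such points.\<close>

definition W_c :: "(real^'n) set \<Rightarrow> (real^'n) set set \<Rightarrow> (real^'n \<Rightarrow> real^'n) set" where
  "W_c \<Lambda> \<T> = {u. compact (closure {x. gradient (interpolant \<Lambda> \<T> u) x \<noteq> 0})}"

definition W_12 :: "(real^'n) set \<Rightarrow> (real^'n) set set \<Rightarrow> (real^'n \<Rightarrow> real^'n) set" where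
  "W_12 \<Lambda> \<T> = {u. square_integrable (gradient (interpolant \<Lambda> \<T> u))}"

definition W_12_seminorm :: "(real^'n) set \<Rightarrow> (real^'n) set set \<Rightarrow> (real^'n \<Rightarrow> real^'n) \<Rightarrow> real" where
  "W_12_seminorm \<Lambda> \<T> u = L2_norm (gradient (interpolant \<Lambda> \<T> u))"


section \<open>Finite differences\<close>

definition fdiff :: "real^'n \<Rightarrow> (real^'n \<Rightarrow> real^'n) \<Rightarrow> real^'n \<Rightarrow> real^'n" where
  "fdiff \<rho> u l = u (l + \<rho>) - u l"

definition stencil_norm :: "(real^'n) set \<Rightarrow> (real^'n \<Rightarrow> real^'n) \<Rightarrow> real" where
  "stencil_norm S g = L2_set (\<lambda>\<rho>. norm (g \<rho>)) S"

text \<open>The moduli of \<open>Du(l)\<close> and \<open>D\<^sup>2u(l) = (D\<^sub>\<rho> D\<^sub>\<sigma> u(l))\<close>.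
  In \<open>D\<^sub>\<rho> Du(l) = Du(l+\<rho>) - Du(l)\<close> only the components \<open>\<sigma>\<close> belonging to the stencils of both sites
  are meaningful; away from the defect all stencils coincide and this is no restriction.\<close>

definition D1_norm ::
  "(real^'n \<Rightarrow> (real^'n) set) \<Rightarrow> (real^'n \<Rightarrow> real^'n) \<Rightarrow> real^'n \<Rightarrow> real" where
  "D1_norm \<R> u l = stencil_norm (\<R> l) (\<lambda>\<rho>. fdiff \<rho> u l)"

definition D2_norm ::
  "(real^'n \<Rightarrow> (real^'n) set) \<Rightarrow> (real^'n \<Rightarrow> real^'n) \<Rightarrow> real^'n \<Rightarrow> real" where
  "D2_norm \<R> u l =
     L2_set (\<lambda>(\<rho>, \<sigma>). norm (fdiff \<rho> (fdiff \<sigma> u) l)) (SIGMA \<rho>:\<R> l. \<R> l \<inter> \<R> (l + \<rho>))"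

text \<open>All sums to which this is applied converge: they are finite, or follow from
  \<open>\<nabla>u \<in> L\<^sup>2\<close>.\<close>

definition l2_norm :: "('a \<Rightarrow> real) \<Rightarrow> 'a set \<Rightarrow> real" where
  "l2_norm f S = sqrt (\<Sum>\<^sub>\<infinity>x\<in>S. (f x)\<^sup>2)"


section \<open>Differentiability classes and variations\<close>

text \<open>\<open>F\<close> is \<open>k\<close> times continuously Frechet differentiable on the linear space \<open>W\<close> of functions
  with semi-norm \<open>p\<close>: \<open>D j u\<close> is the \<open>j\<close>-th derivative at \<open>u\<close>, a bounded \<open>j\<close>-linear form taking the
  list of its arguments.

  The space \<open>(\<real>\<^sup>d)\<^sup>S\<close>, \<open>S\<close> finite, is represented by all total functions with semi-norm
  \<open>stencil_norm S\<close>. A functional that is differentiable with respect to this semi-norm depends on the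
  values on \<open>S\<close> only.\<close>

definition Ck_on ::
  "nat \<Rightarrow> ('a \<Rightarrow> 'b::real_vector) set \<Rightarrow> (('a \<Rightarrow> 'b) \<Rightarrow> real) \<Rightarrow> (('a \<Rightarrow> 'b) \<Rightarrow> real) \<Rightarrow> bool" where
  "Ck_on k W p F \<longleftrightarrow>
     (\<exists>D :: nat \<Rightarrow> ('a \<Rightarrow> 'b) \<Rightarrow> ('a \<Rightarrow> 'b) list \<Rightarrow> real.
        (\<forall>u\<in>W. D 0 u [] = F u) \<and>
        (\<forall>j\<le>k. \<forall>u\<in>W. \<forall>vs\<in>lists W. \<forall>i<j. \<forall>v\<in>W. \<forall>w\<in>W. \<forall>a b. length vs = j \<longrightarrow>
            D j u (vs[i := (\<lambda>x. a *\<^sub>R v x + b *\<^sub>R w x)])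
              = a * D j u (vs[i := v]) + b * D j u (vs[i := w])) \<and>
        (\<forall>j\<le>k. \<forall>u\<in>W. \<exists>M. \<forall>vs\<in>lists W. length vs = j \<longrightarrow>
            \<bar>D j u vs\<bar> \<le> M * prod_list (map p vs)) \<and>
        (\<forall>j<k. \<forall>u\<in>W. \<forall>\<epsilon>>0. \<exists>\<delta>>0. \<forall>w\<in>W. p w < \<delta> \<longrightarrow>
            (\<forall>vs\<in>lists W. length vs = j \<longrightarrow>
               \<bar>D j (\<lambda>x. u x + w x) vs - D j u vs - D (Suc j) u (w # vs)\<bar>
                 \<le> \<epsilon> * p w * prod_list (map p vs))) \<and>
        (\<forall>u\<in>W. \<forall>\<epsilon>>0. \<exists>\<delta>>0. \<forall>w\<in>W. p w < \<delta> \<longrightarrow>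
            (\<forall>vs\<in>lists W. length vs = k \<longrightarrow>
               \<bar>D k (\<lambda>x. u x + w x) vs - D k u vs\<bar> \<le> \<epsilon> * prod_list (map p vs))))"

text \<open>\<open>\<langle>\<delta>F(u), v\<rangle>\<close> and \<open>\<langle>\<delta>\<^sup>2F(u) v, v\<rangle>\<close>, for \<open>F\<close> of class \<open>C\<^sup>2\<close>.\<close>

definition first_variation ::
  "(('a \<Rightarrow> 'b::real_vector) \<Rightarrow> real) \<Rightarrow> ('a \<Rightarrow> 'b) \<Rightarrow> ('a \<Rightarrow> 'b) \<Rightarrow> real" where
  "first_variation F u v = deriv (\<lambda>t. F (\<lambda>x. u x + t *\<^sub>R v x)) 0"

definition second_variation ::
  "(('a \<Rightarrow> 'b::real_vector) \<Rightarrow> real) \<Rightarrow> ('a \<Rightarrow> 'b) \<Rightarrow> ('a \<Rightarrow> 'b) \<Rightarrow> real" where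
  "second_variation F u v = (deriv ^^ 2) (\<lambda>t. F (\<lambda>x. u x + t *\<^sub>R v x)) 0"


section \<open>The point defect\<close>

definition bravais_lattice :: "real^'n^'n \<Rightarrow> (real^'n) set" where
  "bravais_lattice A = {A *v z | z. \<forall>i. z $ i \<in> \<int>}"

text \<open>\<open>\<R> l\<close> and \<open>V l\<close> are the stencil and the potential of the site \<open>l\<close>, \<open>\<R>h\<close> and \<open>Vh\<close> those of the
  homogeneous lattice. Balls are open, so that the complement of \<open>ball 0 Rdef\<close> is \<open>\<bar>l\<bar> \<ge> Rdef\<close>.\<close>

locale point_defect =
  fixes A :: "real^'n^'n" and Rdef rcut :: real
    and \<Lambda> :: "(real^'n) set" and \<T> :: "(real^'n) set set"
    and \<R> :: "real^'n \<Rightarrow> (real^'n) set" and \<R>h :: "(real^'n) set"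
    and V :: "real^'n \<Rightarrow> (real^'n \<Rightarrow> real^'n) \<Rightarrow> real" and Vh :: "(real^'n \<Rightarrow> real^'n) \<Rightarrow> real"
    and k :: nat
  assumes dim: "CARD('n) \<in> {2, 3}"
    and nonsingular: "invertible A"
    and Rdef_pos: "Rdef > 0"
    and lattice_outside: "\<Lambda> - ball 0 Rdef = bravais_lattice A - ball 0 Rdef"
    and finite_core: "finite (\<Lambda> \<inter> ball 0 Rdef)"
    and partition: "regular_partition \<T> UNIV"
    and nodes_partition: "nodes \<T> = \<Lambda>"
    and homogeneous: "\<And>T \<rho>. T \<in> \<T> \<Longrightarrow> \<rho> \<in> bravais_lattice A \<Longrightarrow> T \<subseteq> - ball 0 Rdef \<Longrightarrow>
            (+) \<rho> ` T \<subseteq> - ball 0 Rdef \<Longrightarrow> (+) \<rho> ` T \<in> \<T>"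
    and rcut_pos: "rcut > 0"
    and stencil: "\<And>l. l \<in> \<Lambda> \<Longrightarrow> \<R> l \<subseteq> (ball 0 rcut \<inter> {\<rho>. l + \<rho> \<in> \<Lambda>}) - {0}"
    and edges: "\<And>l \<rho> T. l \<in> \<Lambda> \<Longrightarrow> T \<in> \<T> \<Longrightarrow> closed_segment l (l + \<rho>) edge_of T \<Longrightarrow> \<rho> \<in> \<R> l"
    and k_ge: "k \<ge> 4"
    and smooth: "\<And>l. l \<in> \<Lambda> \<Longrightarrow> Ck_on k UNIV (stencil_norm (\<R> l)) (V l)"
    and normalised: "\<And>l. l \<in> \<Lambda> \<Longrightarrow> V l (\<lambda>\<rho>. 0) = 0"
    and stencil_outside: "\<And>l. l \<in> \<Lambda> \<Longrightarrow> norm l \<ge> Rdef \<Longrightarrow> \<R> l = \<R>h"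
    and potential_outside: "\<And>l. l \<in> \<Lambda> \<Longrightarrow> norm l \<ge> Rdef \<Longrightarrow> V l = Vh"
    and stencil_symmetric: "uminus ` \<R>h = \<R>h"
    and point_symmetric: "\<And>g. Vh (\<lambda>\<rho>. - g (- \<rho>)) = Vh g"
    and stencil_basis: "\<And>n. A *v axis n 1 \<in> \<R>h"

text \<open>For \<open>u \<in> W_c\<close> only finitely many terms of the sum are nonzero.\<close>

definition atomistic_energy ::
  "(real^'n) set \<Rightarrow> (real^'n \<Rightarrow> (real^'n \<Rightarrow> real^'n) \<Rightarrow> real) \<Rightarrow> (real^'n \<Rightarrow> real^'n) \<Rightarrow> real" where
  "atomistic_energy \<Lambda> V u = (\<Sum>\<^sub>\<infinity>l\<in>\<Lambda>. V l (\<lambda>\<rho>. fdiff \<rho> u l))"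

text \<open>\<open>E\<close> is the continuous extension of the energy from \<open>W_c\<close> to \<open>W_12\<close>; by density of \<open>W_c\<close> it is
  unique on \<open>W_12\<close>.\<close>

definition energy_extension ::
  "(real^'n) set \<Rightarrow> (real^'n) set set \<Rightarrow> (real^'n \<Rightarrow> (real^'n \<Rightarrow> real^'n) \<Rightarrow> real) \<Rightarrow> nat
     \<Rightarrow> ((real^'n \<Rightarrow> real^'n) \<Rightarrow> real) \<Rightarrow> bool" where
  "energy_extension \<Lambda> \<T> V k E \<longleftrightarrow>
     (\<forall>u\<in>W_c \<Lambda> \<T>. E u = atomistic_energy \<Lambda> V u) \<and>
     Ck_on k (W_12 \<Lambda> \<T>) (W_12_seminorm \<Lambda> \<T>) E"

definition strongly_stable ::
  "(real^'n) set \<Rightarrow> (real^'n) set set \<Rightarrow> ((real^'n \<Rightarrow> real^'n) \<Rightarrow> real) \<Rightarrow> (real^'n \<Rightarrow> real^'n) \<Rightarrow> bool"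
where
  "strongly_stable \<Lambda> \<T> E u \<longleftrightarrow>
     u \<in> W_12 \<Lambda> \<T> \<and>
     (\<forall>v\<in>W_12 \<Lambda> \<T>. first_variation E u v = 0) \<and>
     (\<exists>c>0. \<forall>v\<in>W_c \<Lambda> \<T>. second_variation E u v \<ge> c * (W_12_seminorm \<Lambda> \<T> v)\<^sup>2)"


section \<open>Atomistic-to-continuum coupling\<close>

text \<open>The data for a single value of the parameter: atomistic region \<open>\<Omega>a\<close>, interface region \<open>\<Omega>i\<close>,
  computational domain \<open>\<omega>\<close>, mesh \<open>\<T>c\<close> and interface potentials \<open>Vi\<close>. The domain is open and the
  elements are closed, so the mesh covers the closure of the domain.\<close>

locale ac_coupling =
  fixes \<Lambda> :: "(real^'n) set" and \<R>h :: "(real^'n) set" and k :: nat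
    and Vi :: "real^'n \<Rightarrow> (real^'n \<Rightarrow> real^'n) \<Rightarrow> real"
    and \<Omega>a \<Omega>i \<omega> :: "(real^'n) set" and \<T>c :: "(real^'n) set set"
  assumes regions: "\<Omega>a \<subseteq> \<Lambda>" "\<Omega>i \<subseteq> \<Lambda>" "\<Omega>a \<union> \<Omega>i \<subseteq> \<omega>"
    and domain: "open \<omega>" "connected \<omega>" "\<omega> \<noteq> {}" "simply_connected \<omega>"
    and mesh: "finite \<T>c" "regular_partition \<T>c (closure \<omega>)"
    and interface_smooth: "\<And>l. l \<in> \<Omega>i \<Longrightarrow> Ck_on k UNIV (stencil_norm \<R>h) (Vi l)"

definition W_0 :: "(real^'n) set \<Rightarrow> (real^'n) set set \<Rightarrow> (real^'n \<Rightarrow> real^'n) set" where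
  "W_0 \<omega> \<T>c = {u. continuous_on UNIV u \<and> piecewise_affine \<T>c u \<and> (\<forall>x\<in>-\<omega>. u x = 0)}"

definition voronoi_cell :: "(real^'n) set \<Rightarrow> real^'n \<Rightarrow> (real^'n) set" where
  "voronoi_cell \<Lambda> l = {x. \<forall>m\<in>\<Lambda>. dist x l \<le> dist x m}"

definition effective_volume :: "(real^'n) set \<Rightarrow> (real^'n) set \<Rightarrow> (real^'n) set \<Rightarrow> real" where
  "effective_volume \<Lambda> \<Omega> T = measure lebesgue (T - (\<Union>l\<in>\<Omega>. voronoi_cell \<Lambda> l))"

definition cauchy_born :: "((real^'n \<Rightarrow> real^'n) \<Rightarrow> real) \<Rightarrow> real^'n^'n \<Rightarrow> real" where
  "cauchy_born Vh F = Vh (\<lambda>\<rho>. F *v \<rho>)"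

definition ac_energy ::
  "(real^'n) set \<Rightarrow> (real^'n \<Rightarrow> (real^'n \<Rightarrow> real^'n) \<Rightarrow> real) \<Rightarrow> ((real^'n \<Rightarrow> real^'n) \<Rightarrow> real)
     \<Rightarrow> (real^'n \<Rightarrow> (real^'n \<Rightarrow> real^'n) \<Rightarrow> real)
     \<Rightarrow> (real^'n) set \<Rightarrow> (real^'n) set \<Rightarrow> (real^'n) set set \<Rightarrow> (real^'n \<Rightarrow> real^'n) \<Rightarrow> real" where
  "ac_energy \<Lambda> V Vh Vi \<Omega>a \<Omega>i \<T>c u =
     (\<Sum>l\<in>\<Omega>a. V l (\<lambda>\<rho>. fdiff \<rho> u l)) + (\<Sum>l\<in>\<Omega>i. Vi l (\<lambda>\<rho>. fdiff \<rho> u l))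
       + (\<Sum>T\<in>\<T>c. effective_volume \<Lambda> (\<Omega>a \<union> \<Omega>i) T * cauchy_born Vh (gradient_on T u))"

definition strongly_stable_ac ::
  "(real^'n) set \<Rightarrow> (real^'n) set set \<Rightarrow> ((real^'n \<Rightarrow> real^'n) \<Rightarrow> real) \<Rightarrow> (real^'n \<Rightarrow> real^'n) \<Rightarrow> bool"
where
  "strongly_stable_ac \<omega> \<T>c Eac u \<longleftrightarrow>
     u \<in> W_0 \<omega> \<T>c \<and>
     (\<forall>v\<in>W_0 \<omega> \<T>c. first_variation Eac u v = 0) \<and>
     (\<exists>c>0. \<forall>v\<in>W_0 \<omega> \<T>c. second_variation Eac u v \<ge> c * (L2_norm (gradient v))\<^sup>2)"

text \<open>\<open>\<parallel>h D\<^sup>2u\<parallel>\<close> over the sites of \<open>\<omega> \<setminus> B\<^sub>R\<close> plus \<open>\<parallel>Du\<parallel>\<close> over the sites outside \<open>B\<^sub>r\<close>, \<open>r = Rc/2\<close>.\<close>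

definition ac_bound ::
  "(real^'n) set \<Rightarrow> (real^'n \<Rightarrow> (real^'n) set) \<Rightarrow> (real^'n) set \<Rightarrow> (real^'n) set set
     \<Rightarrow> real \<Rightarrow> real \<Rightarrow> (real^'n \<Rightarrow> real^'n) \<Rightarrow> real" where
  "ac_bound \<Lambda> \<R> \<omega> \<T>c R Rc u =
     l2_norm (\<lambda>l. mesh_size \<T>c l * D2_norm \<R> u l) (\<Lambda> \<inter> (\<omega> - ball 0 R))
       + l2_norm (D1_norm \<R> u) (\<Lambda> - ball 0 (Rc / 2))"

definition gradient_error ::
  "(real^'n) set \<Rightarrow> (real^'n) set set \<Rightarrow> (real^'n \<Rightarrow> real^'n) \<Rightarrow> (real^'n \<Rightarrow> real^'n) \<Rightarrow> real" where
  "gradient_error \<Lambda> \<T> uac u = L2_norm (\<lambda>x. gradient uac x - gradient (interpolant \<Lambda> \<T> u) x)"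

end

theory Submission imports Defs begin

text \<open>
  Away from the defect the equilibrium equation on \<open>\<int>\<^sup>d\<close> consists of a finite-range elliptic form
  \<open>B(u, \<phi>)\<close>, a term quadratic in the strain, and a term supported near the origin; the first-order part
  of the energy drops out since it is a null Lagrangian. The form \<open>B\<close> is stable, because the stability
  of \<open>u\<close> can be tested with functions supported where the strain of \<open>u\<close> is negligible.

  Decay of the strain follows by duality, without a Green's function. The energy of \<open>y = u\<close>, or
  \<open>y = D\<^sub>j u\<close>, outside a cube of side \<open>r\<close> is tested with the solution \<open>\<phi>\<close> of the corresponding dual
  problem. Inside the cube \<open>\<phi>\<close> is harmonic for \<open>B\<close>, and iterated Caccioppoli and Sobolev inequalities
  give \<open>\<bar>\<nabla>\<phi>\<bar> \<lesssim> r powr (-d/2)\<close> and \<open>\<bar>\<nabla>\<^sup>2\<phi>\<bar> \<lesssim> r powr (-d/2-1)\<close> near the origin. The tails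
  \<open>f(r)\<close> therefore satisfy \<open>f(L r) \<le> C r powr (-p) + \<epsilon> f(r)\<close> with \<open>\<epsilon>\<close> as small as desired, which
  iterates to \<open>f(r) \<lesssim> r powr (-p)\<close>, where \<open>p = d/2\<close> for \<open>Du\<close> and \<open>p = d/2 + 1\<close> for \<open>D\<^sup>2u\<close>.

  Since \<open>2\<beta> < d + 2\<close>, summation over dyadic shells bounds \<open>\<parallel>h D\<^sup>2u\<parallel>\<close> by a multiple of
  \<open>R powr (-d/2-1)\<close>, and the choice \<open>Rc \<approx> R powr (1+2/d)\<close> gives the same bound for the far field. Both
  tend to zero, so that the condition of hypothesis (b) holds for large \<open>R\<close>.
\<close>

subsection \<open>Functions on the integer lattice\<close>

text \<open>The exponents are those of a strain of order \<open>|x| powr (-d)\<close> and a strain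
  gradient of order \<open>|x| powr (-d-1)\<close>, seen through l2 tails. Two obstacles shape the
  argument. First, \<open>u\<close> has finite energy but no decay, and in two dimensions it need
  not approach a constant, whereas the variations of the energy are explicit only for finitely
  supported functions. With the Poincare inequality on full cubes a single cutoff leaves an error
  that is bounded but not small; this is why cutoffs at many scales are averaged. Second, the
  nonlinear term is merely summable near the origin. There it is paired with a supremum bound for
  the dual function; far out it is quadratic, and one of its two strain factors is the small number
  that closes the recursion. For the strain gradient the difference stays on the dual function where
  that function is harmonic and returns to the nonlinearity elsewhere. The price is a boundary
  layer, which the decay of the strain, obtained beforehand, controls.\<close>

definition ldiff :: "'a::plus \<Rightarrow> ('a \<Rightarrow> 'b::minus) \<Rightarrow> 'a \<Rightarrow> 'b" where
  "ldiff \<rho> v x = v (x + \<rho>) - v x"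

definition cube :: "int \<Rightarrow> (int^'n) set" where
  "cube r = {x. \<forall>i. \<bar>x $ i\<bar> \<le> r}"

definition grad_sq :: "(int^'n \<Rightarrow> 'b::real_normed_vector) \<Rightarrow> int^'n \<Rightarrow> real" where
  "grad_sq v x = (\<Sum>i\<in>UNIV. (norm (ldiff (axis i 1) v x))\<^sup>2)"

definition finsupp :: "('a \<Rightarrow> 'b::zero) \<Rightarrow> bool" where
  "finsupp v \<longleftrightarrow> finite {x. v x \<noteq> 0}"

definition upd :: "'a^'n \<Rightarrow> 'n \<Rightarrow> 'a \<Rightarrow> 'a^'n" where
  "upd x i t = (\<chi> j. if j = i then t else x $ j)"

text \<open>Passing from \<open>x\<close> to \<open>z\<close> one coordinate at a time keeps all
  intermediate points in every cube that contains both, and each step is one-dimensional. The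
  Poincare, Sobolev and path estimates all rest on this.\<close>

definition mix :: "'n set \<Rightarrow> 'a^'n \<Rightarrow> 'a^'n \<Rightarrow> 'a^'n" where
  "mix J z x = (\<chi> j. if j \<in> J then z $ j else x $ j)"

lemma grad_sq_nonneg [simp]: "grad_sq v x \<ge> 0"
  by (simp add: grad_sq_def sum_nonneg)

lemma norm_ldiff_le_grad_sq: "(norm (ldiff (axis i 1) v x))\<^sup>2 \<le> grad_sq v x"
  unfolding grad_sq_def by (rule member_le_sum) auto

lemma cube_eq_image: "cube r = vec_lambda ` (PiE UNIV (\<lambda>_::'n::finite. {-r..r}))"
proof -
  have "x \<in> vec_lambda ` (PiE UNIV (\<lambda>_::'n. {-r..r}))" if "x \<in> cube r" for x
    using that by (intro image_eqI[of _ _ "vec_nth x"]) (auto simp: cube_def abs_le_iff minus_le_iff)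
  then show ?thesis by (auto simp: cube_def PiE_def Pi_def abs_le_iff minus_le_iff)
qed

lemma finite_cube [simp]: "finite (cube r :: (int^'n) set)"
  by (simp add: cube_eq_image finite_PiE)

lemma card_cube:
  assumes "r \<ge> 0"
  shows "real (card (cube r :: (int^'n) set)) = (2 * real_of_int r + 1) ^ CARD('n)"
proof -
  have "card (cube r :: (int^'n) set) = card (PiE UNIV (\<lambda>_::'n. {-r..r}))"
    unfolding cube_eq_image by (rule card_image) (auto simp: inj_on_def)
  also have "\<dots> = (nat (2 * r + 1)) ^ CARD('n)" by (simp add: card_PiE algebra_simps)
  finally show ?thesis using assms by (simp add: of_nat_nat)
qed

lemma cube_mono: "r \<le> s \<Longrightarrow> cube r \<subseteq> cube s"
  by (auto simp: cube_def intro: order_trans)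

lemma cube_add: "x \<in> cube r \<Longrightarrow> y \<in> cube s \<Longrightarrow> x + y \<in> cube (r + s)"
  by (auto simp: cube_def intro!: order_trans[OF abs_triangle_ineq] add_mono)

lemma cube_minus: "- x \<in> cube r \<longleftrightarrow> x \<in> cube r"
  by (auto simp: cube_def)

lemma zero_in_cube: "r \<ge> 0 \<Longrightarrow> 0 \<in> cube r" by (simp add: cube_def)

lemma axis_in_cube: "axis i 1 \<in> cube 1" by (auto simp: cube_def axis_def)

lemma cube_add_cancel:
  assumes "x + y \<in> cube r" "y \<in> cube s" shows "x \<in> cube (r + s)"
  using cube_add[OF assms(1), of "-y" s] assms(2) by (simp add: cube_minus)

lemma upd_in_cube: "x \<in> cube r \<Longrightarrow> \<bar>t\<bar> \<le> r \<Longrightarrow> upd x i t \<in> cube r"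
  by (auto simp: cube_def upd_def)

lemma mix_in_cube: "x \<in> cube r \<Longrightarrow> z \<in> cube r \<Longrightarrow> mix J z x \<in> cube r"
  by (auto simp: cube_def mix_def)

lemma exists_cube:
  fixes F :: "(int^'n) set"
  assumes "finite F" shows "\<exists>r\<ge>0. F \<subseteq> cube r"
proof -
  have fin: "finite ((\<lambda>(x, i). \<bar>x $ i\<bar>) ` (F \<times> (UNIV::'n set)))" using assms by simp
  define r where "r = Max (insert 0 ((\<lambda>(x, i). \<bar>x $ i\<bar>) ` (F \<times> (UNIV::'n set))))"
  have "0 \<le> r" unfolding r_def using fin by (intro Max_ge) auto
  moreover have "\<bar>x $ i\<bar> \<le> r" if "x \<in> F" for x i
    unfolding r_def using fin that by (intro Max_ge) force+
  ultimately show ?thesis unfolding cube_def by blast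
qed

section \<open>Averaging over coordinates; Poincare and Sobolev inequalities on cubes\<close>

lemma resample:
  fixes f :: "int^'n \<Rightarrow> real"
  assumes "N \<ge> 0"
  shows "(\<Sum>x\<in>cube N. \<Sum>s\<in>{-N..N}. f (upd x i s)) = (2 * real_of_int N + 1) * (\<Sum>x\<in>cube N. f x)"
proof -
  let ?P = "cube N \<times> {-N..N}"
  have c: "x \<in> cube N \<Longrightarrow> - N \<le> x $ i \<and> x $ i \<le> N" for x :: "int^'n"
    by (auto simp: cube_def abs_le_iff minus_le_iff)
  have "(\<Sum>x\<in>cube N. \<Sum>s\<in>{-N..N}. f (upd x i s)) = (\<Sum>(x, s)\<in>?P. f (upd x i s))"
    by (simp add: sum.cartesian_product)
  also have "\<dots> = (\<Sum>(x, s)\<in>?P. f x)"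
    \<comment> \<open>Exchanging the i-th coordinate of \<open>x\<close> with \<open>s\<close> is an
      involution of the cube times the interval, hence its own inverse witness.\<close>
    by (rule sum.reindex_bij_witness[where i = "\<lambda>(x, s). (upd x i s, x $ i)"
          and j = "\<lambda>(x, s). (upd x i s, x $ i)"])
      (auto simp: upd_def vec_eq_iff c intro!: upd_in_cube[unfolded upd_def])
  also have "\<dots> = (\<Sum>x\<in>cube N. \<Sum>s\<in>{-N..N}. f x)" by (rule sum.cartesian_product[symmetric])
  also have "\<dots> = (2 * real_of_int N + 1) * (\<Sum>x\<in>cube N. f x)"
    using assms by (simp add: sum_distrib_left)
  finally show ?thesis .
qed

lemma int_telescope:
  fixes g :: "int \<Rightarrow> 'b::real_normed_vector"
  assumes "s \<le> t"
  shows "g t - g s = (\<Sum>k\<in>{s..<t}. g (k + 1) - g k)"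
  using assms
proof (induction t rule: int_ge_induct)
  case (step t)
  have "{s..<t + 1} = insert t {s..<t}" using step by auto
  then have "(\<Sum>k\<in>{s..<t + 1}. g (k + 1) - g k) = (g (t + 1) - g t) + (\<Sum>k\<in>{s..<t}. g (k + 1) - g k)"
    by simp
  then have "(\<Sum>k\<in>{s..<t + 1}. g (k + 1) - g k) = (g (t + 1) - g t) + (g t - g s)"
    using step by simp
  then show ?case by simp
qed simp

lemma norm_diff_le_sum_int:
  fixes g :: "int \<Rightarrow> 'b::real_normed_vector"
  assumes "s \<in> {-N..N}" "t \<in> {-N..N}"
  shows "norm (g s - g t) \<le> (\<Sum>k\<in>{-N..N}. norm (g (k + 1) - g k))"
proof -
  have *: "norm (g t - g s) \<le> (\<Sum>k\<in>{-N..N}. norm (g (k + 1) - g k))"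
    if "s \<le> t" "s \<in> {-N..N}" "t \<in> {-N..N}" for s t
  proof -
    have "norm (g t - g s) \<le> (\<Sum>k\<in>{s..<t}. norm (g (k + 1) - g k))"
      unfolding int_telescope[OF that(1)] by (rule norm_sum)
    also have "\<dots> \<le> (\<Sum>k\<in>{-N..N}. norm (g (k + 1) - g k))"
      using that by (intro sum_mono2) auto
    finally show ?thesis .
  qed
  show ?thesis
    using *[of s t] *[of t s] assms by (cases "s \<le> t") (auto simp: norm_minus_commute)
qed

lemma norm_diff_sq_le_sum_int:
  fixes g :: "int \<Rightarrow> 'b::real_normed_vector"
  assumes "s \<in> {-N..N}" "t \<in> {-N..N}"
  shows "(norm (g s - g t))\<^sup>2 \<le> (2 * real_of_int N + 1) * (\<Sum>k\<in>{-N..N}. (norm (g (k + 1) - g k))\<^sup>2)"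
proof -
  have "N \<ge> 0" using assms by auto
  have "(norm (g s - g t))\<^sup>2 \<le> (\<Sum>k\<in>{-N..N}. norm (g (k + 1) - g k))\<^sup>2"
    using norm_diff_le_sum_int[OF assms] by (intro power_mono) auto
  also have "\<dots> \<le> (\<Sum>k\<in>{-N..N}. (norm (g (k + 1) - g k))\<^sup>2) * card {-N..N}"
    by (rule sum_squared_le_sum_of_squares)
  finally show ?thesis using \<open>N \<ge> 0\<close> by (simp add: algebra_simps)
qed

lemma upd_same [simp]: "upd x i (x $ i) = x" by (simp add: upd_def vec_eq_iff)

lemma upd_nth [simp]: "upd x i t $ i = t" by (simp add: upd_def)

lemma upd_Suc: "upd x i (k + 1) = upd x i k + axis i (1::int)"
  by (simp add: upd_def vec_eq_iff axis_def)

lemma mix_empty [simp]: "mix {} z x = x" by (simp add: mix_def)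

lemma mix_UNIV [simp]: "mix UNIV z x = z" by (simp add: mix_def)

lemma mix_insert: "mix (insert i J) z x = upd (mix J z x) i (z $ i)"
  by (simp add: mix_def upd_def vec_eq_iff)

lemma upd_mix: "i \<notin> J \<Longrightarrow> upd (mix J z x) i t = mix J z (upd x i t)"
  by (auto simp: mix_def upd_def vec_eq_iff)

lemma mix_upd_left: "i \<notin> J \<Longrightarrow> mix J (upd z i t) x = mix J z x"
  by (auto simp: mix_def upd_def vec_eq_iff)

text \<open>One factor \<open>2 * N + 1\<close> is the Cauchy-Schwarz cost of a path along a line.
  The other comes from \<open>resample\<close>, since the bound on a line no longer depends on the
  coordinate \<open>i\<close> of \<open>x\<close>.\<close>

lemma mix_replace:
  fixes v :: "int^'n \<Rightarrow> 'b::real_normed_vector"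
  assumes "i \<notin> J" "z \<in> cube N"
  shows "(\<Sum>x\<in>cube N. (norm (v (mix J z x) - v (mix (insert i J) z x)))\<^sup>2)
     \<le> (2 * real_of_int N + 1)\<^sup>2 * (\<Sum>x\<in>cube N. (norm (ldiff (axis i 1) v (mix J z x)))\<^sup>2)"
proof -
  have N: "N \<ge> 0" using assms(2) unfolding cube_def using order_trans[OF abs_ge_zero] by blast
  have c: "x $ i \<in> {-N..N}" if "x \<in> cube N" for x :: "int^'n"
    using that by (auto simp: cube_def abs_le_iff minus_le_iff)
  have *: "(norm (v (mix J z x) - v (mix (insert i J) z x)))\<^sup>2
     \<le> (2 * real_of_int N + 1) * (\<Sum>k\<in>{-N..N}. (norm (ldiff (axis i 1) v (mix J z (upd x i k))))\<^sup>2)"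
    if x: "x \<in> cube N" for x
  proof -
    have 1: "mix J z x = upd (mix J z x) i (x $ i)"
      using assms(1) by (auto simp: mix_def upd_def vec_eq_iff)
    show ?thesis
      using norm_diff_sq_le_sum_int[OF c[OF x] c[OF assms(2)], of "\<lambda>t. v (upd (mix J z x) i t)"]
      unfolding mix_insert 1[symmetric] ldiff_def upd_Suc by (simp add: upd_mix[OF assms(1)])
  qed
  have "(\<Sum>x\<in>cube N. (norm (v (mix J z x) - v (mix (insert i J) z x)))\<^sup>2)
     \<le> (\<Sum>x\<in>cube N. (2 * real_of_int N + 1) *
          (\<Sum>k\<in>{-N..N}. (norm (ldiff (axis i 1) v (mix J z (upd x i k))))\<^sup>2))"
    by (intro sum_mono *)
  also have "\<dots> = (2 * real_of_int N + 1)\<^sup>2 * (\<Sum>x\<in>cube N. (norm (ldiff (axis i 1) v (mix J z x)))\<^sup>2)"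
    unfolding sum_distrib_left[symmetric]
      resample[OF N, of "\<lambda>x. (norm (ldiff (axis i 1) v (mix J z x)))\<^sup>2"]
    by (simp add: power2_eq_square)
  finally show ?thesis .
qed

text \<open>If \<open>z\<close> and \<open>x\<close> run independently over the cube,
  \<open>mix J z x\<close> is uniformly distributed over it.\<close>

lemma sum_mix:
  fixes f :: "int^'n \<Rightarrow> real"
  assumes "N \<ge> 0" "finite J"
  shows "(\<Sum>z\<in>cube N. \<Sum>x\<in>cube N. f (mix J z x)) = real (card (cube N :: (int^'n) set)) * (\<Sum>x\<in>cube N. f x)"
  using assms(2)
proof induction
  case (insert i J)
  let ?m = "2 * real_of_int N + 1"
  have "?m * (\<Sum>z\<in>cube N. \<Sum>x\<in>cube N. f (mix (insert i J) z x))
     = (\<Sum>z\<in>cube N. \<Sum>s\<in>{-N..N}. \<Sum>x\<in>cube N. f (mix J z (upd x i s)))"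
    unfolding resample[OF assms(1), of "\<lambda>z. \<Sum>x\<in>cube N. f (mix (insert i J) z x)" i, symmetric]
    using insert.hyps by (simp add: mix_insert mix_upd_left upd_mix upd_nth cong: sum.cong)
  also have "\<dots> = (\<Sum>z\<in>cube N. \<Sum>x\<in>cube N. \<Sum>s\<in>{-N..N}. f (mix J z (upd x i s)))"
    by (intro sum.cong refl sum.swap)
  also have "\<dots> = (\<Sum>z\<in>cube N. ?m * (\<Sum>x\<in>cube N. f (mix J z x)))"
    by (intro sum.cong refl resample[OF assms(1), of "\<lambda>x. f (mix J _ x)"])
  also have "\<dots> = ?m * (real (card (cube N :: (int^'n) set)) * (\<Sum>x\<in>cube N. f x))"
    unfolding sum_distrib_left[symmetric] insert.IH ..
  finally show ?case using assms(1) by simp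
qed simp

lemma norm_sq_triangle: "(norm (a + b))\<^sup>2 \<le> 2 * (norm a)\<^sup>2 + 2 * (norm (b::'b::real_normed_vector))\<^sup>2"
proof -
  have "(norm (a + b))\<^sup>2 \<le> (norm a + norm b)\<^sup>2" by (intro power_mono norm_triangle_ineq) auto
  also have "\<dots> \<le> 2 * (norm a)\<^sup>2 + 2 * (norm b)\<^sup>2"
    using zero_le_power2[of "norm a - norm b"] by (simp add: power2_eq_square algebra_simps)
  finally show ?thesis .
qed

lemma norm_sq_le_diff:
  "(norm a)\<^sup>2 \<le> 2 * (norm b)\<^sup>2 + 2 * (norm (b - (a::'b::real_normed_vector)))\<^sup>2"
  using norm_sq_triangle[of b "a - b"] by (simp add: norm_minus_commute)

lemma norm_sq_triangle_diff:
  "(norm (a - c))\<^sup>2 \<le> 2 * (norm (a - b))\<^sup>2 + 2 * (norm (b - (c::'b::real_normed_vector)))\<^sup>2"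
  using norm_sq_triangle[of "a - b" "b - c"] by simp

text \<open>Averaging over the base point \<open>z\<close> replaces the mean value of \<open>v\<close> by a value of \<open>v\<close>.\<close>

lemma poincare_cube:
  fixes v :: "int^'n \<Rightarrow> 'b::real_normed_vector"
  assumes "N \<ge> 0"
  shows "\<exists>a. (\<Sum>x\<in>cube N. (norm (v x - a))\<^sup>2)
    \<le> 4 ^ CARD('n) * (2 * real_of_int N + 1)\<^sup>2 * (\<Sum>x\<in>cube N. grad_sq v x)"
proof -
  let ?m = "2 * real_of_int N + 1" and ?G = "\<Sum>x\<in>cube N. grad_sq v x"
  let ?Q = "real (card (cube N :: (int^'n) set))"
  have Q: "?Q > 0" using card_cube[OF assms, where 'n = 'n] assms by simp
  \<comment> \<open>The coordinates of \<open>z\<close> replace those of \<open>x\<close> one by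
    one. Each replacement doubles the old sum and adds twice a new one, which
    \<open>4 ^ card J\<close> absorbs because
    \<open>2 * 4 ^ j + 2 \<le> 4 ^ (j + 1)\<close>.\<close>
  have *: "(\<Sum>z\<in>cube N. \<Sum>x\<in>cube N. (norm (v x - v (mix J z x)))\<^sup>2) \<le> 4 ^ card J * ?m\<^sup>2 * (?Q * ?G)"
    if "finite J" for J
    using that
  proof induction
    case empty
    show ?case using Q by (simp add: sum_nonneg)
  next
    case (insert i J)
    have "(\<Sum>z\<in>cube N. \<Sum>x\<in>cube N. (norm (v x - v (mix (insert i J) z x)))\<^sup>2)
      \<le> (\<Sum>z\<in>cube N. \<Sum>x\<in>cube N. 2 * (norm (v x - v (mix J z x)))\<^sup>2
            + 2 * (norm (v (mix J z x) - v (mix (insert i J) z x)))\<^sup>2)"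
      by (intro sum_mono norm_sq_triangle_diff)
    also have "\<dots> = 2 * (\<Sum>z\<in>cube N. \<Sum>x\<in>cube N. (norm (v x - v (mix J z x)))\<^sup>2)
        + 2 * (\<Sum>z\<in>cube N. \<Sum>x\<in>cube N. (norm (v (mix J z x) - v (mix (insert i J) z x)))\<^sup>2)"
      by (simp add: sum.distrib sum_distrib_left)
    also have "(\<Sum>z\<in>cube N. \<Sum>x\<in>cube N. (norm (v (mix J z x) - v (mix (insert i J) z x)))\<^sup>2)
      \<le> (\<Sum>z\<in>cube N. ?m\<^sup>2 * (\<Sum>x\<in>cube N. (norm (ldiff (axis i 1) v (mix J z x)))\<^sup>2))"
      by (intro sum_mono mix_replace insert)
    also have "\<dots> \<le> (\<Sum>z\<in>cube N. ?m\<^sup>2 * (\<Sum>x\<in>cube N. grad_sq v (mix J z x)))"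
      by (intro sum_mono mult_left_mono norm_ldiff_le_grad_sq) auto
    also have "\<dots> = ?m\<^sup>2 * (?Q * ?G)"
      using sum_mix[OF assms, of J "grad_sq v"] insert by (simp add: sum_distrib_left[symmetric])
    finally have "(\<Sum>z\<in>cube N. \<Sum>x\<in>cube N. (norm (v x - v (mix (insert i J) z x)))\<^sup>2)
      \<le> 2 * (4 ^ card J * ?m\<^sup>2 * (?Q * ?G)) + 2 * (?m\<^sup>2 * (?Q * ?G))"
      using insert.IH by linarith
    also have "\<dots> \<le> 2 * (4 ^ card J * ?m\<^sup>2 * (?Q * ?G)) + 2 * (4 ^ card J * (?m\<^sup>2 * (?Q * ?G)))"
      using Q mult_right_mono[of 1 "4 ^ card J" "?m\<^sup>2 * (?Q * ?G)"]
      by (simp add: sum_nonneg mult_ac)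
    finally show ?case using insert by (simp add: algebra_simps)
  qed
  have "\<exists>z\<in>cube N. (\<Sum>x\<in>cube N. (norm (v x - v z))\<^sup>2) \<le> 4 ^ CARD('n) * ?m\<^sup>2 * ?G"
  proof (rule ccontr)
    assume "\<not> ?thesis"
    then have "(\<Sum>z\<in>(cube N::(int^'n) set). 4 ^ CARD('n) * ?m\<^sup>2 * ?G) < (\<Sum>z\<in>cube N. \<Sum>x\<in>cube N. (norm (v x - v z))\<^sup>2)"
      using Q by (intro sum_strict_mono) (auto simp: not_le)
    with *[of UNIV] show False by (simp add: algebra_simps)
  qed
  then show ?thesis by blast
qed

primrec ldiffs :: "'n list \<Rightarrow> (int^'n \<Rightarrow> 'b::minus) \<Rightarrow> int^'n \<Rightarrow> 'b" where
  "ldiffs [] v = v"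
| "ldiffs (i # is) v = ldiff (axis i 1) (ldiffs is v)"

text \<open>The coordinates are frozen at those of \<open>z\<close> one after another. Freezing one
  costs one more difference and a factor of the squared side length, which the scaling of the
  hypothesis compensates. Once all are frozen, the sum is the number of points times the value at
  \<open>z\<close>; this is why differences of order up to \<open>CARD('n)\<close> beyond
  \<open>js\<close> enter.\<close>

lemma sobolev_cube:
  fixes v :: "int^'n \<Rightarrow> 'b::real_normed_vector"
  assumes z: "z \<in> cube N" and X: "X \<ge> 0"
    and bound: "\<And>is. length is \<le> length js + CARD('n) \<Longrightarrow>
      (\<Sum>x\<in>cube N. (norm (ldiffs is v x))\<^sup>2) \<le> X / (2 * real_of_int N + 1) ^ (2 * length is)"
  shows "(norm (ldiffs js v z))\<^sup>2
    \<le> 4 ^ CARD('n) * X / (2 * real_of_int N + 1) ^ (2 * length js + CARD('n))"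
proof -
  let ?m = "2 * real_of_int N + 1"
  have N: "N \<ge> 0" using z unfolding cube_def using order_trans[OF abs_ge_zero] by blast
  have m: "?m > 0" using N by simp
  have *: "(\<Sum>x\<in>cube N. (norm (ldiffs is v (mix J z x)))\<^sup>2) \<le> 4 ^ card J * (X / ?m ^ (2 * length is))"
    if "finite J" "length is + card J \<le> length js + CARD('n)" for J "is"
    using that
  proof (induction arbitrary: "is")
    case empty
    then show ?case using bound by simp
  next
    case (insert i J)
    let ?w = "ldiffs is v"
    have "(\<Sum>x\<in>cube N. (norm (?w (mix (insert i J) z x)))\<^sup>2)
      \<le> (\<Sum>x\<in>cube N. 2 * (norm (?w (mix J z x)))\<^sup>2
            + 2 * (norm (?w (mix J z x) - ?w (mix (insert i J) z x)))\<^sup>2)"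
      by (intro sum_mono norm_sq_le_diff)
    also have "\<dots> = 2 * (\<Sum>x\<in>cube N. (norm (?w (mix J z x)))\<^sup>2)
        + 2 * (\<Sum>x\<in>cube N. (norm (?w (mix J z x) - ?w (mix (insert i J) z x)))\<^sup>2)"
      by (simp add: sum.distrib sum_distrib_left)
    also have "(\<Sum>x\<in>cube N. (norm (?w (mix J z x) - ?w (mix (insert i J) z x)))\<^sup>2)
        \<le> ?m\<^sup>2 * (\<Sum>x\<in>cube N. (norm (ldiff (axis i 1) ?w (mix J z x)))\<^sup>2)"
      by (intro mix_replace insert z)
    also have "(\<Sum>x\<in>cube N. (norm (ldiff (axis i 1) ?w (mix J z x)))\<^sup>2)
        \<le> 4 ^ card J * (X / ?m ^ (2 * length (i # is)))"
      using insert.IH[of "i # is"] insert.prems insert.hyps by simp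
    also have "?m\<^sup>2 * (4 ^ card J * (X / ?m ^ (2 * length (i # is)))) = 4 ^ card J * (X / ?m ^ (2 * length is))"
      using m by (simp add: power_add power2_eq_square)
    also have "(\<Sum>x\<in>cube N. (norm (?w (mix J z x)))\<^sup>2) \<le> 4 ^ card J * (X / ?m ^ (2 * length is))"
      using insert.IH[of "is"] insert.prems insert.hyps by simp
    finally have "(\<Sum>x\<in>cube N. (norm (?w (mix (insert i J) z x)))\<^sup>2)
        \<le> 2 * (4 ^ card J * (X / ?m ^ (2 * length is))) + 2 * (4 ^ card J * (X / ?m ^ (2 * length is)))"
      by (simp add: mult_left_mono)
    then show ?case using insert.hyps by (simp add: mult_ac)
  qed
  have "real (card (cube N::(int^'n) set)) * (norm (ldiffs js v z))\<^sup>2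
      \<le> 4 ^ CARD('n) * (X / ?m ^ (2 * length js))"
    using *[of UNIV js] by simp
  then show ?thesis
    using m unfolding card_cube[OF N] by (simp add: power_add field_simps)
qed

section \<open>Cutoffs in the sup norm and approximation by functions of finite support\<close>

definition supn :: "int^'n \<Rightarrow> int" where "supn x = Max (range (\<lambda>i. \<bar>x $ i\<bar>))"

lemma supn_le_iff: "supn x \<le> r \<longleftrightarrow> x \<in> cube r"
  by (auto simp: supn_def cube_def)

lemma supn_triangle: "supn (x + y) \<le> supn x + supn y"
  using cube_add[of x "supn x" y "supn y"] by (simp add: supn_le_iff[symmetric])

lemma supn_minus: "supn (- x) = supn x" by (simp add: supn_def)

lemma supn_axis: "supn (axis i 1) \<le> 1" by (simp add: supn_le_iff axis_in_cube)

lemma supn_diff: "\<bar>supn x - supn y\<bar> \<le> supn (x - y)"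
  using supn_triangle[of "x - y" y] supn_triangle[of "y - x" x] supn_minus[of "x - y"] by simp

definition cutoff :: "int \<Rightarrow> int \<Rightarrow> int^'n \<Rightarrow> real" where
  "cutoff s t x = max 0 (min 1 (real_of_int (t - supn x) / real_of_int (t - s)))"

lemma cutoff_one: "s < t \<Longrightarrow> x \<in> cube s \<Longrightarrow> cutoff s t x = 1"
  by (auto simp: cutoff_def supn_le_iff[symmetric] field_simps)

lemma cutoff_zero: "s < t \<Longrightarrow> x \<notin> cube (t - 1) \<Longrightarrow> cutoff s t x = 0"
  by (auto simp: cutoff_def supn_le_iff[symmetric] field_simps)

lemma cutoff_bounds: "0 \<le> cutoff s t x" "cutoff s t x \<le> 1"
  by (auto simp: cutoff_def)

lemma cutoff_lipschitz:
  assumes "s < t"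
  shows "\<bar>cutoff s t (x + \<rho>) - cutoff s t x\<bar> \<le> real_of_int (supn \<rho>) / real_of_int (t - s)"
proof -
  have *: "\<bar>max 0 (min 1 a) - max 0 (min 1 b)\<bar> \<le> \<bar>a - b\<bar>" for a b :: real
    by (auto simp: max_def min_def)
  have "\<bar>cutoff s t (x + \<rho>) - cutoff s t x\<bar>
    \<le> \<bar>real_of_int (t - supn (x + \<rho>)) / real_of_int (t - s) - real_of_int (t - supn x) / real_of_int (t - s)\<bar>"
    unfolding cutoff_def by (rule *)
  also have "\<dots> = real_of_int \<bar>supn (x + \<rho>) - supn x\<bar> / real_of_int (t - s)"
    using assms by (simp add: diff_divide_distrib[symmetric] abs_divide abs_minus_commute)
  also have "\<dots> \<le> real_of_int (supn \<rho>) / real_of_int (t - s)"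
    using assms supn_diff[of "x + \<rho>" x] by (intro divide_right_mono of_int_le_iff[THEN iffD2]) auto
  finally show ?thesis .
qed

lemma finsuppI: "(\<And>x. x \<notin> cube r \<Longrightarrow> v x = 0) \<Longrightarrow> finsupp v"
  unfolding finsupp_def by (rule finite_subset[of _ "cube r"]) auto

lemma finsupp_cube:
  fixes v :: "int^'n \<Rightarrow> 'b::zero"
  assumes "finsupp v"
  obtains r where "r \<ge> 0" "\<And>x. x \<notin> cube r \<Longrightarrow> v x = 0"
proof -
  have "\<exists>r\<ge>0. {x. v x \<noteq> 0} \<subseteq> cube r"
    using assms unfolding finsupp_def by (rule exists_cube)
  then show ?thesis using that by blast
qed

lemma tail_small:
  fixes f :: "int^'n \<Rightarrow> real"
  assumes "\<And>x. f x \<ge> 0" "f summable_on UNIV" "\<delta> > 0"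
  shows "\<exists>M\<ge>0. \<forall>F. finite F \<longrightarrow> F \<inter> cube M = {} \<longrightarrow> sum f F \<le> \<delta>"
proof -
  obtain F0 where F0: "finite F0" "dist (sum f F0) (infsum f UNIV) \<le> \<delta>"
    using infsum_finite_approximation[OF assms(2,3)] by auto
  obtain M where M: "M \<ge> 0" "F0 \<subseteq> cube M" using exists_cube[OF F0(1)] by blast
  have "sum f F \<le> \<delta>" if "finite F" "F \<inter> cube M = {}" for F
  proof -
    have "sum f F + sum f F0 = sum f (F \<union> F0)"
      using that M F0 by (intro sum.union_disjoint[symmetric]) auto
    also have "\<dots> \<le> infsum f UNIV"
      using that F0 assms by (intro finite_sum_le_infsum) auto
    finally show ?thesis using F0(2) by (auto simp: dist_real_def)
  qed
  then show ?thesis using M by blast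
qed

text \<open>Stands in for orthogonality, which a mere norm does not offer: at most one of the
  vectors is nonzero.\<close>

lemma norm_sum_sq_disjoint:
  fixes e :: "'k \<Rightarrow> 'b::real_normed_vector"
  assumes "finite K" "\<And>k l. k \<in> K \<Longrightarrow> l \<in> K \<Longrightarrow> k \<noteq> l \<Longrightarrow> e k = 0 \<or> e l = 0"
  shows "(norm (\<Sum>k\<in>K. e k))\<^sup>2 = (\<Sum>k\<in>K. (norm (e k))\<^sup>2)"
  using assms
proof (induction K)
  case (insert k K)
  show ?case
  proof (cases "e k = 0")
    case True
    then show ?thesis using insert by simp
  next
    case False
    then have "\<forall>l\<in>K. e l = 0" using insert by blast
    then show ?thesis using insert.hyps by simp
  qed
qed simp

text \<open>Localises the commutator to the shell between \<open>N\<close> and \<open>2 * N\<close>,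
  so that scales differing by a factor of more than two do not interact.\<close>

lemma commutator_support:
  assumes "N \<ge> 1" "ldiff (axis i 1) (cutoff N (2 * N)) x \<noteq> 0"
  shows "N \<le> supn x" "supn x \<le> 2 * N"
proof -
  have a: "\<bar>supn (x + axis i 1) - supn x\<bar> \<le> 1"
    using supn_diff[of "x + axis i 1" x] supn_axis[of i] by simp
  show "N \<le> supn x"
  proof (rule ccontr)
    assume "\<not> ?thesis"
    then have "x \<in> cube N" "x + axis i 1 \<in> cube N" using a by (auto simp: supn_le_iff[symmetric])
    then show False using assms by (simp add: ldiff_def cutoff_one)
  qed
  show "supn x \<le> 2 * N"
  proof (rule ccontr)
    assume "\<not> ?thesis"
    then have "x \<notin> cube (2 * N - 1)" "x + axis i 1 \<notin> cube (2 * N - 1)"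
      using a by (auto simp: supn_le_iff[symmetric])
    then show False using assms by (simp add: ldiff_def cutoff_zero)
  qed
qed

text \<open>The cutoffs at the scales \<open>4\<^sup>k N\<close> have commutators of bounded energy (by the Poincare inequality)
  with disjoint supports, so the energy of their average over \<open>K\<close> scales is of order \<open>1/K\<close>.\<close>

lemma finsupp_approximation:
  fixes y :: "int^'n \<Rightarrow> 'b::real_normed_vector"
  assumes summ: "grad_sq y summable_on UNIV" and "\<delta> > 0"
  shows "\<exists>w a. finsupp w \<and> (\<forall>x\<in>cube M. w x = y x - a) \<and>
    (\<forall>F. finite F \<longrightarrow> (\<Sum>x\<in>F. grad_sq (\<lambda>x. y x - w x) x) \<le> \<delta>)"
proof -
  let ?d = "CARD('n)"
  define E where "E = infsum (grad_sq y) UNIV"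
  have finE: "finite F \<Longrightarrow> sum (grad_sq y) F \<le> E" for F
    unfolding E_def using summ by (intro finite_sum_le_infsum) auto
  have E0: "E \<ge> 0" using finE[of "{}"] by simp
  \<comment> \<open>One commutator has energy at most \<open>49 * 4 ^ d * E\<close> per direction,
    see \<open>eb\<close>. The factor \<open>2 * d\<close> comes from the triangle inequality and
    the sum over directions; \<open>K\<close> then makes \<open>c * E / K\<close> at most
    \<open>\<delta> / 2\<close>.\<close>
  define c where "c = 2 * real ?d * (49 * 4 ^ ?d)"
  obtain K :: nat where K: "real K > 2 * c * E / \<delta>" using reals_Archimedean2 by blast
  have c0: "c \<ge> 0" by (simp add: c_def)
  have Kpos: "real K > 0" using K c0 E0 assms(2) by (meson divide_nonneg_pos le_less_trans mult_nonneg_nonneg zero_le_numeral)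
  have cK: "c * E / K \<le> \<delta> / 2" using K Kpos assms(2) by (simp add: field_simps)
  obtain M1 where M1: "M1 \<ge> 0" "\<And>F. finite F \<Longrightarrow> F \<inter> cube M1 = {} \<Longrightarrow> sum (grad_sq y) F \<le> \<delta> / 4"
    using tail_small[of "grad_sq y" "\<delta> / 4"] summ assms(2) by auto
  \<comment> \<open>All scales lie beyond \<open>M\<close>, where \<open>w\<close> has to equal
    \<open>y\<close> up to a constant, and beyond \<open>M1\<close>, outside of which little energy
    is left. The ratio 4 keeps the shells from \<open>N k\<close> to \<open>2 * N k\<close>
    apart.\<close>
  define N :: "nat \<Rightarrow> int" where "N k = 4 ^ k * (max M M1 + 1)" for k
  have N: "N k \<ge> max M M1 + 1" for k
    unfolding N_def using M1(1) mult_right_mono[of 1 "4 ^ k :: int" "max M M1 + 1"] by simp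
  have N1: "N k \<ge> 1" for k using N[of k] M1(1) by linarith
  have Nlt: "2 * N k < N l" if "k < l" for k l
  proof -
    have "4 * 4 ^ k \<le> (4 ^ l :: int)"
      using that power_increasing[of "Suc k" l "4::int"] by simp
    then have "4 * N k \<le> N l"
      unfolding N_def using M1(1) mult_right_mono[of "4 * 4 ^ k" "4 ^ l :: int" "max M M1 + 1"] by simp
    then show ?thesis using N1[of k] by linarith
  qed
  define \<eta> where "\<eta> k = (cutoff (N k) (2 * N k) :: int^'n \<Rightarrow> real)" for k
  have "\<forall>k. \<exists>a. (\<Sum>x\<in>cube (2 * N k + 1). (norm (y x - a))\<^sup>2)
      \<le> 4 ^ ?d * (2 * real_of_int (2 * N k + 1) + 1)\<^sup>2 * (\<Sum>x\<in>cube (2 * N k + 1). grad_sq y x)"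
    using order_trans[OF _ N1] by (intro allI poincare_cube) (simp add: order_trans[OF _ N1])
  then obtain a where a: "\<And>k. (\<Sum>x\<in>cube (2 * N k + 1). (norm (y x - a k))\<^sup>2)
      \<le> 4 ^ ?d * (2 * real_of_int (2 * N k + 1) + 1)\<^sup>2 * (\<Sum>x\<in>cube (2 * N k + 1). grad_sq y x)"
    by metis
  define w where "w x = (1 / real K) *\<^sub>R (\<Sum>k<K. \<eta> k x *\<^sub>R (y x - a k))" for x
  define e where "e i k x = ldiff (axis i 1) (\<eta> k) x *\<^sub>R (y (x + axis i 1) - a k)" for i k x
  have avg: "y = (\<lambda>x. (1 / real K) *\<^sub>R (\<Sum>k<K. y x))"
    using Kpos by (simp add: sum_constant_scaleR fun_eq_iff)
  have supp: "finsupp w"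
  proof (rule finsuppI[of "2 * N K"])
    fix x :: "int^'n" assume x: "x \<notin> cube (2 * N K)"
    have "\<eta> k x = 0" if "k < K" for k
    proof -
      have "2 * N k - 1 \<le> 2 * N K" using Nlt[OF that] N1[of K] by linarith
      then have "x \<notin> cube (2 * N k - 1)" using x cube_mono by blast
      then show ?thesis unfolding \<eta>_def using N1[of k] by (intro cutoff_zero) auto
    qed
    then show "w x = 0" by (simp add: w_def)
  qed
  have one: "\<eta> k x = 1" if "x \<in> cube (max M M1)" for k x
  proof -
    have "max M M1 \<le> N k" using N[of k] by linarith
    then show ?thesis
      unfolding \<eta>_def using N1[of k] subsetD[OF cube_mono that] by (intro cutoff_one) auto
  qed
  have onM: "w x = y x - (1 / real K) *\<^sub>R (\<Sum>k<K. a k)" if "x \<in> cube M" for x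
  proof -
    have "x \<in> cube (max M M1)" using that cube_mono[of M "max M M1"] by auto
    then have "w x = (1 / real K) *\<^sub>R (\<Sum>k<K. y x - a k)" unfolding w_def by (simp add: one)
    then show ?thesis
      using Kpos by (simp add: sum_subtractf scaleR_diff_right sum_constant_scaleR)
  qed
  \<comment> \<open>Product rule. The weight of the first term vanishes where all cutoffs equal 1,
    in particular on \<open>cube M1\<close>; the second term collects the commutators.\<close>
  have dif: "ldiff (axis i 1) (\<lambda>x. y x - w x) x
      = ((1 / real K) * (\<Sum>k<K. 1 - \<eta> k x)) *\<^sub>R ldiff (axis i 1) y x - (1 / real K) *\<^sub>R (\<Sum>k<K. e i k x)" for i x
  proof -
    have "ldiff (axis i 1) (\<lambda>x. y x - w x) x
       = (1 / real K) *\<^sub>R (\<Sum>k<K. (y (x + axis i 1) - \<eta> k (x + axis i 1) *\<^sub>R (y (x + axis i 1) - a k))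
              - (y x - \<eta> k x *\<^sub>R (y x - a k)))"
      by (subst avg) (simp add: ldiff_def w_def sum_subtractf scaleR_diff_right)
    also have "\<dots> = (1 / real K) *\<^sub>R (\<Sum>k<K. (1 - \<eta> k x) *\<^sub>R ldiff (axis i 1) y x - e i k x)"
      by (intro arg_cong[of _ _ "scaleR _"] sum.cong refl)
        (simp add: e_def ldiff_def algebra_simps)
    also have "\<dots> = (1 / real K) *\<^sub>R ((\<Sum>k<K. 1 - \<eta> k x) *\<^sub>R ldiff (axis i 1) y x - (\<Sum>k<K. e i k x))"
      by (simp only: sum_subtractf[of "\<lambda>k. (1 - \<eta> k x) *\<^sub>R ldiff (axis i 1) y x"] scaleR_sum_left)
    finally show ?thesis by (simp only: scaleR_diff_right scaleR_scaleR)
  qed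
  have disj: "e i k x = 0 \<or> e i l x = 0" if "k \<noteq> l" for i k l x
  proof (rule ccontr)
    assume "\<not> ?thesis"
    then have "ldiff (axis i 1) (\<eta> k) x \<noteq> 0" "ldiff (axis i 1) (\<eta> l) x \<noteq> 0" by (auto simp: e_def)
    then have "N k \<le> supn x" "supn x \<le> 2 * N k" "N l \<le> supn x" "supn x \<le> 2 * N l"
      unfolding \<eta>_def using commutator_support N1 by blast+
    then show False using that Nlt[of k l] Nlt[of l k] by (cases k l rule: linorder_cases) auto
  qed
  have pt: "(norm (ldiff (axis i 1) (\<lambda>x. y x - w x) x))\<^sup>2
      \<le> 2 * (if x \<in> cube M1 then 0 else (norm (ldiff (axis i 1) y x))\<^sup>2)
         + 2 / (real K)\<^sup>2 * (\<Sum>k<K. (norm (e i k x))\<^sup>2)" for i x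
  proof -
    let ?s = "(1 / real K) * (\<Sum>k<K. 1 - \<eta> k x)"
    have "0 \<le> ?s" using cutoff_bounds by (intro mult_nonneg_nonneg sum_nonneg) (auto simp: \<eta>_def)
    moreover have "(\<Sum>k<K. 1 - \<eta> k x) \<le> (\<Sum>k<K. 1)"
      using cutoff_bounds by (intro sum_mono) (simp add: \<eta>_def)
    then have "?s \<le> 1" using Kpos by (simp add: field_simps)
    moreover have "?s = 0" if "x \<in> cube M1"
      using one[of x] that cube_mono[of M1 "max M M1"] by auto
    ultimately obtain s where s: "0 \<le> s" "s \<le> 1" "x \<in> cube M1 \<longrightarrow> s = 0" "s = ?s" by blast
    have 1: "(norm (?s *\<^sub>R ldiff (axis i 1) y x))\<^sup>2
        \<le> (if x \<in> cube M1 then 0 else (norm (ldiff (axis i 1) y x))\<^sup>2)"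
      unfolding s(4)[symmetric] using s(1-3)
      by (auto simp: power_mult_distrib intro!: mult_left_le_one_le power_le_one)
    have 2: "(norm ((1 / real K) *\<^sub>R (\<Sum>k<K. e i k x)))\<^sup>2 = 1 / (real K)\<^sup>2 * (\<Sum>k<K. (norm (e i k x))\<^sup>2)"
      using norm_sum_sq_disjoint[of "{..<K}" "\<lambda>k. e i k x"] disj
      by (simp add: power_mult_distrib power_divide)
    show ?thesis
      unfolding dif using norm_sq_triangle[of "?s *\<^sub>R ldiff (axis i 1) y x" "- ((1 / real K) *\<^sub>R (\<Sum>k<K. e i k x))"] 1 2
      by simp
  qed
  have eb: "(\<Sum>x\<in>F. (norm (e i k x))\<^sup>2) \<le> 49 * 4 ^ ?d * E" if "finite F" for F i k
  proof -
    let ?n = "real_of_int (N k)"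
    have n1: "?n \<ge> 1" using N1[of k] by simp
    have "(norm (e i k x))\<^sup>2 \<le> (if x \<in> cube (2 * N k) then (1 / ?n)\<^sup>2 * (norm (y (x + axis i 1) - a k))\<^sup>2 else 0)" for x
    proof (cases "ldiff (axis i 1) (\<eta> k) x = 0")
      case False
      then have "x \<in> cube (2 * N k)"
        using commutator_support(2)[OF N1] by (simp add: \<eta>_def supn_le_iff)
      moreover have "\<bar>ldiff (axis i 1) (\<eta> k) x\<bar> \<le> 1 / ?n"
        using cutoff_lipschitz[of "N k" "2 * N k" x "axis i 1"] N1[of k] supn_axis[of i]
          divide_right_mono[of "real_of_int (supn (axis i 1 :: int^'n))" 1 ?n]
        by (auto simp: ldiff_def \<eta>_def)
      then have "(ldiff (axis i 1) (\<eta> k) x)\<^sup>2 \<le> (1 / ?n)\<^sup>2"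
        using power_mono[of "\<bar>ldiff (axis i 1) (\<eta> k) x\<bar>" "1 / ?n" 2] by simp
      ultimately show ?thesis by (simp add: e_def power_mult_distrib mult_right_mono)
    qed (simp add: e_def)
    then have "(\<Sum>x\<in>F. (norm (e i k x))\<^sup>2)
      \<le> (\<Sum>x\<in>F. (if x \<in> cube (2 * N k) then (1 / ?n)\<^sup>2 * (norm (y (x + axis i 1) - a k))\<^sup>2 else 0))"
      by (intro sum_mono)
    also have "\<dots> = (\<Sum>x\<in>F \<inter> cube (2 * N k). (1 / ?n)\<^sup>2 * (norm (y (x + axis i 1) - a k))\<^sup>2)"
      using that by (simp add: sum.inter_restrict)
    also have "\<dots> \<le> (\<Sum>x\<in>cube (2 * N k). (1 / ?n)\<^sup>2 * (norm (y (x + axis i 1) - a k))\<^sup>2)"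
      by (intro sum_mono2) auto
    also have "\<dots> = (1 / ?n)\<^sup>2 * (\<Sum>x\<in>(\<lambda>x. x + axis i 1) ` cube (2 * N k). (norm (y x - a k))\<^sup>2)"
      by (subst sum.reindex) (auto simp: sum_distrib_left)
    also have "\<dots> \<le> (1 / ?n)\<^sup>2 * (\<Sum>x\<in>cube (2 * N k + 1). (norm (y x - a k))\<^sup>2)"
      using cube_add[OF _ axis_in_cube] by (intro mult_left_mono sum_mono2) auto
    also have "\<dots> \<le> (1 / ?n)\<^sup>2 * (4 ^ ?d * (2 * real_of_int (2 * N k + 1) + 1)\<^sup>2 * E)"
      by (intro mult_left_mono order_trans[OF a] finE) auto
    also have "\<dots> = 4 ^ ?d * E * ((2 * real_of_int (2 * N k + 1) + 1) / ?n)\<^sup>2"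
      by (simp add: power_divide)
    \<comment> \<open>The edge of the Poincare cube has \<open>4 * N k + 3\<close> points, at most
      \<open>7 * N k\<close>.\<close>
    also have "\<dots> \<le> 4 ^ ?d * E * 7\<^sup>2"
      using n1 E0 by (intro mult_left_mono power_mono) (auto simp: field_simps)
    finally show ?thesis by simp
  qed
  have "(\<Sum>x\<in>F. grad_sq (\<lambda>x. y x - w x) x) \<le> \<delta>" if F: "finite F" for F
  proof -
    have "(\<Sum>x\<in>F. grad_sq (\<lambda>x. y x - w x) x)
      \<le> (\<Sum>x\<in>F. \<Sum>i\<in>UNIV. 2 * (if x \<in> cube M1 then 0 else (norm (ldiff (axis i 1) y x))\<^sup>2)
         + 2 / (real K)\<^sup>2 * (\<Sum>k<K. (norm (e i k x))\<^sup>2))"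
      unfolding grad_sq_def[of "\<lambda>x. y x - w x"] by (intro sum_mono pt)
    also have "\<dots> = 2 * (\<Sum>x\<in>F. if x \<in> cube M1 then 0 else grad_sq y x)
         + 2 / (real K)\<^sup>2 * (\<Sum>x\<in>F. \<Sum>i\<in>UNIV. \<Sum>k<K. (norm (e i k x))\<^sup>2)"
      unfolding sum.distrib sum_distrib_left grad_sq_def
      by (intro arg_cong2[of _ _ _ _ "(+)"] sum.cong refl) (simp_all add: sum_distrib_left)
    also have "(\<Sum>x\<in>F. if x \<in> cube M1 then 0 else grad_sq y x) = (\<Sum>x\<in>F - cube M1. grad_sq y x)"
      using F by (intro sum.mono_neutral_cong_right) auto
    also have "\<dots> \<le> \<delta> / 4" using F by (intro M1) auto
    also have "(\<Sum>x\<in>F. \<Sum>i\<in>UNIV. \<Sum>k<K. (norm (e i k x))\<^sup>2) = (\<Sum>i\<in>UNIV. \<Sum>k<K. \<Sum>x\<in>F. (norm (e i k x))\<^sup>2)"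
      by (subst sum.swap, intro sum.cong refl, rule sum.swap)
    also have "\<dots> \<le> (\<Sum>i\<in>(UNIV::'n set). \<Sum>k<K. 49 * 4 ^ ?d * E)"
      by (intro sum_mono eb F)
    also have "\<dots> = real ?d * (real K * (49 * 4 ^ ?d * E))" by simp
    finally have "(\<Sum>x\<in>F. grad_sq (\<lambda>x. y x - w x) x)
      \<le> 2 * (\<delta> / 4) + 2 / (real K)\<^sup>2 * (real ?d * (real K * (49 * 4 ^ ?d * E)))"
      by (simp add: mult_left_mono divide_right_mono)
    also have "2 / (real K)\<^sup>2 * (real ?d * (real K * (49 * 4 ^ ?d * E))) = c * E / K"
      using Kpos by (simp add: c_def power2_eq_square field_simps)
    finally show ?thesis using cK by linarith
  qed
  then show ?thesis using supp onM by blast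
qed

subsection \<open>Elliptic finite-range operators on the integer lattice\<close>

text \<open>The difference telescopes along an axis-parallel path from \<open>x\<close> to
  \<open>x + \<rho>\<close> inside \<open>x + cube m\<close>. Allowing all base points of that cube
  makes the bound independent of \<rho>.\<close>

lemma norm_ldiff_le_sum:
  fixes v :: "int^'n \<Rightarrow> 'b::real_normed_vector"
  assumes "\<rho> \<in> cube m"
  shows "norm (ldiff \<rho> v x) \<le> (\<Sum>i\<in>UNIV. \<Sum>y\<in>cube m. norm (ldiff (axis i 1) v (x + y)))"
proof -
  have m: "m \<ge> 0" using assms unfolding cube_def using order_trans[OF abs_ge_zero] by blast
  have "norm (v (x + mix J \<rho> 0) - v x) \<le> (\<Sum>i\<in>J. \<Sum>y\<in>cube m. norm (ldiff (axis i 1) v (x + y)))"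
    if "finite J" for J
    using that
  proof induction
    case (insert i J)
    let ?z = "mix J \<rho> 0"
    have z: "?z \<in> cube m" using assms m by (simp add: mix_in_cube zero_in_cube)
    have 0: "upd ?z i 0 = ?z" using insert.hyps by (auto simp: mix_def upd_def vec_eq_iff)
    have ri: "\<rho> $ i \<in> {-m..m}" using assms by (auto simp: cube_def abs_le_iff minus_le_iff)
    have "norm (v (x + upd ?z i (\<rho> $ i)) - v (x + upd ?z i 0))
        \<le> (\<Sum>k\<in>{-m..m}. norm (v (x + upd ?z i (k + 1)) - v (x + upd ?z i k)))"
      using norm_diff_le_sum_int[OF ri, of 0 "\<lambda>t. v (x + upd ?z i t)"] m by simp
    also have "\<dots> = (\<Sum>y\<in>(\<lambda>k. upd ?z i k) ` {-m..m}. norm (ldiff (axis i 1) v (x + y)))"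
      by (subst sum.reindex)
        (auto simp: inj_on_def upd_def vec_eq_iff ldiff_def upd_Suc[unfolded upd_def] add.assoc)
    also have "\<dots> \<le> (\<Sum>y\<in>cube m. norm (ldiff (axis i 1) v (x + y)))"
      using upd_in_cube[OF z] by (intro sum_mono2) (auto simp: abs_le_iff)
    finally have "norm (v (x + upd ?z i (\<rho> $ i)) - v (x + ?z)) \<le> (\<Sum>y\<in>cube m. norm (ldiff (axis i 1) v (x + y)))"
      by (simp add: 0)
    then show ?case
      using insert norm_triangle_ineq[of "v (x + upd ?z i (\<rho> $ i)) - v (x + ?z)" "v (x + ?z) - v x"]
      by (simp add: mix_insert)
  qed simp
  from this[of UNIV] show ?thesis by (simp add: ldiff_def)
qed

text \<open>The number of unit differences in the path bound, that is, its Cauchy-Schwarz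
  constant.\<close>

definition path_const :: "'n::finite itself \<Rightarrow> int \<Rightarrow> real" where
  "path_const _ m = real CARD('n) * real (card (cube m :: (int^'n) set))"

lemma path_const_nonneg: "path_const TYPE('n::finite) m \<ge> 0" by (simp add: path_const_def)

lemma norm_ldiff_sq_le:
  fixes v :: "int^'n \<Rightarrow> 'b::real_normed_vector"
  assumes "\<rho> \<in> cube m"
  shows "(norm (ldiff \<rho> v x))\<^sup>2 \<le> path_const TYPE('n) m * (\<Sum>y\<in>cube m. grad_sq v (x + y))"
proof -
  let ?I = "(UNIV :: 'n set) \<times> (cube m :: (int^'n) set)"
  have "(norm (ldiff \<rho> v x))\<^sup>2 \<le> (\<Sum>(i, y)\<in>?I. norm (ldiff (axis i 1) v (x + y)))\<^sup>2"
    using norm_ldiff_le_sum[OF assms, of v x] by (intro power_mono) (auto simp: sum.cartesian_product)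
  also have "\<dots> \<le> (\<Sum>p\<in>?I. ((\<lambda>(i, y). norm (ldiff (axis i 1) v (x + y))) p)\<^sup>2) * card ?I"
    by (rule sum_squared_le_sum_of_squares)
  also have "(\<Sum>p\<in>?I. ((\<lambda>(i, y). norm (ldiff (axis i 1) v (x + y))) p)\<^sup>2)
      = (\<Sum>i\<in>UNIV. \<Sum>y\<in>cube m. (norm (ldiff (axis i 1) v (x + y)))\<^sup>2)"
    by (simp add: sum.cartesian_product case_prod_beta)
  also have "\<dots> = (\<Sum>y\<in>cube m. grad_sq v (x + y))"
    unfolding grad_sq_def by (rule sum.swap)
  finally show ?thesis by (simp add: path_const_def card_cartesian_product mult_ac)
qed

definition path_const2 :: "'n::finite itself \<Rightarrow> int \<Rightarrow> real" where
  "path_const2 t m = path_const t m * real (card (cube m :: (int^'n) set))"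

lemma path_const2_nonneg: "path_const2 TYPE('n::finite) m \<ge> 0"
  by (simp add: path_const2_def path_const_nonneg)

text \<open>The bound \<open>X\<close> is asked for finite sets within distance \<open>m\<close> of
  \<open>F\<close>, so that the same estimate serves for the total energy and for tails outside a
  cube.\<close>

lemma sum_ldiff_sq_le:
  fixes v :: "int^'n \<Rightarrow> 'b::real_normed_vector"
  assumes "\<rho> \<in> cube m" "finite F"
    and "\<And>F'. finite F' \<Longrightarrow> (\<And>x. x \<in> F' \<Longrightarrow> \<exists>y\<in>cube m. x - y \<in> F) \<Longrightarrow> sum (grad_sq v) F' \<le> X"
  shows "(\<Sum>x\<in>F. (norm (ldiff \<rho> v x))\<^sup>2) \<le> path_const2 TYPE('n) m * X"
proof -
  have "(\<Sum>x\<in>F. (norm (ldiff \<rho> v x))\<^sup>2) \<le> (\<Sum>x\<in>F. path_const TYPE('n) m * (\<Sum>y\<in>cube m. grad_sq v (x + y)))"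
    by (intro sum_mono norm_ldiff_sq_le assms)
  also have "\<dots> = path_const TYPE('n) m * (\<Sum>y\<in>cube m. \<Sum>x\<in>F. grad_sq v (x + y))"
    unfolding sum_distrib_left[symmetric] by (intro arg_cong[of _ _ "(*) _"] sum.swap)
  also have "\<dots> = path_const TYPE('n) m * (\<Sum>y\<in>cube m. sum (grad_sq v) ((\<lambda>x. x + y) ` F))"
    by (simp add: sum.reindex inj_on_def)
  also have "\<dots> \<le> path_const TYPE('n) m * (\<Sum>y\<in>(cube m :: (int^'n) set). X)"
    using assms(2) path_const_nonneg
    by (intro mult_left_mono sum_mono assms(3)) (auto, metis add_diff_cancel_right')
  finally show ?thesis by (simp add: path_const2_def)
qed

lemma grad_sq_finsupp_zero:
  fixes w :: "int^'n \<Rightarrow> 'b::real_normed_vector"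
  assumes "\<And>x. x \<notin> cube r \<Longrightarrow> w x = 0" "x \<notin> cube (r + 1)"
  shows "grad_sq w x = 0"
proof -
  have "x \<notin> cube r" using assms(2) cube_mono[of r "r + 1"] by auto
  moreover have "x + axis i 1 \<notin> cube r" for i
    using cube_add_cancel[OF _ axis_in_cube, of x i r] assms(2) by auto
  ultimately show ?thesis using assms(1) by (simp add: grad_sq_def ldiff_def)
qed

lemma grad_sq_summable:
  fixes w :: "int^'n \<Rightarrow> 'b::real_normed_vector"
  assumes "finsupp w" shows "grad_sq w summable_on X"
proof -
  obtain r where r: "\<And>x. x \<notin> cube r \<Longrightarrow> w x = 0" using finsupp_cube[OF assms] by blast
  show ?thesis
    by (rule finite_nonzero_values_imp_summable_on, rule finite_subset[of _ "cube (r + 1)"])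
      (use grad_sq_finsupp_zero[of r w] r in auto)
qed

lemma finsupp_ldiff: 
  assumes "finsupp w" shows "finsupp (ldiff \<tau> (w :: int^'n \<Rightarrow> 'b::real_normed_vector))"
proof -
  have "{x. ldiff \<tau> w x \<noteq> 0} \<subseteq> (\<lambda>x. x - \<tau>) ` {x. w x \<noteq> 0} \<union> {x. w x \<noteq> 0}"
    by (auto simp: ldiff_def image_iff) (metis add_diff_cancel_right')
  then show ?thesis using assms unfolding finsupp_def by (meson finite_UnI finite_imageI finite_subset)
qed

section \<open>Bilinear forms of finite range with constant coefficients\<close>

definition form_density ::
  "(int^'n) set \<Rightarrow> (int^'n \<Rightarrow> int^'n \<Rightarrow> 'b \<Rightarrow> 'b \<Rightarrow> real) \<Rightarrow> (int^'n \<Rightarrow> 'b::real_normed_vector) \<Rightarrow> (int^'n \<Rightarrow> 'b) \<Rightarrow> int^'n \<Rightarrow> real"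
where
  "form_density S \<beta> v w x = (\<Sum>\<rho>\<in>S. \<Sum>\<sigma>\<in>S. \<beta> \<rho> \<sigma> (ldiff \<rho> v x) (ldiff \<sigma> w x))"

text \<open>For bilinear \<beta> the sum has finitely many nonzero terms as soon as one argument has
  finite support, whatever the other; this admits the equilibrium itself as an argument.\<close>

definition lform ::
  "(int^'n) set \<Rightarrow> (int^'n \<Rightarrow> int^'n \<Rightarrow> 'b \<Rightarrow> 'b \<Rightarrow> real) \<Rightarrow> (int^'n \<Rightarrow> 'b::real_normed_vector) \<Rightarrow> (int^'n \<Rightarrow> 'b) \<Rightarrow> real"
where
  "lform S \<beta> v w = infsum (form_density S \<beta> v w) UNIV"

text \<open>Elimination of one unknown. The vector \<open>p\<close> with entry 1 at \<open>a\<close>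
  is annihilated by the rows in \<open>J\<close>, so \<open>s\<close>, its image in row
  \<open>a\<close>, is the Schur complement. It equals the quadratic form at \<open>p\<close> and is
  therefore positive.\<close>

lemma posdef_solve:
  fixes M :: "'j \<Rightarrow> 'j \<Rightarrow> real"
  assumes "finite J"
    and "\<forall>x. (\<exists>j\<in>J. x j \<noteq> 0) \<longrightarrow> (\<Sum>i\<in>J. \<Sum>j\<in>J. x i * M i j * x j) > 0"
  shows "\<exists>x. \<forall>i\<in>J. (\<Sum>j\<in>J. M i j * x j) = b i"
  using assms
proof (induction J arbitrary: b rule: finite_induct)
  case (insert a J)
  note IH = insert.IH and pos = insert.prems
  have pd: "\<forall>x. (\<exists>j\<in>J. x j \<noteq> 0) \<longrightarrow> (\<Sum>i\<in>J. \<Sum>j\<in>J. x i * M i j * x j) > 0"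
  proof (intro allI impI)
    fix x :: "'j \<Rightarrow> real" assume ex: "\<exists>j\<in>J. x j \<noteq> 0"
    define x' where "x' = x(a := 0)"
    have *: "x' j = x j" if "j \<in> J" for j using that insert.hyps by (auto simp: x'_def)
    have "(\<Sum>i\<in>insert a J. \<Sum>j\<in>insert a J. x' i * M i j * x' j) > 0"
      using ex * by (intro insert.prems[rule_format, of x']) auto
    then show "(\<Sum>i\<in>J. \<Sum>j\<in>J. x i * M i j * x j) > 0" using insert.hyps * by (simp add: x'_def cong: sum.cong)
  qed
  obtain y where y: "\<And>i. i \<in> J \<Longrightarrow> (\<Sum>j\<in>J. M i j * y j) = b i" using IH[OF pd, of b] by blast
  obtain z where z: "\<And>i. i \<in> J \<Longrightarrow> (\<Sum>j\<in>J. M i j * z j) = - M i a" using IH[OF pd, of "\<lambda>i. - M i a"] by blast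
  define p where "p = z(a := 1)"
  have p: "p j = z j" if "j \<in> J" for j using that insert.hyps by (auto simp: p_def)
  have pJ: "(\<Sum>j\<in>insert a J. M i j * p j) = 0" if "i \<in> J" for i
    using z[OF that] insert.hyps p by (simp cong: sum.cong) (simp add: p_def)
  define s where "s = (\<Sum>j\<in>insert a J. M a j * p j)"
  have "0 < (\<Sum>i\<in>insert a J. \<Sum>j\<in>insert a J. p i * M i j * p j)"
    by (intro insert.prems[rule_format, of p]) (auto simp: p_def)
  also have "\<dots> = (\<Sum>i\<in>insert a J. p i * (\<Sum>j\<in>insert a J. M i j * p j))"
    by (simp add: sum_distrib_left mult.assoc)
  also have "\<dots> = p a * s" using pJ insert.hyps by (simp add: s_def)
  finally have s: "s > 0" by (simp add: p_def)
  define t where "t = (b a - (\<Sum>j\<in>J. M a j * y j)) / s"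
  define x where "x j = (if j = a then 0 else y j) + t * p j" for j
  have x: "(\<Sum>j\<in>insert a J. M i j * x j) = (\<Sum>j\<in>J. M i j * y j) + t * (\<Sum>j\<in>insert a J. M i j * p j)" for i
  proof -
    have "(\<Sum>j\<in>insert a J. M i j * x j)
      = (\<Sum>j\<in>insert a J. M i j * (if j = a then 0 else y j)) + t * (\<Sum>j\<in>insert a J. M i j * p j)"
      unfolding x_def by (simp add: sum.distrib sum_distrib_left algebra_simps)
    also have "(\<Sum>j\<in>insert a J. M i j * (if j = a then 0 else y j)) = (\<Sum>j\<in>J. M i j * y j)"
      using insert.hyps by (auto intro!: sum.cong)
    finally show ?thesis .
  qed
  have "(\<Sum>j\<in>insert a J. M i j * x j) = b i" if "i \<in> insert a J" for i
    using that unfolding x using pJ y s by (auto simp: t_def s_def[symmetric])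
  then show ?case by blast
qed simp

text \<open>The coefficients depend on the two bonds and not on the site: the form commutes with
  translations, so differences of solutions are again solutions. Coercivity is required for all
  finitely supported functions, which is what \<open>lattice_stability\<close> supplies.\<close>

locale lattice_form =
  fixes S :: "(int^'n) set" and \<beta> :: "int^'n \<Rightarrow> int^'n \<Rightarrow> 'b::euclidean_space \<Rightarrow> 'b \<Rightarrow> real"
    and c M :: real and m :: int
  assumes S_cube: "S \<subseteq> cube m" and m_pos: "m \<ge> 1"
    and bilinear_\<beta>: "\<And>\<rho> \<sigma>. bounded_bilinear (\<beta> \<rho> \<sigma>)"
    and bound_\<beta>: "\<And>\<rho> \<sigma> x y. \<bar>\<beta> \<rho> \<sigma> x y\<bar> \<le> M * norm x * norm y"
    and sym_\<beta>: "\<And>\<rho> \<sigma> x y. \<beta> \<rho> \<sigma> x y = \<beta> \<sigma> \<rho> y x"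
    and c_pos: "c > 0" and M_nonneg: "M \<ge> 0"
    and stable: "\<And>v. finsupp v \<Longrightarrow> c * infsum (grad_sq v) UNIV \<le> lform S \<beta> v v"
begin

abbreviation "q \<equiv> form_density S \<beta>"
abbreviation "B \<equiv> lform S \<beta>"

lemma q_add_left: "q (\<lambda>x. v x + v' x) w x = q v w x + q v' w x"
  unfolding form_density_def ldiff_def add_diff_add
  by (simp add: bounded_bilinear.add_left[OF bilinear_\<beta>] sum.distrib)

lemma q_scale_left: "q (\<lambda>x. t *\<^sub>R v x) w x = t * q v w x"
  unfolding form_density_def ldiff_def scaleR_diff_right[symmetric]
  by (simp add: bounded_bilinear.scaleR_left[OF bilinear_\<beta>] sum_distrib_left)

lemma q_sym: "q v w x = q w v x"
  unfolding form_density_def by (subst sum.swap) (simp add: sym_\<beta>[of _ _ "ldiff _ v x"])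

lemma B_sym: "B v w = B w v"
proof -
  have "q v w = q w v" by (rule ext, rule q_sym)
  then show ?thesis by (simp add: lform_def)
qed

lemma q_bound: "\<bar>q v w x\<bar> \<le> (\<Sum>\<rho>\<in>S. \<Sum>\<sigma>\<in>S. M * (norm (ldiff \<rho> v x) * norm (ldiff \<sigma> w x)))"
proof -
  have "\<bar>q v w x\<bar> \<le> (\<Sum>\<rho>\<in>S. \<Sum>\<sigma>\<in>S. \<bar>\<beta> \<rho> \<sigma> (ldiff \<rho> v x) (ldiff \<sigma> w x)\<bar>)"
    unfolding form_density_def by (intro order_trans[OF sum_abs] sum_mono order_refl)
  also have "\<dots> \<le> (\<Sum>\<rho>\<in>S. \<Sum>\<sigma>\<in>S. M * (norm (ldiff \<rho> v x) * norm (ldiff \<sigma> w x)))"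
    using bound_\<beta> by (intro sum_mono) (simp add: mult.assoc)
  finally show ?thesis .
qed

lemma q_zero:
  assumes "\<And>x. x \<notin> cube r \<Longrightarrow> w x = 0" "x \<notin> cube (r + m)"
  shows "q v w x = 0"
proof -
  have "x \<notin> cube r" using assms(2) cube_mono[of r "r + m"] m_pos by auto
  moreover have "x + \<sigma> \<notin> cube r" if "\<sigma> \<in> S" for \<sigma>
    using cube_add_cancel[of x \<sigma> r m] that S_cube assms(2) by auto
  ultimately show ?thesis
    using assms(1) by (simp add: form_density_def ldiff_def bounded_bilinear.zero_right[OF bilinear_\<beta>])
qed

lemma B_eq_sum:
  assumes "\<And>x. x \<notin> cube r \<Longrightarrow> w x = 0" "r + m \<le> R"
  shows "B v w = (\<Sum>x\<in>cube R. q v w x)"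
proof -
  have "B v w = infsum (q v w) (cube R)"
    unfolding lform_def using q_zero[of r w _ v] assms cube_mono[of "r + m" R]
    by (intro infsum_cong_neutral) auto
  then show ?thesis by simp
qed

lemma q_summable: "finsupp w \<Longrightarrow> q v w summable_on UNIV"
proof -
  assume "finsupp w"
  then obtain r where r: "\<And>x. x \<notin> cube r \<Longrightarrow> w x = 0" using finsupp_cube by blast
  show ?thesis
    by (rule finite_nonzero_values_imp_summable_on, rule finite_subset[of _ "cube (r + m)"])
      (use q_zero[of r w] r in auto)
qed

lemma B_add_left: "finsupp w \<Longrightarrow> B (\<lambda>x. v x + v' x) w = B v w + B v' w"
  unfolding lform_def q_add_left[abs_def] by (intro infsum_add q_summable)

lemma B_scale_left: "finsupp w \<Longrightarrow> B (\<lambda>x. t *\<^sub>R v x) w = t * B v w"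
  unfolding lform_def q_scale_left[abs_def] by (intro infsum_cmult_right q_summable)

lemma B_diff_left: "finsupp w \<Longrightarrow> B (\<lambda>x. v x - v' x) w = B v w - B v' w"
  using B_add_left[of w v "\<lambda>x. (-1) *\<^sub>R v' x"] B_scale_left[of w "-1" v'] by simp

lemma B_zero_left: "B (\<lambda>x. 0) w = 0"
  unfolding lform_def form_density_def ldiff_def
  by (simp add: bounded_bilinear.zero_left[OF bilinear_\<beta>])

lemma B_sum_left: "finsupp w \<Longrightarrow> finite J \<Longrightarrow> B (\<lambda>x. \<Sum>j\<in>J. t j *\<^sub>R e j x) w = (\<Sum>j\<in>J. t j * B (e j) w)"
  by (induction J rule: infinite_finite_induct) (simp_all add: B_zero_left B_add_left B_scale_left)

lemma B_shift: "B (\<lambda>x. v (x + \<tau>)) w = B v (\<lambda>x. w (x - \<tau>))"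
proof -
  have "q (\<lambda>x. v (x + \<tau>)) w x = q v (\<lambda>x. w (x - \<tau>)) (x + \<tau>)" for x
    by (simp add: form_density_def ldiff_def algebra_simps)
  then have "q (\<lambda>x. v (x + \<tau>)) w = (\<lambda>x. q v (\<lambda>x. w (x - \<tau>)) (x + \<tau>))" by (rule ext)
  then have "B (\<lambda>x. v (x + \<tau>)) w = infsum (\<lambda>x. q v (\<lambda>x. w (x - \<tau>)) (x + \<tau>)) UNIV"
    by (simp add: lform_def)
  also have "\<dots> = B v (\<lambda>x. w (x - \<tau>))"
    unfolding lform_def
    by (rule infsum_reindex_bij_betw, rule bij_betwI[where g = "\<lambda>x. x - \<tau>"]) auto
  finally show ?thesis .
qed

lemma finsupp_shift: "finsupp w \<Longrightarrow> finsupp (\<lambda>x::int^'n. w (x + \<tau>) :: 'b)"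
proof -
  assume w: "finsupp w"
  have "{x. w (x + \<tau>) \<noteq> 0} = (\<lambda>x. x - \<tau>) ` {x. w x \<noteq> 0}"
    by (auto simp: image_iff) (metis add_diff_cancel_right')
  then show ?thesis using w by (simp add: finsupp_def)
qed

text \<open>Summation by parts, as translation invariance. \<open>v\<close> may have infinite
  support, so additivity in \<open>w\<close> is derived from the summability of the
  densities.\<close>

lemma B_ldiff: "finsupp w \<Longrightarrow> B (ldiff \<tau> v) w = B v (ldiff (- \<tau>) w)"
proof -
  assume w: "finsupp w"
  have "B (ldiff \<tau> v) w = B (\<lambda>x. v (x + \<tau>)) w - B v w"
    unfolding ldiff_def using w by (rule B_diff_left)
  also have "\<dots> = B (\<lambda>x. w (x + (- \<tau>))) v - B w v"
    by (simp add: B_shift B_sym[of v])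
  also have "\<dots> = B (ldiff (- \<tau>) w) v"
    unfolding ldiff_def lform_def
  proof -
    have qs: "q v w = q w v" for v w by (rule ext, rule q_sym)
    have 1: "q (\<lambda>x. w (x + - \<tau>)) v summable_on UNIV" "(\<lambda>x. - q w v x) summable_on UNIV"
      using q_summable[OF finsupp_shift[OF w], of v "- \<tau>"] summable_on_uminus[THEN iffD2, OF q_summable[OF w, of v]]
      unfolding qs[of v] by simp_all
    have "q (\<lambda>x. w (x + - \<tau>) - w x) v x = q (\<lambda>x. w (x + - \<tau>)) v x + - q w v x" for x
      using q_add_left[of "\<lambda>x. w (x + - \<tau>)" "\<lambda>x. (-1) *\<^sub>R w x" v x] q_scale_left[of "-1" w v x] by simp
    then have "q (\<lambda>x. w (x + - \<tau>) - w x) v = (\<lambda>x. q (\<lambda>x. w (x + - \<tau>)) v x + - q w v x)" by (rule ext)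
    then show "infsum (q (\<lambda>x. w (x + - \<tau>)) v) UNIV - infsum (q w v) UNIV
      = infsum (q (\<lambda>x. w (x + - \<tau>) - w x) v) UNIV"
      using infsum_add[OF 1] by (simp only: infsum_uminus)
  qed
  finally show ?thesis by (simp add: B_sym)
qed

definition "Kb = M * real (card S) ^ 2 * path_const2 TYPE('n) m"

lemma Kb_nonneg: "Kb \<ge> 0" by (simp add: Kb_def M_nonneg path_const2_nonneg)

lemma B_bound:
  assumes w: "finsupp w" and v: "\<And>F. finite F \<Longrightarrow> sum (grad_sq v) F \<le> X"
  shows "\<bar>B v w\<bar> \<le> Kb * sqrt X * sqrt (infsum (grad_sq w) UNIV)"
proof -
  obtain r where r: "\<And>x. x \<notin> cube r \<Longrightarrow> w x = 0" using finsupp_cube[OF w] by blast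
  let ?R = "r + m" let ?E = "infsum (grad_sq w) UNIV" let ?P = "path_const2 TYPE('n) m"
  have cs: "(\<Sum>x\<in>cube ?R. norm (ldiff \<rho> v x) * norm (ldiff \<sigma> w x)) \<le> ?P * (sqrt X * sqrt ?E)"
    if "\<rho> \<in> S" "\<sigma> \<in> S" for \<rho> \<sigma>
  proof -
    have 1: "(\<Sum>x\<in>cube ?R. (norm (ldiff \<rho> v x))\<^sup>2) \<le> ?P * X"
      using that S_cube by (intro sum_ldiff_sq_le v) auto
    have 2: "(\<Sum>x\<in>cube ?R. (norm (ldiff \<sigma> w x))\<^sup>2) \<le> ?P * ?E"
      using that S_cube grad_sq_summable[OF w]
      by (intro sum_ldiff_sq_le finite_sum_le_infsum) auto
    have "(\<Sum>x\<in>cube ?R. norm (ldiff \<rho> v x) * norm (ldiff \<sigma> w x))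
      \<le> L2_set (\<lambda>x. norm (ldiff \<rho> v x)) (cube ?R) * L2_set (\<lambda>x. norm (ldiff \<sigma> w x)) (cube ?R)"
      using L2_set_mult_ineq[of "\<lambda>x. norm (ldiff \<rho> v x)" "\<lambda>x. norm (ldiff \<sigma> w x)" "cube ?R"] by simp
    also have "\<dots> \<le> sqrt (?P * X) * sqrt (?P * ?E)"
      unfolding L2_set_def using 1 2 by (intro mult_mono real_sqrt_le_mono) (auto simp: sum_nonneg intro: order_trans[rotated])
    also have "\<dots> = ?P * (sqrt X * sqrt ?E)"
      using path_const2_nonneg[where 'n = 'n, of m] by (simp add: real_sqrt_mult)
    finally show ?thesis .
  qed
  have Beq: "B v w = (\<Sum>x\<in>cube ?R. q v w x)" by (rule B_eq_sum) (use r in auto)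
  have "\<bar>B v w\<bar> \<le> (\<Sum>x\<in>cube ?R. \<Sum>\<rho>\<in>S. \<Sum>\<sigma>\<in>S. M * (norm (ldiff \<rho> v x) * norm (ldiff \<sigma> w x)))"
    unfolding Beq by (rule order_trans[OF sum_abs sum_mono[OF q_bound]])
  also have "\<dots> = (\<Sum>\<rho>\<in>S. \<Sum>\<sigma>\<in>S. M * (\<Sum>x\<in>cube ?R. norm (ldiff \<rho> v x) * norm (ldiff \<sigma> w x)))"
    unfolding sum_distrib_left
    by (subst sum.swap, rule sum.cong[OF refl], rule sum.swap)
  also have "\<dots> \<le> (\<Sum>\<rho>\<in>S. \<Sum>\<sigma>\<in>S. M * (?P * (sqrt X * sqrt ?E)))"
    by (intro sum_mono mult_left_mono cs M_nonneg)
  finally show ?thesis by (simp add: Kb_def power2_eq_square mult_ac)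
qed

end

lemma ldiffs_append: "ldiffs (is @ js) v = ldiffs is (ldiffs js v)"
  by (induction "is") auto

lemma finsupp_ldiffs: "finsupp w \<Longrightarrow> finsupp (ldiffs is (w :: int^'n \<Rightarrow> 'b::real_normed_vector))"
  by (induction "is") (auto intro: finsupp_ldiff)

lemma infsum_le_sum_bound:
  fixes f :: "'a \<Rightarrow> real"
  assumes "\<And>x. x \<in> A \<Longrightarrow> f x \<ge> 0" "\<And>F. finite F \<Longrightarrow> F \<subseteq> A \<Longrightarrow> sum f F \<le> X" 
  shows "f summable_on A" "infsum f A \<le> X"
proof -
  show s: "f summable_on A"
    using assms by (intro nonneg_bdd_above_summable_on) (auto simp: bdd_above_def)
  show "infsum f A \<le> X" using s assms(2) by (rule infsum_le_finite_sums)
qed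

section \<open>Interior regularity of functions that are harmonic for the form\<close>

context lattice_form
begin

definition "harmonic t \<phi> \<longleftrightarrow> (\<forall>w. (\<forall>x. x \<notin> cube t \<longrightarrow> w x = 0) \<longrightarrow> B \<phi> w = 0)"

lemma harmonic_mono: "harmonic t \<phi> \<Longrightarrow> s \<le> t \<Longrightarrow> harmonic s \<phi>"
  unfolding harmonic_def using cube_mono by blast

text \<open>The adjoint difference of a test function supported in \<open>cube (t - 1)\<close> is
  supported in \<open>cube t\<close>.\<close>

lemma harmonic_ldiff:
  assumes "harmonic t \<phi>" shows "harmonic (t - 1) (ldiff (axis i 1) \<phi>)"
  unfolding harmonic_def
proof (intro allI impI)
  fix w :: "int^'n \<Rightarrow> 'b" assume w: "\<forall>x. x \<notin> cube (t - 1) \<longrightarrow> w x = 0"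
  have "ldiff (- axis i 1) w x = 0" if "x \<notin> cube t" for x
  proof -
    have "x \<notin> cube (t - 1)" using that cube_mono[of "t - 1" t] by auto
    moreover have "x + - axis i 1 \<notin> cube (t - 1)"
      using cube_add[OF _ axis_in_cube, of "x + - axis i 1" "t - 1" i] that by auto
    ultimately show ?thesis using w by (simp add: ldiff_def)
  qed
  then have "B \<phi> (ldiff (- axis i 1) w) = 0" using assms by (simp add: harmonic_def)
  moreover have "finsupp w" using w by (intro finsuppI) auto
  ultimately show "B (ldiff (axis i 1) \<phi>) w = 0" by (simp add: B_ldiff)
qed

text \<open>Localisation: the terms of \<open>q (\<eta>v) (\<eta>v) - q (\<eta>\<^sup>2v) v\<close>, symmetrised, contain only squares of
  differences of \<open>\<eta>\<close>.\<close>

definition ims :: "(int^'n \<Rightarrow> real) \<Rightarrow> (int^'n \<Rightarrow> 'b) \<Rightarrow> int^'n \<Rightarrow> real" where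
  "ims \<eta> v x = (\<Sum>\<rho>\<in>S. \<Sum>\<sigma>\<in>S.
     - (\<eta> (x + \<rho>) - \<eta> (x + \<sigma>))\<^sup>2 / 2 * \<beta> \<rho> \<sigma> (v (x + \<rho>)) (v (x + \<sigma>))
     + (\<eta> (x + \<rho>) - \<eta> x)\<^sup>2 / 2 * \<beta> \<rho> \<sigma> (v (x + \<rho>)) (v x)
     + (\<eta> x - \<eta> (x + \<sigma>))\<^sup>2 / 2 * \<beta> \<rho> \<sigma> (v x) (v (x + \<sigma>)))"

text \<open>The identity \<open>a * b = (a\<^sup>2 + b\<^sup>2) / 2 - (a - b)\<^sup>2 / 2\<close> is
  applied to the product of cutoff values in front of each of the four terms of the density.\<close>

lemma q_cutoff:
  "q (\<lambda>x. \<eta> x *\<^sub>R v x) (\<lambda>x. \<eta> x *\<^sub>R v x) x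
    = (q (\<lambda>x. (\<eta> x)\<^sup>2 *\<^sub>R v x) v x + q v (\<lambda>x. (\<eta> x)\<^sup>2 *\<^sub>R v x) x) / 2 + ims \<eta> v x"
  unfolding form_density_def ims_def add_divide_distrib sum_divide_distrib sum.distrib[symmetric] ldiff_def
  by (intro sum.cong refl)
    (simp add: bounded_bilinear.diff_left[OF bilinear_\<beta>] bounded_bilinear.diff_right[OF bilinear_\<beta>]
      bounded_bilinear.scaleR_left[OF bilinear_\<beta>] bounded_bilinear.scaleR_right[OF bilinear_\<beta>],
      simp add: field_simps power2_eq_square)

lemma ims_bound:
  assumes L: "\<And>\<rho>. \<rho> \<in> S \<Longrightarrow> \<bar>\<eta> (x + \<rho>) - \<eta> x\<bar> \<le> L"
  shows "\<bar>ims \<eta> v x\<bar> \<le> 2 * M * L\<^sup>2 *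
    (\<Sum>\<rho>\<in>S. \<Sum>\<sigma>\<in>S. (norm (v (x + \<rho>)))\<^sup>2 + (norm (v (x + \<sigma>)))\<^sup>2 + (norm (v x))\<^sup>2)"
proof -
  have sq: "a\<^sup>2 \<le> L'\<^sup>2" if "\<bar>a\<bar> \<le> L'" for a L' :: real
    using power_mono[OF that, of 2] by simp
  have tm: "\<bar>s * \<beta> \<rho> \<sigma> a b\<bar> \<le> M * L\<^sup>2 * ((norm a)\<^sup>2 + (norm b)\<^sup>2)" if "0 \<le> s" "s \<le> 2 * L\<^sup>2" for s a b \<rho> \<sigma>
  proof -
    have "\<bar>s * \<beta> \<rho> \<sigma> a b\<bar> \<le> (2 * L\<^sup>2) * (M * norm a * norm b)"
      unfolding abs_mult using that bound_\<beta>[of \<rho> \<sigma> a b] by (intro mult_mono) auto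
    also have "\<dots> = M * L\<^sup>2 * (2 * norm a * norm b)" by simp
    also have "\<dots> \<le> M * L\<^sup>2 * ((norm a)\<^sup>2 + (norm b)\<^sup>2)"
      using M_nonneg sum_squares_bound[of "norm a" "norm b"] by (intro mult_left_mono) auto
    finally show ?thesis .
  qed
  have "\<bar>ims \<eta> v x\<bar> \<le> (\<Sum>\<rho>\<in>S. \<Sum>\<sigma>\<in>S. M * L\<^sup>2 * ((norm (v (x + \<rho>)))\<^sup>2 + (norm (v (x + \<sigma>)))\<^sup>2)
     + M * L\<^sup>2 * ((norm (v (x + \<rho>)))\<^sup>2 + (norm (v x))\<^sup>2) + M * L\<^sup>2 * ((norm (v x))\<^sup>2 + (norm (v (x + \<sigma>)))\<^sup>2))"
    unfolding ims_def
  proof (rule order_trans[OF sum_abs sum_mono], rule order_trans[OF sum_abs sum_mono])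
    fix \<rho> \<sigma> assume S: "\<rho> \<in> S" "\<sigma> \<in> S"
    have 1: "(\<eta> (x + \<rho>) - \<eta> (x + \<sigma>))\<^sup>2 \<le> (2 * L)\<^sup>2" using L[OF S(1)] L[OF S(2)] by (intro sq) linarith
    have 2: "(\<eta> (x + \<rho>) - \<eta> x)\<^sup>2 \<le> L\<^sup>2" "(\<eta> x - \<eta> (x + \<sigma>))\<^sup>2 \<le> L\<^sup>2"
      using L[OF S(1)] L[OF S(2)] by (auto intro!: sq simp: abs_minus_commute)
    have t1: "\<bar>(\<eta> (x + \<rho>) - \<eta> (x + \<sigma>))\<^sup>2 / 2 * \<beta> \<rho> \<sigma> (v (x + \<rho>)) (v (x + \<sigma>))\<bar>
       \<le> M * L\<^sup>2 * ((norm (v (x + \<rho>)))\<^sup>2 + (norm (v (x + \<sigma>)))\<^sup>2)"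
      using 1 by (intro tm) (auto simp: power_mult_distrib)
    have t2: "\<bar>(\<eta> (x + \<rho>) - \<eta> x)\<^sup>2 / 2 * \<beta> \<rho> \<sigma> (v (x + \<rho>)) (v x)\<bar>
       \<le> M * L\<^sup>2 * ((norm (v (x + \<rho>)))\<^sup>2 + (norm (v x))\<^sup>2)"
      using 2 zero_le_power2[of L] by (intro tm, simp, linarith)
    have t3: "\<bar>(\<eta> x - \<eta> (x + \<sigma>))\<^sup>2 / 2 * \<beta> \<rho> \<sigma> (v x) (v (x + \<sigma>))\<bar>
       \<le> M * L\<^sup>2 * ((norm (v x))\<^sup>2 + (norm (v (x + \<sigma>)))\<^sup>2)"
      using 2 zero_le_power2[of L] by (intro tm, simp, linarith)
    show "\<bar>- (\<eta> (x + \<rho>) - \<eta> (x + \<sigma>))\<^sup>2 / 2 * \<beta> \<rho> \<sigma> (v (x + \<rho>)) (v (x + \<sigma>))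
       + (\<eta> (x + \<rho>) - \<eta> x)\<^sup>2 / 2 * \<beta> \<rho> \<sigma> (v (x + \<rho>)) (v x)
       + (\<eta> x - \<eta> (x + \<sigma>))\<^sup>2 / 2 * \<beta> \<rho> \<sigma> (v x) (v (x + \<sigma>))\<bar>
      \<le> M * L\<^sup>2 * ((norm (v (x + \<rho>)))\<^sup>2 + (norm (v (x + \<sigma>)))\<^sup>2)
     + M * L\<^sup>2 * ((norm (v (x + \<rho>)))\<^sup>2 + (norm (v x))\<^sup>2) + M * L\<^sup>2 * ((norm (v x))\<^sup>2 + (norm (v (x + \<sigma>)))\<^sup>2)"
      using t1 t2 t3 by simp
  qed
  also have "\<dots> = 2 * M * L\<^sup>2 * (\<Sum>\<rho>\<in>S. \<Sum>\<sigma>\<in>S. (norm (v (x + \<rho>)))\<^sup>2 + (norm (v (x + \<sigma>)))\<^sup>2 + (norm (v x))\<^sup>2)"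
    unfolding sum_distrib_left by (intro sum.cong refl) (simp add: algebra_simps)
  finally show ?thesis .
qed

text \<open>Stability is applied to \<phi> times the cutoff. Harmonicity, tested with \<phi> times
  the squared cutoff, removes the main terms of \<open>q_cutoff\<close>, and what is left carries
  the squared slope. As to the margins: for \<open>x\<close> in \<open>cube (s - 1)\<close> the
  cutoff is 1 at \<open>x\<close> and at \<open>x + axis i 1\<close>, and stencil shifts of
  \<open>cube (t + m)\<close> stay in \<open>cube (t + 2 * m)\<close>.\<close>

lemma caccioppoli:
  assumes \<phi>: "finsupp \<phi>" "harmonic t \<phi>" and st: "s < t"
  shows "c * (\<Sum>x\<in>cube (s - 1). grad_sq \<phi> x)
    \<le> 6 * M * (real (card S))\<^sup>2 * (real_of_int m / real_of_int (t - s))\<^sup>2 * (\<Sum>x\<in>cube (t + 2 * m). (norm (\<phi> x))\<^sup>2)"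
proof -
  define \<eta> where "\<eta> = (cutoff s t :: int^'n \<Rightarrow> real)"
  let ?L = "real_of_int m / real_of_int (t - s)" and ?V = "\<Sum>x\<in>cube (t + 2 * m). (norm (\<phi> x))\<^sup>2"
  define w where "w = (\<lambda>x. \<eta> x *\<^sub>R \<phi> x)"
  define w2 where "w2 = (\<lambda>x. (\<eta> x)\<^sup>2 *\<^sub>R \<phi> x)"
  have \<eta>0: "\<eta> x = 0" if "x \<notin> cube t" for x
    unfolding \<eta>_def using that cube_mono[of "t - 1" t] st by (intro cutoff_zero) auto
  have L: "\<bar>\<eta> (x + \<rho>) - \<eta> x\<bar> \<le> ?L" if "\<rho> \<in> S" for x \<rho>
  proof -
    have "supn \<rho> \<le> m" using that S_cube by (auto simp: supn_le_iff)
    then have "real_of_int (supn \<rho>) / real_of_int (t - s) \<le> ?L"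
      using st by (intro divide_right_mono) auto
    then show ?thesis using cutoff_lipschitz[OF st, of x \<rho>] by (simp add: \<eta>_def)
  qed
  have w0: "w x = 0" "w2 x = 0" if "x \<notin> cube t" for x using \<eta>0[OF that] by (auto simp: w_def w2_def)
  have fw: "finsupp w" "finsupp w2" using w0 by (auto intro: finsuppI[of t])
  have Bw: "B w w = (\<Sum>x\<in>cube (t + m). q w w x)" and Bw2: "B \<phi> w2 = (\<Sum>x\<in>cube (t + m). q \<phi> w2 x)"
    by (rule B_eq_sum; use w0 in auto)+
  have "B \<phi> w2 = 0" using \<phi>(2) w0 by (auto simp: harmonic_def)
  then have z: "(\<Sum>x\<in>cube (t + m). q \<phi> w2 x) = 0" "(\<Sum>x\<in>cube (t + m). q w2 \<phi> x) = 0"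
    using Bw2 by (simp_all add: q_sym[of w2])
  have "B w w = (\<Sum>x\<in>cube (t + m). (q w2 \<phi> x + q \<phi> w2 x) / 2 + ims \<eta> \<phi> x)"
    unfolding Bw unfolding w_def w2_def by (intro sum.cong refl q_cutoff)
  also have "\<dots> = (\<Sum>x\<in>cube (t + m). ims \<eta> \<phi> x)"
    using z by (simp add: sum.distrib sum_divide_distrib[symmetric])
  also have "\<dots> \<le> (\<Sum>x\<in>cube (t + m). 2 * M * ?L\<^sup>2 *
    (\<Sum>\<rho>\<in>S. \<Sum>\<sigma>\<in>S. (norm (\<phi> (x + \<rho>)))\<^sup>2 + (norm (\<phi> (x + \<sigma>)))\<^sup>2 + (norm (\<phi> x))\<^sup>2))"
    using ims_bound[of \<eta> _ ?L \<phi>] L by (intro sum_mono) (auto simp: abs_le_iff)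
  also have "\<dots> = 2 * M * ?L\<^sup>2 * (\<Sum>\<rho>\<in>S. \<Sum>\<sigma>\<in>S. (\<Sum>x\<in>cube (t + m). (norm (\<phi> (x + \<rho>)))\<^sup>2)
      + (\<Sum>x\<in>cube (t + m). (norm (\<phi> (x + \<sigma>)))\<^sup>2) + (\<Sum>x\<in>cube (t + m). (norm (\<phi> x))\<^sup>2))"
    unfolding sum.distrib[symmetric] sum_distrib_left[symmetric]
    by (intro arg_cong[of _ _ "(*) _"], subst sum.swap, rule sum.cong[OF refl], rule sum.swap)
  also have "\<dots> \<le> 2 * M * ?L\<^sup>2 * (\<Sum>\<rho>\<in>S. \<Sum>\<sigma>\<in>S. ?V + ?V + ?V)"
  proof (intro mult_left_mono sum_mono add_mono)
    have *: "(\<Sum>x\<in>cube (t + m). (norm (\<phi> (x + \<rho>)))\<^sup>2) \<le> ?V" if "\<rho> \<in> cube m" for \<rho>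
    proof -
      have "(\<Sum>x\<in>cube (t + m). (norm (\<phi> (x + \<rho>)))\<^sup>2) = (\<Sum>x\<in>(\<lambda>x. x + \<rho>) ` cube (t + m). (norm (\<phi> x))\<^sup>2)"
        by (simp add: sum.reindex inj_on_def)
      also have "\<dots> \<le> ?V"
        using cube_add[OF _ that, of _ "t + m"] by (intro sum_mono2) (auto simp: algebra_simps)
      finally show ?thesis .
    qed
    show "(\<Sum>x\<in>cube (t + m). (norm (\<phi> (x + \<rho>)))\<^sup>2) \<le> ?V" if "\<rho> \<in> S" for \<rho> using * that S_cube by blast
    show "(\<Sum>x\<in>cube (t + m). (norm (\<phi> (x + \<sigma>)))\<^sup>2) \<le> ?V" if "\<sigma> \<in> S" for \<sigma> using * that S_cube by blast
    show "(\<Sum>x\<in>cube (t + m). (norm (\<phi> x))\<^sup>2) \<le> ?V" using *[OF zero_in_cube] m_pos by simp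
  qed (use M_nonneg in auto)
  also have "\<dots> = 6 * M * (real (card S))\<^sup>2 * ?L\<^sup>2 * ?V" by (simp add: power2_eq_square)
  finally have up: "B w w \<le> 6 * M * (real (card S))\<^sup>2 * ?L\<^sup>2 * ?V" .
  have "(\<Sum>x\<in>cube (s - 1). grad_sq \<phi> x) = (\<Sum>x\<in>cube (s - 1). grad_sq w x)"
  proof (rule sum.cong[OF refl])
    fix x :: "int^'n" assume x: "x \<in> cube (s - 1)"
    have "x \<in> cube s" "x + axis i 1 \<in> cube s" for i
      using x cube_mono[of "s - 1" s] cube_add[OF x axis_in_cube, of i] by auto
    then show "grad_sq \<phi> x = grad_sq w x"
      using st by (simp add: grad_sq_def ldiff_def w_def \<eta>_def cutoff_one)
  qed
  also have "\<dots> \<le> infsum (grad_sq w) UNIV"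
    using grad_sq_summable[OF fw(1)] by (intro finite_sum_le_infsum) auto
  finally have "c * (\<Sum>x\<in>cube (s - 1). grad_sq \<phi> x) \<le> c * infsum (grad_sq w) UNIV"
    using c_pos by simp
  also have "\<dots> \<le> B w w" by (rule stable[OF fw(1)])
  finally show ?thesis using up by simp
qed

lemma harmonic_ldiffs: "harmonic t \<phi> \<Longrightarrow> harmonic (t - int (length is)) (ldiffs is \<phi>)"
proof (induction "is")
  case (Cons i "is")
  then show ?case using harmonic_ldiff[of "t - int (length is)" "ldiffs is \<phi>" i] by (simp add: algebra_simps)
qed simp

text \<open>The factor 24 is the 6 of \<open>caccioppoli\<close> times 4, from
  \<open>t - s \<ge> r / 2\<close>. Adding 1 makes the powers of \<open>Cc\<close> increase with the
  exponent.\<close>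

definition "Cc = 1 + 24 * M * (real (card S))\<^sup>2 * (real_of_int m)\<^sup>2 / c"

lemma Cc_ge: "Cc \<ge> 1" using M_nonneg c_pos by (simp add: Cc_def)

text \<open>Every difference beyond the first costs one Caccioppoli inequality and one layer of
  width \<open>r\<close>. Of this width \<open>2 * m + 1\<close> is lost to the margins, and
  \<open>r \<ge> 4 * m + 2\<close> leaves at least half.\<close>

lemma interior_L2:
  assumes \<phi>: "finsupp \<phi>" "harmonic (int A * r) \<phi>" and r: "r \<ge> 4 * m + 2"
    and "j < A" "length is = Suc j"
  shows "(\<Sum>x\<in>cube ((int A - int j) * r). (norm (ldiffs is \<phi> x))\<^sup>2)
    \<le> (Cc / (real_of_int r)\<^sup>2) ^ j * infsum (grad_sq \<phi>) UNIV"
  using assms(4,5)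
proof (induction j arbitrary: "is")
  case 0
  then obtain i where i: "is = [i]" by (cases "is") auto
  have "(\<Sum>x\<in>cube (int A * r). (norm (ldiff (axis i 1) \<phi> x))\<^sup>2) \<le> (\<Sum>x\<in>cube (int A * r). grad_sq \<phi> x)"
    by (intro sum_mono norm_ldiff_le_grad_sq)
  also have "\<dots> \<le> infsum (grad_sq \<phi>) UNIV"
    using grad_sq_summable[OF \<phi>(1)] by (intro finite_sum_le_infsum) auto
  finally show ?case using i by simp
next
  case (Suc j)
  then obtain i js where i: "is = i # js" and js: "length js = Suc j" by (cases "is") auto
  let ?v = "ldiffs js \<phi>"
  define t where "t = (int A - int j) * r - 2 * m"
  define s where "s = (int A - int (Suc j)) * r + 1"
  have ts: "t - s = r - 2 * m - 1" by (simp add: t_def s_def algebra_simps)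
  have st: "s < t" using ts r m_pos by linarith
  have rpos: "r > 0" using r m_pos by linarith
  have "int j * r \<ge> int j" using rpos mult_left_mono[of 1 r "int j"] by simp
  then have "int A * r - int (length js) \<ge> t"
    using m_pos js by (simp add: t_def algebra_simps)
  then have harm: "harmonic t ?v" using harmonic_mono[OF harmonic_ldiffs[OF \<phi>(2), of js]] by blast
  have "c * (\<Sum>x\<in>cube (s - 1). grad_sq ?v x)
    \<le> 6 * M * (real (card S))\<^sup>2 * (real_of_int m / real_of_int (t - s))\<^sup>2 * (\<Sum>x\<in>cube (t + 2 * m). (norm (?v x))\<^sup>2)"
    by (rule caccioppoli[OF finsupp_ldiffs[OF \<phi>(1)] harm st])
  also have "\<dots> \<le> 6 * M * (real (card S))\<^sup>2 * (2 * real_of_int m / real_of_int r)\<^sup>2 * (\<Sum>x\<in>cube (t + 2 * m). (norm (?v x))\<^sup>2)"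
  proof (intro mult_right_mono mult_left_mono power_mono sum_nonneg)
    have "r \<le> 2 * (t - s)" unfolding ts using r by simp
    then have "real_of_int r \<le> real_of_int (2 * (t - s))" by (rule of_int_le_iff[THEN iffD2])
    then have "real_of_int r \<le> 2 * real_of_int (t - s)" by simp
    then show "real_of_int m / real_of_int (t - s) \<le> 2 * real_of_int m / real_of_int r"
      using st rpos m_pos mult_left_mono[of "real_of_int r" "2 * real_of_int (t - s)" "real_of_int m"]
      by (simp add: field_simps)
  qed (use M_nonneg st m_pos in auto)
  finally have "(\<Sum>x\<in>cube (s - 1). grad_sq ?v x) \<le> (6 * M * (real (card S))\<^sup>2 * (2 * real_of_int m / real_of_int r)\<^sup>2
      * (\<Sum>x\<in>cube (t + 2 * m). (norm (?v x))\<^sup>2)) / c"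
    using c_pos by (simp add: pos_le_divide_eq mult.commute)
  also have "\<dots> = (24 * M * (real (card S))\<^sup>2 * (real_of_int m)\<^sup>2 / c) / (real_of_int r)\<^sup>2 * (\<Sum>x\<in>cube (t + 2 * m). (norm (?v x))\<^sup>2)"
    by (simp add: power_divide power_mult_distrib mult_ac)
  finally have 1: "(\<Sum>x\<in>cube (s - 1). grad_sq ?v x)
    \<le> (24 * M * (real (card S))\<^sup>2 * (real_of_int m)\<^sup>2 / c) / (real_of_int r)\<^sup>2 * (\<Sum>x\<in>cube (t + 2 * m). (norm (?v x))\<^sup>2)" .
  have "(\<Sum>x\<in>cube ((int A - int (Suc j)) * r). (norm (ldiffs is \<phi> x))\<^sup>2) \<le> (\<Sum>x\<in>cube (s - 1). grad_sq ?v x)"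
    unfolding i by (simp add: s_def, intro sum_mono norm_ldiff_le_grad_sq)
  also note 1
  also have "(24 * M * (real (card S))\<^sup>2 * (real_of_int m)\<^sup>2 / c) / (real_of_int r)\<^sup>2 * (\<Sum>x\<in>cube (t + 2 * m). (norm (?v x))\<^sup>2)
     \<le> Cc / (real_of_int r)\<^sup>2 * ((Cc / (real_of_int r)\<^sup>2) ^ j * infsum (grad_sq \<phi>) UNIV)"
  proof (intro mult_mono divide_right_mono)
    show "(\<Sum>x\<in>cube (t + 2 * m). (norm (?v x))\<^sup>2) \<le> (Cc / (real_of_int r)\<^sup>2) ^ j * infsum (grad_sq \<phi>) UNIV"
      using Suc.IH[of js] Suc.prems js by (simp add: t_def)
  qed (use Cc_ge in \<open>auto simp: Cc_def intro!: sum_nonneg\<close>)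
  finally show ?case by simp
qed

text \<open>The power of 4 is the Sobolev constant, 9 comes from
  \<open>2 * r + 1 \<le> 3 * r\<close>, and \<open>CARD('n) + 1\<close> bounds the order of the
  differences used in \<open>interior_sup\<close>.\<close>

definition "Ci = 4 ^ CARD('n) * (9 * Cc) ^ (CARD('n) + 1)"

lemma Ci_pos: "Ci > 0" using Cc_ge by (simp add: Ci_def)



text \<open>With d the dimension, Sobolev on \<open>cube r\<close> uses up to d + 1 differences of a
  unit difference of \<phi>. Each consumes one layer of width \<open>r\<close>, and the d + 3 layers
  of the hypothesis accommodate them; the first difference is bounded by the total energy
  itself.\<close>

lemma interior_sup:
  assumes \<phi>: "finsupp \<phi>" "harmonic (int (CARD('n) + 3) * r) \<phi>" and r: "r \<ge> 4 * m + 2" and z: "z \<in> cube r"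
    and js: "length js \<le> 1"
  shows "(norm (ldiffs js (ldiff (axis i 1) \<phi>) z))\<^sup>2
    \<le> Ci * infsum (grad_sq \<phi>) UNIV / real_of_int r ^ (2 * length js + CARD('n))"
proof -
  let ?v = "ldiff (axis i 1) \<phi>" and ?I = "infsum (grad_sq \<phi>) UNIV" and ?N = "2 * real_of_int r + 1"
  have rpos: "real_of_int r > 0" and r1: "real_of_int r \<ge> 1" using r m_pos by linarith+
  have I0: "?I \<ge> 0" by (simp add: infsum_nonneg)
  have "(norm (ldiffs js ?v z))\<^sup>2
    \<le> 4 ^ CARD('n) * ((9 * Cc) ^ (CARD('n) + 1) * ?I) / ?N ^ (2 * length js + CARD('n))"
  proof (rule sobolev_cube[OF z])
    fix ks :: "'n list" assume ks: "length ks \<le> length js + CARD('n)"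
    let ?j = "length ks"
    have lj: "?j \<le> CARD('n) + 1" using ks js by simp
    have sub: "cube r \<subseteq> cube ((int (CARD('n) + 3) - int ?j) * r)"
      using lj rpos mult_right_mono[of 1 "int (CARD('n) + 3) - int ?j" r] by (intro cube_mono) auto
    have "(\<Sum>x\<in>cube r. (norm (ldiffs ks ?v x))\<^sup>2) \<le> (\<Sum>x\<in>cube ((int (CARD('n) + 3) - int ?j) * r). (norm (ldiffs (ks @ [i]) \<phi> x))\<^sup>2)"
      using sub by (simp add: ldiffs_append, intro sum_mono2) auto
    also have "\<dots> \<le> (Cc / (real_of_int r)\<^sup>2) ^ ?j * ?I"
      using lj by (intro interior_L2[OF \<phi>(1) _ r]) (use \<phi>(2) in auto)
    also have "\<dots> \<le> (9 * Cc / ?N\<^sup>2) ^ ?j * ?I"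
    proof (intro mult_right_mono power_mono I0)
      have "?N\<^sup>2 \<le> (3 * real_of_int r)\<^sup>2" using r1 by (intro power_mono) auto
      then have "?N\<^sup>2 \<le> 9 * (real_of_int r)\<^sup>2" by (simp add: power_mult_distrib)
      then have "Cc * ?N\<^sup>2 \<le> Cc * (9 * (real_of_int r)\<^sup>2)" using Cc_ge by (intro mult_left_mono) auto
      then show "Cc / (real_of_int r)\<^sup>2 \<le> 9 * Cc / ?N\<^sup>2"
        using rpos by (simp add: divide_le_eq le_divide_eq field_simps)
    qed (use Cc_ge in auto)
    also have "\<dots> = (9 * Cc) ^ ?j * ?I / ?N ^ (2 * ?j)"
      by (simp add: power_divide power_mult)
    also have "\<dots> \<le> (9 * Cc) ^ (CARD('n) + 1) * ?I / ?N ^ (2 * ?j)"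
      using lj Cc_ge I0 rpos by (intro divide_right_mono mult_right_mono power_increasing) auto
    finally show "(\<Sum>x\<in>cube r. (norm (ldiffs ks ?v x))\<^sup>2) \<le> (9 * Cc) ^ (CARD('n) + 1) * ?I / ?N ^ (2 * ?j)" .
  qed (use I0 Cc_ge in auto)
  also have "\<dots> = Ci * ?I / ?N ^ (2 * length js + CARD('n))" by (simp add: Ci_def)
  also have "\<dots> \<le> Ci * ?I / real_of_int r ^ (2 * length js + CARD('n))"
    using rpos I0 Ci_pos by (intro divide_left_mono power_mono mult_nonneg_nonneg) auto
  finally show ?thesis .
qed

end

section \<open>Dirichlet problems on cubes and the dual test function\<close>

lemma grad_sq_total_pos:
  fixes \<phi> :: "int^'n \<Rightarrow> 'b::real_normed_vector"
  assumes \<phi>: "finsupp \<phi>" and "\<phi> z \<noteq> 0"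
  shows "infsum (grad_sq \<phi>) UNIV > 0"
proof (rule ccontr)
  assume "\<not> ?thesis"
  then have 0: "grad_sq \<phi> x = 0" for x
    by (intro nonneg_infsum_le_0D[of "grad_sq \<phi>" UNIV] grad_sq_summable \<phi>) auto
  have step: "\<phi> (x + axis i 1) = \<phi> x" for x i
    using norm_ldiff_le_grad_sq[of i \<phi> x] by (simp add: 0 ldiff_def)
  obtain r where r: "r \<ge> 0" "\<And>x. x \<notin> cube r \<Longrightarrow> \<phi> x = 0" using finsupp_cube[OF \<phi>] by blast
  fix i :: 'n
  \<comment> \<open>A vanishing gradient makes \<phi> constant on the line through \<open>z\<close>
    in direction \<open>i\<close>, and that line leaves the support.\<close>
  have "\<phi> (upd z i (z $ i + int k)) = \<phi> z" for k
  proof (induction k)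
    case (Suc k)
    have "\<phi> (upd z i (z $ i + int (Suc k))) = \<phi> (upd z i ((z $ i + int k) + 1))"
      by (simp add: algebra_simps)
    then show ?case unfolding upd_Suc step Suc .
  qed simp
  from this[of "nat (r + \<bar>z $ i\<bar> + 1)"] have "\<phi> (upd z i (z $ i + (r + \<bar>z $ i\<bar> + 1))) = \<phi> z"
    using r(1) by simp
  moreover have "\<bar>z $ i + (r + \<bar>z $ i\<bar> + 1)\<bar> > r" using r(1) by linarith
  then have "upd z i (z $ i + (r + \<bar>z $ i\<bar> + 1)) \<notin> cube r"
    unfolding cube_def by (auto intro!: exI[of _ i] simp: not_le)
  ultimately show False using r(2) assms(2) by simp
qed

context lattice_form
begin

text \<open>In the basis of point masses \<open>e\<close> this is a finite linear system. Its matrix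
  is positive definite by stability, since a nonzero function of finite support has positive
  gradient energy.\<close>

lemma dirichlet_solve:
  fixes rhs :: "(int^'n \<Rightarrow> 'b) \<Rightarrow> real"
  assumes add: "\<And>v w. rhs (\<lambda>x. v x + w x) = rhs v + rhs w" and scale: "\<And>t v. rhs (\<lambda>x. t *\<^sub>R v x) = t * rhs v"
  shows "\<exists>\<phi>. (\<forall>x. x \<notin> cube R \<longrightarrow> \<phi> x = 0) \<and> (\<forall>w. (\<forall>x. x \<notin> cube R \<longrightarrow> w x = 0) \<longrightarrow> B \<phi> w = rhs w)"
proof -
  define J where "J = (cube R :: (int^'n) set) \<times> (Basis :: 'b set)"
  define e where "e = (\<lambda>(z, b) (x::int^'n). if x = z then b else (0::'b))"
  have J: "finite J" by (simp add: J_def)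
  have e0: "e j x = 0" if "x \<notin> cube R" "j \<in> J" for j x
    using that by (auto simp: e_def J_def)
  have fe: "finsupp (e j)" if "j \<in> J" for j using e0[OF _ that] by (rule finsuppI)
  have lin: "rhs (\<lambda>x. \<Sum>j\<in>K. t j *\<^sub>R e j x) = (\<Sum>j\<in>K. t j * rhs (e j))" if "finite K" for K t
    using that
  proof induction
    case empty
    show ?case using scale[of 0 "\<lambda>_. 0"] by simp
  qed (simp add: add scale)
  have comp: "(\<Sum>j\<in>J. t j *\<^sub>R e j x) \<bullet> b = t (x, b)" if "(x, b) \<in> J" for t x b
  proof -
    have "(\<Sum>j\<in>J. t j *\<^sub>R e j x) \<bullet> b = (\<Sum>j\<in>J. if j = (x, b) then t j else 0)"
      unfolding inner_sum_left using that
      by (intro sum.cong refl) (auto simp: e_def J_def inner_Basis split: if_splits)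
    then show ?thesis using J that by simp
  qed
  have expand: "w = (\<lambda>x. \<Sum>j\<in>J. (w (fst j) \<bullet> snd j) *\<^sub>R e j x)" if "\<forall>x. x \<notin> cube R \<longrightarrow> w x = 0" for w
  proof
    fix x
    show "w x = (\<Sum>j\<in>J. (w (fst j) \<bullet> snd j) *\<^sub>R e j x)"
    proof (cases "x \<in> cube R")
      case True
      show ?thesis
      proof (rule euclidean_eqI)
        fix b :: 'b assume "b \<in> Basis"
        then show "w x \<bullet> b = (\<Sum>j\<in>J. (w (fst j) \<bullet> snd j) *\<^sub>R e j x) \<bullet> b"
          using comp[of x b "\<lambda>j. w (fst j) \<bullet> snd j"] True by (simp add: J_def)
      qed
    next
      case False
      then show ?thesis using that e0 by simp
    qed
  qed
  define Mt where "Mt i j = B (e j) (e i)" for i j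
  have pos: "\<forall>x. (\<exists>j\<in>J. x j \<noteq> 0) \<longrightarrow> (\<Sum>i\<in>J. \<Sum>j\<in>J. x i * Mt i j * x j) > 0"
  proof (intro allI impI)
    fix x :: "(int^'n) \<times> 'b \<Rightarrow> real" assume "\<exists>j\<in>J. x j \<noteq> 0"
    then obtain z b where zb: "(z, b) \<in> J" "x (z, b) \<noteq> 0" by auto
    define v where "v = (\<lambda>y. \<Sum>j\<in>J. x j *\<^sub>R e j y)"
    have v0: "v y = 0" if "y \<notin> cube R" for y using e0[OF that] by (simp add: v_def)
    have fv: "finsupp v" using v0 by (rule finsuppI)
    have "v z \<noteq> 0" using comp[OF zb(1), of x] zb(2) by (auto simp: v_def)
    then have "0 < c * infsum (grad_sq v) UNIV" using grad_sq_total_pos[OF fv] c_pos by simp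
    also have "\<dots> \<le> B v v" by (rule stable[OF fv])
    also have "B v v = (\<Sum>j\<in>J. x j * B (e j) v)"
      by (subst (1) v_def) (rule B_sum_left[OF fv J])
    also have "\<dots> = (\<Sum>j\<in>J. x j * (\<Sum>i\<in>J. x i * B (e i) (e j)))"
    proof (intro sum.cong refl arg_cong[of _ _ "(*) _"])
      fix j assume j: "j \<in> J"
      have "B (e j) v = B v (e j)" by (rule B_sym)
      also have "\<dots> = (\<Sum>i\<in>J. x i * B (e i) (e j))"
        unfolding v_def by (rule B_sum_left[OF fe[OF j] J])
      finally show "B (e j) v = (\<Sum>i\<in>J. x i * B (e i) (e j))" .
    qed
    also have "\<dots> = (\<Sum>i\<in>J. \<Sum>j\<in>J. x i * Mt i j * x j)"
      by (simp add: Mt_def sum_distrib_left mult_ac)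
    finally show "(\<Sum>i\<in>J. \<Sum>j\<in>J. x i * Mt i j * x j) > 0" .
  qed
  obtain x where x: "\<forall>i\<in>J. (\<Sum>j\<in>J. Mt i j * x j) = rhs (e i)" using posdef_solve[OF J pos, of "\<lambda>i. rhs (e i)"] by blast
  define \<phi> where "\<phi> = (\<lambda>y. \<Sum>j\<in>J. x j *\<^sub>R e j y)"
  have \<phi>0: "\<phi> y = 0" if "y \<notin> cube R" for y using e0[OF that] by (simp add: \<phi>_def)
  have f\<phi>: "finsupp \<phi>" using \<phi>0 by (rule finsuppI)
  have Be: "B \<phi> (e i) = rhs (e i)" if "i \<in> J" for i
    using x that unfolding \<phi>_def B_sum_left[OF fe[OF that] J] Mt_def by (simp add: mult.commute)
  have "B \<phi> w = rhs w" if "\<forall>x. x \<notin> cube R \<longrightarrow> w x = 0" for w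
  proof -
    have "B \<phi> w = B w \<phi>" by (rule B_sym)
    also have "\<dots> = (\<Sum>j\<in>J. (w (fst j) \<bullet> snd j) * B (e j) \<phi>)"
      by (subst expand[OF that]) (rule B_sum_left[OF f\<phi> J])
    also have "\<dots> = (\<Sum>j\<in>J. (w (fst j) \<bullet> snd j) * rhs (e j))"
      unfolding B_sym[of _ \<phi>] using Be by simp
    also have "\<dots> = rhs w"
      by (subst (2) expand[OF that]) (rule lin[OF J, symmetric])
    finally show ?thesis .
  qed
  then show ?thesis using \<phi>0 by blast
qed

lemma sum_inner_grad_bound:
  fixes y w :: "int^'n \<Rightarrow> 'b"
  shows "\<bar>\<Sum>x\<in>P. \<Sum>i\<in>UNIV. ldiff (axis i 1) y x \<bullet> ldiff (axis i 1) w x\<bar>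
    \<le> sqrt (sum (grad_sq y) P) * sqrt (sum (grad_sq w) P)"
proof -
  let ?I = "P \<times> (UNIV::'n set)"
  let ?a = "\<lambda>y (x, i). norm (ldiff (axis i 1) y x :: 'b)"
  have L2: "L2_set (?a y) ?I = sqrt (sum (grad_sq y) P)" for y
    by (simp add: L2_set_def grad_sq_def sum.cartesian_product case_prod_beta)
  have "\<bar>\<Sum>x\<in>P. \<Sum>i\<in>UNIV. ldiff (axis i 1) y x \<bullet> ldiff (axis i 1) w x\<bar>
     \<le> (\<Sum>x\<in>P. \<Sum>i\<in>UNIV. \<bar>ldiff (axis i 1) y x \<bullet> ldiff (axis i 1) w x\<bar>)"
    by (rule order_trans[OF sum_abs]) (intro sum_mono sum_abs)
  also have "\<dots> \<le> (\<Sum>x\<in>P. \<Sum>i\<in>UNIV. norm (ldiff (axis i 1) y x) * norm (ldiff (axis i 1) w x))"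
    by (intro sum_mono Cauchy_Schwarz_ineq2)
  also have "\<dots> = (\<Sum>p\<in>?I. \<bar>?a y p\<bar> * \<bar>?a w p\<bar>)"
    by (simp add: sum.cartesian_product case_prod_beta)
  also have "\<dots> \<le> L2_set (?a y) ?I * L2_set (?a w) ?I" by (rule L2_set_mult_ineq)
  finally show ?thesis unfolding L2 .
qed

text \<open>The energy of \<open>y\<close> on a set \<open>P\<close> is tested with the solution \<open>\<phi>\<close> of the problem whose right-hand
  side is the gradient of \<open>y\<close> restricted to \<open>P\<close>. Solving on a large cube, rather than on the whole
  lattice, costs the error \<open>\<epsilon>\<close>.\<close>

lemma dual_test_function:
  fixes y :: "int^'n \<Rightarrow> 'b"
  assumes y: "grad_sq y summable_on UNIV" and P: "finite P" "P \<inter> cube r = {}" and \<epsilon>: "\<epsilon> > 0"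
  shows "\<exists>\<phi>. finsupp \<phi> \<and> sqrt (infsum (grad_sq \<phi>) UNIV) \<le> sqrt (sum (grad_sq y) P) / c \<and>
    harmonic (r - 1) \<phi> \<and> sum (grad_sq y) P \<le> B y \<phi> + \<epsilon>"
proof -
  define X where "X = sum (grad_sq y) P"
  have X0: "X \<ge> 0" by (simp add: X_def sum_nonneg)
  \<comment> \<open>The two errors of replacing \<open>y\<close> by \<open>w\<close> are
    \<open>sqrt \<delta>\<close> times the first two summands; \<delta> is chosen so that together
    they are at most \<epsilon>.\<close>
  define A where "A = Kb * (sqrt X / c) + sqrt X + 1"
  have A: "A > 0" using X0 Kb_nonneg c_pos by (simp add: A_def add_nonneg_pos)
  define \<delta> where "\<delta> = (\<epsilon> / A)\<^sup>2"
  have \<delta>: "\<delta> > 0" "sqrt \<delta> = \<epsilon> / A" using \<epsilon> A by (simp_all add: \<delta>_def)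
  obtain w where w: "finsupp w" "\<And>F. finite F \<Longrightarrow> (\<Sum>x\<in>F. grad_sq (\<lambda>x. y x - w x) x) \<le> \<delta>"
    using finsupp_approximation[OF y \<delta>(1), of 0] by blast
  obtain rw where rw: "\<And>x. x \<notin> cube rw \<Longrightarrow> w x = 0" using finsupp_cube[OF w(1)] by blast
  define R where "R = max r rw"
  define z where "z = (\<lambda>x. y x - w x)"
  define rhs where "rhs v = (\<Sum>x\<in>P. \<Sum>i\<in>UNIV. ldiff (axis i 1) y x \<bullet> ldiff (axis i 1) v x)" for v
  have "rhs (\<lambda>x. v x + v' x) = rhs v + rhs v'" for v v'
    unfolding rhs_def ldiff_def add_diff_add by (simp add: inner_add_right sum.distrib)
  moreover have "rhs (\<lambda>x. t *\<^sub>R v x) = t * rhs v" for t v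
    unfolding rhs_def ldiff_def scaleR_diff_right[symmetric] by (simp add: sum_distrib_left)
  ultimately obtain \<phi> where \<phi>0: "\<forall>x. x \<notin> cube R \<longrightarrow> \<phi> x = 0"
    and \<phi>: "\<And>w. \<forall>x. x \<notin> cube R \<longrightarrow> w x = 0 \<Longrightarrow> B \<phi> w = rhs w"
    using dirichlet_solve[of rhs R] by blast
  have f\<phi>: "finsupp \<phi>" using \<phi>0 by (intro finsuppI) auto
  define I where "I = infsum (grad_sq \<phi>) UNIV"
  have I0: "I \<ge> 0" by (simp add: I_def infsum_nonneg)
  have "c * I \<le> rhs \<phi>" using stable[OF f\<phi>] \<phi>[OF \<phi>0] by (simp add: I_def)
  also have "\<dots> \<le> sqrt X * sqrt (sum (grad_sq \<phi>) P)"
    using sum_inner_grad_bound[of y \<phi> P] by (simp add: rhs_def X_def)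
  also have "\<dots> \<le> sqrt X * sqrt I"
    unfolding I_def using grad_sq_summable[OF f\<phi>] P X0
    by (intro mult_left_mono real_sqrt_le_mono finite_sum_le_infsum) auto
  finally have "c * (sqrt I * sqrt I) \<le> sqrt X * sqrt I" using I0 by simp
  then have "c * sqrt I \<le> sqrt X"
    using I0 X0 mult_right_le_imp_le[of "c * sqrt I" "sqrt I" "sqrt X"]
    by (cases "I = 0") (auto simp: mult.assoc)
  then have sI: "sqrt I \<le> sqrt X / c" using c_pos by (simp add: field_simps)
  \<comment> \<open>A test function supported in \<open>cube (r - 1)\<close> has vanishing unit
    differences at all points outside \<open>cube r\<close>, so the right-hand side, which lives on
    \<open>P\<close>, does not see it.\<close>
  have harm: "harmonic (r - 1) \<phi>"
    unfolding harmonic_def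
  proof (intro allI impI)
    fix v :: "int^'n \<Rightarrow> 'b" assume v: "\<forall>x. x \<notin> cube (r - 1) \<longrightarrow> v x = 0"
    have "\<forall>x. x \<notin> cube R \<longrightarrow> v x = 0"
    proof -
      have "cube (r - 1) \<subseteq> cube R" by (rule cube_mono) (simp add: R_def)
      then show ?thesis using v by blast
    qed
    then have "B \<phi> v = rhs v" by (rule \<phi>)
    also have "\<dots> = 0"
      unfolding rhs_def
    proof (intro sum.neutral ballI)
      fix x i assume x: "x \<in> P"
      then have "x \<notin> cube r" using P by auto
      then have "x \<notin> cube (r - 1)" "x + axis i 1 \<notin> cube (r - 1)"
        using cube_mono[of "r - 1" r] cube_add_cancel[OF _ axis_in_cube, of x i "r - 1"] by auto
      then show "ldiff (axis i 1) y x \<bullet> ldiff (axis i 1) v x = 0" using v by (simp add: ldiff_def)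
    qed
    finally show "B \<phi> v = 0" .
  qed
  have w0: "\<forall>x. x \<notin> cube R \<longrightarrow> w x = 0" 
  proof -
    have "cube rw \<subseteq> cube R" by (rule cube_mono) (simp add: R_def)
    then show ?thesis using rw by blast
  qed
  have "X = rhs y" by (simp add: X_def rhs_def grad_sq_def power2_norm_eq_inner)
  \<comment> \<open>\<open>y\<close> is not admissible in the finite problem. \<open>w\<close> is,
    and the rest \<open>z\<close> has small energy.\<close>
  also have "\<dots> = rhs w + rhs z"
    unfolding z_def rhs_def ldiff_def by (simp add: sum.distrib[symmetric] inner_diff_right)
  also have "rhs w = B w \<phi>" using \<phi>[OF w0] by (simp add: B_sym)
  also have "\<dots> = B y \<phi> - B z \<phi>"
    using B_diff_left[OF f\<phi>, of y z] by (simp add: z_def)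
  finally have "X \<le> B y \<phi> + \<bar>B z \<phi>\<bar> + \<bar>rhs z\<bar>" by linarith
  moreover have "\<bar>B z \<phi>\<bar> \<le> Kb * sqrt \<delta> * (sqrt X / c)"
  proof -
    have "\<bar>B z \<phi>\<bar> \<le> Kb * sqrt \<delta> * sqrt I"
      unfolding I_def by (rule B_bound[OF f\<phi>]) (use w(2) in \<open>simp add: z_def\<close>)
    also have "\<dots> \<le> Kb * sqrt \<delta> * (sqrt X / c)"
      using Kb_nonneg \<delta>(1) by (intro mult_left_mono sI) simp
    finally show ?thesis .
  qed
  moreover have "\<bar>rhs z\<bar> \<le> sqrt X * sqrt \<delta>"
  proof -
    have "\<bar>rhs z\<bar> \<le> sqrt X * sqrt (sum (grad_sq z) P)"
      using sum_inner_grad_bound[of y z P] by (simp add: rhs_def X_def)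
    also have "\<dots> \<le> sqrt X * sqrt \<delta>"
      using w(2)[OF P(1)] X0 by (intro mult_left_mono real_sqrt_le_mono) (simp_all add: z_def)
    finally show ?thesis .
  qed
  ultimately have "X \<le> B y \<phi> + sqrt \<delta> * (Kb * (sqrt X / c) + sqrt X)" by (simp add: algebra_simps)
  also have "sqrt \<delta> * (Kb * (sqrt X / c) + sqrt X) \<le> sqrt \<delta> * A"
    using \<delta>(1) by (intro mult_left_mono) (simp_all add: A_def)
  also have "sqrt \<delta> * A = \<epsilon>" unfolding \<delta>(2) using A by simp
  finally have "X \<le> B y \<phi> + \<epsilon>" by simp
  then show ?thesis using f\<phi> sI harm unfolding X_def I_def by blast
qed

end

section \<open>Decay of tails by iteration\<close>

lemma decay_recursion:
  fixes f :: "int \<Rightarrow> real"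
  assumes mono: "\<And>r s. r \<le> s \<Longrightarrow> f s \<le> f r" and "p > 0" "L \<ge> 1" "C \<ge> 0" and nn: "\<And>r. f r \<ge> 0"
    and rec: "\<And>r. r \<ge> r0 \<Longrightarrow> f (L * r) \<le> C * real_of_int r powr - p + \<epsilon> * f r"
    and \<epsilon>: "0 \<le> \<epsilon>" "\<epsilon> * (2 * real_of_int L) powr p \<le> 1 / 2"
  shows "\<exists>C'\<ge>0. \<forall>r\<ge>1. f r \<le> C' * real_of_int r powr - p"
proof -
  define r1 where "r1 = max r0 1"
  let ?L = "real_of_int L"
  \<comment> \<open>The first entry covers the radii below \<open>L * r1\<close>, where no recursion
    is available; the second makes the source term at most half of the claim. The factor
    \<open>2 * L\<close> enters because \<open>s = r div L\<close> only gives
    \<open>r \<le> 2 * L * s\<close>.\<close>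
  define C' where "C' = max (f 0 * real_of_int (L * r1) powr p) (2 * C * (2 * ?L) powr p)"
  have C'0: "C' \<ge> 0" using nn[of 0] by (auto simp: C'_def le_max_iff_disj)
  have r1: "r1 \<ge> 1" by (simp add: r1_def)
  have *: "f (int n) \<le> C' * real_of_int (int n) powr - p" if "n \<ge> 1" for n :: nat
    using that
  proof (induction n rule: less_induct)
    case (less n)
    define r where "r = int n"
    have r: "r \<ge> 1" using less.prems by (simp add: r_def)
    show ?case
    proof (cases "r \<ge> L * r1")
      case False
      have "r \<le> L * r1" using False by simp
      then have "real_of_int r \<le> real_of_int (L * r1)" by (rule of_int_le_iff[THEN iffD2])
      then have "f r * real_of_int r powr p \<le> f 0 * real_of_int (L * r1) powr p"
        using r assms(2) nn by (intro mult_mono mono powr_mono2) auto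
      also have "\<dots> \<le> C'" by (simp add: C'_def)
      finally show ?thesis
        using r unfolding r_def[symmetric] by (simp add: powr_minus field_simps)
    next
      case True
      define s where "s = r div L"
      have s1: "s \<ge> r1" using zdiv_mono1[OF True, of L] assms(3) unfolding s_def by simp
      have rs: "r = L * s + r mod L" unfolding s_def by simp
      have Ls: "L * s \<le> r" using rs pos_mod_sign[of L r] assms(3) by linarith
      have "r < L * s + L" using rs pos_mod_bound[of L r] assms(3) by linarith
      also have "\<dots> \<le> 2 * L * s" using s1 r1 assms(3) mult_left_mono[of 1 s L] by simp
      finally have r2: "real_of_int r \<le> 2 * ?L * real_of_int s"
        by (metis of_int_le_iff of_int_mult of_int_numeral order_less_imp_le)
      have sr: "s < r \<or> s = r"
        using Ls s1 r1 assms(3) mult_right_mono[of 1 L s] by linarith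
      have s0: "real_of_int s > 0" using s1 r1 by simp
      have pw: "real_of_int s powr - p \<le> (2 * ?L) powr p * real_of_int r powr - p"
      proof -
        have "real_of_int r powr p \<le> (2 * ?L) powr p * real_of_int s powr p"
          using powr_mono2[OF _ _ r2, of p] assms(2,3) r s0 by (simp add: powr_mult)
        then show ?thesis using r s0 by (simp add: powr_minus field_simps)
      qed
      \<comment> \<open>For \<open>L > 1\<close> the induction hypothesis applies to
        \<open>s < r\<close>. For \<open>L = 1\<close> the recursion relates \<open>f r\<close> to
        itself and is solved for \<open>f r\<close> below.\<close>
      have fs: "\<epsilon> * f s \<le> \<epsilon> * (C' * real_of_int s powr - p) \<or> L = 1"
      proof (cases "s < r")
        case True
        then have "f (int (nat s)) \<le> C' * real_of_int (int (nat s)) powr - p"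
          using s1 r1 by (intro less.IH) (auto simp: r_def)
        then show ?thesis using s1 r1 \<epsilon> by (auto intro: mult_left_mono)
      next
        case False
        then have "L * s \<le> s" using sr Ls by simp
        then show ?thesis using s1 r1 assms(3) by (simp add: mult_le_cancel_right1)
      qed
      have e: "\<epsilon> * (2 * ?L) powr p \<le> 1 / 2" by (rule \<epsilon>(2))
      have main: "C * real_of_int s powr - p + \<epsilon> * (C' * real_of_int s powr - p) \<le> C' * real_of_int r powr - p"
      proof -
        have "C * real_of_int s powr - p + \<epsilon> * (C' * real_of_int s powr - p)
           = (C + \<epsilon> * C') * real_of_int s powr - p" by (simp add: algebra_simps)
        also have "\<dots> \<le> (C + \<epsilon> * C') * ((2 * ?L) powr p * real_of_int r powr - p)"
          using pw \<epsilon> assms C'0 by (intro mult_left_mono) auto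
        also have "\<dots> = (C * (2 * ?L) powr p + (\<epsilon> * (2 * ?L) powr p) * C') * real_of_int r powr - p"
          by (simp add: algebra_simps)
        also have "\<dots> \<le> (C' / 2 + 1 / 2 * C') * real_of_int r powr - p"
          using e C'0 by (intro mult_right_mono add_mono) (auto simp: C'_def)
        finally show ?thesis by simp
      qed
      have step: "f r \<le> C * real_of_int s powr - p + \<epsilon> * f s"
        using mono[OF Ls] rec[of s] s1 by (auto simp: r1_def intro: order_trans)
      show ?thesis
      proof (cases "L = 1")
        case False
        then show ?thesis using step fs main by (simp add: r_def)
      next
        case True
        then have sr': "s = r" by (simp add: s_def)
        have "(2 * ?L) powr p \<ge> 1" using True assms(2) by (simp add: ge_one_powr_ge_zero)
        then have "\<epsilon> \<le> 1 / 2" using e \<epsilon>(1) mult_left_mono[of 1 "(2 * ?L) powr p" \<epsilon>] by linarith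
        then have "f r \<le> C * real_of_int r powr - p + 1 / 2 * f r"
          using step nn[of r] mult_right_mono[of \<epsilon> "1/2" "f r"] unfolding sr' by linarith
        then have "f r \<le> 2 * C * real_of_int r powr - p" by simp
        also have "\<dots> \<le> C' * real_of_int r powr - p"
        proof (rule mult_right_mono)
          have "2 * C * 1 \<le> 2 * C * (2 * ?L) powr p"
            using \<open>(2 * ?L) powr p \<ge> 1\<close> assms by (intro mult_left_mono) auto
          then show "2 * C \<le> C'" by (simp add: C'_def)
        qed simp
        finally show ?thesis by (simp add: r_def)
      qed
    qed
  qed
  have "f r \<le> C' * real_of_int r powr - p" if "r \<ge> 1" for r
  proof -
    have "f (int (nat r)) \<le> C' * real_of_int (int (nat r)) powr - p"
      using that by (intro *) simp
    then show ?thesis using that by simp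
  qed
  then show ?thesis using C'0 by blast
qed

definition tail_norm :: "(int^'n \<Rightarrow> 'b::real_normed_vector) \<Rightarrow> int \<Rightarrow> real" where
  "tail_norm v r = sqrt (infsum (grad_sq v) (- cube r))"

lemma tail_norm_nonneg: "tail_norm v r \<ge> 0"
  by (simp add: tail_norm_def infsum_nonneg)

lemma sum_grad_sq_le_tail:
  fixes v :: "int^'n \<Rightarrow> 'b::real_normed_vector"
  assumes "grad_sq v summable_on UNIV" "finite F" "F \<inter> cube r = {}"
  shows "sum (grad_sq v) F \<le> (tail_norm v r)\<^sup>2"
proof -
  have "sum (grad_sq v) F \<le> infsum (grad_sq v) (- cube r)"
    using assms by (intro finite_sum_le_infsum summable_on_subset_banach[OF assms(1)]) auto
  then show ?thesis by (simp add: tail_norm_def infsum_nonneg)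
qed

lemma tail_norm_le:
  fixes v :: "int^'n \<Rightarrow> 'b::real_normed_vector"
  assumes "X \<ge> 0" "\<And>F. finite F \<Longrightarrow> F \<inter> cube r = {} \<Longrightarrow> sqrt (sum (grad_sq v) F) \<le> X"
  shows "tail_norm v r \<le> X"
proof -
  have "infsum (grad_sq v) (- cube r) \<le> X\<^sup>2"
  proof (rule infsum_le_sum_bound)
    fix F :: "(int^'n) set" assume "finite F" "F \<subseteq> - cube r"
    then show "sum (grad_sq v) F \<le> X\<^sup>2" using assms(2)[of F] by (intro sqrt_le_D) auto
  qed simp
  then show ?thesis using assms(1) by (simp add: tail_norm_def real_le_lsqrt infsum_nonneg)
qed

lemma tail_norm_mono:
  fixes v :: "int^'n \<Rightarrow> 'b::real_normed_vector"
  assumes "grad_sq v summable_on UNIV" "r \<le> s"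
  shows "tail_norm v s \<le> tail_norm v r"
proof (intro tail_norm_le tail_norm_nonneg)
  fix F :: "(int^'n) set" assume F: "finite F" "F \<inter> cube s = {}"
  then have "F \<inter> cube r = {}" using cube_mono[OF assms(2)] by blast
  then show "sqrt (sum (grad_sq v) F) \<le> tail_norm v r"
    using F by (intro real_le_lsqrt tail_norm_nonneg sum_grad_sq_le_tail assms)
qed

lemma tail_norm_tendsto:
  fixes v :: "int^'n \<Rightarrow> 'b::real_normed_vector"
  assumes "grad_sq v summable_on UNIV" "\<epsilon> > 0"
  shows "\<exists>r\<ge>0. tail_norm v r \<le> \<epsilon>"
proof -
  obtain r where r: "r \<ge> 0" "\<And>F. finite F \<Longrightarrow> F \<inter> cube r = {} \<Longrightarrow> sum (grad_sq v) F \<le> \<epsilon>\<^sup>2"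
    using tail_small[OF _ assms(1), of "\<epsilon>\<^sup>2"] assms(2) by auto
  have "tail_norm v r \<le> \<epsilon>"
    using r(2) assms(2) by (intro tail_norm_le real_le_lsqrt) (auto simp: sum_nonneg)
  then show ?thesis using r(1) by blast
qed

text \<open>The sum of the norms splits bond by bond and, after \<open>lift\<close>, dominates the
  Euclidean \<open>stencil_norm\<close>; the cost is powers of \<open>card S\<close>.\<close>

definition stn :: "(int^'n) set \<Rightarrow> (int^'n \<Rightarrow> 'b::real_normed_vector) \<Rightarrow> real" where
  "stn S g = (\<Sum>\<rho>\<in>S. norm (g \<rho>))"

lemma stn_nonneg [simp]: "stn S g \<ge> 0" by (simp add: stn_def sum_nonneg)

context lattice_form
begin

abbreviation "Df v x \<equiv> (\<lambda>\<rho>. ldiff \<rho> v x)"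

definition "Ks = (real (card S))\<^sup>2 * path_const2 TYPE('n) m"

lemma Ks_nonneg: "Ks \<ge> 0" by (simp add: Ks_def path_const2_nonneg)

lemma sum_stn_sq_le:
  fixes v :: "int^'n \<Rightarrow> 'v::real_normed_vector"
  assumes "finite F"
    and X: "\<And>F'. finite F' \<Longrightarrow> (\<And>x. x \<in> F' \<Longrightarrow> \<exists>y\<in>cube m. x - y \<in> F) \<Longrightarrow> sum (grad_sq v) F' \<le> X"
  shows "(\<Sum>x\<in>F. (stn S (\<lambda>\<rho>. ldiff \<rho> v x))\<^sup>2) \<le> Ks * X"
proof -
  have "(\<Sum>x\<in>F. (stn S (\<lambda>\<rho>. ldiff \<rho> v x))\<^sup>2) \<le> (\<Sum>x\<in>F. real (card S) * (\<Sum>\<rho>\<in>S. (norm (ldiff \<rho> v x))\<^sup>2))"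
    unfolding stn_def using sum_squared_le_sum_of_squares[of "\<lambda>\<rho>. norm (ldiff \<rho> v _)" S]
    by (intro sum_mono) (simp add: mult.commute)
  also have "\<dots> = real (card S) * (\<Sum>\<rho>\<in>S. \<Sum>x\<in>F. (norm (ldiff \<rho> v x))\<^sup>2)"
    unfolding sum_distrib_left[symmetric] by (intro arg_cong[of _ _ "(*) _"] sum.swap)
  also have "\<dots> \<le> real (card S) * (\<Sum>\<rho>\<in>S. path_const2 TYPE('n) m * X)"
    using S_cube by (intro mult_left_mono sum_mono sum_ldiff_sq_le assms) auto
  finally show ?thesis by (simp add: Ks_def power2_eq_square mult_ac)
qed

lemma sum_stn_sq_tail:
  fixes v :: "int^'n \<Rightarrow> 'v::real_normed_vector"
  assumes "grad_sq v summable_on UNIV" "finite F" "F \<inter> cube r = {}"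
  shows "(\<Sum>x\<in>F. (stn S (\<lambda>\<rho>. ldiff \<rho> v x))\<^sup>2) \<le> Ks * (tail_norm v (r - m))\<^sup>2"
proof (rule sum_stn_sq_le[OF assms(2)])
  fix F' :: "(int^'n) set" assume F': "finite F'" "\<And>x. x \<in> F' \<Longrightarrow> \<exists>y\<in>cube m. x - y \<in> F"
  have "x \<notin> cube (r - m)" if x: "x \<in> F'" for x
  proof
    assume "x \<in> cube (r - m)"
    moreover obtain y where "y \<in> cube m" "x - y \<in> F" using F'(2)[OF x] by blast
    ultimately have "x - y \<in> cube r" using cube_add[of x "r - m" "- y" m] by (simp add: cube_minus)
    then show False using assms(3) \<open>x - y \<in> F\<close> by blast
  qed
  then show "sum (grad_sq v) F' \<le> (tail_norm v (r - m))\<^sup>2"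
    using F' by (intro sum_grad_sq_le_tail assms) auto
qed

text \<open>On a lattice a single term is at most the whole sum, so square summability already gives
  pointwise smallness of the strain.\<close>

lemma stn_tail:
  fixes v :: "int^'n \<Rightarrow> 'v::real_normed_vector"
  assumes "grad_sq v summable_on UNIV" "x \<notin> cube r"
  shows "stn S (\<lambda>\<rho>. ldiff \<rho> v x) \<le> sqrt Ks * tail_norm v (r - m)"
proof -
  have "(stn S (\<lambda>\<rho>. ldiff \<rho> v x))\<^sup>2 \<le> Ks * (tail_norm v (r - m))\<^sup>2"
    using sum_stn_sq_tail[OF assms(1), of "{x}" r] assms(2) by simp
  then have "sqrt ((stn S (\<lambda>\<rho>. ldiff \<rho> v x))\<^sup>2) \<le> sqrt (Ks * (tail_norm v (r - m))\<^sup>2)"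
    by (rule real_sqrt_le_mono)
  then show ?thesis by (simp add: real_sqrt_mult tail_norm_nonneg)
qed

lemma stn_le_sup:
  fixes v :: "int^'n \<Rightarrow> 'v::real_normed_vector"
  assumes "\<And>y. y \<in> cube m \<Longrightarrow> grad_sq v (x + y) \<le> G"
  shows "stn S (\<lambda>\<rho>. ldiff \<rho> v x) \<le> sqrt (Ks * G)"
proof -
  have "norm (ldiff \<rho> v x) \<le> sqrt (path_const2 TYPE('n) m * G)" if "\<rho> \<in> S" for \<rho>
  proof -
    have "(norm (ldiff \<rho> v x))\<^sup>2 \<le> path_const TYPE('n) m * (\<Sum>y\<in>cube m. grad_sq v (x + y))"
      using that S_cube by (intro norm_ldiff_sq_le) auto
    also have "\<dots> \<le> path_const TYPE('n) m * (\<Sum>y\<in>(cube m :: (int^'n) set). G)"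
      using path_const_nonneg by (intro mult_left_mono sum_mono assms)
    finally show ?thesis by (intro real_le_rsqrt) (simp add: path_const2_def)
  qed
  then have "stn S (\<lambda>\<rho>. ldiff \<rho> v x) \<le> (\<Sum>\<rho>\<in>S. sqrt (path_const2 TYPE('n) m * G))"
    unfolding stn_def by (intro sum_mono)
  also have "\<dots> = sqrt (Ks * G)" by (simp add: Ks_def real_sqrt_mult real_sqrt_power)
  finally show ?thesis .
qed

section \<open>Pointwise bounds for harmonic functions near the origin\<close>

definition "Cs = sqrt (Ks * (real CARD('n) * Ci))"

lemma Cs_nonneg: "Cs \<ge> 0" using Ks_nonneg Ci_pos by (simp add: Cs_def)

definition "Cg = sqrt (real CARD('n) * Ci)"

lemma Cg_nonneg: "Cg \<ge> 0" using Ci_pos by (simp add: Cg_def)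

lemma sqrt_pow_eq: "r > 0 \<Longrightarrow> sqrt (1 / r ^ k) = r powr (- (real k / 2))"
  by (simp add: powr_minus powr_half_sqrt_powr powr_realpow real_sqrt_divide inverse_eq_divide)

context
  fixes \<phi> r
  assumes \<phi>: "finsupp \<phi>" "harmonic (int (CARD('n) + 3) * r) \<phi>" and r: "r \<ge> 4 * m + 2"
begin

lemma half_power_eq: "- (real (2 + k) / 2) = - (real k / 2) - 1" by (simp add: field_simps)

lemma r_pos: "real_of_int r > 0" using r m_pos by linarith

lemma grad_sup:
  assumes "z \<in> cube r"
  shows "grad_sq \<phi> z \<le> real CARD('n) * Ci * infsum (grad_sq \<phi>) UNIV / real_of_int r ^ CARD('n)"
proof -
  have "grad_sq \<phi> z \<le> (\<Sum>i\<in>(UNIV::'n set). Ci * infsum (grad_sq \<phi>) UNIV / real_of_int r ^ CARD('n))"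
    unfolding grad_sq_def[of \<phi> z] using interior_sup[OF \<phi> r assms, of "[]"] by (intro sum_mono) simp
  then show ?thesis by simp
qed

lemma grad2_sup:
  assumes "z \<in> cube (r - 1)"
  shows "grad_sq (ldiff (- axis j 1) \<phi>) z \<le> real CARD('n) * Ci * infsum (grad_sq \<phi>) UNIV / real_of_int r ^ (2 + CARD('n))"
proof -
  have z: "z - axis j 1 \<in> cube r"
    using cube_add[OF assms, of "- axis j 1" 1] axis_in_cube[of j] by (simp add: cube_minus)
  \<comment> \<open>Up to sign a backward difference is the forward difference at the point shifted
    by \<open>axis j 1\<close>; this shift is why \<open>z\<close> is taken in
    \<open>cube (r - 1)\<close>.\<close>
  have "norm (ldiff (axis i 1) (ldiff (- axis j 1) \<phi>) z) = norm (ldiffs [j] (ldiff (axis i 1) \<phi>) (z - axis j 1))" for i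
    by (subst norm_minus_cancel[symmetric]) (simp add: ldiff_def algebra_simps)
  then have "grad_sq (ldiff (- axis j 1) \<phi>) z \<le> (\<Sum>i\<in>(UNIV::'n set). Ci * infsum (grad_sq \<phi>) UNIV / real_of_int r ^ (2 + CARD('n)))"
    unfolding grad_sq_def[of "ldiff (- axis j 1) \<phi>" z] using interior_sup[OF \<phi> r z, of "[j]"] by (intro sum_mono) simp
  then show ?thesis by simp
qed

lemma stn_sup:
  assumes "x \<in> cube (r - m)"
  shows "stn S (Df \<phi> x) \<le> Cs * sqrt (infsum (grad_sq \<phi>) UNIV) * real_of_int r powr (- (real CARD('n) / 2))"
proof -
  have "stn S (Df \<phi> x) \<le> sqrt (Ks * (real CARD('n) * Ci * infsum (grad_sq \<phi>) UNIV / real_of_int r ^ CARD('n)))"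
    using cube_add[OF assms] by (intro stn_le_sup grad_sup) force
  also have "\<dots> = Cs * sqrt (infsum (grad_sq \<phi>) UNIV) * sqrt (1 / real_of_int r ^ CARD('n))"
    unfolding Cs_def real_sqrt_mult[symmetric] by (simp add: mult_ac)
  finally show ?thesis unfolding sqrt_pow_eq[OF r_pos] .
qed

lemma stn2_sup:
  assumes "x \<in> cube (r - m - 1)"
  shows "stn S (Df (ldiff (- axis j 1) \<phi>) x)
    \<le> Cs * sqrt (infsum (grad_sq \<phi>) UNIV) * real_of_int r powr (- (real CARD('n) / 2) - 1)"
proof -
  have "stn S (Df (ldiff (- axis j 1) \<phi>) x)
     \<le> sqrt (Ks * (real CARD('n) * Ci * infsum (grad_sq \<phi>) UNIV / real_of_int r ^ (2 + CARD('n))))"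
    using cube_add[OF assms] by (intro stn_le_sup grad2_sup) force
  also have "\<dots> = Cs * sqrt (infsum (grad_sq \<phi>) UNIV) * sqrt (1 / real_of_int r ^ (2 + CARD('n)))"
    unfolding Cs_def real_sqrt_mult[symmetric] by (simp add: mult_ac)
  finally show ?thesis unfolding sqrt_pow_eq[OF r_pos] half_power_eq .
qed

lemma sqrt_grad_sup:
  assumes "z \<in> cube r"
  shows "sqrt (grad_sq \<phi> z) \<le> Cg * sqrt (infsum (grad_sq \<phi>) UNIV) * real_of_int r powr (- (real CARD('n) / 2))"
proof -
  have "sqrt (grad_sq \<phi> z) \<le> sqrt (real CARD('n) * Ci * infsum (grad_sq \<phi>) UNIV / real_of_int r ^ CARD('n))"
    using assms by (intro real_sqrt_le_mono grad_sup)
  also have "\<dots> = Cg * sqrt (infsum (grad_sq \<phi>) UNIV) * sqrt (1 / real_of_int r ^ CARD('n))"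
    unfolding Cg_def real_sqrt_mult[symmetric] by (simp add: mult_ac)
  finally show ?thesis unfolding sqrt_pow_eq[OF r_pos] .
qed

lemma sqrt_grad2_sup:
  assumes "z \<in> cube (r - 1)"
  shows "sqrt (grad_sq (ldiff (- axis j 1) \<phi>) z)
    \<le> Cg * sqrt (infsum (grad_sq \<phi>) UNIV) * real_of_int r powr (- (real CARD('n) / 2) - 1)"
proof -
  have "sqrt (grad_sq (ldiff (- axis j 1) \<phi>) z)
     \<le> sqrt (real CARD('n) * Ci * infsum (grad_sq \<phi>) UNIV / real_of_int r ^ (2 + CARD('n)))"
    using assms by (intro real_sqrt_le_mono grad2_sup)
  also have "\<dots> = Cg * sqrt (infsum (grad_sq \<phi>) UNIV) * sqrt (1 / real_of_int r ^ (2 + CARD('n)))"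
    unfolding Cg_def real_sqrt_mult[symmetric] by (simp add: mult_ac)
  finally show ?thesis unfolding sqrt_pow_eq[OF r_pos] half_power_eq .
qed

end

end

section \<open>The abstract equilibrium equation and the decay of its solutions\<close>

lemma cauchy_schwarz_sum:
  fixes a b :: "'a \<Rightarrow> real"
  shows "(\<Sum>x\<in>F. a x * b x) \<le> sqrt (\<Sum>x\<in>F. (a x)\<^sup>2) * sqrt (\<Sum>x\<in>F. (b x)\<^sup>2)"
proof -
  have "(\<Sum>x\<in>F. a x * b x) \<le> (\<Sum>x\<in>F. \<bar>a x\<bar> * \<bar>b x\<bar>)"
    by (intro sum_mono) (simp add: abs_mult[symmetric])
  also have "\<dots> \<le> L2_set a F * L2_set b F" by (rule L2_set_mult_ineq)
  finally show ?thesis by (simp add: L2_set_def)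
qed

lemma grad_sq_ldiff_summable:
  fixes u :: "int^'n \<Rightarrow> 'b::real_normed_vector"
  assumes "grad_sq u summable_on UNIV"
  shows "grad_sq (ldiff \<tau> u) summable_on UNIV"
proof (rule infsum_le_sum_bound(1))
  fix F :: "(int^'n) set" assume F: "finite F"
  have le: "grad_sq (ldiff \<tau> u) x \<le> 2 * grad_sq u (x + \<tau>) + 2 * grad_sq u x" for x
  proof -
    have "(norm (ldiff (axis i 1) (ldiff \<tau> u) x))\<^sup>2
       \<le> 2 * (norm (ldiff (axis i 1) u (x + \<tau>)))\<^sup>2 + 2 * (norm (ldiff (axis i 1) u x))\<^sup>2" for i
    proof -
      have "ldiff (axis i 1) (ldiff \<tau> u) x = ldiff (axis i 1) u (x + \<tau>) + (- ldiff (axis i 1) u x)"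
        by (simp add: ldiff_def algebra_simps)
      then show ?thesis
        using norm_sq_triangle[of "ldiff (axis i 1) u (x + \<tau>)" "- ldiff (axis i 1) u x"] by simp
    qed
    then show ?thesis
      unfolding grad_sq_def sum_distrib_left sum.distrib[symmetric] by (intro sum_mono)
  qed
  have s: "sum (grad_sq u) F' \<le> infsum (grad_sq u) UNIV" if "finite F'" for F'
    using that assms by (intro finite_sum_le_infsum) auto
  have "sum (grad_sq (ldiff \<tau> u)) F \<le> (\<Sum>x\<in>F. 2 * grad_sq u (x + \<tau>) + 2 * grad_sq u x)"
    by (intro sum_mono le)
  also have "\<dots> = 2 * sum (grad_sq u) ((\<lambda>x. x + \<tau>) ` F) + 2 * sum (grad_sq u) F"
    by (simp add: sum.distrib sum_distrib_left sum.reindex inj_on_def)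
  also have "\<dots> \<le> 2 * infsum (grad_sq u) UNIV + 2 * infsum (grad_sq u) UNIV"
    using F by (intro add_mono mult_left_mono s) auto
  finally show "sum (grad_sq (ldiff \<tau> u)) F \<le> 2 * infsum (grad_sq u) UNIV + 2 * infsum (grad_sq u) UNIV" .
qed simp

lemma sqrt_le_from_self_bound:
  assumes "X \<ge> 0" "Y \<ge> 0" "\<And>\<epsilon>. \<epsilon> > 0 \<Longrightarrow> X \<le> sqrt X * Y + \<epsilon>"
  shows "sqrt X \<le> (Y::real)"
proof (cases "X = 0")
  case False
  have "sqrt X * sqrt X \<le> sqrt X * Y" using assms field_le_epsilon[of X "sqrt X * Y"] by simp
  moreover have "sqrt X > 0" using False assms(1) by simp
  ultimately show ?thesis by (rule mult_left_le_imp_le)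
qed (use assms in simp)

text \<open>\<open>N g w\<close> stands for the part of the first variation that is quadratic in the
  strain \<open>g\<close>, tested with the strain \<open>w\<close>. \<open>N_lipschitz\<close> is
  the form of quadratic smallness that survives taking differences. The right-hand side of
  \<open>equilibrium\<close> is the effect of the defect: a force near the origin, measured against
  gradients because constants cost nothing.\<close>

locale lattice_equilibrium = lattice_form S \<beta> c M m
  for S :: "(int^'n) set" and \<beta> :: "int^'n \<Rightarrow> int^'n \<Rightarrow> 'b::euclidean_space \<Rightarrow> 'b \<Rightarrow> real"
    and c M :: real and m :: int +
  fixes u :: "int^'n \<Rightarrow> 'b" and N :: "(int^'n \<Rightarrow> 'b) \<Rightarrow> (int^'n \<Rightarrow> 'b) \<Rightarrow> real"
    and KN K0 \<delta>0 :: real and m0 m1 :: int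
  assumes u_summable: "grad_sq u summable_on UNIV"
    and N_diff: "\<And>g w w'. N g (\<lambda>\<rho>. w \<rho> - w' \<rho>) = N g w - N g w'"
    and N_zero: "\<And>w. N (\<lambda>_. 0) w = 0"
    and N_lipschitz: "\<And>g g' w. stn S g \<le> \<delta>0 \<Longrightarrow> stn S g' \<le> \<delta>0 \<Longrightarrow>
      \<bar>N g w - N g' w\<bar> \<le> KN * (stn S g + stn S g') * stn S (\<lambda>\<rho>. g \<rho> - g' \<rho>) * stn S w"
    and constants: "KN \<ge> 0" "K0 \<ge> 0" "\<delta>0 \<ge> 0" "m0 \<ge> 0" "m1 \<ge> 0"
    and u_small: "\<And>x. x \<notin> cube m0 \<Longrightarrow> stn S (\<lambda>\<rho>. ldiff \<rho> u x) \<le> \<delta>0"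
    and equilibrium: "\<And>\<phi>. finsupp \<phi> \<Longrightarrow>
      \<bar>lform S \<beta> u \<phi> + infsum (\<lambda>x. N (\<lambda>\<rho>. ldiff \<rho> u x) (\<lambda>\<rho>. ldiff \<rho> \<phi> x)) (- cube m0)\<bar>
        \<le> K0 * (\<Sum>x\<in>cube m1. sqrt (grad_sq \<phi> x))"
begin

lemma N_quad: "stn S g \<le> \<delta>0 \<Longrightarrow> \<bar>N g w\<bar> \<le> KN * (stn S g)\<^sup>2 * stn S w"
  using N_lipschitz[of g "\<lambda>_. 0" w] constants by (simp add: N_zero stn_def power2_eq_square mult.assoc)

abbreviation "Nu \<phi> x \<equiv> N (Df u x) (Df \<phi> x)"

lemma Nu_bound: "x \<notin> cube m0 \<Longrightarrow> \<bar>Nu \<phi> x\<bar> \<le> KN * (stn S (Df u x))\<^sup>2 * stn S (Df \<phi> x)"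
  by (intro N_quad u_small)

lemma stn_finsupp_zero:
  assumes "\<And>x. x \<notin> cube R \<Longrightarrow> \<phi> x = 0" "x \<notin> cube (R + m)"
  shows "stn S (Df \<phi> x) = 0"
proof -
  have "x \<notin> cube R" using assms(2) cube_mono[of R "R + m"] m_pos by auto
  moreover have "x + \<rho> \<notin> cube R" if "\<rho> \<in> S" for \<rho>
    using cube_add_cancel[of x \<rho> R m] that S_cube assms(2) by auto
  ultimately show ?thesis using assms(1) by (simp add: stn_def ldiff_def)
qed

lemma infsum_Nu:
  assumes "\<And>x. x \<notin> cube R \<Longrightarrow> \<phi> x = 0"
  shows "infsum (Nu \<phi>) (- cube m0) = (\<Sum>x\<in>cube (R + m) - cube m0. Nu \<phi> x)"
proof -
  have "Nu \<phi> x = 0" if "x \<notin> cube m0" "x \<notin> cube (R + m)" for x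
    using Nu_bound[OF that(1), of \<phi>] stn_finsupp_zero[of R \<phi> x] assms that(2) by simp
  then have "infsum (Nu \<phi>) (- cube m0) = infsum (Nu \<phi>) (cube (R + m) - cube m0)"
    by (intro infsum_cong_neutral) auto
  then show ?thesis by simp
qed

definition "Eu = infsum (grad_sq u) UNIV"

lemma sum_stn_u: "finite F \<Longrightarrow> (\<Sum>x\<in>F. (stn S (Df u x))\<^sup>2) \<le> Ks * Eu"
  unfolding Eu_def using u_summable by (intro sum_stn_sq_le finite_sum_le_infsum) auto

lemma sum_stn_finsupp: "finsupp \<phi> \<Longrightarrow> finite F \<Longrightarrow> (\<Sum>x\<in>F. (stn S (Df \<phi> x))\<^sup>2) \<le> Ks * infsum (grad_sq \<phi>) UNIV"
  using grad_sq_summable[of \<phi>] by (intro sum_stn_sq_le finite_sum_le_infsum) auto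

lemma Eu_nonneg: "Eu \<ge> 0" by (simp add: Eu_def infsum_nonneg)



text \<open>Near the origin no decay of the strain is available. The quadratic term is merely
  summable, which suffices against a supremum bound for the test function.\<close>

lemma near_bound:
  assumes F: "finite F" "F \<inter> cube m0 = {}" and Y: "Y \<ge> 0" "\<And>x. x \<in> F \<Longrightarrow> stn S (Df \<phi> x) \<le> Y"
  shows "\<bar>\<Sum>x\<in>F. Nu \<phi> x\<bar> \<le> KN * Ks * Eu * Y"
proof -
  have "\<bar>Nu \<phi> x\<bar> \<le> KN * (stn S (Df u x))\<^sup>2 * Y" if "x \<in> F" for x
  proof -
    have "\<bar>Nu \<phi> x\<bar> \<le> KN * (stn S (Df u x))\<^sup>2 * stn S (Df \<phi> x)" using that F by (intro Nu_bound) auto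
    also have "\<dots> \<le> KN * (stn S (Df u x))\<^sup>2 * Y" using that Y constants(1) by (intro mult_left_mono) auto
    finally show ?thesis .
  qed
  then have "\<bar>\<Sum>x\<in>F. Nu \<phi> x\<bar> \<le> (\<Sum>x\<in>F. KN * (stn S (Df u x))\<^sup>2 * Y)"
    by (rule order_trans[OF sum_abs sum_mono])
  also have "\<dots> = KN * Y * (\<Sum>x\<in>F. (stn S (Df u x))\<^sup>2)" by (simp add: sum_distrib_left mult_ac)
  also have "\<dots> \<le> KN * Y * (Ks * Eu)" using constants(1) Y F by (intro mult_left_mono sum_stn_u) auto
  finally show ?thesis by (simp add: mult_ac)
qed

text \<open>The dual function \<phi> has a gradient of order \<open>r powr (-d/2)\<close> on
  \<open>cube r\<close>, which settles the core and the quadratic term near it. Outside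
  \<open>cube (r - m)\<close> one strain factor is bounded pointwise by the tail, and the other,
  together with the strain of \<phi>, by Cauchy-Schwarz; hence the squared tail.\<close>

lemma first_step:
  "\<exists>C\<ge>0. \<forall>r\<ge>max (4 * m + 2) (max m1 (m0 + m)). tail_norm u (int (CARD('n) + 3) * r + 1)
     \<le> C * (real_of_int r powr (- (real CARD('n) / 2)) + (tail_norm u (r - 2 * m))\<^sup>2)"
proof -
  define C where "C = (K0 * real (card (cube m1 :: (int^'n) set)) * Cg + KN * Ks * Eu * Cs + KN * Ks * sqrt Ks) / c"
  have C1: "K0 * real (card (cube m1 :: (int^'n) set)) * Cg + KN * Ks * Eu * Cs \<le> c * C" "KN * Ks * sqrt Ks \<le> c * C"
    using constants Cg_nonneg Cs_nonneg Ks_nonneg Eu_nonneg c_pos by (simp_all add: C_def)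
  have C0: "C \<ge> 0" using constants Cg_nonneg Cs_nonneg Ks_nonneg Eu_nonneg c_pos by (simp add: C_def)
  have "tail_norm u (int (CARD('n) + 3) * r + 1)
     \<le> C * (real_of_int r powr (- (real CARD('n) / 2)) + (tail_norm u (r - 2 * m))\<^sup>2)"
    if "r \<ge> max (4 * m + 2) (max m1 (m0 + m))" for r
  proof -
    have r: "r \<ge> 4 * m + 2" "r \<ge> m1" "r - m \<ge> m0" using that by auto
    let ?p = "real_of_int r powr (- (real CARD('n) / 2))" and ?T = "tail_norm u (r - 2 * m)"
    let ?Y = "C * (?p + ?T\<^sup>2)"
    show ?thesis
    proof (rule tail_norm_le)
      show Y0: "0 \<le> ?Y" using C0 by simp
      fix P :: "(int^'n) set" assume P: "finite P" "P \<inter> cube (int (CARD('n) + 3) * r + 1) = {}"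
      let ?X = "sum (grad_sq u) P"
      show "sqrt ?X \<le> ?Y"
      proof (rule sqrt_le_from_self_bound)
        fix \<epsilon> :: real assume "\<epsilon> > 0"
        then obtain \<phi> where \<phi>: "finsupp \<phi>" "sqrt (infsum (grad_sq \<phi>) UNIV) \<le> sqrt ?X / c"
          "harmonic (int (CARD('n) + 3) * r) \<phi>" "?X \<le> B u \<phi> + \<epsilon>"
          using dual_test_function[OF u_summable P, of \<epsilon>] by auto
        define I where "I = infsum (grad_sq \<phi>) UNIV"
        have I0: "I \<ge> 0" by (simp add: I_def infsum_nonneg)
        obtain R0 where R0: "R0 \<ge> 0" "\<And>x. x \<notin> cube R0 \<Longrightarrow> \<phi> x = 0" using finsupp_cube[OF \<phi>(1)] by blast
        let ?F = "cube (R0 + m) - cube m0 :: (int^'n) set"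
        have core: "K0 * (\<Sum>x\<in>cube m1. sqrt (grad_sq \<phi> x)) \<le> K0 * (real (card (cube m1 :: (int^'n) set)) * (Cg * sqrt I * ?p))"
        proof (intro mult_left_mono constants)
          have "(\<Sum>x\<in>cube m1. sqrt (grad_sq \<phi> x)) \<le> (\<Sum>x\<in>(cube m1 :: (int^'n) set). Cg * sqrt I * ?p)"
            unfolding I_def using cube_mono[OF r(2)] by (intro sum_mono sqrt_grad_sup[OF \<phi>(1,3) r(1)]) auto
          then show "(\<Sum>x\<in>cube m1. sqrt (grad_sq \<phi> x)) \<le> real (card (cube m1 :: (int^'n) set)) * (Cg * sqrt I * ?p)" by simp
        qed
        have near: "\<bar>\<Sum>x\<in>?F \<inter> cube (r - m). Nu \<phi> x\<bar> \<le> KN * Ks * Eu * (Cs * sqrt I * ?p)"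
          unfolding I_def using Cs_nonneg
          by (intro near_bound stn_sup[OF \<phi>(1,3) r(1)]) (auto intro!: mult_nonneg_nonneg infsum_nonneg)
        have far: "\<bar>\<Sum>x\<in>?F - cube (r - m). Nu \<phi> x\<bar> \<le> KN * Ks * sqrt Ks * ?T\<^sup>2 * sqrt I"
        proof -
          let ?G = "?F - cube (r - m)"
          have "\<bar>Nu \<phi> x\<bar> \<le> KN * (sqrt Ks * ?T) * (stn S (Df u x) * stn S (Df \<phi> x))" if "x \<in> ?G" for x
          proof -
            have "\<bar>Nu \<phi> x\<bar> \<le> KN * (stn S (Df u x))\<^sup>2 * stn S (Df \<phi> x)" using that by (intro Nu_bound) auto
            also have "\<dots> = KN * stn S (Df u x) * (stn S (Df u x) * stn S (Df \<phi> x))" by (simp add: power2_eq_square)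
            also have "\<dots> \<le> KN * (sqrt Ks * ?T) * (stn S (Df u x) * stn S (Df \<phi> x))"
            proof (intro mult_right_mono mult_left_mono)
              show "stn S (Df u x) \<le> sqrt Ks * ?T"
                using stn_tail[OF u_summable, of x "r - m"] that by simp
            qed (use constants in auto)
            finally show ?thesis .
          qed
          then have "\<bar>\<Sum>x\<in>?G. Nu \<phi> x\<bar> \<le> (\<Sum>x\<in>?G. KN * (sqrt Ks * ?T) * (stn S (Df u x) * stn S (Df \<phi> x)))"
            by (rule order_trans[OF sum_abs sum_mono])
          also have "\<dots> = KN * (sqrt Ks * ?T) * (\<Sum>x\<in>?G. stn S (Df u x) * stn S (Df \<phi> x))"
            by (simp add: sum_distrib_left)
          also have "\<dots> \<le> KN * (sqrt Ks * ?T) * (sqrt (Ks * ?T\<^sup>2) * sqrt (Ks * I))"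
          proof (intro mult_left_mono order_trans[OF cauchy_schwarz_sum] mult_mono real_sqrt_le_mono)
            show "(\<Sum>x\<in>?G. (stn S (Df u x))\<^sup>2) \<le> Ks * ?T\<^sup>2"
              using sum_stn_sq_tail[OF u_summable, of ?G "r - m"] by (simp add: Diff_Int_distrib2 Int_commute)
            show "(\<Sum>x\<in>?G. (stn S (Df \<phi> x))\<^sup>2) \<le> Ks * I" unfolding I_def by (intro sum_stn_finsupp \<phi>) auto
          qed (use constants Ks_nonneg tail_norm_nonneg in \<open>auto intro!: sum_nonneg mult_nonneg_nonneg\<close>)
          also have "\<dots> = KN * Ks * sqrt Ks * ?T\<^sup>2 * sqrt I"
            using Ks_nonneg tail_norm_nonneg[of u "r - 2 * m"]
            by (simp add: real_sqrt_mult power2_eq_square)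
          finally show ?thesis .
        qed
        have "infsum (Nu \<phi>) (- cube m0) = (\<Sum>x\<in>?F. Nu \<phi> x)" using R0(2) by (rule infsum_Nu)
        also have "\<dots> = (\<Sum>x\<in>?F \<inter> cube (r - m). Nu \<phi> x) + (\<Sum>x\<in>?F - cube (r - m). Nu \<phi> x)"
          by (subst sum.union_disjoint[symmetric]) (auto intro: sum.cong)
        finally have "B u \<phi> \<le> K0 * (real (card (cube m1 :: (int^'n) set)) * (Cg * sqrt I * ?p))
            + KN * Ks * Eu * (Cs * sqrt I * ?p) + KN * Ks * sqrt Ks * ?T\<^sup>2 * sqrt I"
          using equilibrium[OF \<phi>(1)] core near far by linarith
        also have "\<dots> = sqrt I * ((K0 * real (card (cube m1 :: (int^'n) set)) * Cg + KN * Ks * Eu * Cs) * ?p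
             + KN * Ks * sqrt Ks * ?T\<^sup>2)" by (simp add: algebra_simps)
        also have "\<dots> \<le> sqrt I * ((c * C) * ?p + (c * C) * ?T\<^sup>2)"
          using C1 I0 by (intro mult_left_mono add_mono mult_right_mono) auto
        also have "\<dots> = (c * sqrt I) * ?Y" by (simp add: algebra_simps)
        also have "\<dots> \<le> sqrt ?X * ?Y"
          using \<phi>(2) c_pos Y0 by (intro mult_right_mono) (simp_all add: I_def field_simps)
        finally show "?X \<le> sqrt ?X * ?Y + \<epsilon>" using \<phi>(4) by linarith
      qed (use Y0 in \<open>auto intro: sum_nonneg\<close>)
    qed
  qed
  then show ?thesis using C0 by blast
qed

lemma first_decay:
  "\<exists>C\<ge>0. \<forall>r\<ge>1. tail_norm u r \<le> C * real_of_int r powr (- (real CARD('n) / 2))"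
proof -
  let ?d = "real CARD('n) / 2"
  obtain C where C: "C \<ge> 0" "\<And>r. r \<ge> max (4 * m + 2) (max m1 (m0 + m)) \<Longrightarrow> tail_norm u (int (CARD('n) + 3) * r + 1)
     \<le> C * (real_of_int r powr (- ?d) + (tail_norm u (r - 2 * m))\<^sup>2)"
    using first_step by blast
  define L where "L = 2 * int (CARD('n) + 3) + 1"
  define \<epsilon> where "\<epsilon> = 1 / (2 * (2 * real_of_int L) powr ?d)"
  have L: "L \<ge> 1" by (simp add: L_def)
  have \<epsilon>: "\<epsilon> > 0" using L by (simp add: \<epsilon>_def)
  obtain r1 where r1: "tail_norm u r1 \<le> \<epsilon> / (C + 1)"
    using tail_norm_tendsto[OF u_summable, of "\<epsilon> / (C + 1)"] \<epsilon> C(1) by auto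
  define r0 where "r0 = max r1 (max (2 * m) (max (4 * m + 2) (max m1 (m0 + m))))"
  show ?thesis
  proof (rule decay_recursion[where L = L and C = C and \<epsilon> = \<epsilon> and ?r0.0 = r0])
    show "tail_norm u s \<le> tail_norm u r" if "r \<le> s" for r s by (rule tail_norm_mono[OF u_summable that])
    show "tail_norm u (L * r) \<le> C * real_of_int r powr - ?d + \<epsilon> * tail_norm u r" if r: "r \<ge> r0" for r
    proof -
      have r': "r \<ge> r1" "r \<ge> 2 * m" "r \<ge> 4 * m + 2" "r \<ge> m1" "r \<ge> m0 + m" using r by (auto simp: r0_def)
      have rpos: "r > 0" using r'(3) m_pos by linarith
      have "tail_norm u (L * r) \<le> tail_norm u (int (CARD('n) + 3) * (2 * r) + 1)"
        using rpos by (intro tail_norm_mono u_summable) (simp add: L_def algebra_simps)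
      also have "\<dots> \<le> C * (real_of_int (2 * r) powr (- ?d) + (tail_norm u (2 * r - 2 * m))\<^sup>2)"
        using r' rpos by (intro C(2)) auto
      also have "\<dots> \<le> C * (real_of_int r powr (- ?d) + (tail_norm u r)\<^sup>2)"
        using C(1) r'(2) rpos
        by (intro mult_left_mono add_mono power_mono tail_norm_mono u_summable tail_norm_nonneg powr_mono2') auto
      also have "\<dots> = C * real_of_int r powr - ?d + (C * tail_norm u r) * tail_norm u r"
        by (simp add: algebra_simps power2_eq_square)
      also have "\<dots> \<le> C * real_of_int r powr - ?d + \<epsilon> * tail_norm u r"
      proof (intro add_left_mono mult_right_mono tail_norm_nonneg)
        have "C * tail_norm u r \<le> C * (\<epsilon> / (C + 1))"
          using C(1) r1 tail_norm_mono[OF u_summable r'(1)] by (intro mult_left_mono) auto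
        also have "\<dots> \<le> \<epsilon>" using C(1) \<epsilon> by (simp add: field_simps)
        finally show "C * tail_norm u r \<le> \<epsilon>" .
      qed
      finally show ?thesis .
    qed
    show "\<epsilon> * (2 * real_of_int L) powr ?d \<le> 1 / 2" using L by (simp add: \<epsilon>_def)
  qed (use L C \<epsilon> tail_norm_nonneg in auto)
qed

text \<open>The difference that defines \<open>y\<close> is passed to the dual function. In
  \<open>cube s\<close> this gains a power of \<open>r\<close>, since \<phi> is harmonic around it.
  Further out there is no such gain, and the difference is moved back onto the strain of
  \<open>u\<close>, where the Lipschitz bound produces the tail of \<open>y\<close>.\<close>

lemma second_step:
  "\<exists>C\<ge>0. \<forall>j. \<forall>r\<ge>max (4 * m + 2) (max (m1 + 1) (m0 + m + 1)).
     tail_norm (ldiff (axis j 1) u) (int (CARD('n) + 3) * r + 1)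
     \<le> C * (real_of_int r powr (- (real CARD('n) / 2) - 1)
          + real_of_int r powr (- (real CARD('n) / 2)) * (tail_norm u (r - 2 * m - 3))\<^sup>2
          + tail_norm u (r - 2 * m - 3) * tail_norm (ldiff (axis j 1) u) (r - 2 * m - 3))"
proof -
  define A1 where "A1 = K0 * real (card (cube m1 :: (int^'n) set)) * Cg + KN * Ks * Eu * Cs"
  define A2 where "A2 = 2 * KN * Ks * Cs"
  define A3 where "A3 = 2 * KN * Ks * sqrt Ks"
  have A0: "A1 \<ge> 0" "A2 \<ge> 0" "A3 \<ge> 0"
    using constants Cg_nonneg Cs_nonneg Ks_nonneg Eu_nonneg by (simp_all add: A1_def A2_def A3_def)
  define C where "C = (A1 + A2 + A3) / c"
  have C1: "A1 \<le> c * C" "A2 \<le> c * C" "A3 \<le> c * C" using A0 c_pos by (simp_all add: C_def)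
  have C0: "C \<ge> 0" using A0 c_pos by (simp add: C_def)
  have "tail_norm (ldiff (axis j 1) u) (int (CARD('n) + 3) * r + 1)
     \<le> C * (real_of_int r powr (- (real CARD('n) / 2) - 1)
          + real_of_int r powr (- (real CARD('n) / 2)) * (tail_norm u (r - 2 * m - 3))\<^sup>2
          + tail_norm u (r - 2 * m - 3) * tail_norm (ldiff (axis j 1) u) (r - 2 * m - 3))"
    if "r \<ge> max (4 * m + 2) (max (m1 + 1) (m0 + m + 1))" for j r
  proof -
    have r: "r \<ge> 4 * m + 2" "m1 \<le> r - 1" "r - m - 1 \<ge> m0" using that by auto
    define \<tau> :: "int^'n" where "\<tau> = axis j 1"
    define y where "y = ldiff \<tau> u"
    have ysum: "grad_sq y summable_on UNIV" unfolding y_def by (rule grad_sq_ldiff_summable[OF u_summable])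
    \<comment> \<open>One less than \<open>r - m\<close>, so that the bound \<open>sup\<close> for
      the strain of \<phi> reaches up to \<open>cube (s + 1)\<close> and covers the boundary
      layer.\<close>
    define s where "s = r - m - 1"
    have s: "s \<ge> m0" using r by (simp add: s_def)
    have \<tau>: "\<tau> \<in> cube 1" by (simp add: \<tau>_def axis_in_cube)
    let ?p = "real_of_int r powr (- (real CARD('n) / 2))"
    let ?p1 = "real_of_int r powr (- (real CARD('n) / 2) - 1)"
    let ?T = "tail_norm u (r - 2 * m - 3)" and ?Ty = "tail_norm y (r - 2 * m - 3)"
    have T0: "?T \<ge> 0" "?Ty \<ge> 0" by (simp_all add: tail_norm_nonneg)
    let ?Y = "C * (?p1 + ?p * ?T\<^sup>2 + ?T * ?Ty)"
    have "tail_norm y (int (CARD('n) + 3) * r + 1) \<le> ?Y"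
    proof (rule tail_norm_le)
      show Y0: "0 \<le> ?Y" using C0 T0 by simp
      fix P :: "(int^'n) set" assume P: "finite P" "P \<inter> cube (int (CARD('n) + 3) * r + 1) = {}"
      let ?X = "sum (grad_sq y) P"
      show "sqrt ?X \<le> ?Y"
      proof (rule sqrt_le_from_self_bound)
        fix \<epsilon> :: real assume "\<epsilon> > 0"
        then obtain \<phi> where \<phi>: "finsupp \<phi>" "sqrt (infsum (grad_sq \<phi>) UNIV) \<le> sqrt ?X / c"
          "harmonic (int (CARD('n) + 3) * r) \<phi>" "?X \<le> B y \<phi> + \<epsilon>"
          using dual_test_function[OF ysum P, of \<epsilon>] by auto
        define \<psi> where "\<psi> = ldiff (- \<tau>) \<phi>"
        have f\<psi>: "finsupp \<psi>" unfolding \<psi>_def by (rule finsupp_ldiff[OF \<phi>(1)])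
        have B\<psi>: "B y \<phi> = B u \<psi>" unfolding y_def \<psi>_def by (rule B_ldiff[OF \<phi>(1)])
        define I where "I = infsum (grad_sq \<phi>) UNIV"
        have I0: "I \<ge> 0" by (simp add: I_def infsum_nonneg)
        obtain R0 where R0: "R0 \<ge> 0" "\<And>x. x \<notin> cube R0 \<Longrightarrow> \<phi> x = 0" using finsupp_cube[OF \<phi>(1)] by blast
        define R where "R = R0 + 1 + m"
        have \<phi>0: "stn S (Df \<phi> x) = 0" if "x \<notin> cube (R - 1)" for x
          using stn_finsupp_zero[of R0 \<phi> x] R0(2) that by (simp add: R_def)
        have \<psi>0: "\<psi> x = 0" if "x \<notin> cube (R0 + 1)" for x
        proof -
          have "x \<notin> cube R0" using that cube_mono[of R0 "R0 + 1"] by auto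
          moreover have "x + - \<tau> \<notin> cube R0" using cube_add[OF _ \<tau>, of "x + - \<tau>" R0] that by auto
          ultimately show ?thesis using R0(2) by (simp add: \<psi>_def ldiff_def)
        qed
        have sup: "stn S (Df \<phi> x) \<le> Cs * sqrt I * ?p" if "x \<in> cube (s + 1)" for x
          unfolding I_def using that by (intro stn_sup[OF \<phi>(1,3) r(1)]) (simp add: s_def)
        let ?F = "cube R - cube m0 :: (int^'n) set"
        have core: "K0 * (\<Sum>x\<in>cube m1. sqrt (grad_sq \<psi> x)) \<le> K0 * (real (card (cube m1 :: (int^'n) set)) * (Cg * sqrt I * ?p1))"
        proof (intro mult_left_mono constants)
          have "(\<Sum>x\<in>cube m1. sqrt (grad_sq \<psi> x)) \<le> (\<Sum>x\<in>(cube m1 :: (int^'n) set). Cg * sqrt I * ?p1)"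
            unfolding I_def \<psi>_def \<tau>_def using cube_mono[OF r(2)]
            by (intro sum_mono sqrt_grad2_sup[OF \<phi>(1,3) r(1)]) auto
          then show "(\<Sum>x\<in>cube m1. sqrt (grad_sq \<psi> x)) \<le> real (card (cube m1 :: (int^'n) set)) * (Cg * sqrt I * ?p1)" by simp
        qed
        have near: "\<bar>\<Sum>x\<in>?F \<inter> cube s. Nu \<psi> x\<bar> \<le> KN * Ks * Eu * (Cs * sqrt I * ?p1)"
        proof (rule near_bound)
          show "stn S (Df \<psi> x) \<le> Cs * sqrt I * ?p1" if "x \<in> ?F \<inter> cube s" for x
            unfolding I_def \<psi>_def \<tau>_def using that by (intro stn2_sup[OF \<phi>(1,3) r(1)]) (simp add: s_def)
        qed (use Cs_nonneg I0 in auto)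
        (* summation by parts: outside the cube of side s the difference is moved from the test function
           to the nonlinearity, at the price of terms in the boundary layer of that cube *)
        define h where "h x = (if x + \<tau> \<in> cube s then 0 else N (Df u (x + \<tau>)) (Df \<phi> x))
            - (if x \<in> cube s then 0 else N (Df u x) (Df \<phi> x))" for x
        have far_eq: "(\<Sum>x\<in>?F - cube s. Nu \<psi> x) = (\<Sum>x\<in>cube (R + 1). h x)"
        proof -
          have cR: "?F - cube s = cube R - cube s" using cube_mono[OF s] by auto
          have N0: "N (Df u z) (Df \<phi> x) = 0" if "z \<notin> cube s" "x \<notin> cube (R - 1)" for z x
            using N_quad[OF u_small, of z "Df \<phi> x"] \<phi>0[OF that(2)] that(1) cube_mono[OF s] by auto
          have "(\<Sum>x\<in>cube R - cube s. Nu \<psi> x) = (\<Sum>x\<in>cube R - cube s. N (Df u x) (Df \<phi> (x - \<tau>)) - N (Df u x) (Df \<phi> x))"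
          proof (rule sum.cong[OF refl])
            fix x :: "int^'n"
            have "Df \<psi> x = (\<lambda>\<rho>. Df \<phi> (x - \<tau>) \<rho> - Df \<phi> x \<rho>)" by (simp add: \<psi>_def ldiff_def fun_eq_iff algebra_simps)
            then show "Nu \<psi> x = N (Df u x) (Df \<phi> (x - \<tau>)) - N (Df u x) (Df \<phi> x)" by (simp add: N_diff)
          qed
          also have "\<dots> = (\<Sum>x\<in>cube R - cube s. N (Df u x) (Df \<phi> (x - \<tau>))) - (\<Sum>x\<in>cube R - cube s. N (Df u x) (Df \<phi> x))"
            by (rule sum_subtractf)
          also have "(\<Sum>x\<in>cube R - cube s. N (Df u x) (Df \<phi> (x - \<tau>)))
             = (\<Sum>x\<in>(\<lambda>x. x - \<tau>) ` (cube R - cube s). N (Df u (x + \<tau>)) (Df \<phi> x))"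
            by (simp add: sum.reindex inj_on_def)
          also have "\<dots> = (\<Sum>x\<in>cube (R + 1). if x + \<tau> \<in> cube s then 0 else N (Df u (x + \<tau>)) (Df \<phi> x))"
          proof (rule sum.mono_neutral_cong_left)
            show "(\<lambda>x. x - \<tau>) ` (cube R - cube s) \<subseteq> cube (R + 1)"
              using cube_add[of _ R "- \<tau>" 1] \<tau> by (auto simp: cube_minus)
            show "\<forall>x\<in>cube (R + 1) - (\<lambda>x. x - \<tau>) ` (cube R - cube s).
               (if x + \<tau> \<in> cube s then 0 else N (Df u (x + \<tau>)) (Df \<phi> x)) = 0"
            proof
              fix x assume x: "x \<in> cube (R + 1) - (\<lambda>x. x - \<tau>) ` (cube R - cube s)"
              have "x + \<tau> \<notin> cube R - cube s"
              proof
                assume "x + \<tau> \<in> cube R - cube s"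
                then have "x + \<tau> - \<tau> \<in> (\<lambda>x. x - \<tau>) ` (cube R - cube s)" by blast
                then show False using x by simp
              qed
              then consider "x + \<tau> \<in> cube s" | "x + \<tau> \<notin> cube s" "x + \<tau> \<notin> cube R" by blast
              then show "(if x + \<tau> \<in> cube s then 0 else N (Df u (x + \<tau>)) (Df \<phi> x)) = 0"
              proof cases
                case 2
                then have "x \<notin> cube (R - 1)" using cube_add[OF _ \<tau>, of x "R - 1"] by auto
                then show ?thesis using N0 2 by simp
              qed simp
            qed
          qed auto
          also have "(\<Sum>x\<in>cube R - cube s. N (Df u x) (Df \<phi> x)) = (\<Sum>x\<in>cube (R + 1). if x \<in> cube s then 0 else N (Df u x) (Df \<phi> x))"
          proof (rule sum.mono_neutral_cong_left)
            show "cube R - cube s \<subseteq> cube (R + 1)" using cube_mono[of R "R + 1"] by auto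
            show "\<forall>x\<in>cube (R + 1) - (cube R - cube s). (if x \<in> cube s then 0 else N (Df u x) (Df \<phi> x)) = 0"
              using N0 cube_mono[of "R - 1" R] by auto
          qed auto
          finally show ?thesis unfolding cR h_def by (simp only: sum_subtractf)
        qed
        have quad: "\<bar>if z \<in> cube s then 0 else N (Df u z) (Df \<phi> x)\<bar> \<le> KN * (stn S (Df u z))\<^sup>2 * stn S (Df \<phi> x)" for z x
          using N_quad[OF u_small, of z "Df \<phi> x"] cube_mono[OF s] constants by auto
        let ?G = "cube (R + 1) :: (int^'n) set"
        \<comment> \<open>On \<open>cube (s - 1)\<close> both terms of \<open>h\<close> vanish, so a
          layer of width two remains. There the quadratic bound is applied to each term separately
          and gives the middle term of the claim.\<close>
        have mid: "\<bar>\<Sum>x\<in>?G \<inter> cube (s + 1). h x\<bar> \<le> A2 * (sqrt I * ?p * ?T\<^sup>2)"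
        proof -
          let ?G1 = "?G \<inter> cube (s + 1) - cube (s - 1)"
          have h0: "h x = 0" if "x \<in> cube (s - 1)" for x
            using that cube_mono[of "s - 1" s] cube_add[OF that \<tau>] by (auto simp: h_def)
          have hb: "\<bar>h x\<bar> \<le> KN * (Cs * sqrt I * ?p) * ((stn S (Df u (x + \<tau>)))\<^sup>2 + (stn S (Df u x))\<^sup>2)" if "x \<in> cube (s + 1)" for x
          proof -
            have "\<bar>h x\<bar> \<le> KN * (stn S (Df u (x + \<tau>)))\<^sup>2 * stn S (Df \<phi> x) + KN * (stn S (Df u x))\<^sup>2 * stn S (Df \<phi> x)"
              unfolding h_def using quad[of "x + \<tau>" x] quad[of x x] by linarith
            also have "\<dots> = KN * ((stn S (Df u (x + \<tau>)))\<^sup>2 + (stn S (Df u x))\<^sup>2) * stn S (Df \<phi> x)"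
              by (simp add: algebra_simps)
            also have "\<dots> \<le> KN * ((stn S (Df u (x + \<tau>)))\<^sup>2 + (stn S (Df u x))\<^sup>2) * (Cs * sqrt I * ?p)"
              using sup[OF that] constants by (intro mult_left_mono) auto
            finally show ?thesis by (simp add: mult_ac)
          qed
          have "(\<Sum>x\<in>?G \<inter> cube (s + 1). h x) = (\<Sum>x\<in>?G1. h x)"
            using h0 by (intro sum.mono_neutral_right) auto
          then have "\<bar>\<Sum>x\<in>?G \<inter> cube (s + 1). h x\<bar> \<le> (\<Sum>x\<in>?G1. KN * (Cs * sqrt I * ?p) * ((stn S (Df u (x + \<tau>)))\<^sup>2 + (stn S (Df u x))\<^sup>2))"
            using hb by (simp only:) (intro order_trans[OF sum_abs sum_mono], auto)
          also have "\<dots> = KN * (Cs * sqrt I * ?p) * ((\<Sum>x\<in>?G1. (stn S (Df u (x + \<tau>)))\<^sup>2) + (\<Sum>x\<in>?G1. (stn S (Df u x))\<^sup>2))"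
            unfolding sum_distrib_left[symmetric] sum.distrib ..
          also have "\<dots> \<le> KN * (Cs * sqrt I * ?p) * (Ks * ?T\<^sup>2 + Ks * ?T\<^sup>2)"
          proof (intro mult_left_mono add_mono)
            have "(\<Sum>x\<in>?G1. (stn S (Df u (x + \<tau>)))\<^sup>2) = (\<Sum>x\<in>(\<lambda>x. x + \<tau>) ` ?G1. (stn S (Df u x))\<^sup>2)"
              by (simp add: sum.reindex inj_on_def)
            also have "\<dots> \<le> Ks * (tail_norm u ((s - 2) - m))\<^sup>2"
            proof (rule sum_stn_sq_tail[OF u_summable])
              have "x + \<tau> \<notin> cube (s - 2)" if "x \<notin> cube (s - 1)" for x
                using cube_add_cancel[of x \<tau> "s - 2" 1] \<tau> that by auto
              then show "(\<lambda>x. x + \<tau>) ` ?G1 \<inter> cube (s - 2) = {}" by auto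
            qed simp
            finally show "(\<Sum>x\<in>?G1. (stn S (Df u (x + \<tau>)))\<^sup>2) \<le> Ks * ?T\<^sup>2" by (simp add: s_def algebra_simps)
            have "(\<Sum>x\<in>?G1. (stn S (Df u x))\<^sup>2) \<le> Ks * (tail_norm u ((s - 1) - m))\<^sup>2"
              by (rule sum_stn_sq_tail[OF u_summable]) auto
            also have "\<dots> \<le> Ks * ?T\<^sup>2"
              using Ks_nonneg by (intro mult_left_mono power_mono tail_norm_mono u_summable tail_norm_nonneg) (auto simp: s_def)
            finally show "(\<Sum>x\<in>?G1. (stn S (Df u x))\<^sup>2) \<le> Ks * ?T\<^sup>2" .
          qed (use constants Cs_nonneg I0 in simp)
          also have "\<dots> = A2 * (sqrt I * ?p * ?T\<^sup>2)" by (simp add: A2_def algebra_simps)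
          finally show ?thesis .
        qed
        \<comment> \<open>Beyond the layer \<open>x\<close> and \<open>x + \<tau>\<close> both lie
          outside \<open>cube s\<close>, so \<open>h\<close> is a difference of the nonlinearity at
          neighbouring strains and is bounded by a small multiple of the strain of
          \<open>y\<close>.\<close>
        have far: "\<bar>\<Sum>x\<in>?G - cube (s + 1). h x\<bar> \<le> A3 * (?T * ?Ty * sqrt I)"
        proof -
          let ?G2 = "?G - cube (s + 1)"
          have hb: "\<bar>h x\<bar> \<le> 2 * KN * (sqrt Ks * ?T) * (stn S (Df y x) * stn S (Df \<phi> x))" if "x \<in> ?G2" for x
          proof -
            have x: "x \<notin> cube s" using that cube_mono[of s "s + 1"] by auto
            have x\<tau>: "x + \<tau> \<notin> cube s" using cube_add_cancel[of x \<tau> s 1] \<tau> that by auto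
            have m0: "x \<notin> cube m0" "x + \<tau> \<notin> cube m0" using x x\<tau> cube_mono[OF s] by auto
            have tb: "stn S (Df u z) \<le> sqrt Ks * ?T" if "z \<notin> cube s" for z
            proof -
              have "stn S (Df u z) \<le> sqrt Ks * tail_norm u (s - m)" by (rule stn_tail[OF u_summable that])
              also have "\<dots> \<le> sqrt Ks * ?T"
                using Ks_nonneg by (intro mult_left_mono tail_norm_mono u_summable) (auto simp: s_def)
              finally show ?thesis .
            qed
            have "\<bar>h x\<bar> \<le> KN * (stn S (Df u (x + \<tau>)) + stn S (Df u x)) * stn S (\<lambda>\<rho>. Df u (x + \<tau>) \<rho> - Df u x \<rho>) * stn S (Df \<phi> x)"
              using x x\<tau> N_lipschitz[OF u_small[OF m0(2)] u_small[OF m0(1)], of "Df \<phi> x"] by (simp add: h_def)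
            also have "(\<lambda>\<rho>. Df u (x + \<tau>) \<rho> - Df u x \<rho>) = Df y x"
              by (simp add: y_def ldiff_def fun_eq_iff algebra_simps)
            also have "KN * (stn S (Df u (x + \<tau>)) + stn S (Df u x)) * stn S (Df y x) * stn S (Df \<phi> x)
               \<le> KN * (sqrt Ks * ?T + sqrt Ks * ?T) * stn S (Df y x) * stn S (Df \<phi> x)"
              using constants by (intro mult_right_mono mult_left_mono add_mono tb x x\<tau>) auto
            finally show ?thesis by (simp add: algebra_simps)
          qed
          then have "\<bar>\<Sum>x\<in>?G2. h x\<bar> \<le> (\<Sum>x\<in>?G2. 2 * KN * (sqrt Ks * ?T) * (stn S (Df y x) * stn S (Df \<phi> x)))"
            by (rule order_trans[OF sum_abs sum_mono])
          also have "\<dots> = 2 * KN * (sqrt Ks * ?T) * (\<Sum>x\<in>?G2. stn S (Df y x) * stn S (Df \<phi> x))"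
            by (simp add: sum_distrib_left)
          also have "\<dots> \<le> 2 * KN * (sqrt Ks * ?T) * (sqrt (Ks * ?Ty\<^sup>2) * sqrt (Ks * I))"
          proof (intro mult_left_mono order_trans[OF cauchy_schwarz_sum] mult_mono real_sqrt_le_mono)
            have "(\<Sum>x\<in>?G2. (stn S (Df y x))\<^sup>2) \<le> Ks * (tail_norm y ((s + 1) - m))\<^sup>2"
              by (rule sum_stn_sq_tail[OF ysum]) auto
            also have "\<dots> \<le> Ks * ?Ty\<^sup>2"
              using Ks_nonneg by (intro mult_left_mono power_mono tail_norm_mono ysum tail_norm_nonneg) (auto simp: s_def)
            finally show "(\<Sum>x\<in>?G2. (stn S (Df y x))\<^sup>2) \<le> Ks * ?Ty\<^sup>2" .
            show "(\<Sum>x\<in>?G2. (stn S (Df \<phi> x))\<^sup>2) \<le> Ks * I" unfolding I_def by (intro sum_stn_finsupp \<phi>) auto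
          qed (use constants Ks_nonneg T0 in \<open>auto intro!: sum_nonneg mult_nonneg_nonneg\<close>)
          also have "\<dots> = A3 * (?T * ?Ty * sqrt I)"
            using Ks_nonneg T0 by (simp add: real_sqrt_mult A3_def mult_ac)
          finally show ?thesis .
        qed
        have "infsum (Nu \<psi>) (- cube m0) = (\<Sum>x\<in>?F. Nu \<psi> x)"
          unfolding R_def using \<psi>0 by (rule infsum_Nu)
        also have "\<dots> = (\<Sum>x\<in>?F \<inter> cube s. Nu \<psi> x) + (\<Sum>x\<in>?F - cube s. Nu \<psi> x)"
          by (subst sum.union_disjoint[symmetric]) (auto intro: sum.cong)
        also have "(\<Sum>x\<in>?F - cube s. Nu \<psi> x) = (\<Sum>x\<in>?G \<inter> cube (s + 1). h x) + (\<Sum>x\<in>?G - cube (s + 1). h x)"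
          unfolding far_eq by (subst sum.union_disjoint[symmetric]) (auto intro: sum.cong)
        finally have "B y \<phi> \<le> K0 * (real (card (cube m1 :: (int^'n) set)) * (Cg * sqrt I * ?p1))
            + KN * Ks * Eu * (Cs * sqrt I * ?p1) + A2 * (sqrt I * ?p * ?T\<^sup>2) + A3 * (?T * ?Ty * sqrt I)"
          using equilibrium[OF f\<psi>] core near mid far unfolding B\<psi> by linarith
        also have "\<dots> = sqrt I * (A1 * ?p1 + A2 * (?p * ?T\<^sup>2) + A3 * (?T * ?Ty))"
          by (simp add: A1_def algebra_simps)
        also have "\<dots> \<le> sqrt I * ((c * C) * ?p1 + (c * C) * (?p * ?T\<^sup>2) + (c * C) * (?T * ?Ty))"
          using C1 I0 T0 by (intro mult_left_mono add_mono mult_right_mono) auto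
        also have "\<dots> = (c * sqrt I) * ?Y" by (simp add: algebra_simps)
        also have "\<dots> \<le> sqrt ?X * ?Y"
          using \<phi>(2) c_pos Y0 by (intro mult_right_mono) (simp_all add: I_def field_simps)
        finally show "?X \<le> sqrt ?X * ?Y + \<epsilon>" using \<phi>(4) by linarith
      qed (use Y0 in \<open>auto intro: sum_nonneg\<close>)
    qed
    then show ?thesis by (simp add: y_def \<tau>_def)
  qed
  then show ?thesis using C0 by blast
qed

text \<open>By the first decay the layer term is of order \<open>r powr (-d/2 - d)\<close>, which is
  enough since \<open>d \<ge> 1\<close>. The product of the two tails is absorbed as in
  \<open>first_decay\<close>, with the tail of \<open>u\<close> as the small factor.\<close>

lemma second_decay:
  "\<exists>C\<ge>0. \<forall>r\<ge>1. tail_norm (ldiff (axis j 1) u) r \<le> C * real_of_int r powr (- (real CARD('n) / 2) - 1)"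
proof -
  let ?d = "real CARD('n) / 2" and ?y = "ldiff (axis j 1) u"
  have ysum: "grad_sq ?y summable_on UNIV" by (rule grad_sq_ldiff_summable[OF u_summable])
  obtain C where C: "C \<ge> 0" "\<And>r. r \<ge> max (4 * m + 2) (max (m1 + 1) (m0 + m + 1)) \<Longrightarrow>
     tail_norm ?y (int (CARD('n) + 3) * r + 1)
     \<le> C * (real_of_int r powr (- ?d - 1) + real_of_int r powr (- ?d) * (tail_norm u (r - 2 * m - 3))\<^sup>2
          + tail_norm u (r - 2 * m - 3) * tail_norm ?y (r - 2 * m - 3))"
    using second_step by blast
  obtain C2 where C2: "C2 \<ge> 0" "\<And>r. r \<ge> 1 \<Longrightarrow> tail_norm u r \<le> C2 * real_of_int r powr (- ?d)"
    using first_decay by blast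
  define L where "L = 2 * int (CARD('n) + 3) + 1"
  define \<epsilon> where "\<epsilon> = 1 / (2 * (2 * real_of_int L) powr (?d + 1))"
  have L: "L \<ge> 1" by (simp add: L_def)
  have \<epsilon>: "\<epsilon> > 0" using L by (simp add: \<epsilon>_def)
  obtain r1 where r1: "tail_norm u r1 \<le> \<epsilon> / (C + 1)"
    using tail_norm_tendsto[OF u_summable, of "\<epsilon> / (C + 1)"] \<epsilon> C(1) by auto
  define r0 where "r0 = max r1 (max (2 * m + 3) (max (4 * m + 2) (max (m1 + 1) (m0 + m + 1))))"
  have "\<exists>C'\<ge>0. \<forall>r\<ge>1. tail_norm ?y r \<le> C' * real_of_int r powr - (?d + 1)"
  proof (rule decay_recursion[where L = L and C = "C * (1 + C2\<^sup>2)" and \<epsilon> = \<epsilon> and ?r0.0 = r0])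
    show "tail_norm ?y s \<le> tail_norm ?y r" if "r \<le> s" for r s by (rule tail_norm_mono[OF ysum that])
    show "tail_norm ?y (L * r) \<le> C * (1 + C2\<^sup>2) * real_of_int r powr - (?d + 1) + \<epsilon> * tail_norm ?y r" if r: "r \<ge> r0" for r
    proof -
      have r': "r \<ge> r1" "r \<ge> 2 * m + 3" "r \<ge> 4 * m + 2" "r \<ge> m1 + 1" "r \<ge> m0 + m + 1" using r by (auto simp: r0_def)
      have rpos: "r \<ge> 1" using r'(3) m_pos by linarith
      have "tail_norm ?y (L * r) \<le> tail_norm ?y (int (CARD('n) + 3) * (2 * r) + 1)"
        using rpos by (intro tail_norm_mono ysum) (simp add: L_def algebra_simps)
      also have "\<dots> \<le> C * (real_of_int (2 * r) powr (- ?d - 1) + real_of_int (2 * r) powr (- ?d) * (tail_norm u (2 * r - 2 * m - 3))\<^sup>2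
          + tail_norm u (2 * r - 2 * m - 3) * tail_norm ?y (2 * r - 2 * m - 3))"
        using r' rpos by (intro C(2)) auto
      also have "\<dots> \<le> C * (real_of_int r powr (- ?d - 1) + real_of_int r powr (- ?d) * (tail_norm u r)\<^sup>2
          + tail_norm u r * tail_norm ?y r)"
        using C(1) r'(2) rpos
        by (intro mult_left_mono add_mono mult_mono power_mono tail_norm_mono u_summable ysum
            tail_norm_nonneg powr_mono2') (auto simp: tail_norm_nonneg)
      also have "real_of_int r powr (- ?d) * (tail_norm u r)\<^sup>2 \<le> C2\<^sup>2 * real_of_int r powr (- ?d - 1)"
      proof -
        have "(tail_norm u r)\<^sup>2 \<le> (C2 * real_of_int r powr (- ?d))\<^sup>2"
          using C2(2)[OF rpos] by (intro power_mono tail_norm_nonneg)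
        also have "\<dots> = C2\<^sup>2 * real_of_int r powr (- real CARD('n))"
          using rpos by (simp add: power_mult_distrib power2_eq_square powr_add[symmetric])
        also have "\<dots> \<le> C2\<^sup>2 * real_of_int r powr (- 1)"
          using rpos by (intro mult_left_mono powr_mono) (auto simp: Suc_le_eq)
        finally have "real_of_int r powr (- ?d) * (tail_norm u r)\<^sup>2
            \<le> real_of_int r powr (- ?d) * (C2\<^sup>2 * real_of_int r powr (- 1))"
          by (intro mult_left_mono) auto
        also have "\<dots> = C2\<^sup>2 * real_of_int r powr (- ?d - 1)"
        proof -
          have "real_of_int r powr (- ?d - 1) = real_of_int r powr (- ?d) * real_of_int r powr (- 1)"
            by (subst powr_add[symmetric]) simp
          then show ?thesis by (simp only: mult.left_commute)
        qed
        finally show ?thesis .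
      qed
      finally have "tail_norm ?y (L * r) \<le> C * (real_of_int r powr (- ?d - 1) + C2\<^sup>2 * real_of_int r powr (- ?d - 1)
          + tail_norm u r * tail_norm ?y r)" using C(1) by (simp add: mult_left_mono)
      also have "\<dots> = C * (1 + C2\<^sup>2) * real_of_int r powr - (?d + 1) + (C * tail_norm u r) * tail_norm ?y r"
      proof -
        have "- (?d + 1) = - ?d - 1" by simp
        then show ?thesis by (simp only:) (simp only: algebra_simps mult_1_right)
      qed
      also have "\<dots> \<le> C * (1 + C2\<^sup>2) * real_of_int r powr - (?d + 1) + \<epsilon> * tail_norm ?y r"
      proof (intro add_left_mono mult_right_mono tail_norm_nonneg)
        have "C * tail_norm u r \<le> C * (\<epsilon> / (C + 1))"
          using C(1) r1 tail_norm_mono[OF u_summable r'(1)] by (intro mult_left_mono) auto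
        also have "\<dots> \<le> \<epsilon>" using C(1) \<epsilon> by (simp add: field_simps)
        finally show "C * tail_norm u r \<le> \<epsilon>" .
      qed
      finally show ?thesis .
    qed
    show "\<epsilon> * (2 * real_of_int L) powr (?d + 1) \<le> 1 / 2" using L by (simp add: \<epsilon>_def)
  qed (use L C \<epsilon> tail_norm_nonneg in auto)
  moreover have "- (?d + 1) = - ?d - 1" by simp
  ultimately show ?thesis by (simp only:)
qed

theorem lattice_decay:
  obtains C where "C \<ge> 0"
    "\<And>r. r \<ge> 1 \<Longrightarrow> tail_norm u r \<le> C * real_of_int r powr (- (real CARD('n) / 2))"
    "\<And>r j. r \<ge> 1 \<Longrightarrow> tail_norm (ldiff (axis j 1) u) r \<le> C * real_of_int r powr (- (real CARD('n) / 2) - 1)"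
proof -
  obtain C1 where C1: "C1 \<ge> 0" "\<And>r. r \<ge> 1 \<Longrightarrow> tail_norm u r \<le> C1 * real_of_int r powr (- (real CARD('n) / 2))"
    using first_decay by blast
  have "\<forall>j. \<exists>C\<ge>0. \<forall>r\<ge>1. tail_norm (ldiff (axis j 1) u) r \<le> C * real_of_int r powr (- (real CARD('n) / 2) - 1)"
    using second_decay by blast
  then obtain C2 where C2: "\<And>j. C2 j \<ge> 0"
    "\<And>j r. r \<ge> 1 \<Longrightarrow> tail_norm (ldiff (axis j 1) u) r \<le> C2 j * real_of_int r powr (- (real CARD('n) / 2) - 1)"
    by metis
  define C where "C = C1 + (\<Sum>j\<in>UNIV. C2 j)"
  have "C2 j \<le> (\<Sum>j\<in>UNIV. C2 j)" for j using C2(1) by (intro member_le_sum) auto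
  then have le: "C1 \<le> C" "C2 j \<le> C" for j
    using C1(1) sum_nonneg[of UNIV C2] C2(1) by (auto simp: C_def intro: add_increasing)
  show thesis
  proof (rule that[of C])
    show "C \<ge> 0" using le(1) C1(1) by linarith
    show "tail_norm u r \<le> C * real_of_int r powr (- (real CARD('n) / 2))" if "r \<ge> 1" for r
      using C1(2)[OF that] le(1) by (rule order_trans[OF _ mult_right_mono]) auto
    show "tail_norm (ldiff (axis j 1) u) r \<le> C * real_of_int r powr (- (real CARD('n) / 2) - 1)" if "r \<ge> 1" for r j
      using C2(2)[OF that] le(2) by (rule order_trans[OF _ mult_right_mono]) auto
  qed
qed

end

subsection \<open>Differentiable functionals\<close>

text \<open>The body of \<open>Ck_on\<close> with its witness \<open>D\<close> made a parameter, so
  that derivatives can be named and computed.\<close>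

definition Ck_derivs ::
  "nat \<Rightarrow> ('a \<Rightarrow> 'b::real_vector) set \<Rightarrow> (('a \<Rightarrow> 'b) \<Rightarrow> real) \<Rightarrow> (('a \<Rightarrow> 'b) \<Rightarrow> real)
    \<Rightarrow> (nat \<Rightarrow> ('a \<Rightarrow> 'b) \<Rightarrow> ('a \<Rightarrow> 'b) list \<Rightarrow> real) \<Rightarrow> bool" where
  "Ck_derivs k W p F D \<longleftrightarrow>
        (\<forall>u\<in>W. D 0 u [] = F u) \<and>
        (\<forall>j\<le>k. \<forall>u\<in>W. \<forall>vs\<in>lists W. \<forall>i<j. \<forall>v\<in>W. \<forall>w\<in>W. \<forall>a b. length vs = j \<longrightarrow>
            D j u (vs[i := (\<lambda>x. a *\<^sub>R v x + b *\<^sub>R w x)])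
              = a * D j u (vs[i := v]) + b * D j u (vs[i := w])) \<and>
        (\<forall>j\<le>k. \<forall>u\<in>W. \<exists>M. \<forall>vs\<in>lists W. length vs = j \<longrightarrow>
            \<bar>D j u vs\<bar> \<le> M * prod_list (map p vs)) \<and>
        (\<forall>j<k. \<forall>u\<in>W. \<forall>\<epsilon>>0. \<exists>\<delta>>0. \<forall>w\<in>W. p w < \<delta> \<longrightarrow>
            (\<forall>vs\<in>lists W. length vs = j \<longrightarrow>
               \<bar>D j (\<lambda>x. u x + w x) vs - D j u vs - D (Suc j) u (w # vs)\<bar>
                 \<le> \<epsilon> * p w * prod_list (map p vs))) \<and>
        (\<forall>u\<in>W. \<forall>\<epsilon>>0. \<exists>\<delta>>0. \<forall>w\<in>W. p w < \<delta> \<longrightarrow>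
            (\<forall>vs\<in>lists W. length vs = k \<longrightarrow>
               \<bar>D k (\<lambda>x. u x + w x) vs - D k u vs\<bar> \<le> \<epsilon> * prod_list (map p vs)))"

lemma Ck_on_iff: "Ck_on k W p F \<longleftrightarrow> (\<exists>D. Ck_derivs k W p F D)"
  unfolding Ck_on_def Ck_derivs_def ..

text \<open>Serves both for the site potentials, where \<open>W\<close> is everything, and for the
  energy on \<open>W_12\<close>. Nonnegativity and homogeneity of the semi-norm are assumed here,
  the triangle inequality in \<open>Ck_functional_triangle\<close>.\<close>

locale Ck_functional =
  fixes k :: nat and W :: "('a \<Rightarrow> 'b::real_vector) set" and p F :: "('a \<Rightarrow> 'b) \<Rightarrow> real"
    and D :: "nat \<Rightarrow> ('a \<Rightarrow> 'b) \<Rightarrow> ('a \<Rightarrow> 'b) list \<Rightarrow> real"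
  assumes derivs: "Ck_derivs k W p F D"
    and W_lin: "\<And>u v a b. u \<in> W \<Longrightarrow> v \<in> W \<Longrightarrow> (\<lambda>x. a *\<^sub>R u x + b *\<^sub>R v x) \<in> W"
    and W_zero: "(\<lambda>x. 0) \<in> W"
    and p_nonneg: "\<And>v. p v \<ge> 0"
    and p_scale: "\<And>v a. v \<in> W \<Longrightarrow> p (\<lambda>x. a *\<^sub>R v x) = \<bar>a\<bar> * p v"
begin

lemma W_scale: "u \<in> W \<Longrightarrow> (\<lambda>x. a *\<^sub>R u x) \<in> W" using W_lin[of u u a 0] by simp
lemma W_add_scale: "u \<in> W \<Longrightarrow> v \<in> W \<Longrightarrow> (\<lambda>x. u x + t *\<^sub>R v x) \<in> W" using W_lin[of u v 1 t] by simp
lemma W_diff: "u \<in> W \<Longrightarrow> v \<in> W \<Longrightarrow> (\<lambda>x. u x - v x) \<in> W" using W_lin[of u v 1 "-1"] by simp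

lemma D_zero: "u \<in> W \<Longrightarrow> D 0 u [] = F u" using derivs by (simp add: Ck_derivs_def)

lemma D_linear:
  assumes "j \<le> k" "u \<in> W" "vs \<in> lists W" "i < j" "v \<in> W" "w \<in> W" "length vs = j"
  shows "D j u (vs[i := (\<lambda>x. a *\<^sub>R v x + b *\<^sub>R w x)]) = a * D j u (vs[i := v]) + b * D j u (vs[i := w])"
  by (rule derivs[unfolded Ck_derivs_def, THEN conjunct2, THEN conjunct1, rule_format, OF assms])

lemma D_bound:
  assumes "j \<le> k" "u \<in> W"
  obtains M where "M \<ge> 0" "\<And>vs. vs \<in> lists W \<Longrightarrow> length vs = j \<Longrightarrow> \<bar>D j u vs\<bar> \<le> M * prod_list (map p vs)"
proof -
  obtain M where M: "\<forall>vs\<in>lists W. length vs = j \<longrightarrow> \<bar>D j u vs\<bar> \<le> M * prod_list (map p vs)"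
    using derivs[unfolded Ck_derivs_def, THEN conjunct2, THEN conjunct2, THEN conjunct1, rule_format, OF assms] by blast
  have pl: "prod_list (map p vs) \<ge> 0" for vs by (induction vs) (simp_all add: p_nonneg)
  have "\<bar>D j u vs\<bar> \<le> \<bar>M\<bar> * prod_list (map p vs)" if "vs \<in> lists W" "length vs = j" for vs
  proof -
    have "\<bar>D j u vs\<bar> \<le> M * prod_list (map p vs)" using M that by blast
    also have "\<dots> \<le> \<bar>M\<bar> * prod_list (map p vs)" by (intro mult_right_mono pl) auto
    finally show ?thesis .
  qed
  then show thesis using that[of "\<bar>M\<bar>"] by simp
qed

lemma D_diff:
  assumes "j < k" "u \<in> W" "\<epsilon> > 0"
  obtains \<delta> where "\<delta> > 0" "\<And>w vs. w \<in> W \<Longrightarrow> p w < \<delta> \<Longrightarrow> vs \<in> lists W \<Longrightarrow> length vs = j \<Longrightarrow>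
    \<bar>D j (\<lambda>x. u x + w x) vs - D j u vs - D (Suc j) u (w # vs)\<bar> \<le> \<epsilon> * p w * prod_list (map p vs)"
proof -
  have "\<exists>\<delta>>0. \<forall>w\<in>W. p w < \<delta> \<longrightarrow> (\<forall>vs\<in>lists W. length vs = j \<longrightarrow>
      \<bar>D j (\<lambda>x. u x + w x) vs - D j u vs - D (Suc j) u (w # vs)\<bar> \<le> \<epsilon> * p w * prod_list (map p vs))"
    by (rule derivs[unfolded Ck_derivs_def, THEN conjunct2, THEN conjunct2, THEN conjunct2, THEN conjunct1,
          rule_format, OF assms])
  then show thesis using that by blast
qed

lemma prod_list_p_nonneg: "prod_list (map p vs) \<ge> 0" by (induction vs) (simp_all add: p_nonneg)

lemma D_hd_linear:
  assumes "Suc j \<le> k" "u \<in> W" "vs \<in> lists W" "length vs = j" "v \<in> W" "w \<in> W"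
  shows "D (Suc j) u ((\<lambda>x. a *\<^sub>R v x + b *\<^sub>R w x) # vs) = a * D (Suc j) u (v # vs) + b * D (Suc j) u (w # vs)"
  using D_linear[of "Suc j" u "v # vs" 0 v w a b] assms by simp

lemma D_hd_scale:
  assumes "Suc j \<le> k" "u \<in> W" "vs \<in> lists W" "length vs = j" "v \<in> W"
  shows "D (Suc j) u ((\<lambda>x. a *\<^sub>R v x) # vs) = a * D (Suc j) u (v # vs)"
  using D_hd_linear[OF assms assms(5), of a 0] by simp

text \<open>Differentiability with \<epsilon> = 1 and the bound on the next derivative at
  \<open>u\<close> combine to a Lipschitz estimate centred at \<open>u\<close>.\<close>

lemma D_lipschitz:
  assumes "j < k" "u \<in> W"
  obtains \<delta> M where "\<delta> > 0" "M \<ge> 0" "\<And>w vs. w \<in> W \<Longrightarrow> p w < \<delta> \<Longrightarrow> vs \<in> lists W \<Longrightarrow> length vs = j \<Longrightarrow>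
    \<bar>D j (\<lambda>x. u x + w x) vs - D j u vs\<bar> \<le> M * p w * prod_list (map p vs)"
proof -
  obtain M where M: "M \<ge> 0" "\<And>vs. vs \<in> lists W \<Longrightarrow> length vs = Suc j \<Longrightarrow> \<bar>D (Suc j) u vs\<bar> \<le> M * prod_list (map p vs)"
    using D_bound[of "Suc j" u] assms by auto
  obtain \<delta> where \<delta>: "\<delta> > 0" "\<And>w vs. w \<in> W \<Longrightarrow> p w < \<delta> \<Longrightarrow> vs \<in> lists W \<Longrightarrow> length vs = j \<Longrightarrow>
    \<bar>D j (\<lambda>x. u x + w x) vs - D j u vs - D (Suc j) u (w # vs)\<bar> \<le> 1 * p w * prod_list (map p vs)"
    using D_diff[OF assms, of 1] by auto
  have "\<bar>D j (\<lambda>x. u x + w x) vs - D j u vs\<bar> \<le> (M + 1) * p w * prod_list (map p vs)"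
    if "w \<in> W" "p w < \<delta>" "vs \<in> lists W" "length vs = j" for w vs
    using \<delta>(2)[OF that] M(2)[of "w # vs"] that by (simp add: algebra_simps)
  then show thesis using that[of \<delta> "M + 1"] \<delta>(1) M(1) by auto
qed

text \<open>Turns differentiability with respect to a semi-norm into independence of what the
  semi-norm does not see; for site potentials these are the values off the stencil.\<close>

lemma D_cong:
  assumes "j < k" "u \<in> W" "u' \<in> W" "p (\<lambda>x. u' x - u x) = 0" "vs \<in> lists W" "length vs = j"
  shows "D j u' vs = D j u vs"
proof -
  obtain \<delta> M where \<delta>: "\<delta> > 0" "\<And>w vs. w \<in> W \<Longrightarrow> p w < \<delta> \<Longrightarrow> vs \<in> lists W \<Longrightarrow> length vs = j \<Longrightarrow>
    \<bar>D j (\<lambda>x. u x + w x) vs - D j u vs\<bar> \<le> M * p w * prod_list (map p vs)"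
    using D_lipschitz[OF assms(1,2)] by metis
  show ?thesis using \<delta>(2)[of "\<lambda>x. u' x - u x" vs] assms \<delta>(1) W_diff[OF assms(3,2)] by simp
qed

lemma D_line_derivative:
  assumes "j < k" "u \<in> W" "v \<in> W" "vs \<in> lists W" "length vs = j"
  shows "((\<lambda>t. D j (\<lambda>x. u x + t *\<^sub>R v x) vs) has_real_derivative D (Suc j) (\<lambda>x. u x + t *\<^sub>R v x) (v # vs)) (at t)"
  unfolding DERIV_def LIM_eq
proof (intro allI impI)
  fix r :: real assume "r > 0"
  let ?u = "\<lambda>x. u x + t *\<^sub>R v x"
  have u: "?u \<in> W" using assms by (intro W_add_scale)
  define P where "P = p v * prod_list (map p vs)"
  have P: "P \<ge> 0" by (simp add: P_def p_nonneg prod_list_p_nonneg)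
  \<comment> \<open>\<open>P\<close> may vanish; dividing by \<open>P + 1\<close> avoids that case
    and makes the final inequality strict.\<close>
  obtain \<delta> where \<delta>: "\<delta> > 0" "\<And>w vs. w \<in> W \<Longrightarrow> p w < \<delta> \<Longrightarrow> vs \<in> lists W \<Longrightarrow> length vs = j \<Longrightarrow>
    \<bar>D j (\<lambda>x. ?u x + w x) vs - D j ?u vs - D (Suc j) ?u (w # vs)\<bar> \<le> r / (P + 1) * p w * prod_list (map p vs)"
    using D_diff[OF assms(1) u, of "r / (P + 1)"] \<open>r > 0\<close> P by (auto simp: add_nonneg_pos)
  show "\<exists>s>0. \<forall>h. h \<noteq> 0 \<and> norm (h - 0) < s \<longrightarrow>
     norm ((D j (\<lambda>x. u x + (t + h) *\<^sub>R v x) vs - D j ?u vs) / h - D (Suc j) ?u (v # vs)) < r"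
  proof (intro exI conjI allI impI)
    show "\<delta> / (p v + 1) > 0" using \<delta>(1) p_nonneg[of v] by (simp add: add_nonneg_pos)
    fix h :: real assume h: "h \<noteq> 0 \<and> norm (h - 0) < \<delta> / (p v + 1)"
    let ?w = "\<lambda>x. h *\<^sub>R v x"
    have w: "?w \<in> W" using assms by (intro W_scale)
    have "\<bar>h\<bar> * p v \<le> \<bar>h\<bar> * (p v + 1)" by (intro mult_left_mono) auto
    also have "\<dots> < \<delta>" using h p_nonneg[of v] by (simp add: pos_less_divide_eq add_nonneg_pos)
    finally have "p ?w < \<delta>" using assms by (simp add: p_scale)
    then have "\<bar>D j (\<lambda>x. ?u x + ?w x) vs - D j ?u vs - D (Suc j) ?u (?w # vs)\<bar> \<le> r / (P + 1) * p ?w * prod_list (map p vs)"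
      using \<delta>(2)[OF w] assms by blast
    also have "D (Suc j) ?u (?w # vs) = h * D (Suc j) ?u (v # vs)"
      using assms u by (intro D_hd_scale) auto
    also have "(\<lambda>x. ?u x + ?w x) = (\<lambda>x. u x + (t + h) *\<^sub>R v x)" by (simp add: algebra_simps)
    also have "r / (P + 1) * p ?w * prod_list (map p vs) = \<bar>h\<bar> * (r * (P / (P + 1)))"
      using assms by (simp add: p_scale P_def)
    finally have "\<bar>D j (\<lambda>x. u x + (t + h) *\<^sub>R v x) vs - D j ?u vs - h * D (Suc j) ?u (v # vs)\<bar> \<le> \<bar>h\<bar> * (r * (P / (P + 1)))" .
    also have "\<dots> < \<bar>h\<bar> * r"
      using h \<open>r > 0\<close> P by (simp add: pos_divide_less_eq add_nonneg_pos)
    finally have "\<bar>(D j (\<lambda>x. u x + (t + h) *\<^sub>R v x) vs - D j ?u vs - h * D (Suc j) ?u (v # vs)) / h\<bar> < r"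
      using h by (simp add: abs_divide pos_divide_less_eq mult.commute)
    moreover have "(D j (\<lambda>x. u x + (t + h) *\<^sub>R v x) vs - D j ?u vs - h * D (Suc j) ?u (v # vs)) / h
      = (D j (\<lambda>x. u x + (t + h) *\<^sub>R v x) vs - D j ?u vs) / h - D (Suc j) ?u (v # vs)"
      using h by (simp add: diff_divide_distrib)
    ultimately show "norm ((D j (\<lambda>x. u x + (t + h) *\<^sub>R v x) vs - D j ?u vs) / h - D (Suc j) ?u (v # vs)) < r"
      by simp
  qed
qed

lemma F_line_derivative:
  assumes "0 < k" "u \<in> W" "v \<in> W"
  shows "((\<lambda>t. F (\<lambda>x. u x + t *\<^sub>R v x)) has_real_derivative D 1 (\<lambda>x. u x + t *\<^sub>R v x) [v]) (at t)"
  using D_line_derivative[OF assms, of "[]" t] D_zero[OF W_add_scale[OF assms(2,3)]] by simp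

lemma first_variation_eq:
  assumes "0 < k" "u \<in> W" "v \<in> W"
  shows "first_variation F u v = D 1 u [v]"
  unfolding first_variation_def using F_line_derivative[OF assms, of 0] by (simp add: DERIV_imp_deriv)

lemma second_variation_eq:
  assumes "1 < k" "u \<in> W" "v \<in> W"
  shows "second_variation F u v = D 2 u [v, v]"
proof -
  have "deriv (\<lambda>t. F (\<lambda>x. u x + t *\<^sub>R v x)) = (\<lambda>t. D 1 (\<lambda>x. u x + t *\<^sub>R v x) [v])"
    using F_line_derivative[of u v] assms by (intro ext DERIV_imp_deriv) auto
  moreover have "((\<lambda>t. D 1 (\<lambda>x. u x + t *\<^sub>R v x) [v]) has_real_derivative D 2 u [v, v]) (at 0)"
    using D_line_derivative[of 1 u v "[v]" 0] assms by (simp add: numeral_2_eq_2)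
  ultimately show ?thesis
    unfolding second_variation_def by (simp add: numeral_2_eq_2 DERIV_imp_deriv)
qed

end

section \<open>Symmetry of the second derivative and the Taylor remainder\<close>

locale Ck_functional_triangle = Ck_functional +
  assumes p_triangle: "\<And>v w. v \<in> W \<Longrightarrow> w \<in> W \<Longrightarrow> p (\<lambda>x. v x + w x) \<le> p v + p w"
begin

text \<open>The mean value theorem along \<open>v\<close> turns the mixed second difference into a
  difference of first derivatives at two points near \<open>u\<close>. Each is expanded to first
  order at \<open>u\<close>, and the terms in \<open>D 2 u [v, v]\<close> cancel.\<close>

lemma second_difference:
  assumes "1 < k" "u \<in> W" "v \<in> W" "w \<in> W" "\<epsilon> > 0"
  shows "\<exists>s0>0. \<forall>s. 0 < s \<longrightarrow> s < s0 \<longrightarrow>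
    \<bar>F (\<lambda>x. u x + (s *\<^sub>R v x + s *\<^sub>R w x)) - F (\<lambda>x. u x + s *\<^sub>R w x) - F (\<lambda>x. u x + s *\<^sub>R v x) + F u
      - s\<^sup>2 * D 2 u [w, v]\<bar> \<le> \<epsilon> * s\<^sup>2"
proof -
  define Q where "Q = (p w + 2 * p v) * p v"
  have Q: "Q \<ge> 0" by (simp add: Q_def p_nonneg)
  obtain \<delta> where \<delta>: "\<delta> > 0" "\<And>z vs. z \<in> W \<Longrightarrow> p z < \<delta> \<Longrightarrow> vs \<in> lists W \<Longrightarrow> length vs = 1 \<Longrightarrow>
    \<bar>D 1 (\<lambda>x. u x + z x) vs - D 1 u vs - D (Suc 1) u (z # vs)\<bar> \<le> \<epsilon> / (Q + 1) * p z * prod_list (map p vs)"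
    using D_diff[OF assms(1,2), of "\<epsilon> / (Q + 1)"] assms(5) Q by (auto simp: add_nonneg_pos)
  define s0 where "s0 = \<delta> / (p w + p v + 1)"
  have pos: "p w + p v + 1 > 0" using p_nonneg[of w] p_nonneg[of v] by linarith
  show ?thesis
  proof (intro exI conjI allI impI)
    show "s0 > 0" using \<delta>(1) pos by (simp add: s0_def)
    fix s :: real assume s: "0 < s" "s < s0"
    let ?a = "\<lambda>t x. (u x + s *\<^sub>R w x) + t *\<^sub>R v x" and ?b = "\<lambda>t x. u x + t *\<^sub>R v x"
    have uw: "(\<lambda>x. u x + s *\<^sub>R w x) \<in> W" using assms by (intro W_add_scale)
    have "\<exists>\<xi>. 0 < \<xi> \<and> \<xi> < s \<and> (F (?a s) - F (?b s)) - (F (?a 0) - F (?b 0)) = (s - 0) * (D 1 (?a \<xi>) [v] - D 1 (?b \<xi>) [v])"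
    proof (rule MVT2[of 0 s "\<lambda>t. F (?a t) - F (?b t)" "\<lambda>t. D 1 (?a t) [v] - D 1 (?b t) [v]"])
      fix t
      show "((\<lambda>t. F (?a t) - F (?b t)) has_real_derivative D 1 (?a t) [v] - D 1 (?b t) [v]) (at t)"
        using F_line_derivative[of "\<lambda>x. u x + s *\<^sub>R w x" v t] F_line_derivative[of u v t] assms uw
        by (intro DERIV_diff) auto
    qed (use s in auto)
    then obtain \<xi> where \<xi>: "0 < \<xi>" "\<xi> < s"
      "(F (?a s) - F (?b s)) - (F (?a 0) - F (?b 0)) = s * (D 1 (?a \<xi>) [v] - D 1 (?b \<xi>) [v])" by auto
    let ?z1 = "\<lambda>x. s *\<^sub>R w x + \<xi> *\<^sub>R v x" and ?z2 = "\<lambda>x. \<xi> *\<^sub>R v x"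
    have z: "?z1 \<in> W" "?z2 \<in> W" using assms by (auto intro: W_lin W_scale)
    have pz: "p ?z1 \<le> s * (p w + p v)" "p ?z2 \<le> s * p v"
    proof -
      have "p ?z1 \<le> p (\<lambda>x. s *\<^sub>R w x) + p (\<lambda>x. \<xi> *\<^sub>R v x)" using assms by (intro p_triangle W_scale)
      also have "\<dots> = s * p w + \<xi> * p v" using assms s \<xi> by (simp add: p_scale)
      also have "\<dots> \<le> s * p w + s * p v" using \<xi> p_nonneg by (intro add_left_mono mult_right_mono) auto
      finally show "p ?z1 \<le> s * (p w + p v)" by (simp add: algebra_simps)
      show "p ?z2 \<le> s * p v" using \<xi> p_nonneg assms by (simp add: p_scale mult_right_mono)
    qed
    have sd: "s * (p w + p v + 1) < \<delta>" using s pos by (simp add: s0_def pos_less_divide_eq)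
    have p1: "p ?z1 < \<delta>" using pz(1) sd s by (simp add: algebra_simps)
    have "s * p v \<le> s * (p w + p v + 1)" using s p_nonneg[of w] by (intro mult_left_mono) auto
    then have p2: "p ?z2 < \<delta>" using pz(2) sd by linarith
    have e1: "\<bar>D 1 (\<lambda>x. u x + ?z1 x) [v] - D 1 u [v] - D 2 u [?z1, v]\<bar> \<le> \<epsilon> / (Q + 1) * (s * (p w + p v)) * p v"
    proof -
      have "\<bar>D 1 (\<lambda>x. u x + ?z1 x) [v] - D 1 u [v] - D 2 u [?z1, v]\<bar> \<le> \<epsilon> / (Q + 1) * p ?z1 * p v"
        using \<delta>(2)[OF z(1) p1, of "[v]"] assms by (simp add: numeral_2_eq_2)
      also have "\<dots> \<le> \<epsilon> / (Q + 1) * (s * (p w + p v)) * p v"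
        using pz(1) assms(5) Q p_nonneg by (intro mult_right_mono mult_left_mono) auto
      finally show ?thesis .
    qed
    have e2: "\<bar>D 1 (\<lambda>x. u x + ?z2 x) [v] - D 1 u [v] - D 2 u [?z2, v]\<bar> \<le> \<epsilon> / (Q + 1) * (s * p v) * p v"
    proof -
      have "\<bar>D 1 (\<lambda>x. u x + ?z2 x) [v] - D 1 u [v] - D 2 u [?z2, v]\<bar> \<le> \<epsilon> / (Q + 1) * p ?z2 * p v"
        using \<delta>(2)[OF z(2) p2, of "[v]"] assms by (simp add: numeral_2_eq_2)
      also have "\<dots> \<le> \<epsilon> / (Q + 1) * (s * p v) * p v"
        using pz(2) assms(5) Q p_nonneg by (intro mult_right_mono mult_left_mono) auto
      finally show ?thesis .
    qed
    have lin: "D 2 u [?z1, v] = s * D 2 u [w, v] + \<xi> * D 2 u [v, v]" "D 2 u [?z2, v] = \<xi> * D 2 u [v, v]"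
      using D_hd_linear[of 1 u "[v]" w v s \<xi>] D_hd_scale[of 1 u "[v]" v \<xi>] assms by (simp_all add: numeral_2_eq_2)
    have ab: "(\<lambda>x. u x + ?z1 x) = ?a \<xi>" by (simp add: algebra_simps)
    have "\<bar>(D 1 (?a \<xi>) [v] - D 1 (?b \<xi>) [v]) - s * D 2 u [w, v]\<bar>
        \<le> \<epsilon> / (Q + 1) * (s * (p w + p v)) * p v + \<epsilon> / (Q + 1) * (s * p v) * p v"
      using e1 e2 unfolding lin ab by linarith
    also have "\<dots> = s * (\<epsilon> * (Q / (Q + 1)))" by (simp add: Q_def algebra_simps add_divide_distrib)
    also have "\<dots> \<le> s * \<epsilon>"
      using s assms(5) Q by (intro mult_left_mono mult_left_le) (auto simp: divide_le_eq_1)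
    finally have b: "\<bar>(D 1 (?a \<xi>) [v] - D 1 (?b \<xi>) [v]) - s * D 2 u [w, v]\<bar> \<le> s * \<epsilon>" .
    have "F (\<lambda>x. u x + (s *\<^sub>R v x + s *\<^sub>R w x)) - F (\<lambda>x. u x + s *\<^sub>R w x) - F (\<lambda>x. u x + s *\<^sub>R v x) + F u
       = (F (?a s) - F (?b s)) - (F (?a 0) - F (?b 0))" by (simp add: algebra_simps)
    also have "\<dots> = s * (D 1 (?a \<xi>) [v] - D 1 (?b \<xi>) [v])" by (rule \<xi>(3))
    finally have "F (\<lambda>x. u x + (s *\<^sub>R v x + s *\<^sub>R w x)) - F (\<lambda>x. u x + s *\<^sub>R w x) - F (\<lambda>x. u x + s *\<^sub>R v x) + F u
      - s\<^sup>2 * D 2 u [w, v] = s * ((D 1 (?a \<xi>) [v] - D 1 (?b \<xi>) [v]) - s * D 2 u [w, v])"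
      by (simp add: algebra_simps power2_eq_square)
    then show "\<bar>F (\<lambda>x. u x + (s *\<^sub>R v x + s *\<^sub>R w x)) - F (\<lambda>x. u x + s *\<^sub>R w x) - F (\<lambda>x. u x + s *\<^sub>R v x) + F u
      - s\<^sup>2 * D 2 u [w, v]\<bar> \<le> \<epsilon> * s\<^sup>2"
      using mult_left_mono[OF b, of s] s by (simp add: abs_mult power2_eq_square mult_ac)
  qed
qed

text \<open>\<open>Ck_on\<close> does not postulate symmetric derivatives, but
  \<open>lattice_form\<close> asks for a symmetric form. The second difference is symmetric in
  \<open>v\<close> and \<open>w\<close> and approximates both sides.\<close>

lemma D2_sym:
  assumes "1 < k" "u \<in> W" "v \<in> W" "w \<in> W"
  shows "D 2 u [v, w] = D 2 u [w, v]"
proof -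
  have "\<bar>D 2 u [v, w] - D 2 u [w, v]\<bar> \<le> 0 + \<epsilon>" if \<epsilon>: "\<epsilon> > 0" for \<epsilon> :: real
  proof -
    obtain s1 where s1: "s1 > 0" "\<And>s. 0 < s \<Longrightarrow> s < s1 \<Longrightarrow>
      \<bar>F (\<lambda>x. u x + (s *\<^sub>R v x + s *\<^sub>R w x)) - F (\<lambda>x. u x + s *\<^sub>R w x) - F (\<lambda>x. u x + s *\<^sub>R v x) + F u
      - s\<^sup>2 * D 2 u [w, v]\<bar> \<le> \<epsilon> / 2 * s\<^sup>2"
      using second_difference[OF assms, of "\<epsilon> / 2"] \<epsilon> by auto
    obtain s2 where s2: "s2 > 0" "\<And>s. 0 < s \<Longrightarrow> s < s2 \<Longrightarrow>
      \<bar>F (\<lambda>x. u x + (s *\<^sub>R w x + s *\<^sub>R v x)) - F (\<lambda>x. u x + s *\<^sub>R v x) - F (\<lambda>x. u x + s *\<^sub>R w x) + F u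
      - s\<^sup>2 * D 2 u [v, w]\<bar> \<le> \<epsilon> / 2 * s\<^sup>2"
      using second_difference[OF assms(1,2,4,3), of "\<epsilon> / 2"] \<epsilon> by auto
    define s where "s = min s1 s2 / 2"
    have s: "0 < s" "s < s1" "s < s2" using s1(1) s2(1) by (auto simp: s_def)
    have "\<bar>s\<^sup>2 * D 2 u [v, w] - s\<^sup>2 * D 2 u [w, v]\<bar> \<le> \<epsilon> / 2 * s\<^sup>2 + \<epsilon> / 2 * s\<^sup>2"
    proof -
      have eq: "(\<lambda>x. u x + (s *\<^sub>R w x + s *\<^sub>R v x)) = (\<lambda>x. u x + (s *\<^sub>R v x + s *\<^sub>R w x))"
        by (simp add: add.commute)
      show ?thesis using s1(2)[OF s(1,2)] s2(2)[OF s(1,3)] unfolding eq by linarith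
    qed
    then have "s\<^sup>2 * \<bar>D 2 u [v, w] - D 2 u [w, v]\<bar> \<le> s\<^sup>2 * \<epsilon>"
      by (simp add: right_diff_distrib[symmetric] abs_mult mult.commute)
    then show ?thesis using s(1) by simp
  qed
  then have "\<bar>D 2 u [v, w] - D 2 u [w, v]\<bar> \<le> 0" by (rule field_le_epsilon)
  then show ?thesis by simp
qed

text \<open>What the expansion of the first variation at zero strain leaves beyond its linear part;
  it becomes the nonlinearity \<open>N\<close> of the lattice equation.\<close>

definition "remainder g w = D 1 g [w] - D 1 (\<lambda>x. 0) [w] - D 2 (\<lambda>x. 0) [g, w]"

lemma remainder_zero: "1 < k \<Longrightarrow> w \<in> W \<Longrightarrow> remainder (\<lambda>x. 0) w = 0"
  using D_hd_scale[of 1 "\<lambda>x. 0" "[w]" "\<lambda>x. 0" 0] W_zero by (simp add: remainder_def numeral_2_eq_2)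

lemma D1_diff:
  assumes "0 < k" "g \<in> W" "v \<in> W" "w \<in> W"
  shows "D 1 g [\<lambda>x. v x - w x] = D 1 g [v] - D 1 g [w]"
  using D_linear[of 1 g "[v]" 0 v w 1 "-1"] assms by simp

lemma D2_diff_right:
  assumes "1 < k" "g \<in> W" "f \<in> W" "v \<in> W" "w \<in> W"
  shows "D 2 g [f, \<lambda>x. v x - w x] = D 2 g [f, v] - D 2 g [f, w]"
  using D_linear[of 2 g "[f, v]" 1 v w 1 "-1"] assms by simp

lemma remainder_diff:
  assumes "1 < k" "g \<in> W" "v \<in> W" "w \<in> W"
  shows "remainder g (\<lambda>x. v x - w x) = remainder g v - remainder g w"
  using assms W_zero by (simp add: remainder_def D1_diff D2_diff_right del: One_nat_def)

text \<open>The mean value theorem on the segment from \<open>g'\<close> to \<open>g\<close> leaves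
  the second derivative on the segment minus the one at 0, and \<open>D_lipschitz\<close> applies at
  0. The threshold \<open>\<delta> / 3\<close> keeps the segment within \<delta> of 0.\<close>

lemma remainder_lipschitz:
  assumes "2 < k"
  shows "\<exists>\<delta>>0. \<exists>K\<ge>0. \<forall>g\<in>W. \<forall>g'\<in>W. \<forall>w\<in>W. p g \<le> \<delta> \<longrightarrow> p g' \<le> \<delta> \<longrightarrow>
    \<bar>remainder g w - remainder g' w\<bar> \<le> K * (p g + p g') * p (\<lambda>x. g x - g' x) * p w"
proof -
  obtain \<delta> M where \<delta>: "\<delta> > 0" "M \<ge> 0" "\<And>z vs. z \<in> W \<Longrightarrow> p z < \<delta> \<Longrightarrow> vs \<in> lists W \<Longrightarrow> length vs = 2 \<Longrightarrow>
    \<bar>D 2 (\<lambda>x. 0 + z x) vs - D 2 (\<lambda>x. 0) vs\<bar> \<le> M * p z * prod_list (map p vs)"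
    using D_lipschitz[OF assms W_zero] by metis
  have "\<bar>remainder g w - remainder g' w\<bar> \<le> M * (p g + p g') * p (\<lambda>x. g x - g' x) * p w"
    if W: "g \<in> W" "g' \<in> W" "w \<in> W" and small: "p g \<le> \<delta> / 3" "p g' \<le> \<delta> / 3" for g g' w
  proof -
    let ?f = "\<lambda>x. g x - g' x" and ?g = "\<lambda>t x. g' x + t *\<^sub>R (g x - g' x)"
    have f: "?f \<in> W" using W by (intro W_diff)
    have der: "((\<lambda>t. remainder (?g t) w) has_real_derivative D 2 (?g t) [?f, w] - D 2 (\<lambda>x. 0) [?f, w]) (at t)" for t
    proof -
      have "D 2 (\<lambda>x. 0) [?g t, w] = D 2 (\<lambda>x. 0) [g', w] + t * D 2 (\<lambda>x. 0) [?f, w]" for t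
        using D_hd_linear[of 1 "\<lambda>x. 0" "[w]" g' ?f 1 t] assms W W_zero f by (simp add: numeral_2_eq_2)
      moreover have "((\<lambda>t. D 1 (?g t) [w]) has_real_derivative D 2 (?g t) [?f, w]) (at t)"
        using D_line_derivative[of 1 g' ?f "[w]" t] assms W f by (simp add: numeral_2_eq_2)
      ultimately show ?thesis
        unfolding remainder_def by (auto intro!: derivative_eq_intros)
    qed
    obtain t where t: "0 < t" "t < 1"
      "remainder (?g 1) w - remainder (?g 0) w = (1 - 0) * (D 2 (?g t) [?f, w] - D 2 (\<lambda>x. 0) [?f, w])"
      using MVT2[of 0 1 "\<lambda>t. remainder (?g t) w" "\<lambda>t. D 2 (?g t) [?f, w] - D 2 (\<lambda>x. 0) [?f, w]"] der by auto
    have gt: "?g t \<in> W" using W f by (intro W_add_scale)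
    have "?g t = (\<lambda>x. (1 - t) *\<^sub>R g' x + t *\<^sub>R g x)" by (simp add: algebra_simps)
    then have "p (?g t) \<le> p (\<lambda>x. (1 - t) *\<^sub>R g' x) + p (\<lambda>x. t *\<^sub>R g x)"
      using p_triangle[of "\<lambda>x. (1 - t) *\<^sub>R g' x" "\<lambda>x. t *\<^sub>R g x"] W W_scale by simp
    also have "\<dots> = (1 - t) * p g' + t * p g" using W t by (simp add: p_scale)
    also have "\<dots> \<le> 1 * p g' + 1 * p g" using t p_nonneg by (intro add_mono mult_right_mono) auto
    finally have pg: "p (?g t) \<le> p g + p g'" by simp
    then have "p (?g t) < \<delta>" using small \<delta>(1) by linarith
    then have "\<bar>D 2 (?g t) [?f, w] - D 2 (\<lambda>x. 0) [?f, w]\<bar> \<le> M * p (?g t) * (p ?f * p w)"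
      using \<delta>(3)[OF gt, of "[?f, w]"] f W by simp
    also have "\<dots> \<le> M * (p g + p g') * (p ?f * p w)"
      using pg \<delta>(2) p_nonneg by (intro mult_right_mono mult_left_mono) auto
    finally show ?thesis using t(3) by (simp add: mult_ac)
  qed
  then show ?thesis using \<delta>(1,2) by (intro exI[of _ "\<delta> / 3"] conjI exI[of _ M]) auto
qed

end

lemma stencil_norm_Ck:
  assumes "Ck_derivs k UNIV (stencil_norm S) F D"
  shows "Ck_functional_triangle k UNIV (stencil_norm S) F D"
proof
  show "Ck_derivs k UNIV (stencil_norm S) F D" by fact
  fix v w :: "real^'a \<Rightarrow> real^'a" and a :: real
  show "stencil_norm S v \<ge> 0" by (simp add: stencil_norm_def)
  show "stencil_norm S (\<lambda>x. a *\<^sub>R v x) = \<bar>a\<bar> * stencil_norm S v"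
    by (simp add: stencil_norm_def L2_set_right_distrib)
  have "stencil_norm S (\<lambda>x. v x + w x) \<le> L2_set (\<lambda>x. norm (v x) + norm (w x)) S"
    unfolding stencil_norm_def by (intro L2_set_mono norm_triangle_ineq) auto
  also have "\<dots> \<le> stencil_norm S v + stencil_norm S w"
    unfolding stencil_norm_def by (rule L2_set_triangle_ineq)
  finally show "stencil_norm S (\<lambda>x. v x + w x) \<le> stencil_norm S v + stencil_norm S w" .
qed auto

subsection \<open>The reference lattice and its triangulation\<close>

definition iota :: "real^'n^'n \<Rightarrow> int^'n \<Rightarrow> real^'n" where
  "iota A z = A *v (\<chi> i. real_of_int (z $ i))"

lemma iota_add: "iota A (x + y) = iota A x + iota A y"
proof -
  have "(\<chi> i. real_of_int ((x + y) $ i)) = (\<chi> i. real_of_int (x $ i)) + (\<chi> i. real_of_int (y $ i))"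
    by (simp add: vec_eq_iff)
  then show ?thesis by (simp add: iota_def matrix_vector_right_distrib)
qed

lemma iota_zero [simp]: "iota A 0 = 0"
  using iota_add[of A 0 0] by simp

lemma iota_minus: "iota A (- x) = - iota A x"
  using iota_add[of A x "- x"] by (simp add: eq_neg_iff_add_eq_0 add.commute)

lemma iota_diff: "iota A (x - y) = iota A x - iota A y"
  using iota_add[of A x "- y"] by (simp add: iota_minus)

lemma bravais_lattice_eq: "bravais_lattice A = range (iota A)"
proof
  show "bravais_lattice A \<subseteq> range (iota A)"
  proof
    fix x assume "x \<in> bravais_lattice A"
    then obtain z where z: "x = A *v z" "\<forall>i. z $ i \<in> \<int>" by (auto simp: bravais_lattice_def)
    then have zz: "z = (\<chi> i. real_of_int ((\<chi> i. \<lfloor>z $ i\<rfloor>) $ i))" by (simp add: vec_eq_iff)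
    have "x = iota A (\<chi> i. \<lfloor>z $ i\<rfloor>)" unfolding iota_def zz[symmetric] by (rule z(1))
    then show "x \<in> range (iota A)" by blast
  qed
qed (auto simp: bravais_lattice_def iota_def)

lemma abs_le_supn: "\<bar>z $ i\<bar> \<le> supn z"
  using supn_le_iff[of z "supn z"] by (simp add: cube_def)

abbreviation "verts T \<equiv> {x. x extreme_point_of T}"

context point_defect
begin

lemma iota_lower: "\<exists>a>0. \<forall>z. a * real_of_int (supn z) \<le> norm (iota A z)"
proof -
  obtain B where B: "B ** A = mat 1" using nonsingular by (auto simp: invertible_def)
  obtain K where K: "K > 0" "\<And>x. norm (B *v x) \<le> norm x * K"
    using bounded_linear.pos_bounded[OF matrix_vector_mul_bounded_linear[of B]] by blast
  have "real_of_int (supn z) / K \<le> norm (iota A z)" for z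
  proof -
    let ?x = "\<chi> i. real_of_int (z $ i)"
    have "supn z \<in> range (\<lambda>i. \<bar>z $ i\<bar>)" unfolding supn_def by (intro Max_in) auto
    then obtain i where i: "supn z = \<bar>z $ i\<bar>" by auto
    have "real_of_int (supn z) = \<bar>?x $ i\<bar>" by (simp add: i)
    also have "\<dots> \<le> norm ?x" by (rule component_le_norm_cart)
    also have "?x = B *v (A *v ?x)" by (simp add: matrix_vector_mul_assoc B)
    also have "norm \<dots> \<le> norm (A *v ?x) * K" by (rule K(2))
    finally show ?thesis using K(1) by (simp add: iota_def pos_divide_le_eq)
  qed
  then show ?thesis using K(1) by (intro exI[of _ "1 / K"]) auto
qed

text \<open>Fixed by choice from an existence statement, like \<open>ahi\<close>, \<open>rin\<close>
  and \<open>dmax\<close> after it, so that further constants can be defined from it.\<close>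

definition "alo = (SOME a. a > 0 \<and> (\<forall>z. a * real_of_int (supn z) \<le> norm (iota A z)))"

lemma alo: "alo > 0" "alo * real_of_int (supn z) \<le> norm (iota A z)"
  using someI_ex[OF iota_lower] unfolding alo_def by auto

lemma iota_inj: "inj (iota A)"
proof
  fix x y assume "iota A x = iota A y"
  then have "alo * real_of_int (supn (x - y)) \<le> 0" using alo(2)[of "x - y"] by (simp add: iota_diff)
  then have "supn (x - y) \<le> 0" using alo(1) by (simp add: mult_le_0_iff)
  then have "x - y \<in> cube 0" by (simp add: supn_le_iff)
  then show "x = y" by (simp add: cube_def vec_eq_iff)
qed

lemma iota_upper: "\<exists>b>0. \<forall>x. norm (A *v x) \<le> b * norm x"
  using bounded_linear.pos_bounded[OF matrix_vector_mul_bounded_linear[of A]] by (auto simp: mult.commute)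

definition "ahi = (SOME b. b > 0 \<and> (\<forall>x. norm (A *v x) \<le> b * norm x))"

lemma ahi: "ahi > 0" "norm (A *v x) \<le> ahi * norm x"
  using someI_ex[OF iota_upper] unfolding ahi_def by auto

lemma norm_iota_le: "norm (iota A z) \<le> ahi * (real CARD('n) * real_of_int (supn z))"
proof -
  have "norm (\<chi> i. real_of_int (z $ i)) \<le> (\<Sum>i\<in>(UNIV::'n set). \<bar>(\<chi> i. real_of_int (z $ i)) $ i\<bar>)"
    by (rule norm_le_l1_cart)
  also have "\<dots> \<le> (\<Sum>i\<in>(UNIV::'n set). real_of_int (supn z))"
    using abs_le_supn[of z] by (intro sum_mono) (simp flip: of_int_abs)
  finally have "norm (\<chi> i. real_of_int (z $ i)) \<le> real CARD('n) * real_of_int (supn z)" by simp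
  then have "ahi * norm (\<chi> i. real_of_int (z $ i)) \<le> ahi * (real CARD('n) * real_of_int (supn z))"
    using ahi(1) by (intro mult_left_mono) auto
  then show ?thesis unfolding iota_def using ahi(2) order_trans by blast
qed

lemma finite_iota_ball: "finite {z. norm (iota A z) \<le> r}"
proof -
  have "{z. norm (iota A z) \<le> r} \<subseteq> cube \<lfloor>r / alo\<rfloor>"
  proof
    fix z assume "z \<in> {z. norm (iota A z) \<le> r}"
    then have "alo * real_of_int (supn z) \<le> r" using alo(2)[of z] by simp
    then have "real_of_int (supn z) \<le> r / alo" using alo(1) by (simp add: field_simps)
    then show "z \<in> cube \<lfloor>r / alo\<rfloor>" by (simp add: supn_le_iff[symmetric] le_floor_iff)
  qed
  then show ?thesis using finite_subset finite_cube by blast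
qed

definition "Nlat r = card {z. norm (iota A z) \<le> 2 * r}"

text \<open>Translation by one lattice point of the ball moves all others into the ball of twice the
  radius at the origin; so the count is independent of the centre.\<close>

lemma iota_ball: "finite {z. dist (iota A z) p \<le> r}" "card {z. dist (iota A z) p \<le> r} \<le> Nlat r"
proof -
  have "finite {z. dist (iota A z) p \<le> r} \<and> card {z. dist (iota A z) p \<le> r} \<le> Nlat r"
  proof (cases "{z. dist (iota A z) p \<le> r} = {}")
    case False
    then obtain w where w: "dist (iota A w) p \<le> r" by blast
    have sub: "(\<lambda>z. z - w) ` {z. dist (iota A z) p \<le> r} \<subseteq> {z. norm (iota A z) \<le> 2 * r}"
      using w dist_triangle3[of "iota A _" "iota A w" p]
      by (auto simp: iota_diff dist_norm[symmetric] dist_commute) (smt (verit) dist_commute dist_triangle)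
    have inj: "inj_on (\<lambda>z. z - w) {z. dist (iota A z) p \<le> r}" by (simp add: inj_on_def)
    show ?thesis
      using finite_iota_ball[of "2 * r"] sub inj card_inj_on_le[OF inj sub] inj_on_finite[OF inj sub]
      by (simp add: Nlat_def)
  qed simp
  then show "finite {z. dist (iota A z) p \<le> r}" "card {z. dist (iota A z) p \<le> r} \<le> Nlat r" by auto
qed

lemma \<Lambda>_lattice: "l \<in> \<Lambda> \<Longrightarrow> norm l \<ge> Rdef \<Longrightarrow> l \<in> range (iota A)"
  and lattice_\<Lambda>: "norm (iota A z) \<ge> Rdef \<Longrightarrow> iota A z \<in> \<Lambda>"
  using lattice_outside unfolding bravais_lattice_eq by (auto simp: set_eq_iff)

definition "N\<Lambda> r = card (\<Lambda> \<inter> ball 0 Rdef) + Nlat r"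

lemma \<Lambda>_ball: "finite (\<Lambda> \<inter> cball p r)" "card (\<Lambda> \<inter> cball p r) \<le> N\<Lambda> r"
proof -
  let ?S = "(\<Lambda> \<inter> ball 0 Rdef) \<union> iota A ` {z. dist (iota A z) p \<le> r}"
  have sub: "\<Lambda> \<inter> cball p r \<subseteq> ?S"
    using \<Lambda>_lattice by (force simp: dist_commute)
  have fin: "finite ?S" using finite_core iota_ball(1) by blast
  show "finite (\<Lambda> \<inter> cball p r)" using sub fin by (rule finite_subset)
  have "card (\<Lambda> \<inter> cball p r) \<le> card ?S" by (rule card_mono[OF fin sub])
  also have "\<dots> \<le> card (\<Lambda> \<inter> ball 0 Rdef) + card (iota A ` {z. dist (iota A z) p \<le> r})" by (rule card_Un_le)
  also have "\<dots> \<le> N\<Lambda> r"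
    using card_image_le[OF iota_ball(1), of "iota A" p r] iota_ball(2)[of p r] by (simp add: N\<Lambda>_def)
  finally show "card (\<Lambda> \<inter> cball p r) \<le> N\<Lambda> r" .
qed

text \<open>A lattice point near \<open>p\<close> may lie in the core, where it need not be a site.
  Therefore \<open>p\<close> is first moved radially outward by \<open>s\<close>, which carries the
  nearby lattice point out of the core.\<close>

lemma covering: "\<exists>\<rho>>0. \<forall>p. \<exists>l\<in>\<Lambda>. dist p l < \<rho>"
proof -
  obtain B where B: "A ** B = mat 1" using nonsingular by (auto simp: invertible_def)
  have near: "\<exists>z. dist p (iota A z) \<le> ahi * real CARD('n)" for p
  proof -
    define q where "q = B *v p"
    have p: "p = A *v q" by (simp add: q_def matrix_vector_mul_assoc B)
    define z where "z = (\<chi> i. \<lfloor>q $ i\<rfloor>)"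
    have "norm (q - (\<chi> i. real_of_int (z $ i))) \<le> (\<Sum>i\<in>(UNIV::'n set). \<bar>(q - (\<chi> i. real_of_int (z $ i))) $ i\<bar>)"
      by (rule norm_le_l1_cart)
    also have "\<dots> \<le> (\<Sum>i\<in>(UNIV::'n set). 1)"
      by (intro sum_mono) (simp add: z_def, linarith)
    finally have n: "norm (q - (\<chi> i. real_of_int (z $ i))) \<le> real CARD('n)" by simp
    have "dist p (iota A z) = norm (A *v (q - (\<chi> i. real_of_int (z $ i))))"
      unfolding p iota_def dist_norm by (simp add: matrix_vector_mult_diff_distrib)
    also have "\<dots> \<le> ahi * real CARD('n)"
      using ahi n by (meson order_trans mult_left_mono less_imp_le)
    finally show ?thesis by blast
  qed
  define c where "c = ahi * real CARD('n)"
  define s where "s = Rdef + c"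
  have c0: "c \<ge> 0" using ahi(1) by (simp add: c_def)
  have s: "s > 0" using c0 Rdef_pos by (simp add: s_def)
  note near = near[folded c_def]
  have "\<exists>l\<in>\<Lambda>. dist p l < 2 * s + 1" for p
  proof -
    fix i :: 'n
    define e where "e = (if p = 0 then axis i 1 else p /\<^sub>R norm p)"
    have e: "norm e = 1" "p + s *\<^sub>R e = (norm p + s) *\<^sub>R e"
      by (auto simp: e_def algebra_simps norm_axis_1)
    obtain z where z: "dist (p + s *\<^sub>R e) (iota A z) \<le> c" using near by blast
    have "norm (p + s *\<^sub>R e) = norm p + s"
      unfolding e(2) using e(1) s by simp
    moreover have "norm (p + s *\<^sub>R e) \<le> norm (iota A z) + dist (p + s *\<^sub>R e) (iota A z)"
      using norm_triangle_sub[of "p + s *\<^sub>R e" "iota A z"] by (simp add: dist_norm)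
    ultimately have "norm (iota A z) \<ge> Rdef" using z norm_ge_zero[of p] s_def by linarith
    then have "iota A z \<in> \<Lambda>" by (rule lattice_\<Lambda>)
    moreover have "dist p (iota A z) \<le> dist p (p + s *\<^sub>R e) + dist (p + s *\<^sub>R e) (iota A z)" by (rule dist_triangle)
    moreover have "dist p (p + s *\<^sub>R e) = s" using e(1) s by (simp add: dist_norm)
    ultimately have "dist p (iota A z) < 2 * s + 1" using z Rdef_pos s_def by linarith
    then show ?thesis using \<open>iota A z \<in> \<Lambda>\<close> by blast
  qed
  then show ?thesis using s by (intro exI[of _ "2 * s + 1"]) auto
qed

text \<open>Three cases: two lattice points, at distance at least \<open>alo\<close>; two sites in a
  ball slightly larger than the core, of which there are finitely many pairs; a core site and a site
  outside that larger ball, at distance at least 1.\<close>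

lemma separated: "\<exists>\<delta>>0. \<forall>l\<in>\<Lambda>. \<forall>m\<in>\<Lambda>. l \<noteq> m \<longrightarrow> \<delta> \<le> dist l m"
proof -
  let ?C = "\<Lambda> \<inter> cball 0 (Rdef + 1)"
  let ?D = "insert 1 ((\<lambda>(l, m). dist l m) ` {(l, m). l \<in> ?C \<and> m \<in> ?C \<and> l \<noteq> m})"
  have "{(l, m). l \<in> ?C \<and> m \<in> ?C \<and> l \<noteq> m} \<subseteq> ?C \<times> ?C" by auto
  then have fin: "finite ?D" using finite_subset[OF _ finite_cartesian_product[OF \<Lambda>_ball(1) \<Lambda>_ball(1)]] by blast
  define \<delta> where "\<delta> = min alo (Min ?D)"
  have "Min ?D \<in> ?D" using fin by (intro Min_in) auto
  then have pos: "\<delta> > 0" using alo(1) by (auto simp: \<delta>_def)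
  have "\<delta> \<le> dist l m" if lm: "l \<in> \<Lambda>" "m \<in> \<Lambda>" "l \<noteq> m" for l m
  proof (cases "norm l \<ge> Rdef \<and> norm m \<ge> Rdef")
    case True
    then obtain x y where xy: "l = iota A x" "m = iota A y" using \<Lambda>_lattice lm by blast
    have "x - y \<noteq> 0" using lm xy by auto
    then have "x - y \<notin> cube 0" by (auto simp: cube_def vec_eq_iff)
    then have "supn (x - y) \<ge> 1" using supn_le_iff[of "x - y" 0] by linarith
    then have "alo * 1 \<le> alo * real_of_int (supn (x - y))" using alo(1) by (intro mult_left_mono) auto
    also have "\<dots> \<le> dist l m" using alo(2)[of "x - y"] by (simp add: xy dist_norm iota_diff)
    finally show ?thesis by (simp add: \<delta>_def)
  next
    case False
    show ?thesis
    proof (cases "l \<in> ?C \<and> m \<in> ?C")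
      case True
      then have "dist l m \<in> ?D" using lm by (force intro: image_eqI[where x = "(l, m)"])
      then show ?thesis using fin by (simp add: \<delta>_def min_le_iff_disj)
    next
      case far: False
      then have "norm l > Rdef + 1 \<or> norm m > Rdef + 1" using lm by (auto simp: dist_norm)
      then have "dist l m \<ge> 1" using False norm_triangle_ineq2[of l m] norm_triangle_ineq2[of m l]
        by (auto simp: dist_norm norm_minus_commute)
      moreover have "\<delta> \<le> 1" using fin by (simp add: \<delta>_def min_le_iff_disj)
      ultimately show ?thesis by simp
    qed
  qed
  then show ?thesis using pos by blast
qed

section \<open>Geometry of the partition\<close>

lemma simplex_T: "T \<in> \<T> \<Longrightarrow> int CARD('n) simplex T"
  and conform: "T \<in> \<T> \<Longrightarrow> T' \<in> \<T> \<Longrightarrow> (T \<inter> T') face_of T"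
  and cover: "\<Union>\<T> = UNIV"
  using partition by (auto simp: regular_partition_def)

lemma T_props:
  assumes "T \<in> \<T>"
  shows "compact T" "convex T" "T = convex hull verts T" "finite (verts T)" "verts T \<subseteq> \<Lambda>" "verts T \<subseteq> T"
    "card (verts T) = CARD('n) + 1" "\<not> affine_dependent (verts T)"
proof -
  obtain C where C: "\<not> affine_dependent C" "int (card C) = int CARD('n) + 1" "T = convex hull C"
    using simplex_T[OF assms] by (auto simp: simplex_def)
  have v: "verts T = C" unfolding C(3) using extreme_point_of_convex_hull_affine_independent[OF C(1)] by blast
  have fC: "finite C" using C(1) by (rule aff_independent_finite)
  show "finite (verts T)" unfolding v by (rule fC)
  show "compact T" unfolding C(3) using fC by (rule finite_imp_compact_convex_hull)
  show "convex T" unfolding C(3) by (rule convex_convex_hull)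
  show "T = convex hull verts T" unfolding v by (rule C(3))
  show "verts T \<subseteq> \<Lambda>" using nodes_partition assms by (auto simp: nodes_def)
  show "verts T \<subseteq> T" by (auto simp: extreme_point_of_def)
  show "card (verts T) = CARD('n) + 1" unfolding v using C(2) by simp
  show "\<not> affine_dependent (verts T)" unfolding v by (rule C(1))
qed

lemma diameter_ge:
  assumes "T \<in> \<T>" "x \<in> T" "y \<in> T" shows "dist x y \<le> diameter T"
  using T_props(1)[OF assms(1)] assms by (intro diameter_bounded_bound compact_imp_bounded)

lemma inball: "\<exists>\<rho>>0. \<forall>T\<in>\<T>. \<exists>x. cball x \<rho> \<subseteq> T"
proof -
  obtain \<kappa> where \<kappa>: "\<kappa> > 0" "\<forall>T\<in>\<T>. \<exists>x. cball x (\<kappa> * diameter T) \<subseteq> T"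
    using partition by (auto simp: regular_partition_def)
  obtain \<delta> where \<delta>: "\<delta> > 0" "\<forall>l\<in>\<Lambda>. \<forall>m\<in>\<Lambda>. l \<noteq> m \<longrightarrow> \<delta> \<le> dist l m" using separated by blast
  have "\<exists>x. cball x (\<kappa> * \<delta>) \<subseteq> T" if T: "T \<in> \<T>" for T
  proof -
    have "card (verts T) \<ge> 2" using T_props(7)[OF T] by (simp add: Suc_le_eq)
    then have "\<not> card (verts T) \<le> Suc 0" by simp
    then obtain l m where lm: "l \<in> verts T" "m \<in> verts T" "l \<noteq> m"
      unfolding card_le_Suc0_iff_eq[OF T_props(4)[OF T]] by blast
    have "\<delta> \<le> dist l m" using lm T_props(5)[OF T] \<delta>(2) by blast
    also have "\<dots> \<le> diameter T" using lm T_props(6)[OF T] by (intro diameter_ge T) auto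
    finally have "\<kappa> * \<delta> \<le> \<kappa> * diameter T" using \<kappa>(1) by simp
    then show ?thesis using \<kappa>(2) T subset_cball[of "\<kappa> * \<delta>" "\<kappa> * diameter T"] by blast
  qed
  then show ?thesis using \<kappa>(1) \<delta>(1) by (intro exI[of _ "\<kappa> * \<delta>"]) auto
qed

definition "rin = (SOME \<rho>. \<rho> > 0 \<and> (\<forall>T\<in>\<T>. \<exists>x. cball x \<rho> \<subseteq> T))"

lemma rin: "rin > 0" "T \<in> \<T> \<Longrightarrow> \<exists>x. cball x rin \<subseteq> T"
  using someI_ex[OF inball] unfolding rin_def by auto

text \<open>A node is a vertex of some element \<open>T'\<close>. If it were interior to
  \<open>T\<close>, conformity would force \<open>T \<subseteq> T'\<close>, and a vertex of
  \<open>T'\<close> would be interior to \<open>T'\<close>.\<close>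

lemma node_not_interior:
  assumes "T \<in> \<T>" "l \<in> \<Lambda>" shows "l \<notin> interior T"
proof
  assume l: "l \<in> interior T"
  obtain T' where T': "T' \<in> \<T>" "l extreme_point_of T'"
    using assms(2) nodes_partition by (auto simp: nodes_def)
  have "l \<in> T'" using T'(2) by (auto simp: extreme_point_of_def)
  then have "(T \<inter> T') \<inter> interior T \<noteq> {}" using l interior_subset by blast
  then have "T \<inter> T' = T"
    using face_of_disjoint_interior[OF conform[OF assms(1) T'(1)]] by blast
  then have "l \<in> interior T'" using l interior_mono[of T T'] by auto
  then show False using extreme_point_not_in_interior[OF T'(2)] by simp
qed

lemma interiors_disjoint:
  assumes "T \<in> \<T>" "T' \<in> \<T>" "x \<in> interior T" "x \<in> interior T'" shows "T = T'"
proof -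
  have "x \<in> T \<inter> T'" using assms interior_subset by blast
  then have "T \<inter> T' = T" "T' \<inter> T = T'"
    using face_of_disjoint_interior[OF conform[OF assms(1,2)]] face_of_disjoint_interior[OF conform[OF assms(2,1)]] assms
    by blast+
  then show ?thesis by blast
qed

text \<open>By shape regularity a large element contains a large ball, and by
  \<open>covering\<close> that ball has a node in its interior.\<close>

lemma bounded_diameter: "\<exists>D>0. \<forall>T\<in>\<T>. diameter T \<le> D"
proof -
  obtain \<kappa> where \<kappa>: "\<kappa> > 0" "\<forall>T\<in>\<T>. \<exists>x. cball x (\<kappa> * diameter T) \<subseteq> T"
    using partition by (auto simp: regular_partition_def)
  obtain \<rho> where \<rho>: "\<rho> > 0" "\<forall>p. \<exists>l\<in>\<Lambda>. dist p l < \<rho>" using covering by blast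
  have "diameter T \<le> \<rho> / \<kappa>" if T: "T \<in> \<T>" for T
  proof (rule ccontr)
    assume "\<not> ?thesis"
    then have "\<rho> < \<kappa> * diameter T" using \<kappa>(1) by (simp add: field_simps)
    moreover obtain x where x: "cball x (\<kappa> * diameter T) \<subseteq> T" using \<kappa>(2) T by blast
    moreover obtain l where l: "l \<in> \<Lambda>" "dist x l < \<rho>" using \<rho>(2) by blast
    ultimately have "l \<in> ball x (\<kappa> * diameter T)" "ball x (\<kappa> * diameter T) \<subseteq> T" using ball_subset_cball by (force, blast)
    then have "l \<in> interior T" using open_ball interior_maximal by blast
    then show False using node_not_interior[OF T l(1)] by simp
  qed
  then show ?thesis using \<kappa>(1) \<rho>(1) by (intro exI[of _ "\<rho> / \<kappa>"]) auto
qed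

definition "dmax = (SOME D. D > 0 \<and> (\<forall>T\<in>\<T>. diameter T \<le> D))"

lemma dmax: "dmax > 0" "T \<in> \<T> \<Longrightarrow> diameter T \<le> dmax"
  using someI_ex[OF bounded_diameter] unfolding dmax_def by auto

lemma T_dist: "T \<in> \<T> \<Longrightarrow> x \<in> T \<Longrightarrow> y \<in> T \<Longrightarrow> dist x y \<le> dmax"
  using diameter_ge dmax(2) order_trans by blast

lemma inj_verts: "inj_on (\<lambda>T. verts T) \<T>"
  by (intro inj_onI) (metis T_props(3))

text \<open>An element is determined by its vertices, and these are among the boundedly many sites
  within \<open>r + dmax\<close> of \<open>p\<close>.\<close>

lemma near_elements:
  "finite {T\<in>\<T>. T \<inter> cball p r \<noteq> {}}" "card {T\<in>\<T>. T \<inter> cball p r \<noteq> {}} \<le> 2 ^ N\<Lambda> (r + dmax)"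
proof -
  let ?X = "{T\<in>\<T>. T \<inter> cball p r \<noteq> {}}" and ?L = "\<Lambda> \<inter> cball p (r + dmax)"
  have sub: "(\<lambda>T. verts T) ` ?X \<subseteq> Pow ?L"
  proof
    fix X assume "X \<in> (\<lambda>T. verts T) ` ?X"
    then obtain T y where T: "T \<in> \<T>" "X = verts T" and y: "y \<in> T" "y \<in> cball p r" by blast
    have "x \<in> ?L" if x: "x \<in> verts T" for x
    proof -
      have "dist y x \<le> dmax" using T_dist[OF T(1) y(1)] T_props(6)[OF T(1)] x by blast
      then have "dist p x \<le> r + dmax" using y(2) dist_triangle[of p x y] by simp
      then show ?thesis using T_props(5)[OF T(1)] x by auto
    qed
    then show "X \<in> Pow ?L" using T(2) by blast
  qed
  have inj: "inj_on (\<lambda>T. verts T) ?X" by (rule inj_on_subset[OF inj_verts]) auto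
  have fin: "finite (Pow ?L)" by (rule finite_Pow_iff[THEN iffD2, OF \<Lambda>_ball(1)])
  show "finite ?X" using inj_on_finite[OF inj sub fin] .
  have "card ?X \<le> card (Pow ?L)" using card_inj_on_le[OF inj sub fin] .
  also have "\<dots> = 2 ^ card ?L" by (rule card_Pow[OF \<Lambda>_ball(1)])
  also have "\<dots> \<le> 2 ^ N\<Lambda> (r + dmax)" using \<Lambda>_ball(2) by (intro power_increasing) auto
  finally show "card ?X \<le> 2 ^ N\<Lambda> (r + dmax)" .
qed

lemma countable_T: "countable \<T>"
proof -
  have "\<T> \<subseteq> (\<Union>n::nat. {T\<in>\<T>. T \<inter> cball 0 (real n) \<noteq> {}})"
  proof
    fix T assume T: "T \<in> \<T>"
    then obtain x where "x \<in> T" using rin(2)[OF T] rin(1) by fastforce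
    moreover obtain n :: nat where "norm x \<le> real n" using real_arch_simple by blast
    ultimately show "T \<in> (\<Union>n::nat. {T\<in>\<T>. T \<inter> cball 0 (real n) \<noteq> {}})" using T by (auto simp: disjoint_iff)
  qed
  then show ?thesis
    by (rule countable_subset) (use near_elements(1) in \<open>auto intro: countable_finite\<close>)
qed

end

subsection \<open>Piecewise affine interpolation\<close>

lemma matrix_eq_on_ball:
  fixes F G :: "real^'n^'m"
  assumes "r > 0" "\<And>x. x \<in> cball p r \<Longrightarrow> F *v x + b = G *v x + c"
  shows "F = G"
proof -
  have "F *v axis i 1 = G *v axis i 1" for i
  proof -
    have "p + r *\<^sub>R axis i 1 \<in> cball p r" "p \<in> cball p r" using assms(1) by (auto simp: dist_norm norm_axis_1)
    then have "F *v (p + r *\<^sub>R axis i 1) + b = G *v (p + r *\<^sub>R axis i 1) + c" "F *v p + b = G *v p + c"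
      using assms(2) by blast+
    moreover have "r *\<^sub>R (H *v axis i 1) = (H *v (p + r *\<^sub>R axis i 1) + a) - (H *v p + a)" for H :: "real^'n^'m" and a
      by (simp add: matrix_vector_right_distrib matrix_vector_mult_scaleR)
    ultimately have "r *\<^sub>R (F *v axis i 1) = r *\<^sub>R (G *v axis i 1)" by metis
    then show ?thesis using assms(1) by simp
  qed
  then show ?thesis by (simp add: matrix_vector_mult_basis column_def vec_eq_iff)
qed

lemma affine_eq_on_hull:
  fixes F G :: "real^'n^'m"
  assumes "\<And>v. v \<in> C \<Longrightarrow> F *v v + b = G *v v + c" "x \<in> convex hull C"
  shows "F *v x + b = G *v x + c"
proof -
  have "convex {x. F *v x + b = G *v x + c}"
  proof (rule convexI, clarify)
    fix x y and s t :: real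
    assume x: "F *v x + b = G *v x + c" and y: "F *v y + b = G *v y + c" and st: "s + t = 1"
    have lin: "H *v (s *\<^sub>R x + t *\<^sub>R y) + a = s *\<^sub>R (H *v x + a) + t *\<^sub>R (H *v y + a)" for H :: "real^'n^'m" and a
    proof -
      have "a = s *\<^sub>R a + t *\<^sub>R a" using st by (metis scaleR_add_left scaleR_one)
      then show ?thesis
        by (simp add: matrix_vector_right_distrib matrix_vector_mult_scaleR scaleR_add_right)
    qed
    show "F *v (s *\<^sub>R x + t *\<^sub>R y) + b = G *v (s *\<^sub>R x + t *\<^sub>R y) + c"
      unfolding lin x y ..
  qed
  then have "convex hull C \<subseteq> {x. F *v x + b = G *v x + c}" using assms(1) by (intro hull_minimal) auto
  then show ?thesis using assms(2) by blast
qed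

lemma norm_matrix_vector_le: "norm (F *v x) \<le> norm (F :: real^'n^'m) * norm x"
proof -
  have "(norm (F *v x))\<^sup>2 = (\<Sum>i\<in>UNIV. (F $ i \<bullet> x)\<^sup>2)"
    by (simp add: norm_vec_def L2_set_def matrix_vector_mul_component sum_nonneg)
  also have "\<dots> \<le> (\<Sum>i\<in>UNIV. (norm (F $ i) * norm x)\<^sup>2)"
    by (intro sum_mono) (metis Cauchy_Schwarz_ineq2 abs_ge_zero power2_abs power_mono)
  also have "\<dots> = (norm F * norm x)\<^sup>2"
    by (simp add: norm_vec_def[of F] L2_set_def power_mult_distrib sum_distrib_right sum_nonneg)
  finally show ?thesis by (rule power2_le_imp_le) simp
qed

lemma norm_matrix_le:
  fixes F :: "real^'n^'m"
  assumes "\<And>j. norm (F *v axis j 1) \<le> M"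
  shows "norm F \<le> real CARD('m) * (real CARD('n) * M)"
proof -
  have "norm F \<le> (\<Sum>i\<in>UNIV. norm (F $ i))" unfolding norm_vec_def[of F] by (rule L2_set_le_sum) simp
  also have "\<dots> \<le> (\<Sum>i\<in>(UNIV::'m set). \<Sum>j\<in>(UNIV::'n set). M)"
  proof (rule sum_mono)
    fix i
    have "norm (F $ i) \<le> (\<Sum>j\<in>UNIV. \<bar>F $ i $ j\<bar>)" by (rule norm_le_l1_cart)
    also have "\<dots> \<le> (\<Sum>j\<in>(UNIV::'n set). M)"
    proof (rule sum_mono)
      fix j
      have "\<bar>F $ i $ j\<bar> = \<bar>(F *v axis j 1) $ i\<bar>" by (simp add: matrix_vector_mult_basis column_def)
      also have "\<dots> \<le> M" using component_le_norm_cart assms order_trans by blast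
      finally show "\<bar>F $ i $ j\<bar> \<le> M" .
    qed
    finally show "norm (F $ i) \<le> (\<Sum>j\<in>(UNIV::'n set). M)" .
  qed
  finally show ?thesis by simp
qed

context point_defect
begin

lemma vertsD: "T \<in> \<T> \<Longrightarrow> v \<in> verts T \<Longrightarrow> v \<in> \<Lambda>" "T \<in> \<T> \<Longrightarrow> v \<in> verts T \<Longrightarrow> v \<in> T"
  using T_props(5,6) by blast+

lemma affine_through_vertices:
  fixes u :: "real^'n \<Rightarrow> real^'n"
  assumes "T \<in> \<T>"
  shows "\<exists>F b. \<forall>v\<in>verts T. F *v v + b = u v"
proof -
  have "verts T \<noteq> {}" using T_props(7)[OF assms] by force
  then obtain a where a: "a \<in> verts T" by blast
  have "independent ((\<lambda>x. - a + x) ` (verts T - {a}))"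
    using T_props(8)[OF assms] affine_dependent_iff_dependent2[OF a] by blast
  then obtain g where g: "linear g" "\<forall>x\<in>(\<lambda>x. - a + x) ` (verts T - {a}). g x = u (x + a) - u a"
    using linear_independent_extend[of _ "\<lambda>x. u (x + a) - u a"] by blast
  have "matrix g *v v + (u a - matrix g *v a) = u v" if "v \<in> verts T" for v
  proof (cases "v = a")
    case False
    then have "- a + v \<in> (\<lambda>x. - a + x) ` (verts T - {a})" using that by blast
    then have "g (- a + v) = u v - u a" using g(2) by force
    moreover have "g (- a + v) = g v - g a"
      using linear_diff[OF g(1), of v a] by simp
    ultimately have "g v = u v - u a + g a" by (metis diff_add_cancel)
    then show ?thesis using g(1) by (simp add: matrix_works)
  qed simp
  then show ?thesis by blast
qed

text \<open>The intersection is a face of both elements, so its extreme points are vertices of both,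
  and by Krein-Milman it is their convex hull.\<close>

lemma hull_intersection:
  assumes "T \<in> \<T>" "T' \<in> \<T>" "x \<in> T" "x \<in> T'"
  shows "x \<in> convex hull (verts T \<inter> verts T')"
proof -
  have comp: "compact (T \<inter> T')" "convex (T \<inter> T')"
    using T_props(1,2) assms by (auto intro: compact_Int convex_Int)
  have v: "verts (T \<inter> T') \<subseteq> verts T \<inter> verts T'"
    using extreme_point_of_face[OF conform[OF assms(1,2)]] extreme_point_of_face[OF conform[OF assms(2,1)]]
    by (auto simp: Int_commute)
  have "x \<in> convex hull verts (T \<inter> T')"
    using Krein_Milman_Minkowski[OF comp] assms by blast
  then show ?thesis using hull_mono[OF v] by blast
qed

text \<open>The value at \<open>x\<close> is read from an arbitrary element \<open>el x\<close> that
  contains it. Affine maps that agree at the common vertices agree on the intersection, and local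
  finiteness makes the glued function continuous.\<close>

lemma interpolant_exists:
  fixes u :: "real^'n \<Rightarrow> real^'n"
  shows "\<exists>f. continuous_on UNIV f \<and> piecewise_affine \<T> f \<and> (\<forall>l\<in>\<Lambda>. f l = u l)"
proof -
  obtain F b where Fb: "\<And>T v. T \<in> \<T> \<Longrightarrow> v \<in> verts T \<Longrightarrow> F T *v v + b T = u v"
    using affine_through_vertices[of _ u] by metis
  have "\<forall>x. \<exists>T\<in>\<T>. x \<in> T" using cover by blast
  then obtain el where el: "\<And>x. el x \<in> \<T>" "\<And>x. x \<in> el x" by metis
  define f where "f x = F (el x) *v x + b (el x)" for x
  have f: "f x = F T *v x + b T" if T: "T \<in> \<T>" "x \<in> T" for x T
    unfolding f_def
  proof (rule affine_eq_on_hull)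
    show "x \<in> convex hull (verts (el x) \<inter> verts T)" using hull_intersection[OF el(1) T(1) el(2) T(2)] .
    show "F (el x) *v v + b (el x) = F T *v v + b T" if "v \<in> verts (el x) \<inter> verts T" for v
      using Fb[OF el(1)] Fb[OF T(1)] that by simp
  qed
  have "continuous_on (ball x 1) f" for x
  proof -
    let ?X = "{T\<in>\<T>. T \<inter> cball x 1 \<noteq> {}}"
    have "continuous_on (\<Union>T\<in>?X. T) f"
    proof (rule continuous_on_closed_Union)
      show "finite ?X" by (rule near_elements)
      show "closed T" if "T \<in> ?X" for T using T_props(1) that compact_imp_closed by blast
      show "continuous_on T f" if "T \<in> ?X" for T
      proof -
        have "continuous_on T (\<lambda>x. F T *v x + b T)"
          by (intro continuous_intros linear_continuous_on matrix_vector_mul_bounded_linear)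
        then show ?thesis by (rule continuous_on_eq) (use f that in auto)
      qed
    qed
    moreover have "ball x 1 \<subseteq> (\<Union>T\<in>?X. T)"
    proof
      fix y assume "y \<in> ball x 1"
      then have "y \<in> el y \<inter> cball x 1" using el(2) by auto
      then show "y \<in> (\<Union>T\<in>?X. T)" using el(1) by blast
    qed
    ultimately show ?thesis by (rule continuous_on_subset)
  qed
  then have "isCont f x" for x
    using continuous_on_eq_continuous_at[OF open_ball, of x 1 f] by (meson centre_in_ball zero_less_one)
  then have "continuous_on UNIV f" by (simp add: continuous_on_eq_continuous_at)
  moreover have "piecewise_affine \<T> f" unfolding piecewise_affine_def using f by blast
  moreover have "f l = u l" if "l \<in> \<Lambda>" for l
  proof -
    have "l \<in> nodes \<T>" using that nodes_partition by simp
    then obtain T where T: "T \<in> \<T>" "l \<in> verts T" unfolding nodes_def by blast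
    then show ?thesis using f[OF T(1) vertsD(2)[OF T]] Fb[OF T] by simp
  qed
  ultimately show ?thesis by blast
qed

abbreviation "Iu \<equiv> interpolant \<Lambda> \<T>"

lemma pw_affine_unique:
  assumes "piecewise_affine \<T> f" "piecewise_affine \<T> g" "\<forall>l\<in>\<Lambda>. f l = g l"
  shows "f = g"
proof
  fix x
  obtain T where T: "T \<in> \<T>" "x \<in> T" using cover by blast
  obtain F b where F: "\<forall>x\<in>T. f x = F *v x + b" using assms(1) T(1) unfolding piecewise_affine_def by blast
  obtain G c where G: "\<forall>x\<in>T. g x = G *v x + c" using assms(2) T(1) unfolding piecewise_affine_def by blast
  have "F *v v + b = G *v v + c" if "v \<in> verts T" for v
    using F G assms(3) vertsD[OF T(1) that] by metis
  then show "f x = g x"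
    using affine_eq_on_hull[of "verts T" F b G c x] T_props(3)[OF T(1)] T F G by auto
qed

lemma Iu_props:
  "continuous_on UNIV (Iu u)" "piecewise_affine \<T> (Iu u)" "l \<in> \<Lambda> \<Longrightarrow> Iu u l = u l"
proof -
  have "\<exists>!f. continuous_on UNIV f \<and> piecewise_affine \<T> f \<and> (\<forall>l\<in>\<Lambda>. f l = u l)"
    using interpolant_exists[of u] pw_affine_unique by (metis (no_types, lifting))
  from theI'[OF this] show "continuous_on UNIV (Iu u)" "piecewise_affine \<T> (Iu u)" "l \<in> \<Lambda> \<Longrightarrow> Iu u l = u l"
    unfolding interpolant_def by auto
qed

lemma matrix_unique_T:
  assumes "T \<in> \<T>" "\<And>x. x \<in> T \<Longrightarrow> F *v x + b = G *v x + (c :: real^'n)"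
  shows "F = G"
proof -
  obtain p where "cball p rin \<subseteq> T" using rin(2)[OF assms(1)] by blast
  then show ?thesis using assms(2) rin(1) by (intro matrix_eq_on_ball[of rin p F b G c]) auto
qed

abbreviation "gm u T \<equiv> gradient_on T (Iu u)"

lemma gradient_on_eq:
  assumes "T \<in> \<T>" "\<And>x. x \<in> T \<Longrightarrow> f x = F *v x + b"
  shows "gradient_on T f = F"
  unfolding gradient_on_def
proof (rule the_equality)
  fix G assume "\<exists>c. \<forall>x\<in>T. f x = G *v x + c"
  then show "G = F" using assms by (metis matrix_unique_T)
qed (use assms(2) in blast)

lemma Iu_affine:
  assumes "T \<in> \<T>"
  obtains b where "\<And>x. x \<in> T \<Longrightarrow> Iu u x = gm u T *v x + b"
proof -
  obtain F b where F: "\<forall>x\<in>T. Iu u x = F *v x + b" using Iu_props(2)[of u] assms unfolding piecewise_affine_def by blast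
  then show thesis using that[of b] gradient_on_eq[OF assms, of "Iu u" F b] by simp
qed

lemma gm_eqI:
  assumes T: "T \<in> \<T>" and "\<And>v. v \<in> verts T \<Longrightarrow> u v = F *v v + b"
  shows "gm u T = F"
proof -
  obtain c where c: "\<And>x. x \<in> T \<Longrightarrow> Iu u x = gm u T *v x + c" using Iu_affine[OF T] by blast
  have "gm u T *v x + c = F *v x + b" if "x \<in> T" for x
  proof (rule affine_eq_on_hull[of "verts T"])
    fix v assume v: "v \<in> verts T"
    then have "Iu u v = u v" using vertsD[OF T] Iu_props(3) by blast
    moreover have "Iu u v = gm u T *v v + c" using c vertsD[OF T v] by blast
    ultimately show "gm u T *v v + c = F *v v + b" using assms(2)[OF v] by simp
  qed (use T_props(3)[OF T] that in simp)
  then show ?thesis by (rule matrix_unique_T[OF T])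
qed

lemma gm_affine:
  assumes "T \<in> \<T>"
  obtains b where "\<And>v. v \<in> verts T \<Longrightarrow> u v = gm u T *v v + b"
proof -
  obtain b where b: "\<And>x. x \<in> T \<Longrightarrow> Iu u x = gm u T *v x + b" using Iu_affine[OF assms] by blast
  have "u v = gm u T *v v + b" if "v \<in> verts T" for v
    using b Iu_props(3) vertsD[OF assms that] by metis
  then show thesis by (rule that)
qed

lemma gm_lin:
  assumes "T \<in> \<T>"
  shows "gm (\<lambda>x. s *\<^sub>R u x + t *\<^sub>R v x) T = s *\<^sub>R gm u T + t *\<^sub>R gm v T"
proof -
  obtain b where b: "\<And>x. x \<in> verts T \<Longrightarrow> u x = gm u T *v x + b" using gm_affine[OF assms] by blast
  obtain c where c: "\<And>x. x \<in> verts T \<Longrightarrow> v x = gm v T *v x + c" using gm_affine[OF assms] by blast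
  show ?thesis
    by (rule gm_eqI[OF assms, where b = "s *\<^sub>R b + t *\<^sub>R c"])
      (simp add: b c matrix_vector_mult_add_rdistrib scaleR_matrix_vector_assoc scaleR_add_right)
qed

lemma gm_zero: "T \<in> \<T> \<Longrightarrow> (\<And>x. x \<in> verts T \<Longrightarrow> u x = a) \<Longrightarrow> gm u T = 0"
  by (rule gm_eqI[where b = a]) auto

lemma Iu_osc: "T \<in> \<T> \<Longrightarrow> x \<in> T \<Longrightarrow> y \<in> T \<Longrightarrow> norm (Iu u x - Iu u y) \<le> norm (gm u T) * norm (x - y)"
proof -
  assume T: "T \<in> \<T>" "x \<in> T" "y \<in> T"
  obtain b where b: "\<And>x. x \<in> T \<Longrightarrow> Iu u x = gm u T *v x + b" using Iu_affine[OF T(1)] by blast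
  have "Iu u x - Iu u y = gm u T *v (x - y)" using T by (simp add: b matrix_vector_mult_diff_distrib)
  then show ?thesis using norm_matrix_vector_le by metis
qed

definition "Cgm = 2 * (real CARD('n))\<^sup>2 / rin"

text \<open>The bound on oscillations passes from the vertices to the simplex by convexity of balls.
  Difference quotients along radii of an inscribed ball then bound the columns of the
  matrix.\<close>

lemma norm_gm_le:
  assumes T: "T \<in> \<T>" and M: "\<And>v w. v \<in> verts T \<Longrightarrow> w \<in> verts T \<Longrightarrow> norm (u v - u w) \<le> M"
  shows "norm (gm u T) \<le> Cgm * M"
proof -
  obtain b where b: "\<And>x. x \<in> T \<Longrightarrow> Iu u x = gm u T *v x + b" using Iu_affine[OF T] by blast
  obtain p where p: "cball p rin \<subseteq> T" using rin(2)[OF T] by blast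
  have "verts T \<noteq> {}" using T_props(7)[OF T] by force
  then obtain a where a: "a \<in> verts T" by blast
  let ?H = "{x. norm (gm u T *v x + b - u a) \<le> M}"
  have "convex ((\<lambda>x. gm u T *v x + (b - u a)) -` cball 0 M)"
  proof -
    have "convex ((\<lambda>x. gm u T *v x) -` ((\<lambda>y. y + (b - u a)) -` cball 0 M))"
    proof (rule convex_linear_vimage)
      have "(\<lambda>y. y + (b - u a)) -` cball 0 M = cball (u a - b) M"
        by (auto simp: dist_norm norm_minus_commute algebra_simps)
      then show "convex ((\<lambda>y. y + (b - u a)) -` cball 0 M)" by simp
    qed simp
    then show ?thesis by (simp add: vimage_def)
  qed
  moreover have "(\<lambda>x. gm u T *v x + (b - u a)) -` cball 0 M = ?H" by (auto simp: algebra_simps)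
  ultimately have cH: "convex ?H" by simp
  have "verts T \<subseteq> ?H"
  proof
    fix v assume v: "v \<in> verts T"
    have "gm u T *v v + b = u v" using b Iu_props(3) vertsD[OF T v] by metis
    then show "v \<in> ?H" using M[OF v a] by simp
  qed
  then have TH: "T \<subseteq> ?H" using hull_minimal[of "verts T" ?H convex] cH T_props(3)[OF T] by simp
  have "norm (gm u T *v axis j 1) \<le> 2 * M / rin" for j
  proof -
    have "p + rin *\<^sub>R axis j 1 \<in> ?H" "p \<in> ?H" using p rin(1) TH by (auto simp: dist_norm norm_axis_1 subset_iff)
    then have "norm (gm u T *v (p + rin *\<^sub>R axis j 1) + b - u a) + norm (gm u T *v p + b - u a) \<le> M + M"
      by (intro add_mono) auto
    then have "norm ((gm u T *v (p + rin *\<^sub>R axis j 1) + b - u a) - (gm u T *v p + b - u a)) \<le> M + M"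
      using norm_triangle_ineq4 order_trans by blast
    then have "norm (rin *\<^sub>R (gm u T *v axis j 1)) \<le> 2 * M"
      by (simp add: matrix_vector_right_distrib matrix_vector_mult_scaleR)
    then show ?thesis using rin(1) by (simp add: field_simps)
  qed
  from norm_matrix_le[OF this] show ?thesis by (simp add: Cgm_def power2_eq_square mult_ac)
qed

lemma gradient_interior:
  assumes "T \<in> \<T>" "x \<in> interior T"
  shows "gradient (Iu u) x = gm u T"
proof -
  obtain b where b: "\<And>x. x \<in> T \<Longrightarrow> Iu u x = gm u T *v x + b" using Iu_affine[OF assms(1)] by blast
  have "((\<lambda>x. gm u T *v x + b) has_derivative (\<lambda>h. gm u T *v h)) (at x)"
    using has_derivative_add_const[OF bounded_linear.has_derivative[OF matrix_vector_mul_bounded_linear has_derivative_ident]]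
    by blast
  moreover have "gm u T *v y + b = Iu u y" if "y \<in> interior T" for y
    using b[of y] that interior_subset by (metis subsetD)
  ultimately have "(Iu u has_derivative (\<lambda>h. gm u T *v h)) (at x)"
    using has_derivative_transform_within_open[OF _ open_interior assms(2)] by blast
  from frechet_derivative_at[OF this] have "frechet_derivative (Iu u) (at x) = (\<lambda>h. gm u T *v h)" by simp
  then show ?thesis by (simp add: gradient_def jacobian_def)
qed

text \<open>\<open>W_c\<close> refers to the gradient at every point, element boundaries included;
  so it is computed from the vanishing of the interpolant on an open set and not element by
  element.\<close>

lemma gradient_finsupp:
  assumes "\<And>l. l \<in> \<Lambda> \<Longrightarrow> norm l > r \<Longrightarrow> u l = 0" "norm x > r + dmax"
  shows "gradient (Iu u) x = 0"
proof -
  have zero: "Iu u y = 0" if "norm y > r + dmax" for y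
  proof -
    obtain T where T: "T \<in> \<T>" "y \<in> T" using cover by blast
    have v0: "u v = 0" if v: "v \<in> verts T" for v
    proof -
      have "dist y v \<le> dmax" using T_dist[OF T] T_props(6)[OF T(1)] v by blast
      then have "norm v > r" using \<open>norm y > r + dmax\<close> norm_triangle_sub[of y v] by (simp add: dist_norm)
      then show ?thesis using assms(1) T_props(5)[OF T(1)] v by blast
    qed
    obtain b where b: "\<And>x. x \<in> T \<Longrightarrow> Iu u x = gm u T *v x + b" using Iu_affine[OF T(1)] by blast
    have g0: "gm u T = 0" using v0 by (rule gm_zero[OF T(1)])
    have "verts T \<noteq> {}" using T_props(7)[OF T(1)] by force
    then obtain a where a: "a \<in> verts T" by blast
    have "Iu u a = 0" using v0[OF a] Iu_props(3)[OF vertsD(1)[OF T(1) a], of u] by simp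
    then have "b = 0" using b[OF vertsD(2)[OF T(1) a]] g0 by simp
    then show ?thesis using b[OF T(2)] g0 by simp
  qed
  have "((\<lambda>x. 0) has_derivative (\<lambda>h. 0)) (at x)" by simp
  then have "(Iu u has_derivative (\<lambda>h. 0)) (at x)"
  proof (rule has_derivative_transform_within_open)
    show "open {y. norm y > r + dmax}" by (intro open_Collect_less continuous_intros)
  qed (use assms(2) zero in auto)
  then have "frechet_derivative (Iu u) (at x) = (\<lambda>h. 0)"
    using frechet_derivative_at by metis
  then show ?thesis by (simp add: gradient_def jacobian_def matrix_def vec_eq_iff)
qed

lemma finsupp_W_c:
  assumes "finite {l\<in>\<Lambda>. u l \<noteq> 0}" shows "u \<in> W_c \<Lambda> \<T>"
proof -
  obtain r where r: "\<forall>l\<in>{l\<in>\<Lambda>. u l \<noteq> 0}. norm l \<le> r"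
    using finite_imp_bounded[OF assms] by (auto simp: bounded_iff)
  have "{x. gradient (Iu u) x \<noteq> 0} \<subseteq> cball 0 (r + dmax)"
    using gradient_finsupp[of r u] r by (force simp: not_le)
  then have "bounded (closure {x. gradient (Iu u) x \<noteq> 0})"
    using bounded_subset[OF bounded_cball] bounded_closure by blast
  then show ?thesis unfolding W_c_def using compact_eq_bounded_closed by blast
qed

end

section \<open>Integrals of the gradient and sums over elements\<close>

context point_defect
begin

definition "skel = - (\<Union>T\<in>\<T>. interior T)"

lemma skel_null: "skel \<in> null_sets lebesgue"
proof -
  have "skel \<subseteq> (\<Union>T\<in>\<T>. frontier T)"
  proof
    fix x assume x: "x \<in> skel"
    obtain T where T: "T \<in> \<T>" "x \<in> T" using cover by blast
    then have "x \<in> frontier T" using x closure_subset[of T] by (auto simp: skel_def frontier_def)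
    then show "x \<in> (\<Union>T\<in>\<T>. frontier T)" using T by blast
  qed
  moreover have "negligible (\<Union>T\<in>\<T>. frontier T)"
    using countable_T T_props(2) by (intro negligible_countable_Union) (auto intro: negligible_convex_frontier)
  ultimately have "negligible skel" using negligible_subset by blast
  then show ?thesis by (simp add: negligible_iff_null_sets)
qed

lemma AE_interior: "AE x in lebesgue. \<exists>T\<in>\<T>. x \<in> interior T"
  using AE_not_in[OF skel_null] by eventually_elim (auto simp: skel_def)

text \<open>On the skeleton \<open>gradient\<close> may take any value. These points form a null
  set, and the Lebesgue sigma-algebra is complete.\<close>

lemma gradient_measurable: "gradient (Iu u) \<in> borel_measurable lebesgue"
proof (rule borel_measurableI)
  fix S :: "(real^'n^'n) set"
  let ?g = "gradient (Iu u)"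
  let ?O = "\<Union>T\<in>{T\<in>\<T>. gm u T \<in> S}. interior T"
  have eq: "?g -` S \<inter> space lebesgue = ?O \<union> (?g -` S \<inter> skel)"
  proof (intro equalityI subsetI)
    fix x assume x: "x \<in> ?g -` S \<inter> space lebesgue"
    show "x \<in> ?O \<union> (?g -` S \<inter> skel)"
    proof (cases "x \<in> skel")
      case False
      then obtain T where T: "T \<in> \<T>" "x \<in> interior T" by (auto simp: skel_def)
      then show ?thesis using x gradient_interior[OF T, of u] by auto
    qed (use x in auto)
  next
    fix x assume "x \<in> ?O \<union> (?g -` S \<inter> skel)"
    then show "x \<in> ?g -` S \<inter> space lebesgue" using gradient_interior[of _ x u] by auto
  qed
  have "open ?O" by (intro open_UN) auto
  then have s1: "?O \<in> sets lebesgue" using borel_open[of ?O] sets_completionI_sets[of ?O lborel] by simp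
  have "negligible (?g -` S \<inter> skel)"
    using skel_null negligible_subset[of skel] by (simp add: negligible_iff_null_sets[symmetric])
  then have s2: "?g -` S \<inter> skel \<in> sets lebesgue" by (simp add: negligible_imp_sets)
  show "?g -` S \<inter> space lebesgue \<in> sets lebesgue" unfolding eq using s1 s2 by (rule sets.Un)
qed

lemma norm_gradient_measurable [measurable]: "(\<lambda>x. (norm (gradient (Iu u) x))\<^sup>2) \<in> borel_measurable lebesgue"
  using gradient_measurable[of u] by measurable

lemma interior_lmeasurable: "T \<in> \<T> \<Longrightarrow> interior T \<in> lmeasurable"
  using T_props(1) by (intro lmeasurable_open) (auto intro: bounded_subset[OF _ interior_subset] compact_imp_bounded)

definition "vmin = measure lebesgue (ball 0 rin :: (real^'n) set)"
definition "vmax = measure lebesgue (cball 0 dmax :: (real^'n) set)"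

lemma vmin_pos: "vmin > 0" unfolding vmin_def using rin(1) by (simp add: content_ball_pos)

lemma measure_T:
  assumes "T \<in> \<T>" shows "vmin \<le> measure lebesgue (interior T)" "measure lebesgue (interior T) \<le> vmax"
proof -
  obtain p where p: "cball p rin \<subseteq> T" using rin(2)[OF assms] by blast
  then have "ball p rin \<subseteq> interior T"
    using ball_subset_cball by (intro interior_maximal) auto
  then have "measure lebesgue (ball p rin) \<le> measure lebesgue (interior T)"
    using interior_lmeasurable[OF assms] by (intro measure_mono_fmeasurable) auto
  moreover have "measure lebesgue (ball p rin) = vmin"
    unfolding vmin_def using measure_translation[of p "ball 0 rin"] by (simp add: ball_translation[symmetric] flip: ball_translation)
  ultimately show "vmin \<le> measure lebesgue (interior T)" by simp
  have "p \<in> T" using p rin(1) by auto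
  have "interior T \<subseteq> cball p dmax"
  proof
    fix x assume "x \<in> interior T"
    then have "x \<in> T" using interior_subset by blast
    then show "x \<in> cball p dmax" using T_dist[OF assms \<open>p \<in> T\<close>] by simp
  qed
  then have "measure lebesgue (interior T) \<le> measure lebesgue (cball p dmax)"
    using interior_lmeasurable[OF assms] by (intro measure_mono_fmeasurable) (auto simp: fmeasurableD)
  moreover have "measure lebesgue (cball p dmax) = vmax"
    unfolding vmax_def using measure_translation[of p "cball 0 dmax"] by (simp flip: cball_translation)
  ultimately show "measure lebesgue (interior T) \<le> vmax" by simp
qed

text \<open>Interiors of elements are disjoint with volumes bounded below. Together with
  \<open>W_12_upper\<close> this makes the semi-norm equivalent to the l2 norm of the element
  gradients.\<close>

lemma W_12_lower:
  assumes "u \<in> W_12 \<Lambda> \<T>" "finite G" "G \<subseteq> \<T>"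
  shows "(\<Sum>T\<in>G. (norm (gm u T))\<^sup>2) \<le> (W_12_seminorm \<Lambda> \<T> u)\<^sup>2 / vmin"
proof -
  let ?g = "\<lambda>x. (norm (gradient (Iu u) x))\<^sup>2"
  have int: "integrable lebesgue ?g" using assms(1) by (simp add: W_12_def square_integrable_def)
  have im: "integrable lebesgue (\<lambda>x. indicat_real (interior T) x * (norm (gm u T))\<^sup>2)" if "T \<in> G" for T
    using interior_lmeasurable[of T] that assms(3) by (auto simp: fmeasurable_def intro!: integrable_mult_left)
  have "vmin * (\<Sum>T\<in>G. (norm (gm u T))\<^sup>2) \<le> (\<Sum>T\<in>G. measure lebesgue (interior T) * (norm (gm u T))\<^sup>2)"
    unfolding sum_distrib_left using measure_T(1) assms(3) by (intro sum_mono mult_right_mono) auto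
  also have "\<dots> = (\<Sum>T\<in>G. LINT x|lebesgue. indicat_real (interior T) x * (norm (gm u T))\<^sup>2)"
    using interior_lmeasurable assms(3) by (intro sum.cong refl) (auto simp: fmeasurable_def)
  also have "\<dots> = (LINT x|lebesgue. (\<Sum>T\<in>G. indicat_real (interior T) x * (norm (gm u T))\<^sup>2))"
    using im by (intro Bochner_Integration.integral_sum[symmetric]) auto
  also have "\<dots> \<le> (LINT x|lebesgue. ?g x)"
  proof (rule integral_mono)
    show "integrable lebesgue (\<lambda>x. \<Sum>T\<in>G. indicat_real (interior T) x * (norm (gm u T))\<^sup>2)"
      using im by (intro Bochner_Integration.integrable_sum) auto
    fix x
    show "(\<Sum>T\<in>G. indicat_real (interior T) x * (norm (gm u T))\<^sup>2) \<le> ?g x"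
    proof (cases "\<exists>T\<in>G. x \<in> interior T")
      case True
      then obtain T where T: "T \<in> G" "x \<in> interior T" by blast
      have "(\<Sum>T'\<in>G. indicat_real (interior T') x * (norm (gm u T'))\<^sup>2) = (\<Sum>T'\<in>G. if T' = T then (norm (gm u T))\<^sup>2 else 0)"
        using T assms(3) interiors_disjoint[of _ T x] by (intro sum.cong refl) (auto simp: indicator_def)
      also have "\<dots> = ?g x" using T assms gradient_interior[of T x u] by auto
      finally show ?thesis by simp
    next
      case False
      then have "(\<Sum>T\<in>G. indicat_real (interior T) x * (norm (gm u T))\<^sup>2) = 0"
        by (intro sum.neutral) auto
      then show ?thesis by simp
    qed
  qed (rule int)
  also have "\<dots> = (W_12_seminorm \<Lambda> \<T> u)\<^sup>2"
    unfolding W_12_seminorm_def L2_norm_def by simp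
  finally show ?thesis using vmin_pos by (simp add: pos_le_divide_eq mult.commute)
qed

text \<open>Membership and bound come from one estimate of the nonnegative integral, which
  presupposes no integrability.\<close>

lemma W_12_upper:
  assumes K: "\<And>G. finite G \<Longrightarrow> G \<subseteq> \<T> \<Longrightarrow> (\<Sum>T\<in>G. (norm (gm u T))\<^sup>2) \<le> K"
  shows "u \<in> W_12 \<Lambda> \<T>" "(W_12_seminorm \<Lambda> \<T> u)\<^sup>2 \<le> vmax * K"
proof -
  let ?g = "\<lambda>x. (norm (gradient (Iu u) x))\<^sup>2"
  \<comment> \<open>Empty for indices that do not enumerate an element, as \<open>\<T>\<close> is
    only known to be countable.\<close>
  define E where "E n = (if n \<in> to_nat_on \<T> ` \<T> then interior (from_nat_into \<T> n) else {})" for n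
  define a where "a n = (norm (gm u (from_nat_into \<T> n)))\<^sup>2" for n
  have vK: "vmax * K \<ge> 0" using K[of "{}"] by (simp add: vmax_def)
  have E: "E n \<in> sets lebesgue" for n
    unfolding E_def by (simp add: borel_open sets_completionI_sets)
  have le: "ennreal (?g x) \<le> (\<Sum>n. ennreal (a n) * indicator (E n) x)" if x: "x \<notin> skel" for x
  proof -
    obtain T where T: "T \<in> \<T>" "x \<in> interior T" using x by (auto simp: skel_def)
    let ?n = "to_nat_on \<T> T"
    have n: "from_nat_into \<T> ?n = T" using T(1) countable_T by simp
    have "ennreal (?g x) = ennreal (a ?n) * indicator (E ?n) x"
      using T by (simp add: a_def E_def n gradient_interior)
    also have "\<dots> \<le> (\<Sum>n. ennreal (a n) * indicator (E n) x)"
    proof -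
      define f where "f n = ennreal (a n) * indicator (E n) x" for n
      have "(\<Sum>n\<in>{?n}. f n) \<le> suminf f" by (rule sum_le_suminf) auto
      then have "f ?n \<le> suminf f" by simp
      then show ?thesis unfolding f_def .
    qed
    finally show ?thesis .
  qed
  have "(\<integral>\<^sup>+x. ennreal (?g x) \<partial>lebesgue) \<le> (\<integral>\<^sup>+x. (\<Sum>n. ennreal (a n) * indicator (E n) x) \<partial>lebesgue)"
    by (rule nn_integral_mono_AE) (use AE_not_in[OF skel_null] le in \<open>auto elim!: eventually_mono\<close>)
  also have "\<dots> = (\<Sum>n. \<integral>\<^sup>+x. ennreal (a n) * indicator (E n) x \<partial>lebesgue)"
    using E by (intro nn_integral_suminf) auto
  also have "\<dots> = (\<Sum>n. ennreal (a n) * emeasure lebesgue (E n))"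
    using E by (simp add: nn_integral_cmult_indicator)
  also have "\<dots> \<le> ennreal (vmax * K)"
  proof (rule suminf_le_const)
    fix N :: nat
    let ?I = "{..<N} \<inter> to_nat_on \<T> ` \<T>"
    let ?G = "from_nat_into \<T> ` ?I"
    have inj: "inj_on (from_nat_into \<T>) ?I"
      using countable_T by (auto intro!: inj_onI) 
    have G: "finite ?G" "?G \<subseteq> \<T>" using countable_T by auto
    have "(\<Sum>n<N. ennreal (a n) * emeasure lebesgue (E n)) = (\<Sum>n\<in>?I. ennreal (a n) * emeasure lebesgue (E n))"
      by (intro sum.mono_neutral_right) (auto simp: E_def)
    also have "\<dots> \<le> (\<Sum>n\<in>?I. ennreal (vmax * a n))"
    proof (rule sum_mono)
      fix n assume n: "n \<in> ?I"
      then have T: "from_nat_into \<T> n \<in> \<T>" using G(2) by blast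
      have "emeasure lebesgue (E n) = ennreal (measure lebesgue (interior (from_nat_into \<T> n)))"
        using n emeasure_eq_measure2[OF interior_lmeasurable[OF T]] by (simp add: E_def)
      also have "\<dots> \<le> ennreal vmax" using measure_T(2)[OF T] by (rule ennreal_leI)
      finally have "ennreal (a n) * emeasure lebesgue (E n) \<le> ennreal (a n) * ennreal vmax"
        by (intro mult_left_mono) auto
      then show "ennreal (a n) * emeasure lebesgue (E n) \<le> ennreal (vmax * a n)"
        by (simp add: ennreal_mult[symmetric] a_def vmax_def mult.commute)
    qed
    also have "\<dots> = ennreal (vmax * (\<Sum>n\<in>?I. a n))"
      unfolding sum_distrib_left by (intro sum_ennreal) (simp add: a_def vmax_def)
    also have "(\<Sum>n\<in>?I. a n) = (\<Sum>T\<in>?G. (norm (gm u T))\<^sup>2)"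
      unfolding a_def by (simp add: sum.reindex[OF inj])
    also have "ennreal (vmax * \<dots>) \<le> ennreal (vmax * K)"
      using K[OF G] by (intro ennreal_leI mult_left_mono) (auto simp: vmax_def)
    finally show "(\<Sum>n<N. ennreal (a n) * emeasure lebesgue (E n)) \<le> ennreal (vmax * K)" .
  qed simp
  finally have nn: "(\<integral>\<^sup>+x. ennreal (?g x) \<partial>lebesgue) \<le> ennreal (vmax * K)" .
  have int: "integrable lebesgue ?g"
    using nn by (intro integrableI_bounded) (auto simp: le_less_trans[OF _ ennreal_less_top])
  show "u \<in> W_12 \<Lambda> \<T>"
    unfolding W_12_def square_integrable_def using int gradient_measurable by simp
  have "(W_12_seminorm \<Lambda> \<T> u)\<^sup>2 = (LINT x|lebesgue. ?g x)"
    unfolding W_12_seminorm_def L2_norm_def by simp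
  moreover have "ennreal (LINT x|lebesgue. ?g x) \<le> ennreal (vmax * K)"
    using nn nn_integral_eq_integral[OF int] by simp
  ultimately show "(W_12_seminorm \<Lambda> \<T> u)\<^sup>2 \<le> vmax * K" using vK by simp
qed

lemma W_12_lin:
  assumes "u \<in> W_12 \<Lambda> \<T>" "v \<in> W_12 \<Lambda> \<T>"
  shows "(\<lambda>x. s *\<^sub>R u x + t *\<^sub>R v x) \<in> W_12 \<Lambda> \<T>"
proof (rule W_12_upper(1))
  fix G assume G: "finite G" "G \<subseteq> \<T>"
  let ?A = "\<lambda>u. (W_12_seminorm \<Lambda> \<T> u)\<^sup>2 / vmin"
  have "(\<Sum>T\<in>G. (norm (gm (\<lambda>x. s *\<^sub>R u x + t *\<^sub>R v x) T))\<^sup>2)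
     \<le> (\<Sum>T\<in>G. 2 * s\<^sup>2 * (norm (gm u T))\<^sup>2 + 2 * t\<^sup>2 * (norm (gm v T))\<^sup>2)"
  proof (rule sum_mono)
    fix T assume "T \<in> G"
    then show "(norm (gm (\<lambda>x. s *\<^sub>R u x + t *\<^sub>R v x) T))\<^sup>2 \<le> 2 * s\<^sup>2 * (norm (gm u T))\<^sup>2 + 2 * t\<^sup>2 * (norm (gm v T))\<^sup>2"
      using norm_sq_triangle[of "s *\<^sub>R gm u T" "t *\<^sub>R gm v T"] gm_lin[of T s u t v] G(2)
      by (auto simp: power_mult_distrib)
  qed
  also have "\<dots> = 2 * s\<^sup>2 * (\<Sum>T\<in>G. (norm (gm u T))\<^sup>2) + 2 * t\<^sup>2 * (\<Sum>T\<in>G. (norm (gm v T))\<^sup>2)"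
    by (simp add: sum.distrib sum_distrib_left)
  also have "\<dots> \<le> 2 * s\<^sup>2 * ?A u + 2 * t\<^sup>2 * ?A v"
    using W_12_lower[OF assms(1) G] W_12_lower[OF assms(2) G] by (intro add_mono mult_left_mono) auto
  finally show "(\<Sum>T\<in>G. (norm (gm (\<lambda>x. s *\<^sub>R u x + t *\<^sub>R v x) T))\<^sup>2) \<le> 2 * s\<^sup>2 * ?A u + 2 * t\<^sup>2 * ?A v" .
qed

lemma W_12_seminorm_scale: "W_12_seminorm \<Lambda> \<T> (\<lambda>x. a *\<^sub>R u x) = \<bar>a\<bar> * W_12_seminorm \<Lambda> \<T> u"
proof -
  have "AE x in lebesgue. (norm (gradient (Iu (\<lambda>x. a *\<^sub>R u x)) x))\<^sup>2 = a\<^sup>2 * (norm (gradient (Iu u) x))\<^sup>2"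
    using AE_interior
  proof eventually_elim
    case (elim x)
    then obtain T where T: "T \<in> \<T>" "x \<in> interior T" by blast
    show ?case
      using gm_lin[OF T(1), of a u 0 u] by (simp add: gradient_interior[OF T] power_mult_distrib)
  qed
  then have "(LINT x|lebesgue. (norm (gradient (Iu (\<lambda>x. a *\<^sub>R u x)) x))\<^sup>2)
     = (LINT x|lebesgue. a\<^sup>2 * (norm (gradient (Iu u) x))\<^sup>2)"
    by (intro integral_cong_AE) auto
  then show ?thesis unfolding W_12_seminorm_def L2_norm_def by (simp add: real_sqrt_mult)
qed

lemma energy_Ck:
  assumes "Ck_derivs k (W_12 \<Lambda> \<T>) (W_12_seminorm \<Lambda> \<T>) E DE"
  shows "Ck_functional k (W_12 \<Lambda> \<T>) (W_12_seminorm \<Lambda> \<T>) E DE"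
proof
  show "(\<lambda>x. 0) \<in> W_12 \<Lambda> \<T>"
    using gm_zero[of _ "\<lambda>x. 0" 0] by (intro W_12_upper(1)[where K = 0]) (simp add: subset_iff)
qed (use assms W_12_lin W_12_seminorm_scale in \<open>auto simp: W_12_seminorm_def L2_norm_def\<close>)

end

section \<open>Comparison of the semi-norm on the mesh with differences on the lattice\<close>

context point_defect
begin

text \<open>The interpolant is affine on each element that the segment from \<open>l\<close> to
  \<open>l'\<close> meets. These closed pieces cover the segment, so it is Lipschitz along it, with
  a constant in which \<open>M\<close> dominates all the gradients involved.\<close>

lemma pair_difference:
  assumes "l \<in> \<Lambda>" "l' \<in> \<Lambda>" "dist l l' \<le> \<rho>"
  shows "(norm (u l' - u l))\<^sup>2 \<le> \<rho>\<^sup>2 * (\<Sum>T\<in>{T\<in>\<T>. T \<inter> cball l \<rho> \<noteq> {}}. (norm (gm u T))\<^sup>2)"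
proof -
  let ?X = "{T\<in>\<T>. T \<inter> cball l \<rho> \<noteq> {}}"
  define M where "M = sqrt (\<Sum>T\<in>?X. (norm (gm u T))\<^sup>2)"
  have fin: "finite ?X" by (rule near_elements)
  have M0: "M \<ge> 0" by (simp add: M_def sum_nonneg)
  have \<rho>0: "\<rho> \<ge> 0" using assms(3) zero_le_dist order_trans by blast
  have gM: "norm (gm u T) \<le> M" if "T \<in> ?X" for T
    unfolding M_def using fin that by (intro real_le_rsqrt member_le_sum) auto
  define \<gamma> where "\<gamma> t = l + t *\<^sub>R (l' - l)" for t :: real
  have cont: "continuous_on UNIV \<gamma>" unfolding \<gamma>_def by (intro continuous_intros)
  have "lipschitz_on (M * \<rho>) {0..1} (\<lambda>t. Iu u (\<gamma> t))"
  proof (rule lipschitz_on_closed_Union[where I = ?X and U = "\<lambda>T. \<gamma> -` T"])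
    fix T assume T: "T \<in> ?X"
    show "closed (\<gamma> -` T)"
      using T_props(1) T cont by (intro closed_vimage compact_imp_closed) (auto simp: continuous_on_eq_continuous_within)
    show "lipschitz_on (M * \<rho>) (\<gamma> -` T) (\<lambda>t. Iu u (\<gamma> t))"
    proof (rule lipschitz_onI)
      fix s t assume st: "s \<in> \<gamma> -` T" "t \<in> \<gamma> -` T"
      have "dist (Iu u (\<gamma> s)) (Iu u (\<gamma> t)) \<le> norm (gm u T) * norm (\<gamma> s - \<gamma> t)"
        using Iu_osc[of T "\<gamma> s" "\<gamma> t" u] T st by (simp add: dist_norm)
      also have "\<gamma> s - \<gamma> t = (s - t) *\<^sub>R (l' - l)" by (simp add: \<gamma>_def algebra_simps)
      also have "norm (gm u T) * norm ((s - t) *\<^sub>R (l' - l)) \<le> M * (\<bar>s - t\<bar> * \<rho>)"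
        using gM[OF T] assms(3) M0 \<rho>0
        by (intro mult_mono) (auto simp: dist_norm norm_minus_commute mult_left_mono)
      finally show "dist (Iu u (\<gamma> s)) (Iu u (\<gamma> t)) \<le> M * \<rho> * dist s t" by (simp add: dist_norm mult_ac)
    qed (use M0 \<rho>0 in simp)
  next
    show "{0..1} \<subseteq> (\<Union>T\<in>?X. \<gamma> -` T)"
    proof
      fix t :: real assume t: "t \<in> {0..1}"
      obtain T where T: "T \<in> \<T>" "\<gamma> t \<in> T" using cover by blast
      have "dist l (\<gamma> t) = \<bar>t\<bar> * dist l l'" by (simp add: \<gamma>_def dist_norm norm_minus_commute)
      also have "\<dots> \<le> 1 * \<rho>" using t assms(3) by (intro mult_mono) auto
      finally have "\<gamma> t \<in> T \<inter> cball l \<rho>" using T(2) by simp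
      then show "t \<in> (\<Union>T\<in>?X. \<gamma> -` T)" using T(1) by blast
    qed
  qed (use fin M0 \<rho>0 in auto)
  then have "dist (Iu u (\<gamma> 1)) (Iu u (\<gamma> 0)) \<le> M * \<rho> * dist 1 (0::real)" by (rule lipschitz_onD) auto
  then have "norm (u l' - u l) \<le> M * \<rho>"
    using Iu_props(3)[OF assms(1), of u] Iu_props(3)[OF assms(2), of u] by (simp add: \<gamma>_def dist_norm)
  then have "(norm (u l' - u l))\<^sup>2 \<le> (M * \<rho>)\<^sup>2" by (intro power_mono) auto
  then show ?thesis by (simp add: M_def power_mult_distrib sum_nonneg mult.commute)
qed

abbreviation "lat u \<equiv> (\<lambda>x. u (iota A x))"

definition "Rl = Rdef + ahi"

lemma norm_iota_axis: "norm (iota A (axis i 1)) \<le> ahi"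
proof -
  have "(\<chi> j. real_of_int (axis i 1 $ j)) = (axis i 1 :: real^'n)" by (simp add: vec_eq_iff axis_def)
  then show ?thesis using ahi(2)[of "axis i 1"] by (simp add: iota_def norm_axis_1)
qed

lemma far_lattice:
  assumes "norm (iota A x) \<ge> Rl" shows "iota A x \<in> \<Lambda>" "iota A (x + axis i 1) \<in> \<Lambda>"
proof -
  show "iota A x \<in> \<Lambda>" using assms ahi(1) by (intro lattice_\<Lambda>) (simp add: Rl_def)
  have "norm (iota A x) \<le> norm (iota A (x + axis i 1)) + norm (iota A (axis i 1))"
    using norm_triangle_ineq4[of "iota A (x + axis i 1)" "iota A (axis i 1)"] by (simp add: iota_add)
  then show "iota A (x + axis i 1) \<in> \<Lambda>"
    using assms norm_iota_axis[of i] by (intro lattice_\<Lambda>) (simp add: Rl_def)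
qed

definition "Klow = real CARD('n) * ahi\<^sup>2 * real (Nlat (ahi + dmax)) / vmin"

lemma Klow_nonneg: "Klow \<ge> 0" using vmin_pos by (simp add: Klow_def)

text \<open>Each element is counted only for lattice points within \<open>ahi + dmax\<close> of one
  of its points, at most \<open>Nlat (ahi + dmax)\<close> of them. Beyond \<open>Rl\<close> both
  ends of a unit bond are sites, as \<open>pair_difference\<close> requires.\<close>

lemma lattice_lower:
  assumes u: "u \<in> W_12 \<Lambda> \<T>" and F: "finite F" "\<And>x. x \<in> F \<Longrightarrow> norm (iota A x) \<ge> Rl"
  shows "(\<Sum>x\<in>F. grad_sq (lat u) x) \<le> Klow * (W_12_seminorm \<Lambda> \<T> u)\<^sup>2"
proof -
  let ?X = "\<lambda>x. {T\<in>\<T>. T \<inter> cball (iota A x) ahi \<noteq> {}}"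
  let ?g = "\<lambda>T. (norm (gm u T))\<^sup>2"
  define G where "G = (\<Union>x\<in>F. ?X x)"
  have G: "finite G" "G \<subseteq> \<T>" unfolding G_def using F(1) near_elements(1) by auto
  have one: "grad_sq (lat u) x \<le> real CARD('n) * ahi\<^sup>2 * (\<Sum>T\<in>G. if T \<in> ?X x then ?g T else 0)" if x: "x \<in> F" for x
  proof -
    have "(norm (ldiff (axis i 1) (lat u) x))\<^sup>2 \<le> ahi\<^sup>2 * (\<Sum>T\<in>?X x. ?g T)" for i
      using pair_difference[OF far_lattice(1)[OF F(2)[OF x]] far_lattice(2)[OF F(2)[OF x], of i], where u = u and \<rho> = ahi] norm_iota_axis[of i]
      by (simp add: ldiff_def iota_add dist_norm)
    then have "grad_sq (lat u) x \<le> (\<Sum>i\<in>(UNIV::'n set). ahi\<^sup>2 * (\<Sum>T\<in>?X x. ?g T))"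
      unfolding grad_sq_def by (intro sum_mono)
    also have "(\<Sum>T\<in>?X x. ?g T) = (\<Sum>T\<in>G. if T \<in> ?X x then ?g T else 0)"
      using x G(1) by (intro sum.mono_neutral_cong_left) (auto simp: G_def)
    finally show ?thesis by simp
  qed
  have cnt: "(\<Sum>x\<in>F. if T \<in> ?X x then ?g T else 0) \<le> real (Nlat (ahi + dmax)) * ?g T" if T: "T \<in> \<T>" for T
  proof -
    obtain p where "cball p rin \<subseteq> T" using rin(2)[OF T] by blast
    then have p: "p \<in> T" using rin(1) by auto
    have "(\<Sum>x\<in>F. if T \<in> ?X x then ?g T else 0) = real (card {x\<in>F. T \<in> ?X x}) * ?g T"
      using F(1) by (simp add: sum.If_cases Int_def)
    also have "\<dots> \<le> real (Nlat (ahi + dmax)) * ?g T"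
    proof (intro mult_right_mono of_nat_mono)
      have "{x\<in>F. T \<in> ?X x} \<subseteq> {x. dist (iota A x) p \<le> ahi + dmax}"
      proof
        fix x assume "x \<in> {x\<in>F. T \<in> ?X x}"
        then obtain y where "y \<in> T" "y \<in> cball (iota A x) ahi" by blast
        then show "x \<in> {x. dist (iota A x) p \<le> ahi + dmax}"
          using T_dist[OF T _ p, of y] dist_triangle[of "iota A x" p y] by simp
      qed
      then have "card {x\<in>F. T \<in> ?X x} \<le> card {x. dist (iota A x) p \<le> ahi + dmax}"
        using iota_ball(1) by (intro card_mono)
      then show "card {x\<in>F. T \<in> ?X x} \<le> Nlat (ahi + dmax)" using iota_ball(2) order_trans by blast
    qed simp
    finally show ?thesis .
  qed
  have "(\<Sum>x\<in>F. grad_sq (lat u) x) \<le> (\<Sum>x\<in>F. real CARD('n) * ahi\<^sup>2 * (\<Sum>T\<in>G. if T \<in> ?X x then ?g T else 0))"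
    by (intro sum_mono one)
  also have "\<dots> = real CARD('n) * ahi\<^sup>2 * (\<Sum>T\<in>G. \<Sum>x\<in>F. if T \<in> ?X x then ?g T else 0)"
    unfolding sum_distrib_left[symmetric] by (subst sum.swap) (rule refl)
  also have "\<dots> \<le> real CARD('n) * ahi\<^sup>2 * (\<Sum>T\<in>G. real (Nlat (ahi + dmax)) * ?g T)"
    using G(2) by (intro mult_left_mono sum_mono cnt) auto
  also have "\<dots> = real CARD('n) * ahi\<^sup>2 * real (Nlat (ahi + dmax)) * (\<Sum>T\<in>G. ?g T)"
    by (simp add: sum_distrib_left mult_ac)
  also have "\<dots> \<le> real CARD('n) * ahi\<^sup>2 * real (Nlat (ahi + dmax)) * ((W_12_seminorm \<Lambda> \<T> u)\<^sup>2 / vmin)"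
    by (intro mult_left_mono W_12_lower u G) simp
  finally show ?thesis by (simp add: Klow_def)
qed

text \<open>Near the defect \<open>lat u\<close> reads \<open>u\<close> at lattice points that need
  not be sites, where its values are arbitrary; they are finite in number.\<close>

lemma lattice_summable:
  assumes u: "u \<in> W_12 \<Lambda> \<T>" shows "grad_sq (lat u) summable_on UNIV"
proof (rule infsum_le_sum_bound(1))
  let ?C = "{x. norm (iota A x) \<le> Rl}"
  fix F :: "(int^'n) set" assume F: "finite F"
  have fC: "finite ?C" by (rule finite_iota_ball)
  have "sum (grad_sq (lat u)) F = sum (grad_sq (lat u)) (F \<inter> ?C) + sum (grad_sq (lat u)) (F - ?C)"
    using F by (simp add: sum.Int_Diff)
  also have "\<dots> \<le> sum (grad_sq (lat u)) ?C + Klow * (W_12_seminorm \<Lambda> \<T> u)\<^sup>2"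
    using F fC by (intro add_mono sum_mono2 lattice_lower u) auto
  finally show "sum (grad_sq (lat u)) F \<le> sum (grad_sq (lat u)) ?C + Klow * (W_12_seminorm \<Lambda> \<T> u)\<^sup>2" .
qed simp

definition "mu = \<lfloor>dmax / alo\<rfloor>"

lemma lattice_near: "dist (iota A x) (iota A y) \<le> dmax \<Longrightarrow> y - x \<in> cube mu"
proof -
  assume "dist (iota A x) (iota A y) \<le> dmax"
  then have "norm (iota A (y - x)) \<le> dmax" by (simp add: iota_diff dist_norm norm_minus_commute)
  then have "alo * real_of_int (supn (y - x)) \<le> dmax" using alo(2) order_trans by blast
  then have "real_of_int (supn (y - x)) \<le> dmax / alo" using alo(1) by (simp add: field_simps)
  then show ?thesis by (simp add: mu_def supn_le_iff[symmetric] le_floor_iff)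
qed

definition "Kup = (2 * Cgm)\<^sup>2 * path_const TYPE('n) mu * real (card (cube mu :: (int^'n) set)) * 2 ^ N\<Lambda> (0 + dmax)"

lemma Kup_nonneg: "Kup \<ge> 0" using path_const_nonneg[where 'n = 'n, of mu] by (simp add: Kup_def)

text \<open>Elements with all vertices in the ball of radius \<open>R1\<close> carry no gradient,
  since \<open>w\<close> is constant there. By \<open>R1 \<ge> Rdef + dmax\<close> the vertices of
  every other element lie outside the core, so they are lattice points joined by short lattice
  paths.\<close>

lemma lattice_upper:
  assumes core: "\<And>l. l \<in> \<Lambda> \<Longrightarrow> norm l \<le> R1 \<Longrightarrow> w l = a" and R1: "R1 \<ge> Rdef + dmax"
    and \<delta>: "\<And>F. finite F \<Longrightarrow> (\<Sum>x\<in>F. grad_sq (lat w) x) \<le> \<delta>"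
    and G: "finite G" "G \<subseteq> \<T>"
  shows "(\<Sum>T\<in>G. (norm (gm w T))\<^sup>2) \<le> Kup * \<delta>"
proof -
  define G' where "G' = {T\<in>G. \<exists>v\<in>verts T. norm v > R1}"
  have G': "finite G'" "G' \<subseteq> G" using G by (auto simp: G'_def)
  have far: "v \<in> range (iota A)" if TG: "T \<in> G'" and v: "v \<in> verts T" for T v
  proof -
    obtain v' where v': "v' \<in> verts T" "norm v' > R1" and T: "T \<in> \<T>" using TG G by (auto simp: G'_def)
    have "dist v v' \<le> dmax" using T_dist[OF T vertsD(2)[OF T v] vertsD(2)[OF T v'(1)]] .
    then have "norm v \<ge> Rdef" using v'(2) R1 norm_triangle_sub[of v' v] by (simp add: dist_norm norm_minus_commute)
    then show ?thesis using \<Lambda>_lattice vertsD(1)[OF T v] by blast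
  qed
  have "\<exists>x. iota A x \<in> verts T" if T: "T \<in> G'" for T
  proof -
    have "T \<in> \<T>" using T G G' by blast
    then have "verts T \<noteq> {}" using T_props(7) by force
    then show ?thesis using far[OF T] by blast
  qed
  then obtain xT where xT: "\<And>T. T \<in> G' \<Longrightarrow> iota A (xT T) \<in> verts T" by metis
  define Q where "Q x = path_const TYPE('n) mu * (\<Sum>y\<in>cube mu. grad_sq (lat w) (x + y))" for x
  have Q0: "Q x \<ge> 0" for x using path_const_nonneg[where 'n = 'n, of mu] by (simp add: Q_def sum_nonneg)
  have g: "(norm (gm w T))\<^sup>2 \<le> (2 * Cgm)\<^sup>2 * Q (xT T)" if T: "T \<in> G'" for T
  proof -
    have T': "T \<in> \<T>" using T G G' by blast
    have d: "norm (w v - w (iota A (xT T))) \<le> sqrt (Q (xT T))" if v: "v \<in> verts T" for v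
    proof -
      obtain y where y: "v = iota A y" using far[OF T v] by blast
      have "y - xT T \<in> cube mu"
        using T_dist[OF T' vertsD(2)[OF T' xT[OF T]] vertsD(2)[OF T' v]] y by (intro lattice_near) simp
      then have "(norm (ldiff (y - xT T) (lat w) (xT T)))\<^sup>2 \<le> Q (xT T)"
        unfolding Q_def by (rule norm_ldiff_sq_le)
      then show ?thesis by (intro real_le_rsqrt) (simp add: ldiff_def y)
    qed
    have "norm (gm w T) \<le> Cgm * (2 * sqrt (Q (xT T)))"
    proof (rule norm_gm_le[OF T'])
      fix v v' assume "v \<in> verts T" "v' \<in> verts T"
      then show "norm (w v - w v') \<le> 2 * sqrt (Q (xT T))"
        using d[of v] d[of v'] norm_triangle_ineq4[of "w v - w (iota A (xT T))" "w v' - w (iota A (xT T))"] by simp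
    qed
    then have "(norm (gm w T))\<^sup>2 \<le> (Cgm * (2 * sqrt (Q (xT T))))\<^sup>2" by (intro power_mono) auto
    then show ?thesis using Q0 by (simp add: power_mult_distrib)
  qed
  have zero: "gm w T = 0" if "T \<in> G - G'" for T
  proof (rule gm_zero)
    show "T \<in> \<T>" using that G by blast
    then show "w v = a" if "v \<in> verts T" for v
      using that \<open>T \<in> G - G'\<close> vertsD(1) by (intro core) (auto simp: G'_def not_less)
  qed
  have cnt: "(\<Sum>T\<in>G'. h (xT T)) \<le> 2 ^ N\<Lambda> (0 + dmax) * \<delta>'"
    if h: "\<And>x. h x \<ge> 0" "\<And>F. finite F \<Longrightarrow> sum h F \<le> \<delta>'" for h :: "int^'n \<Rightarrow> real" and \<delta>'
  proof -
    have "(\<Sum>T\<in>G'. h (xT T)) = (\<Sum>x\<in>xT ` G'. \<Sum>T\<in>{T\<in>G'. xT T = x}. h (xT T))"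
      using G'(1) by (rule sum.image_gen)
    also have "\<dots> \<le> (\<Sum>x\<in>xT ` G'. 2 ^ N\<Lambda> (0 + dmax) * h x)"
    proof (rule sum_mono)
      fix x
      have "{T\<in>G'. xT T = x} \<subseteq> {T\<in>\<T>. T \<inter> cball (iota A x) 0 \<noteq> {}}"
      proof clarify
        fix T assume T: "T \<in> G'"
        then have "T \<in> \<T>" using G G' by blast
        moreover have "iota A (xT T) \<in> T" using vertsD(2)[OF \<open>T \<in> \<T>\<close> xT[OF T]] .
        ultimately show "T \<in> \<T> \<and> T \<inter> cball (iota A (xT T)) 0 \<noteq> {}" by auto
      qed
      then have "card {T\<in>G'. xT T = x} \<le> 2 ^ N\<Lambda> (0 + dmax)"
        using card_mono[OF near_elements(1)] near_elements(2)[of "iota A x" 0] order_trans by blast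
      then have "real (card {T\<in>G'. xT T = x}) \<le> real (2 ^ N\<Lambda> (0 + dmax))" by (rule of_nat_mono)
      then have "real (card {T\<in>G'. xT T = x}) \<le> 2 ^ N\<Lambda> (0 + dmax)" by simp
      then show "(\<Sum>T\<in>{T\<in>G'. xT T = x}. h (xT T)) \<le> 2 ^ N\<Lambda> (0 + dmax) * h x"
        using h(1) by (simp add: mult_right_mono)
    qed
    also have "\<dots> \<le> 2 ^ N\<Lambda> (0 + dmax) * \<delta>'"
      unfolding sum_distrib_left[symmetric] using G'(1) h(2) by (intro mult_left_mono) auto
    finally show ?thesis .
  qed
  have "(\<Sum>T\<in>G. (norm (gm w T))\<^sup>2) = (\<Sum>T\<in>G'. (norm (gm w T))\<^sup>2)"
    using G G' zero by (intro sum.mono_neutral_right) auto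
  also have "\<dots> \<le> (\<Sum>T\<in>G'. (2 * Cgm)\<^sup>2 * Q (xT T))" by (intro sum_mono g)
  also have "\<dots> = (2 * Cgm)\<^sup>2 * path_const TYPE('n) mu * (\<Sum>y\<in>cube mu. \<Sum>T\<in>G'. grad_sq (lat w) (xT T + y))"
    unfolding Q_def sum_distrib_left[symmetric] by (subst sum.swap) simp
  also have "\<dots> \<le> (2 * Cgm)\<^sup>2 * path_const TYPE('n) mu * (\<Sum>y\<in>(cube mu :: (int^'n) set). 2 ^ N\<Lambda> (0 + dmax) * \<delta>)"
  proof (intro mult_left_mono sum_mono cnt)
    fix y :: "int^'n" and F :: "(int^'n) set" assume "finite F"
    then show "(\<Sum>x\<in>F. grad_sq (lat w) (x + y)) \<le> \<delta>"
      using \<delta>[of "(\<lambda>x. x + y) ` F"] by (simp add: sum.reindex inj_on_def)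
  qed (use path_const_nonneg[where 'n = 'n, of mu] in auto)
  finally show ?thesis by (simp add: Kup_def mult_ac)
qed

text \<open>Transfers \<open>finsupp_approximation\<close> to the sites. In the ball of radius
  \<open>R\<close>, which contains the core, \<open>uN\<close> is \<open>u - a\<close> at all sites,
  lattice points or not; outside it is the lattice function \<open>w\<close>. The choice of
  \<open>M\<close> makes both descriptions agree at the lattice points of the ball.\<close>

lemma finsupp_approx_W12:
  assumes u: "u \<in> W_12 \<Lambda> \<T>" and "\<epsilon> > 0"
  shows "\<exists>uN a. finite {l\<in>\<Lambda>. uN l \<noteq> 0} \<and> uN \<in> W_12 \<Lambda> \<T> \<and> (\<forall>l\<in>\<Lambda>. norm l \<le> R1 \<longrightarrow> uN l = u l - a) \<and>
     (\<lambda>x. uN x - u x) \<in> W_12 \<Lambda> \<T> \<and> W_12_seminorm \<Lambda> \<T> (\<lambda>x. uN x - u x) \<le> \<epsilon>"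
proof -
  define R where "R = max R1 (Rdef + dmax)"
  define \<delta> where "\<delta> = \<epsilon>\<^sup>2 / (vmax * Kup + 1)"
  have vK: "vmax * Kup + 1 > 0" using Kup_nonneg by (simp add: vmax_def add_nonneg_pos)
  have \<delta>: "\<delta> > 0" using assms(2) vK by (simp add: \<delta>_def)
  obtain M where M: "{x. norm (iota A x) \<le> R} \<subseteq> cube M" using exists_cube[OF finite_iota_ball] by blast
  obtain w a where w: "finsupp w" "\<forall>x\<in>cube M. w x = lat u x - a"
    "\<forall>F. finite F \<longrightarrow> (\<Sum>x\<in>F. grad_sq (\<lambda>x. lat u x - w x) x) \<le> \<delta>"
    using finsupp_approximation[OF lattice_summable[OF u] \<delta>, of M] by blast
  define uN where "uN l = (if norm l \<le> R then u l - a else w (inv (iota A) l))" for l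
  let ?z = "\<lambda>x. uN x - u x"
  have zlat: "lat ?z x = (-1) *\<^sub>R (lat u x - w x)" for x
  proof (cases "norm (iota A x) \<le> R")
    case True
    then have "x \<in> cube M" using M by blast
    then show ?thesis using True w(2) by (simp add: uN_def)
  qed (simp add: uN_def inv_f_f[OF iota_inj])
  have gz: "grad_sq (lat ?z) x = grad_sq (\<lambda>x. lat u x - w x) x" for x
  proof -
    have "norm (ldiff (axis i 1) (lat ?z) x) = norm (ldiff (axis i 1) (\<lambda>x. lat u x - w x) x)" for i
      unfolding ldiff_def zlat scaleR_diff_right[symmetric] by (simp add: norm_minus_commute)
    then show ?thesis by (simp add: grad_sq_def)
  qed
  have zc: "?z l = - a" if "norm l \<le> R" for l using that by (simp add: uN_def)
  have K: "(\<Sum>T\<in>G. (norm (gm ?z T))\<^sup>2) \<le> Kup * \<delta>" if "finite G" "G \<subseteq> \<T>" for G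
  proof (rule lattice_upper[where ?R1.0 = R and a = "- a"])
    show "(\<Sum>x\<in>F. grad_sq (lat ?z) x) \<le> \<delta>" if "finite F" for F using w(3) that by (simp add: gz)
  qed (use that zc in \<open>auto simp: R_def\<close>)
  have zW: "?z \<in> W_12 \<Lambda> \<T>" and zn: "(W_12_seminorm \<Lambda> \<T> ?z)\<^sup>2 \<le> vmax * (Kup * \<delta>)"
    using W_12_upper[of ?z "Kup * \<delta>"] K by blast+
  have "(W_12_seminorm \<Lambda> \<T> ?z)\<^sup>2 \<le> \<epsilon>\<^sup>2"
  proof -
    have "vmax * (Kup * \<delta>) = \<epsilon>\<^sup>2 * ((vmax * Kup) / (vmax * Kup + 1))" by (simp add: \<delta>_def)
    also have "\<dots> \<le> \<epsilon>\<^sup>2 * 1" using vK by (intro mult_left_mono) auto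
    finally show ?thesis using zn by simp
  qed
  then have "W_12_seminorm \<Lambda> \<T> ?z \<le> \<epsilon>" by (rule power2_le_imp_le) (use assms(2) in simp)
  moreover have "finite {l\<in>\<Lambda>. uN l \<noteq> 0}"
  proof (rule finite_subset)
    show "{l\<in>\<Lambda>. uN l \<noteq> 0} \<subseteq> (\<Lambda> \<inter> cball 0 R) \<union> iota A ` {x. w x \<noteq> 0}"
    proof
      fix l assume l: "l \<in> {l\<in>\<Lambda>. uN l \<noteq> 0}"
      show "l \<in> (\<Lambda> \<inter> cball 0 R) \<union> iota A ` {x. w x \<noteq> 0}"
      proof (cases "norm l \<le> R")
        case False
        then have "norm l \<ge> Rdef" using dmax(1) by (simp add: R_def)
        then obtain x where "l = iota A x" using \<Lambda>_lattice l by blast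
        then show ?thesis using l False by (auto simp: uN_def inv_f_f[OF iota_inj])
      qed (use l in auto)
    qed
    show "finite ((\<Lambda> \<inter> cball 0 R) \<union> iota A ` {x. w x \<noteq> 0})"
      using \<Lambda>_ball(1)[of 0 R] w(1) by (simp add: finsupp_def)
  qed
  moreover have "uN \<in> W_12 \<Lambda> \<T>" using W_12_lin[OF zW u, of 1 1] by simp
  ultimately show ?thesis using zW by (intro exI[of _ uN] exI[of _ a]) (auto simp: uN_def R_def)
qed

end

subsection \<open>The equilibrium equation and stability in terms of the site potentials\<close>

abbreviation "site_strain u l \<equiv> (\<lambda>\<rho>. fdiff \<rho> u l)"

lemma stencil_norm_zero: "(\<And>\<rho>. \<rho> \<in> S \<Longrightarrow> g \<rho> = 0) \<Longrightarrow> stencil_norm S g = 0"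
  by (simp add: stencil_norm_def L2_set_def)

context point_defect
begin

lemma finite_stencil: "l \<in> \<Lambda> \<Longrightarrow> finite (\<R> l)"
proof -
  assume l: "l \<in> \<Lambda>"
  have "\<R> l \<subseteq> (\<lambda>m. m - l) ` (\<Lambda> \<inter> cball l rcut)"
  proof
    fix \<rho> assume "\<rho> \<in> \<R> l"
    then have "norm \<rho> < rcut" "l + \<rho> \<in> \<Lambda>" using stencil[OF l] by auto
    then show "\<rho> \<in> (\<lambda>m. m - l) ` (\<Lambda> \<inter> cball l rcut)"
      by (intro image_eqI[of _ _ "l + \<rho>"]) (auto simp: dist_norm)
  qed
  then show ?thesis using \<Lambda>_ball(1) finite_subset by blast
qed

lemma finsupp_W_12:
  assumes fin: "finite {l\<in>\<Lambda>. v l \<noteq> 0}" shows "v \<in> W_12 \<Lambda> \<T>"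
proof (rule W_12_upper(1))
  define G0 where "G0 = (\<Union>l\<in>{l\<in>\<Lambda>. v l \<noteq> 0}. {T\<in>\<T>. T \<inter> cball l 0 \<noteq> {}})"
  have G0: "finite G0" unfolding G0_def using fin near_elements(1) by blast
  have zero: "gm v T = 0" if T: "T \<in> \<T>" "T \<notin> G0" for T
  proof (rule gm_zero[OF T(1), of _ 0])
    fix x assume "x \<in> verts T"
    then have "x \<in> \<Lambda>" "x \<in> T" using vertsD[OF T(1)] by blast+
    then show "v x = 0" using T by (auto simp: G0_def)
  qed
  fix G assume G: "finite G" "G \<subseteq> \<T>"
  have "(\<Sum>T\<in>G. (norm (gm v T))\<^sup>2) = (\<Sum>T\<in>G \<inter> G0. (norm (gm v T))\<^sup>2)"
    using G zero by (intro sum.mono_neutral_right) auto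
  also have "\<dots> \<le> (\<Sum>T\<in>G0. (norm (gm v T))\<^sup>2)" using G0 by (intro sum_mono2) auto
  finally show "(\<Sum>T\<in>G. (norm (gm v T))\<^sup>2) \<le> (\<Sum>T\<in>G0. (norm (gm v T))\<^sup>2)" .
qed

text \<open>The choice depends only on the stencil and the potential, so all sites outside the core
  receive the same derivatives \<open>DH\<close>; see \<open>DV_far\<close>.\<close>

definition "DV l = (SOME D. Ck_derivs k UNIV (stencil_norm (\<R> l)) (V l) D)"
definition "DH = (SOME D. Ck_derivs k UNIV (stencil_norm \<R>h) Vh D)"

lemma site_functional:
  assumes "l \<in> \<Lambda>" shows "Ck_functional_triangle k UNIV (stencil_norm (\<R> l)) (V l) (DV l)"
proof -
  have "\<exists>D. Ck_derivs k UNIV (stencil_norm (\<R> l)) (V l) D"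
    using smooth[OF assms] unfolding Ck_on_iff .
  then show ?thesis unfolding DV_def by (rule stencil_norm_Ck[OF someI_ex])
qed

lemma DV_far: "l \<in> \<Lambda> \<Longrightarrow> norm l \<ge> Rdef \<Longrightarrow> DV l = DH"
  by (simp add: DV_def DH_def stencil_outside potential_outside)

lemma exists_far: "\<exists>z. norm (iota A z) \<ge> r"
proof -
  define z :: "int^'n" where "z = (\<chi> j. \<lceil>\<bar>r\<bar> / alo\<rceil>)"
  fix i :: 'n
  have "\<lceil>\<bar>r\<bar> / alo\<rceil> \<le> supn z" using abs_le_supn[of z i] by (simp add: z_def)
  then have "\<bar>r\<bar> / alo \<le> real_of_int (supn z)" by linarith
  then have "r \<le> alo * real_of_int (supn z)" using alo(1) by (simp add: pos_divide_le_eq mult.commute)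
  then show ?thesis using alo(2) order_trans by blast
qed

lemma hom_functional: "Ck_functional_triangle k UNIV (stencil_norm \<R>h) Vh DH"
proof -
  obtain z where z: "norm (iota A z) \<ge> Rdef" using exists_far by blast
  show ?thesis
    using site_functional[OF lattice_\<Lambda>[OF z]] DV_far[OF lattice_\<Lambda>[OF z] z]
      stencil_outside[OF lattice_\<Lambda>[OF z] z] potential_outside[OF lattice_\<Lambda>[OF z] z] by simp
qed

lemma site_potential_zero:
  assumes l: "l \<in> \<Lambda>" and g: "\<And>\<rho>. \<rho> \<in> \<R> l \<Longrightarrow> g \<rho> = 0"
  shows "V l g = 0"
proof -
  interpret Ck_functional_triangle k UNIV "stencil_norm (\<R> l)" "V l" "DV l" by (rule site_functional[OF l])
  have "DV l 0 g [] = DV l 0 (\<lambda>_. 0) []"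
    using k_ge g by (intro D_cong) (auto intro: stencil_norm_zero)
  then show ?thesis using D_zero[of g] D_zero[of "\<lambda>_. 0"] normalised[OF l] by simp
qed

end

section \<open>Variations of the energy as finite sums over sites\<close>

locale equilibrium_state = point_defect A Rdef rcut \<Lambda> \<T> \<R> \<R>h V Vh k
  for A :: "real^'n^'n" and Rdef rcut :: real
    and \<Lambda> :: "(real^'n) set" and \<T> :: "(real^'n) set set"
    and \<R> :: "real^'n \<Rightarrow> (real^'n) set" and \<R>h :: "(real^'n) set"
    and V :: "real^'n \<Rightarrow> (real^'n \<Rightarrow> real^'n) \<Rightarrow> real" and Vh :: "(real^'n \<Rightarrow> real^'n) \<Rightarrow> real"
    and k :: nat +
  fixes E :: "(real^'n \<Rightarrow> real^'n) \<Rightarrow> real" and u :: "real^'n \<Rightarrow> real^'n"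
  assumes energy: "energy_extension \<Lambda> \<T> V k E" and stable: "strongly_stable \<Lambda> \<T> E u"
begin

definition "DE = (SOME D. Ck_derivs k (W_12 \<Lambda> \<T>) (W_12_seminorm \<Lambda> \<T>) E D)"

sublocale en: Ck_functional k "W_12 \<Lambda> \<T>" "W_12_seminorm \<Lambda> \<T>" E DE
proof (rule energy_Ck)
  have "\<exists>D. Ck_derivs k (W_12 \<Lambda> \<T>) (W_12_seminorm \<Lambda> \<T>) E D"
    using energy unfolding energy_extension_def Ck_on_iff by (rule conjunct2)
  then show "Ck_derivs k (W_12 \<Lambda> \<T>) (W_12_seminorm \<Lambda> \<T>) E DE"
    unfolding DE_def by (rule someI_ex)
qed

lemma u_W_12: "u \<in> W_12 \<Lambda> \<T>" using stable by (simp add: strongly_stable_def)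

abbreviation "fin_supp v \<equiv> finite {l\<in>\<Lambda>. v l \<noteq> 0}"

definition "carries Q v \<longleftrightarrow> finite Q \<and> Q \<subseteq> \<Lambda> \<and> (\<forall>l\<in>\<Lambda> - Q. \<forall>\<rho>\<in>\<R> l. fdiff \<rho> v l = 0)"

lemma carries_ex:
  assumes "fin_supp v" shows "carries (\<Union>m\<in>{l\<in>\<Lambda>. v l \<noteq> 0}. \<Lambda> \<inter> cball m rcut) v"
  unfolding carries_def
proof (intro conjI ballI)
  let ?Q = "\<Union>m\<in>{l\<in>\<Lambda>. v l \<noteq> 0}. \<Lambda> \<inter> cball m rcut"
  show "finite ?Q" using assms \<Lambda>_ball(1) by blast
  show "?Q \<subseteq> \<Lambda>" by blast
  fix l \<rho> assume l: "l \<in> \<Lambda> - ?Q" and \<rho>: "\<rho> \<in> \<R> l"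
  have lr: "l + \<rho> \<in> \<Lambda>" "norm \<rho> < rcut" using stencil[of l] l \<rho> by auto
  have "v (l + \<rho>) = 0"
  proof (rule ccontr)
    assume "v (l + \<rho>) \<noteq> 0"
    moreover have "l \<in> \<Lambda> \<inter> cball (l + \<rho>) rcut" using lr l by (simp add: dist_norm)
    ultimately show False using lr(1) l by blast
  qed
  moreover have "v l = 0"
  proof (rule ccontr)
    assume "v l \<noteq> 0"
    moreover have "l \<in> \<Lambda> \<inter> cball l rcut" using l rcut_pos by simp
    ultimately show False using l by blast
  qed
  ultimately show "fdiff \<rho> v l = 0" by (simp add: fdiff_def)
qed

lemma site_strain_add_scale: "site_strain (\<lambda>x. w x + t *\<^sub>R v x) l = (\<lambda>\<rho>. fdiff \<rho> w l + t *\<^sub>R fdiff \<rho> v l)"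
  by (simp add: fdiff_def algebra_simps)

lemma energy_finite_sum:
  assumes w: "fin_supp w" and Q: "carries Q w"
  shows "E w = (\<Sum>l\<in>Q. V l (site_strain w l))"
proof -
  have "E w = infsum (\<lambda>l. V l (site_strain w l)) \<Lambda>"
    using energy finsupp_W_c[OF w] by (simp add: energy_extension_def atomistic_energy_def)
  also have "\<dots> = infsum (\<lambda>l. V l (site_strain w l)) Q"
    using Q site_potential_zero unfolding carries_def by (intro infsum_cong_neutral) auto
  also have "\<dots> = (\<Sum>l\<in>Q. V l (site_strain w l))" using Q by (simp add: carries_def)
  finally show ?thesis .
qed

lemma site_derivative:
  assumes "l \<in> \<Lambda>" "j < k" "length vs = j"
  shows "((\<lambda>t. DV l j (site_strain (\<lambda>x. w x + t *\<^sub>R v x) l) vs) has_real_derivative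
    DV l (Suc j) (site_strain (\<lambda>x. w x + t *\<^sub>R v x) l) (site_strain v l # vs)) (at t)"
proof -
  interpret s: Ck_functional_triangle k UNIV "stencil_norm (\<R> l)" "V l" "DV l" by (rule site_functional[OF assms(1)])
  show ?thesis
    using s.D_line_derivative[OF assms(2), of "site_strain w l" "site_strain v l" vs t] assms(3)
    unfolding site_strain_add_scale by simp
qed

lemma site_zero:
  assumes "l \<in> \<Lambda>" "j < k" "length vs = Suc j" "v \<in> set vs" "\<And>\<rho>. \<rho> \<in> \<R> l \<Longrightarrow> v \<rho> = 0"
  shows "DV l (Suc j) g vs = 0"
proof -
  interpret s: Ck_functional_triangle k UNIV "stencil_norm (\<R> l)" "V l" "DV l" by (rule site_functional[OF assms(1)])
  obtain M where M: "\<And>vs. vs \<in> lists UNIV \<Longrightarrow> length vs = Suc j \<Longrightarrow>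
      \<bar>DV l (Suc j) g vs\<bar> \<le> M * prod_list (map (stencil_norm (\<R> l)) vs)"
    by (rule s.D_bound[of "Suc j" g]) (use assms(2) in auto)
  have "stencil_norm (\<R> l) v = 0" using assms(5) by (rule stencil_norm_zero)
  then have "0 \<in> set (map (stencil_norm (\<R> l)) vs)" using assms(4) by force
  then have "prod_list (map (stencil_norm (\<R> l)) vs) = 0" by (simp add: prod_list_zero_iff)
  then show ?thesis using M[of vs] assms(3) by simp
qed

lemma site_cong:
  assumes "l \<in> \<Lambda>" "j < k" "length vs = j" "\<And>\<rho>. \<rho> \<in> \<R> l \<Longrightarrow> g' \<rho> = g \<rho>"
  shows "DV l j g' vs = DV l j g vs"
proof -
  interpret s: Ck_functional_triangle k UNIV "stencil_norm (\<R> l)" "V l" "DV l" by (rule site_functional[OF assms(1)])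
  show ?thesis using assms by (intro s.D_cong) (auto intro: stencil_norm_zero)
qed

lemma fin_supp_add_scale:
  fixes v w :: "real^'n \<Rightarrow> real^'n"
  shows "fin_supp w \<Longrightarrow> fin_supp v \<Longrightarrow> fin_supp (\<lambda>x. w x + t *\<^sub>R v x)"
  by (rule finite_subset[of _ "{l\<in>\<Lambda>. w l \<noteq> 0} \<union> {l\<in>\<Lambda>. v l \<noteq> 0}"]) auto

lemma carries_add_scale: "carries Q w \<Longrightarrow> carries Q v \<Longrightarrow> carries Q (\<lambda>x. w x + t *\<^sub>R v x)"
  unfolding carries_def site_strain_add_scale[THEN fun_cong] by simp

text \<open>Along the line the energy is a finite sum over a set \<open>Q'\<close> that carries both
  functions, and it is differentiated term by term. The terms outside \<open>Q\<close> vanish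
  afterwards because \<open>v\<close> has no strain there.\<close>

lemma energy_derivative1:
  assumes w: "fin_supp w" and v: "fin_supp v" and Q: "carries Q v"
  shows "DE 1 w [v] = (\<Sum>l\<in>Q. DV l 1 (site_strain w l) [site_strain v l])"
proof -
  define Q' where "Q' = Q \<union> (\<Union>m\<in>{l\<in>\<Lambda>. w l \<noteq> 0}. \<Lambda> \<inter> cball m rcut)"
  have Q': "carries Q' w" "carries Q' v"
    using carries_ex[OF w] Q unfolding Q'_def carries_def by blast+
  have fQ': "finite Q'" "Q' \<subseteq> \<Lambda>" using Q' by (auto simp: carries_def)
  have "E (\<lambda>x. w x + t *\<^sub>R v x) = (\<Sum>l\<in>Q'. DV l 0 (site_strain (\<lambda>x. w x + t *\<^sub>R v x) l) [])" for t
  proof -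
    have "E (\<lambda>x. w x + t *\<^sub>R v x) = (\<Sum>l\<in>Q'. V l (site_strain (\<lambda>x. w x + t *\<^sub>R v x) l))"
      by (intro energy_finite_sum fin_supp_add_scale carries_add_scale w v Q')
    also have "\<dots> = (\<Sum>l\<in>Q'. DV l 0 (site_strain (\<lambda>x. w x + t *\<^sub>R v x) l) [])"
    proof (rule sum.cong[OF refl])
      fix l assume "l \<in> Q'"
      then have l: "l \<in> \<Lambda>" using fQ' by blast
      interpret s: Ck_functional_triangle k UNIV "stencil_norm (\<R> l)" "V l" "DV l" by (rule site_functional[OF l])
      show "V l (site_strain (\<lambda>x. w x + t *\<^sub>R v x) l) = DV l 0 (site_strain (\<lambda>x. w x + t *\<^sub>R v x) l) []"
        using s.D_zero[of "site_strain (\<lambda>x. w x + t *\<^sub>R v x) l"] by simp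
    qed
    finally show ?thesis .
  qed
  moreover have "((\<lambda>t. \<Sum>l\<in>Q'. DV l 0 (site_strain (\<lambda>x. w x + t *\<^sub>R v x) l) []) has_real_derivative
     (\<Sum>l\<in>Q'. DV l (Suc 0) (site_strain (\<lambda>x. w x + 0 *\<^sub>R v x) l) [site_strain v l])) (at 0)"
    using fQ' k_ge by (intro DERIV_sum site_derivative) auto
  ultimately have "((\<lambda>t. E (\<lambda>x. w x + t *\<^sub>R v x)) has_real_derivative
     (\<Sum>l\<in>Q'. DV l 1 (site_strain w l) [site_strain v l])) (at 0)" by simp
  moreover have "((\<lambda>t. E (\<lambda>x. w x + t *\<^sub>R v x)) has_real_derivative DE 1 w [v]) (at 0)"
    using en.F_line_derivative[of w v 0] k_ge finsupp_W_12[OF w] finsupp_W_12[OF v] by simp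
  ultimately have "DE 1 w [v] = (\<Sum>l\<in>Q'. DV l 1 (site_strain w l) [site_strain v l])"
    using DERIV_unique by blast
  also have "\<dots> = (\<Sum>l\<in>Q. DV l 1 (site_strain w l) [site_strain v l])"
    using fQ' Q k_ge unfolding carries_def
    by (intro sum.mono_neutral_right) (auto simp: Q'_def intro!: site_zero[of _ 0, simplified])
  finally show ?thesis .
qed

lemma energy_derivative2:
  assumes w: "fin_supp w" and v: "fin_supp v" and Q: "carries Q v"
  shows "DE 2 w [v, v] = (\<Sum>l\<in>Q. DV l 2 (site_strain w l) [site_strain v l, site_strain v l])"
proof -
  have fQ: "finite Q" "Q \<subseteq> \<Lambda>" using Q by (auto simp: carries_def)
  have "DE 1 (\<lambda>x. w x + t *\<^sub>R v x) [v] = (\<Sum>l\<in>Q. DV l 1 (site_strain (\<lambda>x. w x + t *\<^sub>R v x) l) [site_strain v l])" for t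
    by (intro energy_derivative1 fin_supp_add_scale w v Q)
  moreover have "((\<lambda>t. \<Sum>l\<in>Q. DV l 1 (site_strain (\<lambda>x. w x + t *\<^sub>R v x) l) [site_strain v l]) has_real_derivative
     (\<Sum>l\<in>Q. DV l (Suc 1) (site_strain (\<lambda>x. w x + 0 *\<^sub>R v x) l) [site_strain v l, site_strain v l])) (at 0)"
    using fQ k_ge by (intro DERIV_sum site_derivative) auto
  ultimately have "((\<lambda>t. DE 1 (\<lambda>x. w x + t *\<^sub>R v x) [v]) has_real_derivative
     (\<Sum>l\<in>Q. DV l 2 (site_strain w l) [site_strain v l, site_strain v l])) (at 0)" by (simp add: numeral_2_eq_2)
  moreover have "((\<lambda>t. DE 1 (\<lambda>x. w x + t *\<^sub>R v x) [v]) has_real_derivative DE 2 w [v, v]) (at 0)"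
    using en.D_line_derivative[of 1 w v "[v]" 0] k_ge finsupp_W_12[OF w] finsupp_W_12[OF v]
    by (simp add: numeral_2_eq_2)
  ultimately show ?thesis using DERIV_unique by blast
qed

text \<open>The approximations \<open>uN\<close> of \<open>u\<close> differ from \<open>u\<close> by a constant near \<open>Q\<close>, so the right-hand sides
  do not change in the limit.\<close>

lemma variation_limit:
  assumes j: "0 < j" "j < k" and vs: "vs \<in> lists (W_12 \<Lambda> \<T>)" "length vs = j" and Q: "finite Q" "Q \<subseteq> \<Lambda>"
    and eq: "\<And>w. fin_supp w \<Longrightarrow> DE j w vs = (\<Sum>l\<in>Q. DV l j (site_strain w l) (gs l))"
    and gs: "\<And>l. length (gs l) = j"
  shows "DE j u vs = (\<Sum>l\<in>Q. DV l j (site_strain u l) (gs l))"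
proof -
  let ?p = "W_12_seminorm \<Lambda> \<T>" and ?S = "\<Sum>l\<in>Q. DV l j (site_strain u l) (gs l)"
  let ?P = "prod_list (map ?p vs)"
  have P0: "?P \<ge> 0" by (rule en.prod_list_p_nonneg)
  obtain \<delta> M where \<delta>: "\<delta> > 0" "M \<ge> 0" "\<And>w vs. w \<in> W_12 \<Lambda> \<T> \<Longrightarrow> ?p w < \<delta> \<Longrightarrow> vs \<in> lists (W_12 \<Lambda> \<T>) \<Longrightarrow> length vs = j \<Longrightarrow>
    \<bar>DE j (\<lambda>x. u x + w x) vs - DE j u vs\<bar> \<le> M * ?p w * prod_list (map ?p vs)"
    by (rule en.D_lipschitz[OF j(2) u_W_12], rule that, assumption+)
  obtain R0 where R0: "\<forall>l\<in>Q. norm l \<le> R0" using finite_imp_bounded[OF Q(1)] by (auto simp: bounded_iff)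
  have "\<bar>?S - DE j u vs\<bar> \<le> 0 + \<epsilon>" if \<epsilon>: "\<epsilon> > 0" for \<epsilon>
  proof -
    define e where "e = min (\<delta> / 2) (\<epsilon> / (M * ?P + 1))"
    have MP: "M * ?P + 1 > 0" using \<delta>(2) P0 by (simp add: add_nonneg_pos)
    have e: "e > 0" "e < \<delta>" "e * (M * ?P) \<le> \<epsilon>"
    proof -
      show "e > 0" using \<delta>(1) \<epsilon> MP by (simp add: e_def)
      have "e \<le> \<delta> / 2" unfolding e_def by (rule min.cobounded1)
      then show "e < \<delta>" using \<delta>(1) by linarith
      have "e * (M * ?P) \<le> e * (M * ?P + 1)" using \<open>e > 0\<close> by simp
      also have "\<dots> \<le> \<epsilon> / (M * ?P + 1) * (M * ?P + 1)"
        using MP by (intro mult_right_mono) (auto simp: e_def)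
      also have "\<dots> = \<epsilon>" using MP by simp
      finally show "e * (M * ?P) \<le> \<epsilon>" .
    qed
    obtain uN a where uN: "fin_supp uN" "\<forall>l\<in>\<Lambda>. norm l \<le> R0 + rcut \<longrightarrow> uN l = u l - a"
      "(\<lambda>x. uN x - u x) \<in> W_12 \<Lambda> \<T>" "?p (\<lambda>x. uN x - u x) \<le> e"
      using finsupp_approx_W12[OF u_W_12 e(1), of "R0 + rcut"] by blast
    have "DE j uN vs = (\<Sum>l\<in>Q. DV l j (site_strain uN l) (gs l))" by (rule eq[OF uN(1)])
    also have "\<dots> = ?S"
    proof (rule sum.cong[OF refl])
      fix l assume lQ: "l \<in> Q"
      then have l: "l \<in> \<Lambda>" using Q by blast
      show "DV l j (site_strain uN l) (gs l) = DV l j (site_strain u l) (gs l)"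
      proof (rule site_cong[OF l j(2) gs])
        fix \<rho> assume "\<rho> \<in> \<R> l"
        then have lr: "l + \<rho> \<in> \<Lambda>" "norm \<rho> < rcut" using stencil[OF l] by auto
        have "norm (l + \<rho>) \<le> R0 + rcut" "norm l \<le> R0 + rcut"
          using R0 lQ lr(2) norm_triangle_ineq[of l \<rho>] rcut_pos by force+
        then show "fdiff \<rho> uN l = fdiff \<rho> u l" using uN(2) l lr(1) by (simp add: fdiff_def)
      qed
    qed
    finally have S: "DE j uN vs = ?S" .
    have "\<bar>DE j (\<lambda>x. u x + (uN x - u x)) vs - DE j u vs\<bar> \<le> M * ?p (\<lambda>x. uN x - u x) * ?P"
      using uN(3,4) e(2) vs by (intro \<delta>(3)) auto
    also have "\<dots> \<le> M * e * ?P" using uN(4) \<delta>(2) P0 by (intro mult_right_mono mult_left_mono)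
    also have "\<dots> \<le> \<epsilon>" using e(3) by (simp add: mult_ac)
    finally show ?thesis using S by simp
  qed
  then have "\<bar>?S - DE j u vs\<bar> \<le> 0" by (rule field_le_epsilon)
  then show ?thesis by simp
qed

lemma equilibrium_equation:
  assumes v: "fin_supp v" and Q: "carries Q v"
  shows "(\<Sum>l\<in>Q. DV l 1 (site_strain u l) [site_strain v l]) = 0"
proof -
  have vW: "v \<in> W_12 \<Lambda> \<T>" by (rule finsupp_W_12[OF v])
  have "DE 1 u [v] = (\<Sum>l\<in>Q. DV l 1 (site_strain u l) [site_strain v l])"
    by (rule variation_limit) (use Q k_ge vW energy_derivative1[OF _ v Q] in \<open>auto simp: carries_def\<close>)
  moreover have "DE 1 u [v] = first_variation E u v"
    using en.first_variation_eq[of u v] u_W_12 vW k_ge by simp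
  moreover have "first_variation E u v = 0" using stable vW by (simp add: strongly_stable_def)
  ultimately show ?thesis by simp
qed

lemma stability_sites:
  obtains c where "c > 0" "\<And>v Q. fin_supp v \<Longrightarrow> carries Q v \<Longrightarrow>
    c * (W_12_seminorm \<Lambda> \<T> v)\<^sup>2 \<le> (\<Sum>l\<in>Q. DV l 2 (site_strain u l) [site_strain v l, site_strain v l])"
proof -
  obtain c where c: "c > 0" "\<forall>v\<in>W_c \<Lambda> \<T>. second_variation E u v \<ge> c * (W_12_seminorm \<Lambda> \<T> v)\<^sup>2"
    using stable by (auto simp: strongly_stable_def)
  have "c * (W_12_seminorm \<Lambda> \<T> v)\<^sup>2 \<le> (\<Sum>l\<in>Q. DV l 2 (site_strain u l) [site_strain v l, site_strain v l])"
    if v: "fin_supp v" and Q: "carries Q v" for v Q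
  proof -
    have vW: "v \<in> W_12 \<Lambda> \<T>" by (rule finsupp_W_12[OF v])
    have "DE 2 u [v, v] = (\<Sum>l\<in>Q. DV l 2 (site_strain u l) [site_strain v l, site_strain v l])"
      by (rule variation_limit) (use Q k_ge vW energy_derivative2[OF _ v Q] in \<open>auto simp: carries_def\<close>)
    moreover have "DE 2 u [v, v] = second_variation E u v"
      using en.second_variation_eq[of u v] u_W_12 vW k_ge by simp
    ultimately show ?thesis using c(2)[rule_format, OF finsupp_W_c[OF v]] by linarith
  qed
  then show thesis using that c(1) by blast
qed

end

subsection \<open>The homogeneous lattice operator\<close>

context Ck_functional
begin

text \<open>Companion of \<open>D_cong\<close> for the directions: by boundedness a direction of
  semi-norm zero annihilates the multilinear form.\<close>

lemma D_arg_cong: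
  assumes "j \<le> k" "u \<in> W" "vs \<in> lists W" "length vs = j" "i < j" "w \<in> W" "p (\<lambda>x. w x - (vs ! i) x) = 0"
  shows "D j u (vs[i := w]) = D j u vs"
proof -
  have vi: "vs ! i \<in> W" using assms by (metis in_listsD nth_mem)
  let ?d = "\<lambda>x. w x - (vs ! i) x"
  have d: "?d \<in> W" using W_diff[OF assms(6) vi] .
  obtain M where M: "\<And>vs. vs \<in> lists W \<Longrightarrow> length vs = j \<Longrightarrow> \<bar>D j u vs\<bar> \<le> M * prod_list (map p vs)"
    by (rule D_bound[OF assms(1,2)]) blast
  have "vs[i := ?d] \<in> lists W" using assms d by (auto simp: in_lists_conv_set dest: subsetD[OF set_update_subset_insert])
  then have "\<bar>D j u (vs[i := ?d])\<bar> \<le> M * prod_list (map p (vs[i := ?d]))" using assms by (intro M) auto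
  moreover have "0 \<in> set (map p (vs[i := ?d]))"
    using assms set_update_memI[of i vs ?d] by force
  then have "prod_list (map p (vs[i := ?d])) = 0" by (simp add: prod_list_zero_iff)
  ultimately have "D j u (vs[i := ?d]) = 0" by simp
  moreover have "D j u (vs[i := ?d]) = D j u (vs[i := w]) - D j u (vs[i := vs ! i])"
    using D_linear[of j u vs i w "vs ! i" 1 "-1"] assms vi by simp
  ultimately show ?thesis by simp
qed

end

lemma stn_sq_le: "(stn S g)\<^sup>2 \<le> real (card S) * (\<Sum>\<rho>\<in>S. (norm (g \<rho>))\<^sup>2)"
  unfolding stn_def using sum_squared_le_sum_of_squares[of "\<lambda>\<rho>. norm (g \<rho>)" S] by (simp add: mult.commute)

context point_defect
begin

sublocale hm: Ck_functional_triangle k UNIV "stencil_norm \<R>h" Vh DH by (rule hom_functional)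

definition "S = {z. iota A z \<in> \<R>h}"

text \<open>That the homogeneous stencil consists of lattice vectors is read off at a site so far
  out that it and its stencil neighbours are all lattice points.\<close>

lemma \<R>h_eq: "\<R>h = iota A ` S" and \<R>h_norm: "\<rho> \<in> \<R>h \<Longrightarrow> norm \<rho> < rcut" and finite_\<R>h: "finite \<R>h"
proof -
  obtain x where x: "norm (iota A x) \<ge> Rdef + rcut" using exists_far by blast
  have l: "iota A x \<in> \<Lambda>" "norm (iota A x) \<ge> Rdef" using x rcut_pos by (auto intro: lattice_\<Lambda>)
  have st: "\<rho> \<in> \<R>h \<Longrightarrow> norm \<rho> < rcut \<and> iota A x + \<rho> \<in> \<Lambda>" for \<rho>
    using stencil[OF l(1)] stencil_outside[OF l] by auto
  show "\<rho> \<in> \<R>h \<Longrightarrow> norm \<rho> < rcut" using st by blast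
  show "finite \<R>h" using finite_stencil[OF l(1)] stencil_outside[OF l] by simp
  have "\<rho> \<in> range (iota A)" if \<rho>: "\<rho> \<in> \<R>h" for \<rho>
  proof -
    have "norm (iota A x) \<le> norm (iota A x + \<rho>) + norm \<rho>"
      using norm_triangle_ineq4[of "iota A x + \<rho>" \<rho>] by simp
    then have "norm (iota A x + \<rho>) \<ge> Rdef" using x st[OF \<rho>] by linarith
    then obtain y where "iota A x + \<rho> = iota A y" using \<Lambda>_lattice st[OF \<rho>] by blast
    then have "\<rho> = iota A (y - x)" by (simp add: iota_diff algebra_simps)
    then show ?thesis by blast
  qed
  then show "\<R>h = iota A ` S" by (auto simp: S_def)
qed

lemma \<R>hE:
  assumes "\<rho> \<in> \<R>h" obtains z where "z \<in> S" "\<rho> = iota A z"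
proof -
  have "\<rho> \<in> iota A ` S" using \<R>h_eq assms by blast
  then show ?thesis using that by blast
qed

lemma finite_S: "finite S"
proof (rule finite_imageD)
  show "finite (iota A ` S)" using finite_\<R>h \<R>h_eq by simp
qed (rule inj_on_subset[OF iota_inj subset_UNIV])

lemma S_cube_ex: "\<exists>m\<ge>1. S \<subseteq> cube m"
proof -
  obtain r where "r \<ge> 0" "S \<subseteq> cube r" using exists_cube[OF finite_S] by blast
  then show ?thesis using cube_mono[of r "r + 1"] by (intro exI[of _ "r + 1"]) auto
qed

definition "mS = (SOME m. m \<ge> 1 \<and> S \<subseteq> cube m)"

lemma mS: "mS \<ge> 1" "S \<subseteq> cube mS"
  using someI_ex[OF S_cube_ex] unfolding mS_def by auto

text \<open>Carries a function on integer bonds to one on real vectors, the form that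
  \<open>DH\<close> expects. Off the lattice its values are arbitrary; those on \<open>\<R>h\<close>
  count.\<close>

definition lift :: "(int^'n \<Rightarrow> real^'n) \<Rightarrow> real^'n \<Rightarrow> real^'n" where
  "lift g \<rho> = g (inv (iota A) \<rho>)"

lemma lift_iota [simp]: "lift g (iota A z) = g z"
  by (simp add: lift_def inv_f_f[OF iota_inj])

lemma stencil_norm_lift: "stencil_norm \<R>h (lift g) \<le> stn S g"
proof -
  have "stencil_norm \<R>h (lift g) \<le> (\<Sum>\<rho>\<in>\<R>h. norm (lift g \<rho>))"
    unfolding stencil_norm_def by (rule L2_set_le_sum) simp
  also have "\<dots> = (\<Sum>z\<in>S. norm (lift g (iota A z)))"
    by (subst \<R>h_eq) (rule sum.reindex[unfolded o_def, OF inj_on_subset[OF iota_inj subset_UNIV]])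
  also have "\<dots> = stn S g" by (simp add: stn_def)
  finally show ?thesis .
qed

abbreviation "Dl v x \<equiv> lift (\<lambda>z. ldiff z v x)"

lemma site_strain_lat: "\<rho> \<in> \<R>h \<Longrightarrow> site_strain v (iota A x) \<rho> = Dl (lat v) x \<rho>"
  by (erule \<R>hE) (simp add: fdiff_def ldiff_def iota_add)

lemma DH_cong:
  assumes "j < k" "length vs = j" "\<And>\<rho>. \<rho> \<in> \<R>h \<Longrightarrow> g' \<rho> = g \<rho>"
  shows "DH j g' vs = DH j g vs"
proof (rule hm.D_cong[OF assms(1)])
  show "stencil_norm \<R>h (\<lambda>\<rho>. g' \<rho> - g \<rho>) = 0" by (rule stencil_norm_zero) (simp add: assms(3))
qed (use assms(2) in simp_all)

lemma DH_arg_cong: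
  assumes "j \<le> k" "length vs = j" "i < j" "\<And>\<rho>. \<rho> \<in> \<R>h \<Longrightarrow> v \<rho> = (vs ! i) \<rho>"
  shows "DH j g (vs[i := v]) = DH j g vs"
proof (rule hm.D_arg_cong[OF assms(1)])
  show "stencil_norm \<R>h (\<lambda>\<rho>. v \<rho> - (vs ! i) \<rho>) = 0" by (rule stencil_norm_zero) (simp add: assms(4))
qed (use assms(2,3) in simp_all)

lemma DV_lift1:
  assumes "norm (iota A x) \<ge> Rdef"
  shows "DV (iota A x) 1 (site_strain w (iota A x)) [site_strain v (iota A x)] = DH 1 (Dl (lat w) x) [Dl (lat v) x]"
proof -
  have k: "1 < k" "1 \<le> k" using k_ge by auto
  have "DH 1 (site_strain w (iota A x)) [site_strain v (iota A x)] = DH 1 (Dl (lat w) x) [site_strain v (iota A x)]"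
    by (rule DH_cong[OF k(1)]) (simp_all only: site_strain_lat, simp)
  also have "\<dots> = DH 1 (Dl (lat w) x) ([Dl (lat v) x][0 := site_strain v (iota A x)])" by simp
  also have "\<dots> = DH 1 (Dl (lat w) x) [Dl (lat v) x]"
  proof (rule DH_arg_cong[OF k(2)])
    fix \<rho> assume "\<rho> \<in> \<R>h"
    then show "site_strain v (iota A x) \<rho> = ([Dl (lat v) x] ! 0) \<rho>" by (simp only: nth_Cons_0 site_strain_lat)
  qed simp_all
  finally show ?thesis unfolding DV_far[OF lattice_\<Lambda>[OF assms] assms] .
qed

lemma DV_lift2:
  assumes "norm (iota A x) \<ge> Rdef"
  shows "DV (iota A x) 2 (site_strain w (iota A x)) [site_strain v (iota A x), site_strain v (iota A x)]
    = DH 2 (Dl (lat w) x) [Dl (lat v) x, Dl (lat v) x]"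
proof -
  let ?s = "site_strain v (iota A x)" and ?t = "Dl (lat v) x" and ?w = "Dl (lat w) x"
  have k: "2 < k" "2 \<le> k" using k_ge by auto
  have "DH 2 (site_strain w (iota A x)) [?s, ?s] = DH 2 ?w [?s, ?s]"
    by (rule DH_cong[OF k(1)]) (simp_all only: site_strain_lat, simp)
  also have "\<dots> = DH 2 ?w ([?t, ?s][0 := ?s])" by simp
  also have "\<dots> = DH 2 ?w [?t, ?s]"
  proof (rule DH_arg_cong[OF k(2)])
    fix \<rho> assume "\<rho> \<in> \<R>h"
    then show "?s \<rho> = ([?t, ?s] ! 0) \<rho>" by (simp only: nth_Cons_0 site_strain_lat)
  qed simp_all
  also have "\<dots> = DH 2 ?w ([?t, ?t][Suc 0 := ?s])" by simp
  also have "\<dots> = DH 2 ?w [?t, ?t]"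
  proof (rule DH_arg_cong[OF k(2)])
    fix \<rho> assume "\<rho> \<in> \<R>h"
    then show "?s \<rho> = ([?t, ?t] ! Suc 0) \<rho>" by (simp only: nth_Cons_0 nth_Cons_Suc site_strain_lat)
  qed simp_all
  finally show ?thesis unfolding DV_far[OF lattice_\<Lambda>[OF assms] assms] .
qed

abbreviation "H0 v w \<equiv> DH 2 (\<lambda>_. 0) [v, w]"

lemma H0_sym: "H0 v w = H0 w v" using k_ge by (intro hm.D2_sym) auto

lemma H0_lin: "H0 (\<lambda>x. a *\<^sub>R v x + b *\<^sub>R v' x) w = a * H0 v w + b * H0 v' w"
  using hm.D_hd_linear[of 1 "\<lambda>_. 0" "[w]" v v' a b] k_ge by (simp add: numeral_2_eq_2)

lemma H0_add: "H0 (\<lambda>x. v x + v' x) w = H0 v w + H0 v' w" using H0_lin[of 1 v 1 v' w] by simp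
lemma H0_scale: "H0 (\<lambda>x. a *\<^sub>R v x) w = a * H0 v w" using H0_lin[of a v 0 v w] by simp
lemma H0_zero: "H0 (\<lambda>x. 0) w = 0" using H0_scale[of 0 "\<lambda>_. 0" w] by simp

lemma H0_sum: "finite Z \<Longrightarrow> H0 (\<lambda>x. \<Sum>z\<in>Z. h z x) w = (\<Sum>z\<in>Z. H0 (h z) w)"
  by (induction Z rule: finite_induct) (simp_all add: H0_zero H0_add)

lemma H0_cong:
  assumes "\<And>\<rho>. \<rho> \<in> \<R>h \<Longrightarrow> v \<rho> = v' \<rho>" shows "H0 v w = H0 v' w"
proof -
  have "DH 2 (\<lambda>_. 0) ([v', w][0 := v]) = DH 2 (\<lambda>_. 0) [v', w]"
    by (rule DH_arg_cong) (use k_ge assms in simp_all)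
  then show ?thesis by simp
qed

definition "single z a = lift (\<lambda>y. if y = z then a else 0)"

lemma single_add: "single z (a + b) = (\<lambda>\<rho>. single z a \<rho> + single z b \<rho>)"
  and single_scale: "single z (t *\<^sub>R a) = (\<lambda>\<rho>. t *\<^sub>R single z a \<rho>)"
  by (auto simp: single_def lift_def)

lemma stencil_norm_single: "stencil_norm \<R>h (single z a) \<le> norm a"
proof -
  have "stencil_norm \<R>h (single z a) \<le> stn S (\<lambda>y. if y = z then a else 0)"
    unfolding single_def by (rule stencil_norm_lift)
  also have "\<dots> = (\<Sum>y\<in>S. if y = z then norm a else 0)" unfolding stn_def by (rule sum.cong) simp_all
  also have "\<dots> = (if z \<in> S then norm a else 0)" by (rule sum.delta[OF finite_S])
  also have "\<dots> \<le> norm a" by simp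
  finally show ?thesis .
qed

text \<open>The block of the Hessian of \<open>Vh\<close> at zero strain that belongs to the bonds
  \<open>z\<close> and \<open>z'\<close>.\<close>

definition "beta z z' a b = H0 (single z a) (single z' b)"

lemma H0_expand: "H0 (lift g) w = (\<Sum>z\<in>S. H0 (single z (g z)) w)"
proof -
  have "H0 (lift g) w = H0 (\<lambda>\<rho>. \<Sum>z\<in>S. single z (g z) \<rho>) w"
  proof (rule H0_cong)
    fix \<rho> assume "\<rho> \<in> \<R>h"
    then obtain y where y: "y \<in> S" "\<rho> = iota A y" by (rule \<R>hE)
    have "(\<Sum>z\<in>S. single z (g z) \<rho>) = (\<Sum>z\<in>S. if y = z then g z else 0)"
      unfolding y(2) single_def by (intro sum.cong) auto
    also have "\<dots> = g y" using y(1) finite_S by simp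
    finally show "lift g \<rho> = (\<Sum>z\<in>S. single z (g z) \<rho>)" by (simp add: y(2))
  qed
  also have "\<dots> = (\<Sum>z\<in>S. H0 (single z (g z)) w)" by (rule H0_sum[OF finite_S])
  finally show ?thesis .
qed

lemma form_density_H0: "form_density S beta v w x = H0 (Dl v x) (Dl w x)"
proof -
  have "H0 (Dl v x) (Dl w x) = (\<Sum>z\<in>S. H0 (single z (ldiff z v x)) (Dl w x))" by (rule H0_expand)
  also have "\<dots> = (\<Sum>z\<in>S. \<Sum>z'\<in>S. beta z z' (ldiff z v x) (ldiff z' w x))"
  proof (rule sum.cong[OF refl])
    fix z
    have "H0 (single z (ldiff z v x)) (Dl w x) = H0 (Dl w x) (single z (ldiff z v x))" by (rule H0_sym)
    also have "\<dots> = (\<Sum>z'\<in>S. H0 (single z' (ldiff z' w x)) (single z (ldiff z v x)))" by (rule H0_expand)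
    also have "\<dots> = (\<Sum>z'\<in>S. beta z z' (ldiff z v x) (ldiff z' w x))"
      unfolding beta_def by (intro sum.cong refl H0_sym)
    finally show "H0 (single z (ldiff z v x)) (Dl w x) = (\<Sum>z'\<in>S. beta z z' (ldiff z v x) (ldiff z' w x))" .
  qed
  finally show ?thesis by (simp add: form_density_def)
qed

lemma H0_bound_ex: "\<exists>M\<ge>0. \<forall>v w. \<bar>H0 v w\<bar> \<le> M * stencil_norm \<R>h v * stencil_norm \<R>h w"
proof -
  obtain M where M: "M \<ge> 0" "\<And>vs. vs \<in> lists UNIV \<Longrightarrow> length vs = 2 \<Longrightarrow>
      \<bar>DH 2 (\<lambda>_. 0) vs\<bar> \<le> M * prod_list (map (stencil_norm \<R>h) vs)"
    by (rule hm.D_bound[of 2 "\<lambda>_. 0"]) (use k_ge in auto)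
  have "\<bar>H0 v w\<bar> \<le> M * stencil_norm \<R>h v * stencil_norm \<R>h w" for v w
    using M(2)[of "[v, w]"] by (simp add: mult.assoc)
  then show ?thesis using M(1) by blast
qed

definition "MH = (SOME M. M \<ge> 0 \<and> (\<forall>v w. \<bar>H0 v w\<bar> \<le> M * stencil_norm \<R>h v * stencil_norm \<R>h w))"

lemma MH: "MH \<ge> 0" "\<bar>H0 v w\<bar> \<le> MH * stencil_norm \<R>h v * stencil_norm \<R>h w"
  using someI_ex[OF H0_bound_ex] unfolding MH_def by auto

lemma beta_bound: "\<bar>beta z z' a b\<bar> \<le> MH * norm a * norm b"
proof -
  have "\<bar>beta z z' a b\<bar> \<le> MH * stencil_norm \<R>h (single z a) * stencil_norm \<R>h (single z' b)"
    unfolding beta_def by (rule MH(2))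
  also have "\<dots> \<le> MH * norm a * norm b"
    using MH(1) stencil_norm_single hm.p_nonneg by (intro mult_mono mult_left_mono) auto
  finally show ?thesis .
qed

lemma beta_bilinear: "bounded_bilinear (beta z z')"
proof
  fix a a' b b' :: "real^'n" and r :: real
  show "beta z z' (a + a') b = beta z z' a b + beta z z' a' b"
    by (simp add: beta_def single_add H0_add)
  show "beta z z' a (b + b') = beta z z' a b + beta z z' a b'"
    by (simp add: beta_def single_add H0_sym[of "single z a"] H0_add)
  show "beta z z' (r *\<^sub>R a) b = r *\<^sub>R beta z z' a b"
    by (simp add: beta_def single_scale H0_scale)
  show "beta z z' a (r *\<^sub>R b) = r *\<^sub>R beta z z' a b"
    by (simp add: beta_def single_scale H0_sym[of "single z a"] H0_scale)
  show "\<exists>K. \<forall>a b. norm (beta z z' a b) \<le> norm a * norm b * K"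
    using beta_bound by (intro exI[of _ MH]) (simp add: mult_ac)
qed

lemma beta_sym: "beta z z' a b = beta z' z b a" unfolding beta_def by (rule H0_sym)

text \<open>The analogue of \<open>stn_tail\<close> for use before a stability constant is known,
  since it helps to obtain that constant.\<close>

lemma stn_small:
  fixes y :: "int^'n \<Rightarrow> real^'n"
  assumes "grad_sq y summable_on UNIV" "e > 0"
  shows "\<exists>R\<ge>0. \<forall>x. x \<notin> cube R \<longrightarrow> stn S (\<lambda>z. ldiff z y x) \<le> e"
proof -
  define K where "K = (real (card S))\<^sup>2 * path_const2 TYPE('n) mS + 1"
  have K: "K > 0" using path_const2_nonneg[where 'n = 'n, of mS] by (simp add: K_def add_nonneg_pos)
  obtain R where R: "R \<ge> 0" "\<And>F. finite F \<Longrightarrow> F \<inter> cube R = {} \<Longrightarrow> sum (grad_sq y) F \<le> e\<^sup>2 / K"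
    using tail_small[OF _ assms(1), of "e\<^sup>2 / K"] K assms(2) by auto
  have "stn S (\<lambda>z. ldiff z y x) \<le> e" if x: "x \<notin> cube (R + mS)" for x
  proof -
    have "(norm (ldiff z y x))\<^sup>2 \<le> path_const2 TYPE('n) mS * (e\<^sup>2 / K)" if z: "z \<in> S" for z
    proof -
      have "(\<Sum>x\<in>{x}. (norm (ldiff z y x))\<^sup>2) \<le> path_const2 TYPE('n) mS * (e\<^sup>2 / K)"
      proof (rule sum_ldiff_sq_le)
        show "z \<in> cube mS" using mS(2) z by blast
        fix F :: "(int^'n) set" assume F: "finite F" "\<And>x'. x' \<in> F \<Longrightarrow> \<exists>y\<in>cube mS. x' - y \<in> {x}"
        have "x' \<notin> cube R" if x': "x' \<in> F" for x'
        proof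
          assume c: "x' \<in> cube R"
          obtain y where "y \<in> cube mS" "x = x' - y" using F(2)[OF x'] by blast
          then have "x \<in> cube (R + mS)" using cube_add[OF c, of "- y" mS] by (simp add: cube_minus)
          then show False using x by simp
        qed
        then show "sum (grad_sq y) F \<le> e\<^sup>2 / K" using F(1) by (intro R(2)) auto
      qed simp
      then show ?thesis by simp
    qed
    then have "(stn S (\<lambda>z. ldiff z y x))\<^sup>2 \<le> real (card S) * (\<Sum>z\<in>S. path_const2 TYPE('n) mS * (e\<^sup>2 / K))"
      by (intro order_trans[OF stn_sq_le] mult_left_mono sum_mono) auto
    also have "\<dots> = e\<^sup>2 * (((real (card S))\<^sup>2 * path_const2 TYPE('n) mS) / K)" by (simp add: power2_eq_square)
    also have "\<dots> \<le> e\<^sup>2 * 1" using K by (intro mult_left_mono) (auto simp: K_def)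
    finally have "(stn S (\<lambda>z. ldiff z y x))\<^sup>2 \<le> e\<^sup>2" by simp
    then show ?thesis by (rule power2_le_imp_le) (use assms(2) in simp)
  qed
  moreover have "R + mS \<ge> 0" using R(1) mS(1) by simp
  ultimately show ?thesis by blast
qed

end

section \<open>Stability of the homogeneous lattice\<close>

context point_defect
begin

lemma Dl_zero:
  fixes \<phi> :: "int^'n \<Rightarrow> real^'n"
  assumes "\<And>x. x \<notin> cube r \<Longrightarrow> \<phi> x = 0" "x \<notin> cube (r + mS)" "z \<in> S"
  shows "ldiff z \<phi> x = 0"
proof -
  have "x \<notin> cube r" using assms(2) cube_mono[of r "r + mS"] mS(1) by auto
  moreover have "x + z \<notin> cube r" using cube_add_cancel[of x z r mS] assms(2,3) mS(2) by auto
  ultimately show ?thesis using assms(1) by (simp add: ldiff_def)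
qed

lemma H0_zero_right: "(\<And>\<rho>. \<rho> \<in> \<R>h \<Longrightarrow> w \<rho> = 0) \<Longrightarrow> H0 v w = 0"
  using H0_cong[of w "\<lambda>_. 0" v] H0_sym[of v w] H0_zero by simp

lemma Dl_zero_\<R>h: "(\<And>z. z \<in> S \<Longrightarrow> ldiff z \<phi> x = 0) \<Longrightarrow> \<rho> \<in> \<R>h \<Longrightarrow> Dl \<phi> x \<rho> = 0"
  by (erule \<R>hE) simp

lemma lform_H0:
  fixes \<phi> :: "int^'n \<Rightarrow> real^'n"
  assumes "\<And>x. x \<notin> cube r \<Longrightarrow> \<phi> x = 0" "r + mS \<le> R"
  shows "lform S beta y \<phi> = (\<Sum>x\<in>cube R. H0 (Dl y x) (Dl \<phi> x))"
proof -
  have "lform S beta y \<phi> = infsum (\<lambda>x. H0 (Dl y x) (Dl \<phi> x)) UNIV"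
    by (simp add: lform_def form_density_H0[abs_def])
  also have "\<dots> = infsum (\<lambda>x. H0 (Dl y x) (Dl \<phi> x)) (cube R)"
  proof (rule infsum_cong_neutral)
    fix x :: "int^'n" assume "x \<in> UNIV - cube R"
    then have "x \<notin> cube (r + mS)" using cube_mono[OF assms(2)] by auto
    then show "H0 (Dl y x) (Dl \<phi> x) = 0"
      using Dl_zero[of r \<phi> x] assms(1) by (intro H0_zero_right Dl_zero_\<R>h) auto
  qed auto
  finally show ?thesis by simp
qed

text \<open>The homogeneous form is invariant under translations, so a test function may be carried
  to where the defect is absent and the strain of \<open>u\<close> is small.\<close>

lemma far_shift: "\<exists>k :: int^'n. \<forall>x\<in>cube r. x + k \<notin> cube R0 \<and> norm (iota A (x + k)) \<ge> Q"
proof -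
  define K where "K = max R0 \<lceil>\<bar>Q\<bar> / alo\<rceil> + r + 1"
  define k :: "int^'n" where "k = (\<chi> j. K)"
  have "x + k \<notin> cube R0 \<and> norm (iota A (x + k)) \<ge> Q" if x: "x \<in> cube r" for x
  proof -
    fix i :: 'n
    have "\<bar>x $ i\<bar> \<le> r" using x by (simp add: cube_def)
    then have xi: "(x + k) $ i > max R0 \<lceil>\<bar>Q\<bar> / alo\<rceil>" unfolding k_def K_def vector_add_component vec_lambda_beta by linarith
    then have "supn (x + k) > max R0 \<lceil>\<bar>Q\<bar> / alo\<rceil>" using abs_le_supn[of "x + k" i] by linarith
    then have s: "supn (x + k) > R0" "supn (x + k) > \<lceil>\<bar>Q\<bar> / alo\<rceil>" by auto
    then have "\<bar>Q\<bar> / alo \<le> real_of_int (supn (x + k))" by linarith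
    then have "Q \<le> alo * real_of_int (supn (x + k))" using alo(1) by (simp add: pos_divide_le_eq mult.commute)
    then have "Q \<le> norm (iota A (x + k))" using alo(2) order_trans by blast
    then show ?thesis using s(1) by (simp add: supn_le_iff[symmetric])
  qed
  then show ?thesis by blast
qed

end

context equilibrium_state
begin

lemma u_summable: "grad_sq (lat u) summable_on UNIV"
  by (rule lattice_summable[OF u_W_12])

text \<open>Far from the defect the strain of \<open>u\<close> tends to zero, so that stability of \<open>u\<close>, tested with functions
  supported there, is stability of the homogeneous lattice.\<close>

lemma lattice_stability:
  "\<exists>c>0. \<forall>\<phi>. finsupp \<phi> \<longrightarrow> c * infsum (grad_sq \<phi>) UNIV \<le> lform S beta \<phi> \<phi>"
proof -
  obtain c where c: "c > 0" "\<And>v Q. fin_supp v \<Longrightarrow> carries Q v \<Longrightarrow>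
    c * (W_12_seminorm \<Lambda> \<T> v)\<^sup>2 \<le> (\<Sum>l\<in>Q. DV l 2 (site_strain u l) [site_strain v l, site_strain v l])"
    by (rule stability_sites) blast
  obtain \<delta> M where \<delta>: "\<delta> > 0" "M \<ge> 0" "\<And>w vs. w \<in> UNIV \<Longrightarrow> stencil_norm \<R>h w < \<delta> \<Longrightarrow> vs \<in> lists UNIV \<Longrightarrow> length vs = 2 \<Longrightarrow>
    \<bar>DH 2 (\<lambda>x. 0 + w x) vs - DH 2 (\<lambda>x. 0) vs\<bar> \<le> M * stencil_norm \<R>h w * prod_list (map (stencil_norm \<R>h) vs)"
    by (rule hm.D_lipschitz[of 2 "\<lambda>_. 0"]) (use k_ge in \<open>simp, simp, blast\<close>)
  \<comment> \<open>\<open>Klow\<close> compares the lattice energy of the translated function with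
    its mesh semi-norm; adding 1 prevents division by zero.\<close>
  have "c / (Klow + 1) * infsum (grad_sq \<phi>) UNIV \<le> lform S beta \<phi> \<phi>" if \<phi>: "finsupp \<phi>" for \<phi>
  proof (rule field_le_epsilon)
    fix \<epsilon> :: real assume \<epsilon>: "\<epsilon> > 0"
    obtain r where r: "r \<ge> 0" "\<And>x. x \<notin> cube r \<Longrightarrow> \<phi> x = 0" using finsupp_cube[OF \<phi>] by blast
    let ?I = "infsum (grad_sq \<phi>) UNIV" and ?C = "cube (r + mS) :: (int^'n) set"
    define W where "W = (\<Sum>y\<in>?C. (stn S (\<lambda>z. ldiff z \<phi> y))\<^sup>2)"
    have W0: "W \<ge> 0" by (simp add: W_def sum_nonneg)
    have MW: "M * W + 1 > 0" using \<delta>(2) W0 by (simp add: add_nonneg_pos)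
    define e where "e = min (\<delta> / 2) (\<epsilon> / (M * W + 1))"
    have e0: "e > 0" using \<delta>(1) \<epsilon> MW by (simp add: e_def)
    have "e \<le> \<delta> / 2" unfolding e_def by (rule min.cobounded1)
    then have e\<delta>: "e < \<delta>" using \<delta>(1) by linarith
    have "e \<le> \<epsilon> / (M * W + 1)" unfolding e_def by (rule min.cobounded2)
    then have "e * (M * W + 1) \<le> \<epsilon>" using MW by (simp add: pos_le_divide_eq)
    then have e\<epsilon>: "M * e * W \<le> \<epsilon>" using e0 by (simp add: algebra_simps)
    obtain R0 where R0: "R0 \<ge> 0" "\<And>x. x \<notin> cube R0 \<Longrightarrow> stn S (\<lambda>z. ldiff z (lat u) x) \<le> e"
      using stn_small[OF u_summable e0] by blast
    \<comment> \<open>The margin \<open>rcut\<close> keeps sites whose stencils meet the support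
      outside the core; \<open>ahi\<close> is the margin of \<open>Rl\<close> in
      \<open>lattice_lower\<close>.\<close>
    obtain k where k: "\<And>x. x \<in> cube (r + mS + 1) \<Longrightarrow> x + k \<notin> cube R0 \<and> norm (iota A (x + k)) \<ge> Rdef + rcut + ahi"
      using far_shift[of "r + mS + 1" R0 "Rdef + rcut + ahi"] by blast
    have sub: "cube r \<subseteq> ?C" "?C \<subseteq> cube (r + mS + 1)" "cube (r + 1) \<subseteq> (cube (r + mS + 1) :: (int^'n) set)"
      using mS(1) by (auto intro!: cube_mono)
    define v where "v l = (if l \<in> range (iota A) then \<phi> (inv (iota A) l - k) else 0)" for l
    have latv: "lat v = (\<lambda>x. \<phi> (x - k))" by (simp add: v_def inv_f_f[OF iota_inj])
    have vsupp: "l \<in> (\<lambda>y. iota A (y + k)) ` cube r" if "v l \<noteq> 0" for l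
    proof -
      obtain x where x: "l = iota A x" using \<open>v l \<noteq> 0\<close> by (auto simp: v_def split: if_splits)
      then have "\<phi> (x - k) \<noteq> 0" using \<open>v l \<noteq> 0\<close> latv[THEN fun_cong, of x] by simp
      then have "x - k \<in> cube r" using r(2) by blast
      then show ?thesis using x by (intro image_eqI[of _ _ "x - k"]) auto
    qed
    have fv: "fin_supp v"
      by (rule finite_subset[of _ "(\<lambda>y. iota A (y + k)) ` cube r"]) (use vsupp in auto)
    let ?Q = "(\<lambda>y. iota A (y + k)) ` ?C"
    have Q: "carries ?Q v"
      unfolding carries_def
    proof (intro conjI ballI)
      show "?Q \<subseteq> \<Lambda>" using k sub(2) rcut_pos ahi(1) by (auto intro!: lattice_\<Lambda> simp: subset_iff) (smt (verit))
      fix l \<rho> assume l: "l \<in> \<Lambda> - ?Q" and \<rho>: "\<rho> \<in> \<R> l"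
      have "v l = 0" using vsupp[of l] l sub(1) by blast
      moreover have "v (l + \<rho>) = 0"
      proof (rule ccontr)
        assume "v (l + \<rho>) \<noteq> 0"
        then obtain y where y: "y \<in> cube r" "l + \<rho> = iota A (y + k)" using vsupp by blast
        have "y \<in> cube (r + mS + 1)" using y(1) sub by blast
        then have "norm (l + \<rho>) \<ge> Rdef + rcut" using k[of y] y(2) ahi(1) by simp
        moreover have "norm \<rho> < rcut" using stencil[of l] l \<rho> by auto
        ultimately have "norm l \<ge> Rdef" using norm_triangle_ineq[of l \<rho>] by linarith
        then have "\<rho> \<in> \<R>h" using stencil_outside[of l] l \<rho> by auto
        then obtain z where z: "z \<in> S" "\<rho> = iota A z" by (rule \<R>hE)
        have "l = iota A ((y - z) + k)" using y(2) z(2) by (simp add: iota_add iota_diff algebra_simps)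
        moreover have "y - z \<in> ?C" using cube_add[OF y(1), of "- z" mS] z(1) mS(2) by (auto simp: cube_minus)
        ultimately show False using l by blast
      qed
      ultimately show "fdiff \<rho> v l = 0" by (simp add: fdiff_def)
    qed simp
    have inj: "inj_on (\<lambda>y. iota A (y + k)) X" for X
      by (intro inj_onI) (metis add_right_cancel injD iota_inj)
    have Dv: "Dl (lat v) (y + k) = Dl \<phi> y" for y
      unfolding latv by (simp add: ldiff_def algebra_simps)
    have "?I = (\<Sum>x\<in>cube (r + 1). grad_sq \<phi> x)"
    proof -
      have "?I = infsum (grad_sq \<phi>) (cube (r + 1))"
        using grad_sq_finsupp_zero[of r \<phi>] r(2) by (intro infsum_cong_neutral) auto
      then show ?thesis by simp
    qed
    also have "\<dots> = (\<Sum>x\<in>(\<lambda>y. y + k) ` cube (r + 1). grad_sq (lat v) x)"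
      unfolding latv by (subst sum.reindex) (auto simp: grad_sq_def ldiff_def inj_on_def algebra_simps)
    also have "\<dots> \<le> Klow * (W_12_seminorm \<Lambda> \<T> v)\<^sup>2"
    proof (rule lattice_lower[OF finsupp_W_12[OF fv]])
      fix x assume "x \<in> (\<lambda>y. y + k) ` cube (r + 1)"
      then obtain y where "y \<in> cube (r + mS + 1)" "x = y + k" using sub(3) by blast
      then show "norm (iota A x) \<ge> Rl" using k[of y] rcut_pos by (simp add: Rl_def)
    qed simp
    also have "\<dots> \<le> (Klow + 1) * (W_12_seminorm \<Lambda> \<T> v)\<^sup>2" by (intro mult_right_mono) auto
    finally have "?I / (Klow + 1) \<le> (W_12_seminorm \<Lambda> \<T> v)\<^sup>2"
      using Klow_nonneg by (simp add: pos_divide_le_eq mult.commute)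
    from mult_left_mono[OF this, of c] have "c / (Klow + 1) * ?I \<le> c * (W_12_seminorm \<Lambda> \<T> v)\<^sup>2"
      using c(1) by simp
    also have "\<dots> \<le> (\<Sum>l\<in>?Q. DV l 2 (site_strain u l) [site_strain v l, site_strain v l])" by (rule c(2)[OF fv Q])
    also have "\<dots> = (\<Sum>y\<in>?C. DV (iota A (y + k)) 2 (site_strain u (iota A (y + k)))
        [site_strain v (iota A (y + k)), site_strain v (iota A (y + k))])"
      by (subst sum.reindex[OF inj]) simp
    also have "\<dots> \<le> (\<Sum>y\<in>?C. H0 (Dl \<phi> y) (Dl \<phi> y) + M * e * (stn S (\<lambda>z. ldiff z \<phi> y))\<^sup>2)"
    proof (rule sum_mono)
      fix y assume "y \<in> ?C"
      then have yk: "y + k \<notin> cube R0" "norm (iota A (y + k)) \<ge> Rdef + rcut + ahi" using k sub(2) by blast+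
      have yR: "norm (iota A (y + k)) \<ge> Rdef" using yk(2) rcut_pos ahi(1) by linarith
      let ?g = "Dl (lat u) (y + k)" and ?w = "Dl \<phi> y"
      have pg: "stencil_norm \<R>h ?g \<le> e" using stencil_norm_lift R0(2)[OF yk(1)] order_trans by blast
      have "\<bar>DH 2 (\<lambda>x. 0 + ?g x) [?w, ?w] - DH 2 (\<lambda>x. 0) [?w, ?w]\<bar>
          \<le> M * stencil_norm \<R>h ?g * prod_list (map (stencil_norm \<R>h) [?w, ?w])"
        using pg e\<delta> by (intro \<delta>(3)) auto
      also have "\<dots> \<le> M * e * (stn S (\<lambda>z. ldiff z \<phi> y))\<^sup>2"
      proof (intro mult_mono mult_left_mono)
        show "prod_list (map (stencil_norm \<R>h) [?w, ?w]) \<le> (stn S (\<lambda>z. ldiff z \<phi> y))\<^sup>2"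
          using stencil_norm_lift[of "\<lambda>z. ldiff z \<phi> y"] hm.p_nonneg by (simp add: power2_eq_square mult_mono)
      qed (use pg \<delta>(2) e0 hm.p_nonneg in auto)
      finally have "DH 2 ?g [?w, ?w] \<le> H0 ?w ?w + M * e * (stn S (\<lambda>z. ldiff z \<phi> y))\<^sup>2" by simp
      then show "DV (iota A (y + k)) 2 (site_strain u (iota A (y + k)))
        [site_strain v (iota A (y + k)), site_strain v (iota A (y + k))]
        \<le> H0 (Dl \<phi> y) (Dl \<phi> y) + M * e * (stn S (\<lambda>z. ldiff z \<phi> y))\<^sup>2"
        unfolding DV_lift2[OF yR] Dv .
    qed
    also have "\<dots> = lform S beta \<phi> \<phi> + M * e * W"
      using lform_H0[of r \<phi> "r + mS" \<phi>] r(2) by (simp add: sum.distrib sum_distrib_left W_def)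
    finally show "c / (Klow + 1) * ?I \<le> lform S beta \<phi> \<phi> + \<epsilon>" using e\<epsilon> by linarith
  qed
  then show ?thesis using c(1) Klow_nonneg by (intro exI[of _ "c / (Klow + 1)"]) auto
qed

end

section \<open>The nonlinear remainder and the equation on the integer lattice\<close>

context point_defect
begin

definition "remN g w = hm.remainder (lift g) (lift w)"

lemma remN_diff: "remN g (\<lambda>\<rho>. w \<rho> - w' \<rho>) = remN g w - remN g w'"
proof -
  have "lift (\<lambda>\<rho>. w \<rho> - w' \<rho>) = (\<lambda>\<rho>. lift w \<rho> - lift w' \<rho>)" by (simp add: fun_eq_iff lift_def)
  then show ?thesis unfolding remN_def using k_ge by (simp add: hm.remainder_diff)
qed

lemma remN_zero: "remN (\<lambda>_. 0) w = 0"
proof -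
  have "lift (\<lambda>_. 0) = (\<lambda>_. 0)" by (simp add: fun_eq_iff lift_def)
  then show ?thesis unfolding remN_def using k_ge by (simp add: hm.remainder_zero)
qed

lemma remN_lipschitz:
  "\<exists>\<delta>>0. \<exists>K\<ge>0. \<forall>g g' w. stn S g \<le> \<delta> \<longrightarrow> stn S g' \<le> \<delta> \<longrightarrow>
    \<bar>remN g w - remN g' w\<bar> \<le> K * (stn S g + stn S g') * stn S (\<lambda>\<rho>. g \<rho> - g' \<rho>) * stn S w"
proof -
  have "2 < k" using k_ge by simp
  from hm.remainder_lipschitz[OF this]
  obtain \<delta> K where \<delta>: "\<delta> > 0" "K \<ge> 0" "\<And>g g' w. stencil_norm \<R>h g \<le> \<delta> \<Longrightarrow> stencil_norm \<R>h g' \<le> \<delta> \<Longrightarrow>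
    \<bar>hm.remainder g w - hm.remainder g' w\<bar>
      \<le> K * (stencil_norm \<R>h g + stencil_norm \<R>h g') * stencil_norm \<R>h (\<lambda>x. g x - g' x) * stencil_norm \<R>h w"
    by auto
  have "\<bar>remN g w - remN g' w\<bar> \<le> K * (stn S g + stn S g') * stn S (\<lambda>\<rho>. g \<rho> - g' \<rho>) * stn S w"
    if g: "stn S g \<le> \<delta>" "stn S g' \<le> \<delta>" for g g' w
  proof -
    have d: "(\<lambda>x. lift g x - lift g' x) = lift (\<lambda>\<rho>. g \<rho> - g' \<rho>)" by (simp add: fun_eq_iff lift_def)
    have "\<bar>remN g w - remN g' w\<bar> \<le> K * (stencil_norm \<R>h (lift g) + stencil_norm \<R>h (lift g'))
        * stencil_norm \<R>h (lift (\<lambda>\<rho>. g \<rho> - g' \<rho>)) * stencil_norm \<R>h (lift w)"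
      unfolding remN_def d[symmetric] using stencil_norm_lift g order_trans by (intro \<delta>(3)) blast+
    also have "\<dots> \<le> K * (stn S g + stn S g') * stn S (\<lambda>\<rho>. g \<rho> - g' \<rho>) * stn S w"
      using \<delta>(2) hm.p_nonneg
      by (intro mult_mono mult_left_mono add_mono stencil_norm_lift mult_nonneg_nonneg add_nonneg_nonneg stn_nonneg) auto
    finally show ?thesis .
  qed
  then show ?thesis using \<delta>(1,2) by blast
qed

abbreviation "G0 w \<equiv> DH 1 (\<lambda>_. 0) [w]"

lemma G0_lin: "G0 (\<lambda>x. a *\<^sub>R v x + b *\<^sub>R v' x) = a * G0 v + b * G0 v'"
  using hm.D_hd_linear[of 0 "\<lambda>_. 0" "[]" v v' a b] k_ge by simp

lemma G0_add: "G0 (\<lambda>x. v x + v' x) = G0 v + G0 v'" using G0_lin[of 1 v 1 v'] by simp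
lemma G0_scale: "G0 (\<lambda>x. a *\<^sub>R v x) = a * G0 v" using G0_lin[of a v 0 v] by simp
lemma G0_zero: "G0 (\<lambda>x. 0) = 0" using G0_scale[of 0 "\<lambda>_. 0"] by simp

lemma G0_sum: "finite Z \<Longrightarrow> G0 (\<lambda>x. \<Sum>z\<in>Z. h z x) = (\<Sum>z\<in>Z. G0 (h z))"
  by (induction Z rule: finite_induct) (simp_all add: G0_zero G0_add del: One_nat_def)

lemma G0_cong:
  assumes "\<And>\<rho>. \<rho> \<in> \<R>h \<Longrightarrow> v \<rho> = v' \<rho>" shows "G0 v = G0 v'"
proof -
  have "DH 1 (\<lambda>_. 0) ([v'][0 := v]) = DH 1 (\<lambda>_. 0) [v']"
    by (rule DH_arg_cong) (use k_ge assms in simp_all)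
  then show ?thesis by simp
qed

lemma lift_expand:
  assumes "\<rho> \<in> \<R>h" shows "lift g \<rho> = (\<Sum>z\<in>S. single z (g z) \<rho>)"
proof -
  obtain y where y: "y \<in> S" "\<rho> = iota A y" using assms by (rule \<R>hE)
  have "(\<Sum>z\<in>S. single z (g z) \<rho>) = (\<Sum>z\<in>S. if y = z then g z else 0)"
    unfolding y(2) single_def by (intro sum.cong) auto
  also have "\<dots> = g y" using y(1) finite_S by simp
  finally show ?thesis by (simp add: y(2))
qed

lemma G0_expand: "G0 (lift g) = (\<Sum>z\<in>S. G0 (single z (g z)))"
  using G0_cong[of "lift g" "\<lambda>\<rho>. \<Sum>z\<in>S. single z (g z) \<rho>"] lift_expand G0_sum[OF finite_S] by simp

text \<open>The linear part of the homogeneous energy is a null Lagrangian.\<close>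

lemma G0_telescope:
  fixes \<phi> :: "int^'n \<Rightarrow> real^'n"
  assumes \<phi>: "\<And>x. x \<notin> cube r \<Longrightarrow> \<phi> x = 0" and R: "r + mS \<le> R"
  shows "(\<Sum>x\<in>cube R. G0 (Dl \<phi> x)) = 0"
proof -
  have "(\<Sum>x\<in>cube R. G0 (single z (ldiff z \<phi> x))) = 0" if z: "z \<in> S" for z
  proof -
    let ?f = "\<lambda>y. G0 (single z (\<phi> y))"
    have zero: "?f y = 0" if "y \<notin> cube r" for y
    proof -
      have "single z (\<phi> y) = (\<lambda>_. 0)" using \<phi>[OF that] by (simp add: fun_eq_iff single_def lift_def)
      then show ?thesis by (simp only: G0_zero)
    qed
    have sum: "(\<Sum>y\<in>Y. ?f y) = (\<Sum>y\<in>cube r. ?f y)" if "finite Y" "cube r \<subseteq> Y" for Y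
      using that zero by (intro sum.mono_neutral_right) auto
    have "G0 (single z (ldiff z \<phi> x)) = ?f (x + z) - ?f x" for x
    proof -
      have "?f (x + z) = G0 (single z (ldiff z \<phi> x + \<phi> x))" by (simp add: ldiff_def)
      also have "\<dots> = G0 (single z (ldiff z \<phi> x)) + ?f x" unfolding single_add by (rule G0_add)
      finally show ?thesis by simp
    qed
    then have "(\<Sum>x\<in>cube R. G0 (single z (ldiff z \<phi> x))) = (\<Sum>x\<in>cube R. ?f (x + z)) - (\<Sum>x\<in>cube R. ?f x)"
      by (simp only: sum_subtractf)
    also have "(\<Sum>x\<in>cube R. ?f (x + z)) = (\<Sum>y\<in>(\<lambda>x. x + z) ` cube R. ?f y)"
      by (rule sum.reindex[unfolded o_def, symmetric]) (simp add: inj_on_def)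
    also have "\<dots> = (\<Sum>y\<in>cube r. ?f y)"
    proof (rule sum)
      show "cube r \<subseteq> (\<lambda>x. x + z) ` cube R"
      proof
        fix y :: "int^'n" assume "y \<in> cube r"
        then have "y + - z \<in> cube (r + mS)" using z mS(2) by (intro cube_add) (auto simp: cube_minus)
        then have "y - z \<in> cube R" using cube_mono[OF R] by auto
        then show "y \<in> (\<lambda>x. x + z) ` cube R" by (intro image_eqI[of _ _ "y - z"]) auto
      qed
    qed simp
    also have "(\<Sum>x\<in>cube R. ?f x) = (\<Sum>y\<in>cube r. ?f y)"
    proof (rule sum)
      show "cube r \<subseteq> cube R" using mS(1) R by (intro cube_mono) simp
    qed simp
    finally show ?thesis by simp
  qed
  then have "(\<Sum>z\<in>S. \<Sum>x\<in>cube R. G0 (single z (ldiff z \<phi> x))) = 0" by (intro sum.neutral) blast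
  also have "(\<Sum>z\<in>S. \<Sum>x\<in>cube R. G0 (single z (ldiff z \<phi> x))) = (\<Sum>x\<in>cube R. G0 (Dl \<phi> x))"
    unfolding G0_expand by (rule sum.swap)
  finally show ?thesis .
qed

lemma G0_bound_ex: "\<exists>M\<ge>0. \<forall>w. \<bar>G0 w\<bar> \<le> M * stencil_norm \<R>h w"
proof -
  obtain M where M: "M \<ge> 0" "\<And>vs. vs \<in> lists UNIV \<Longrightarrow> length vs = 1 \<Longrightarrow>
      \<bar>DH 1 (\<lambda>_. 0) vs\<bar> \<le> M * prod_list (map (stencil_norm \<R>h) vs)"
    by (rule hm.D_bound[of 1 "\<lambda>_. 0"]) (use k_ge in auto)
  have "\<bar>G0 w\<bar> \<le> M * stencil_norm \<R>h w" for w using M(2)[of "[w]"] by simp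
  then show ?thesis using M(1) by blast
qed

lemma site_bound_ex:
  assumes "l \<in> \<Lambda>"
  shows "\<exists>M\<ge>0. \<forall>w. \<bar>DV l 1 g [w]\<bar> \<le> M * stencil_norm (\<R> l) w"
proof -
  interpret s: Ck_functional_triangle k UNIV "stencil_norm (\<R> l)" "V l" "DV l" by (rule site_functional[OF assms(1)])
  obtain M where M: "M \<ge> 0" "\<And>vs. vs \<in> lists UNIV \<Longrightarrow> length vs = 1 \<Longrightarrow>
      \<bar>DV l 1 g vs\<bar> \<le> M * prod_list (map (stencil_norm (\<R> l)) vs)"
    by (rule s.D_bound[of 1 g]) (use k_ge in auto)
  have "\<bar>DV l 1 g [w]\<bar> \<le> M * stencil_norm (\<R> l) w" for w using M(2)[of "[w]"] by simp
  then show ?thesis using M(1) by blast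
qed

end

text \<open>Both points are joined to the origin, hence the factor 2. The right-hand side is the
  form in which core terms enter \<open>lattice_equilibrium\<close>.\<close>

lemma norm_diff_le_grad_sum:
  fixes \<phi> :: "int^'n \<Rightarrow> 'b::real_normed_vector"
  assumes "p \<in> cube m" "q \<in> cube m"
  shows "norm (\<phi> p - \<phi> q) \<le> 2 * real CARD('n) * (\<Sum>x\<in>cube m. sqrt (grad_sq \<phi> x))"
proof -
  have le: "norm (ldiff p \<phi> 0) \<le> real CARD('n) * (\<Sum>x\<in>cube m. sqrt (grad_sq \<phi> x))" if "p \<in> cube m" for p
  proof -
    have "norm (ldiff p \<phi> 0) \<le> (\<Sum>i\<in>UNIV. \<Sum>y\<in>cube m. norm (ldiff (axis i 1) \<phi> (0 + y)))"
      by (rule norm_ldiff_le_sum[OF that])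
    also have "\<dots> \<le> (\<Sum>i\<in>(UNIV::'n set). \<Sum>y\<in>cube m. sqrt (grad_sq \<phi> y))"
      using norm_ldiff_le_grad_sq by (intro sum_mono) (auto intro!: real_le_rsqrt)
    finally show ?thesis by simp
  qed
  have "\<phi> p - \<phi> q = ldiff p \<phi> 0 - ldiff q \<phi> 0" by (simp add: ldiff_def)
  then have "norm (\<phi> p - \<phi> q) \<le> norm (ldiff p \<phi> 0) + norm (ldiff q \<phi> 0)" using norm_triangle_ineq4 by metis
  then show ?thesis using le[OF assms(1)] le[OF assms(2)] by linarith
qed

context equilibrium_state
begin

text \<open>The site equation is tested with \<phi> transplanted to \<open>\<Lambda>\<close>. Far
  sites contribute the expansion of the first variation at zero strain. Its constant part sums to
  zero over the whole lattice, so completing that sum and the quadratic form adds only terms of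
  \<open>cube m0\<close>. These and the sites in \<open>Lc\<close> give finitely many bounded
  functionals of differences of \<phi>.\<close>

lemma lattice_equation:
  assumes m0: "m0 \<ge> 0" "\<And>x. x \<notin> cube m0 \<Longrightarrow> norm (iota A x) \<ge> Rdef + rcut"
  shows "\<exists>m1\<ge>0. \<exists>K0\<ge>0. \<forall>\<phi>. finsupp \<phi> \<longrightarrow>
    \<bar>lform S beta (lat u) \<phi> + infsum (\<lambda>x. remN (\<lambda>\<rho>. ldiff \<rho> (lat u) x) (\<lambda>\<rho>. ldiff \<rho> \<phi> x)) (- cube m0)\<bar>
      \<le> K0 * (\<Sum>x\<in>cube m1. sqrt (grad_sq \<phi> x))"
proof -
  define Lc where "Lc = \<Lambda> - iota A ` (- cube m0)"
  have Lc: "Lc \<subseteq> \<Lambda>" "finite Lc"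
  proof -
    have "Lc \<subseteq> (\<Lambda> \<inter> ball 0 Rdef) \<union> iota A ` cube m0"
    proof
      fix l assume l: "l \<in> Lc"
      show "l \<in> (\<Lambda> \<inter> ball 0 Rdef) \<union> iota A ` cube m0"
      proof (cases "norm l < Rdef")
        case False
        then obtain y where "l = iota A y" using l \<Lambda>_lattice[of l] unfolding Lc_def by auto
        then show ?thesis using l by (auto simp: Lc_def)
      qed (use l in \<open>auto simp: Lc_def\<close>)
    qed
    then show "finite Lc" by (rule finite_subset) (use finite_core in simp)
  qed (simp add: Lc_def)
  \<comment> \<open>Contains all sites that occur in the stencils of \<open>Lc\<close>; their
    lattice coordinates fix \<open>m1\<close>.\<close>
  define N1 where "N1 = (\<Union>l\<in>Lc. \<Lambda> \<inter> cball l rcut)"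
  have "finite N1" unfolding N1_def by (rule finite_UN_I[OF Lc(2) \<Lambda>_ball(1)])
  then have "finite (iota A -` N1)" by (rule finite_vimageI[OF _ iota_inj])
  then obtain m' where m': "m' \<ge> 0" "iota A -` N1 \<subseteq> cube m'" using exists_cube by blast
  define m1 where "m1 = max m' (m0 + mS)"
  have m1: "m1 \<ge> 0" "iota A -` N1 \<subseteq> cube m1" "cube (m0 + mS) \<subseteq> (cube m1 :: (int^'n) set)"
    using m' cube_mono[of m' m1] cube_mono[of "m0 + mS" m1] by (auto simp: m1_def)
  obtain M1 where M1: "M1 \<ge> 0" "\<And>w. \<bar>G0 w\<bar> \<le> M1 * stencil_norm \<R>h w" using G0_bound_ex by blast
  have "\<forall>l\<in>Lc. \<exists>M\<ge>0. \<forall>w. \<bar>DV l 1 (site_strain u l) [w]\<bar> \<le> M * stencil_norm (\<R> l) w"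
    using Lc(1) site_bound_ex by blast
  then obtain M where M: "\<And>l. l \<in> Lc \<Longrightarrow> M l \<ge> 0"
    "\<And>l w. l \<in> Lc \<Longrightarrow> \<bar>DV l 1 (site_strain u l) [w]\<bar> \<le> M l * stencil_norm (\<R> l) w"
    by (auto dest!: bchoice)
  let ?d = "2 * real CARD('n)"
  define K0 where "K0 = (\<Sum>x\<in>cube m0. (MH * stn S (\<lambda>z. ldiff z (lat u) x) + M1) * (real (card S) * ?d))
    + (\<Sum>l\<in>Lc. M l * (real (card (\<R> l)) * ?d))"
  have K0: "K0 \<ge> 0"
    unfolding K0_def using M(1) M1(1) MH(1) stn_nonneg
    by (intro add_nonneg_nonneg sum_nonneg mult_nonneg_nonneg) auto
  have "\<bar>lform S beta (lat u) \<phi> + infsum (\<lambda>x. remN (\<lambda>\<rho>. ldiff \<rho> (lat u) x) (\<lambda>\<rho>. ldiff \<rho> \<phi> x)) (- cube m0)\<bar>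
      \<le> K0 * (\<Sum>x\<in>cube m1. sqrt (grad_sq \<phi> x))" if \<phi>: "finsupp \<phi>" for \<phi>
  proof -
    define P where "P = (\<Sum>x\<in>cube m1. sqrt (grad_sq \<phi> x))"
    have P0: "P \<ge> 0" unfolding P_def by (intro sum_nonneg) simp
    obtain r where r: "r \<ge> 0" "\<And>x. x \<notin> cube r \<Longrightarrow> \<phi> x = 0" using finsupp_cube[OF \<phi>] by blast
    define R where "R = r + mS + m0"
    have R: "r + mS \<le> R" "m0 \<le> R" using r(1) m0(1) mS(1) by (auto simp: R_def)
    define v where "v l = (if norm l \<ge> Rdef then \<phi> (inv (iota A) l) else \<phi> 0)" for l
    have latv: "v (iota A x) = \<phi> x" if "norm (iota A x) \<ge> Rdef" for x
      using that by (simp add: v_def inv_f_f[OF iota_inj])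
    have fv: "fin_supp v"
    proof (rule finite_subset[of _ "(\<Lambda> \<inter> ball 0 Rdef) \<union> iota A ` cube r"])
      show "{l\<in>\<Lambda>. v l \<noteq> 0} \<subseteq> (\<Lambda> \<inter> ball 0 Rdef) \<union> iota A ` cube r"
      proof
        fix l assume l: "l \<in> {l\<in>\<Lambda>. v l \<noteq> 0}"
        show "l \<in> (\<Lambda> \<inter> ball 0 Rdef) \<union> iota A ` cube r"
        proof (cases "norm l < Rdef")
          case False
          then obtain y where y: "l = iota A y" using l \<Lambda>_lattice[of l] by auto
          then have "\<phi> y \<noteq> 0" using l latv[of y] False by auto
          then show ?thesis using r(2) y by blast
        qed (use l in auto)
      qed
    qed (use finite_core in simp)
    have Dv: "site_strain v (iota A x) \<rho> = Dl \<phi> x \<rho>" if x: "x \<notin> cube m0" and \<rho>: "\<rho> \<in> \<R>h" for x \<rho>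
    proof -
      obtain z where z: "z \<in> S" "\<rho> = iota A z" using \<rho> by (rule \<R>hE)
      have "norm (iota A x) \<le> norm (iota A (x + z)) + norm \<rho>"
        using norm_triangle_ineq4[of "iota A (x + z)" \<rho>] by (simp add: z(2) iota_add)
      then have "norm (iota A (x + z)) \<ge> Rdef" "norm (iota A x) \<ge> Rdef"
        using m0(2)[OF x] \<R>h_norm[OF \<rho>] rcut_pos by linarith+
      then show ?thesis using latv[of x] latv[of "x + z"] by (simp add: fdiff_def ldiff_def z(2) iota_add)
    qed
    have far: "norm (iota A x) \<ge> Rdef" if "x \<notin> cube m0" for x using m0(2)[OF that] rcut_pos by linarith
    let ?B = "cube R - cube m0 :: (int^'n) set"
    have Q: "carries (iota A ` ?B \<union> Lc) v"
      unfolding carries_def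
    proof (intro conjI ballI)
      show "finite (iota A ` ?B \<union> Lc)" using Lc by simp
      show "iota A ` ?B \<union> Lc \<subseteq> \<Lambda>" using Lc far lattice_\<Lambda> by blast
      fix l \<rho> assume l: "l \<in> \<Lambda> - (iota A ` ?B \<union> Lc)" and \<rho>: "\<rho> \<in> \<R> l"
      then obtain x where x: "l = iota A x" "x \<notin> cube m0" unfolding Lc_def by blast
      then have xR: "x \<notin> cube R" using l by blast
      have \<rho>h: "\<rho> \<in> \<R>h" using stencil_outside[of l] far[OF x(2)] x(1) l \<rho> by auto
      have "Dl \<phi> x \<rho> = 0"
      proof (rule Dl_zero_\<R>h[OF _ \<rho>h])
        fix z assume "z \<in> S"
        moreover have "x \<notin> cube (r + mS)" using xR cube_mono[OF R(1)] by blast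
        ultimately show "ldiff z \<phi> x = 0" using Dl_zero[of r \<phi> x z] r(2) by blast
      qed
      then show "fdiff \<rho> v l = 0" using Dv[OF x(2) \<rho>h] x(1) by simp
    qed
    have inj: "inj_on (iota A) X" for X by (rule inj_on_subset[OF iota_inj subset_UNIV])
    let ?g = "\<lambda>x. Dl (lat u) x" and ?w = "\<lambda>x. Dl \<phi> x"
    let ?C = "\<Sum>l\<in>Lc. DV l 1 (site_strain u l) [site_strain v l]"
    have "(\<Sum>x\<in>?B. DH 1 (?g x) [?w x]) = (\<Sum>x\<in>?B. DV (iota A x) 1 (site_strain u (iota A x)) [site_strain v (iota A x)])"
    proof (rule sum.cong[OF refl])
      fix x assume "x \<in> ?B"
      then have x: "x \<notin> cube m0" by blast
      have "DH 1 (?g x) ([?w x][0 := Dl (lat v) x]) = DH 1 (?g x) [?w x]"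
      proof (rule DH_arg_cong)
        fix \<rho> assume \<rho>: "\<rho> \<in> \<R>h"
        show "Dl (lat v) x \<rho> = ([?w x] ! 0) \<rho>"
          using Dv[OF x \<rho>] site_strain_lat[OF \<rho>, of v x] by simp
      qed (use k_ge in auto)
      then show "DH 1 (?g x) [?w x] = DV (iota A x) 1 (site_strain u (iota A x)) [site_strain v (iota A x)]"
        unfolding DV_lift1[OF far[OF x]] by simp
    qed
    also have "\<dots> = (\<Sum>l\<in>iota A ` ?B. DV l 1 (site_strain u l) [site_strain v l])"
      by (rule sum.reindex[OF inj, unfolded o_def, symmetric])
    also have "\<dots> = (\<Sum>l\<in>iota A ` ?B \<union> Lc. DV l 1 (site_strain u l) [site_strain v l]) - ?C"
      using Lc by (subst sum.union_disjoint) (auto simp: Lc_def)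
    also have "\<dots> = - ?C" using equilibrium_equation[OF fv Q] by simp
    finally have sumB: "(\<Sum>x\<in>?B. DH 1 (?g x) [?w x]) = - ?C" .
    have split: "(\<Sum>x\<in>cube R. f x) = (\<Sum>x\<in>?B. f x) + (\<Sum>x\<in>cube m0. f x)" for f :: "int^'n \<Rightarrow> real"
      by (rule sum.subset_diff) (use cube_mono[OF R(2)] in simp_all)
    have "infsum (\<lambda>x. remN (\<lambda>\<rho>. ldiff \<rho> (lat u) x) (\<lambda>\<rho>. ldiff \<rho> \<phi> x)) (- cube m0)
      = infsum (\<lambda>x. remN (\<lambda>\<rho>. ldiff \<rho> (lat u) x) (\<lambda>\<rho>. ldiff \<rho> \<phi> x)) ?B"
    proof (rule infsum_cong_neutral)
      fix x :: "int^'n" assume "x \<in> - cube m0 - ?B"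
      then have "x \<notin> cube (r + mS)" using cube_mono[OF R(1)] by auto
      then have z: "Dl \<phi> x \<rho> = 0" if "\<rho> \<in> \<R>h" for \<rho>
        using Dl_zero[of r \<phi> x] r(2) that by (intro Dl_zero_\<R>h) auto
      have "DH 1 (?g x) ([\<lambda>_. 0][0 := ?w x]) = DH 1 (?g x) [\<lambda>_. 0]"
        by (rule DH_arg_cong) (use k_ge z in auto)
      moreover have "DH 1 (?g x) [\<lambda>_. 0] = 0"
        using hm.D_hd_scale[of 0 "?g x" "[]" "\<lambda>_. 0" 0] k_ge by simp
      moreover have "G0 (?w x) = 0" using G0_cong[of "?w x" "\<lambda>_. 0"] z G0_zero by simp
      moreover have "H0 (?g x) (?w x) = 0" by (rule H0_zero_right[OF z])
      ultimately show "remN (\<lambda>\<rho>. ldiff \<rho> (lat u) x) (\<lambda>\<rho>. ldiff \<rho> \<phi> x) = 0"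
        by (simp add: remN_def hm.remainder_def)
    qed auto
    then have inf: "infsum (\<lambda>x. remN (\<lambda>\<rho>. ldiff \<rho> (lat u) x) (\<lambda>\<rho>. ldiff \<rho> \<phi> x)) (- cube m0)
        = (\<Sum>x\<in>?B. DH 1 (?g x) [?w x] - G0 (?w x) - H0 (?g x) (?w x))"
      by (simp add: remN_def hm.remainder_def del: One_nat_def)
    have "lform S beta (lat u) \<phi> + infsum (\<lambda>x. remN (\<lambda>\<rho>. ldiff \<rho> (lat u) x) (\<lambda>\<rho>. ldiff \<rho> \<phi> x)) (- cube m0)
      = (\<Sum>x\<in>cube R. H0 (?g x) (?w x)) + (\<Sum>x\<in>?B. DH 1 (?g x) [?w x]) - (\<Sum>x\<in>?B. G0 (?w x)) - (\<Sum>x\<in>?B. H0 (?g x) (?w x))"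
      unfolding inf using lform_H0[of r \<phi> R "lat u"] r(2) R(1) by (simp add: sum_subtractf)
    also have "\<dots> = (\<Sum>x\<in>cube m0. H0 (?g x) (?w x)) + (\<Sum>x\<in>cube m0. G0 (?w x)) - ?C"
      using split[of "\<lambda>x. H0 (?g x) (?w x)"] split[of "\<lambda>x. G0 (?w x)"] G0_telescope[of r \<phi> R] r(2) R(1) sumB
      by simp
    finally have total: "lform S beta (lat u) \<phi> + infsum (\<lambda>x. remN (\<lambda>\<rho>. ldiff \<rho> (lat u) x) (\<lambda>\<rho>. ldiff \<rho> \<phi> x)) (- cube m0)
      = (\<Sum>x\<in>cube m0. H0 (?g x) (?w x) + G0 (?w x)) - ?C" by (simp only: sum.distrib)
    have near: "\<bar>H0 (?g x) (?w x) + G0 (?w x)\<bar> \<le> (MH * stn S (\<lambda>z. ldiff z (lat u) x) + M1) * (real (card S) * ?d) * P"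
      if x: "x \<in> cube m0" for x
    proof -
      have "stn S (\<lambda>z. ldiff z \<phi> x) \<le> (\<Sum>z\<in>S. ?d * P)"
        unfolding stn_def
      proof (rule sum_mono)
        fix z assume "z \<in> S"
        then have "x + z \<in> cube m1" "x \<in> cube m1"
          using cube_add[OF x, of z mS] cube_mono[of m0 "m0 + mS"] x mS m1(3) by auto
        then show "norm (ldiff z \<phi> x) \<le> ?d * P"
          unfolding ldiff_def P_def by (rule norm_diff_le_grad_sum)
      qed
      then have w: "stencil_norm \<R>h (?w x) \<le> real (card S) * ?d * P"
        using stencil_norm_lift[of "\<lambda>z. ldiff z \<phi> x"] by simp
      have "\<bar>H0 (?g x) (?w x) + G0 (?w x)\<bar> \<le> MH * stencil_norm \<R>h (?g x) * stencil_norm \<R>h (?w x) + M1 * stencil_norm \<R>h (?w x)"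
        using MH(2)[of "?g x" "?w x"] M1(2)[of "?w x"] by linarith
      also have "\<dots> = (MH * stencil_norm \<R>h (?g x) + M1) * stencil_norm \<R>h (?w x)" by (simp add: algebra_simps)
      also have "\<dots> \<le> (MH * stn S (\<lambda>z. ldiff z (lat u) x) + M1) * (real (card S) * ?d * P)"
        using w MH(1) M1(1) hm.p_nonneg stencil_norm_lift
        by (intro mult_mono add_mono mult_left_mono add_nonneg_nonneg mult_nonneg_nonneg stn_nonneg) auto
      finally show ?thesis by (simp add: mult.assoc)
    qed
    have core: "\<bar>DV l 1 (site_strain u l) [site_strain v l]\<bar> \<le> M l * (real (card (\<R> l)) * ?d) * P"
      if l: "l \<in> Lc" for l
    proof -
      have val: "\<exists>y\<in>cube m1. v q = \<phi> y" if q: "q \<in> \<Lambda>" "dist l q \<le> rcut" for q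
      proof (cases "norm q < Rdef")
        case True
        have "(0 :: int^'n) \<in> cube m1" using m1(1) by (simp add: cube_def)
        then show ?thesis using True by (intro bexI[of _ 0]) (auto simp: v_def)
      next
        case False
        then obtain y where y: "q = iota A y" using q(1) \<Lambda>_lattice[of q] by auto
        have "q \<in> N1" unfolding N1_def using q l by auto
        then have "y \<in> cube m1" using y m1(2) by blast
        then show ?thesis using y latv[of y] False by (intro bexI[of _ y]) auto
      qed
      have "stencil_norm (\<R> l) (site_strain v l) \<le> (\<Sum>\<rho>\<in>\<R> l. norm (fdiff \<rho> v l))"
        unfolding stencil_norm_def by (rule L2_set_le_sum) simp
      also have "\<dots> \<le> (\<Sum>\<rho>\<in>\<R> l. ?d * P)"
      proof (rule sum_mono)
        fix \<rho> assume \<rho>: "\<rho> \<in> \<R> l"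
        have l\<Lambda>: "l \<in> \<Lambda>" using Lc(1) l by blast
        then have lr: "l \<in> \<Lambda>" "l + \<rho> \<in> \<Lambda>" "norm \<rho> < rcut" using stencil[OF l\<Lambda>] \<rho> by auto
        obtain y where y: "y \<in> cube m1" "v l = \<phi> y" using val[of l] lr(1) rcut_pos by auto
        obtain y' where y': "y' \<in> cube m1" "v (l + \<rho>) = \<phi> y'" using val[of "l + \<rho>"] lr by (auto simp: dist_norm)
        show "norm (fdiff \<rho> v l) \<le> ?d * P"
          unfolding fdiff_def y(2) y'(2) P_def by (rule norm_diff_le_grad_sum[OF y'(1) y(1)])
      qed
      finally have "stencil_norm (\<R> l) (site_strain v l) \<le> real (card (\<R> l)) * ?d * P" by simp
      then have "M l * stencil_norm (\<R> l) (site_strain v l) \<le> M l * (real (card (\<R> l)) * ?d * P)"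
        using M(1)[OF l] by (rule mult_left_mono)
      then show ?thesis using M(2)[OF l, of "site_strain v l"] by (simp add: mult.assoc)
    qed
    have "\<bar>(\<Sum>x\<in>cube m0. H0 (?g x) (?w x) + G0 (?w x)) - ?C\<bar>
        \<le> (\<Sum>x\<in>cube m0. \<bar>H0 (?g x) (?w x) + G0 (?w x)\<bar>) + (\<Sum>l\<in>Lc. \<bar>DV l 1 (site_strain u l) [site_strain v l]\<bar>)"
      by (rule order_trans[OF abs_triangle_ineq4]) (intro add_mono sum_abs)
    also have "\<dots> \<le> (\<Sum>x\<in>cube m0. (MH * stn S (\<lambda>z. ldiff z (lat u) x) + M1) * (real (card S) * ?d) * P)
        + (\<Sum>l\<in>Lc. M l * (real (card (\<R> l)) * ?d) * P)"
      by (intro add_mono sum_mono near core)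
    also have "\<dots> = K0 * P" unfolding K0_def distrib_right sum_distrib_right ..
    finally show ?thesis unfolding total P_def .
  qed
  then show ?thesis using m1(1) K0 by blast
qed

end

subsection \<open>Decay of the strain and of the weighted strain gradient\<close>

lemma sum_ldiff_sq_tail:
  fixes v :: "int^'n \<Rightarrow> 'b::real_normed_vector"
  assumes "grad_sq v summable_on UNIV" "\<rho> \<in> cube m" "finite F" "F \<inter> cube (r + m) = {}"
  shows "(\<Sum>x\<in>F. (norm (ldiff \<rho> v x))\<^sup>2) \<le> path_const2 TYPE('n) m * (tail_norm v r)\<^sup>2"
proof (rule sum_ldiff_sq_le[OF assms(2,3)])
  fix F' :: "(int^'n) set" assume F': "finite F'" "\<And>x. x \<in> F' \<Longrightarrow> \<exists>y\<in>cube m. x - y \<in> F"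
  have "F' \<inter> cube r = {}"
  proof (rule equals0I)
    fix x assume x: "x \<in> F' \<inter> cube r"
    then obtain y where y: "y \<in> cube m" "x - y \<in> F" using F'(2) by blast
    then have "x + - y \<in> cube (r + m)" using x by (intro cube_add) (auto simp: cube_minus)
    then show False using y(2) assms(4) by auto
  qed
  then show "sum (grad_sq v) F' \<le> (tail_norm v r)\<^sup>2" by (rule sum_grad_sq_le_tail[OF assms(1) F'(1)])
qed

lemma ldiff_commute:
  fixes v :: "'a::ab_semigroup_add \<Rightarrow> 'b::ab_group_add"
  shows "ldiff \<rho> (ldiff \<sigma> v) x = ldiff \<sigma> (ldiff \<rho> v) x"
proof -
  have "x + \<rho> + \<sigma> = x + \<sigma> + \<rho>" by (simp only: add.assoc add.commute[of \<rho> \<sigma>])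
  then show ?thesis by (simp add: ldiff_def)
qed

text \<open>Differences commute: the unit differences of \<open>ldiff \<rho> v\<close> are long
  differences of the unit differences of \<open>v\<close>, and paths of unit steps bound
  those.\<close>

lemma tail_norm_ldiff:
  fixes v :: "int^'n \<Rightarrow> 'b::real_normed_vector"
  assumes v: "grad_sq v summable_on UNIV" and "\<rho> \<in> cube m" and T: "\<And>j. tail_norm (ldiff (axis j 1) v) r \<le> T"
  shows "(tail_norm (ldiff \<rho> v) (r + m))\<^sup>2 \<le> real CARD('n) * path_const2 TYPE('n) m * T\<^sup>2"
proof -
  have "infsum (grad_sq (ldiff \<rho> v)) (- cube (r + m)) \<le> real CARD('n) * path_const2 TYPE('n) m * T\<^sup>2"
  proof (rule infsum_le_sum_bound(2))
    fix F :: "(int^'n) set" assume F: "finite F" "F \<subseteq> - cube (r + m)"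
    have "sum (grad_sq (ldiff \<rho> v)) F = (\<Sum>i\<in>UNIV. \<Sum>x\<in>F. (norm (ldiff \<rho> (ldiff (axis i 1) v) x))\<^sup>2)"
      unfolding grad_sq_def by (subst sum.swap) (simp add: ldiff_commute[of "axis _ 1" \<rho>])
    also have "\<dots> \<le> (\<Sum>i\<in>(UNIV::'n set). path_const2 TYPE('n) m * T\<^sup>2)"
    proof (rule sum_mono)
      fix i
      have "(\<Sum>x\<in>F. (norm (ldiff \<rho> (ldiff (axis i 1) v) x))\<^sup>2)
          \<le> path_const2 TYPE('n) m * (tail_norm (ldiff (axis i 1) v) r)\<^sup>2"
        using F assms(2) by (intro sum_ldiff_sq_tail grad_sq_ldiff_summable[OF v]) auto
      also have "\<dots> \<le> path_const2 TYPE('n) m * T\<^sup>2"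
        by (intro mult_left_mono power_mono T tail_norm_nonneg path_const2_nonneg)
      finally show "(\<Sum>x\<in>F. (norm (ldiff \<rho> (ldiff (axis i 1) v) x))\<^sup>2) \<le> path_const2 TYPE('n) m * T\<^sup>2" .
    qed
    finally show "sum (grad_sq (ldiff \<rho> v)) F \<le> real CARD('n) * path_const2 TYPE('n) m * T\<^sup>2" by simp
  qed simp
  then show ?thesis by (simp add: tail_norm_def infsum_nonneg)
qed

lemma dyadic_bracket:
  fixes x :: real
  assumes "x \<ge> 1" shows "\<exists>n. 2 ^ n \<le> x \<and> x \<le> 2 ^ Suc n"
proof -
  obtain m where m: "x < 2 ^ m" using real_arch_pow[of 2 x] by auto
  define k where "k = (LEAST k. x < 2 ^ k)"
  have k: "x < 2 ^ k" unfolding k_def by (rule LeastI[of _ m]) (rule m)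
  have "k \<noteq> 0" using k assms by (intro notI) simp
  then obtain n where n: "k = Suc n" using not0_implies_Suc by blast
  have "\<not> x < 2 ^ n" using not_less_Least[of n "\<lambda>k. x < 2 ^ k"] n by (simp add: k_def)
  then show ?thesis using k n by (intro exI[of _ n]) auto
qed

text \<open>Between \<open>2 ^ n * R\<close> and \<open>2 ^ (n + 1) * R\<close> the weight is at
  most \<open>2 powr a * (2 ^ n) powr a\<close>, and the tail hypothesis supplies
  \<open>(2 ^ n * R) powr - p\<close>. The shells sum to a geometric series of ratio
  \<open>2 powr (a - p)\<close>, convergent because \<open>a < p\<close>.\<close>

lemma dyadic_weighted_sum:
  fixes f g :: "'a \<Rightarrow> real"
  assumes F: "finite F" and R: "R > 0" and g: "\<And>l. l \<in> F \<Longrightarrow> R \<le> g l" and f: "\<And>l. l \<in> F \<Longrightarrow> f l \<ge> 0"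
    and X: "X \<ge> 0" and a: "a \<ge> 0" "a < p"
    and tail: "\<And>t. t \<ge> R \<Longrightarrow> (\<Sum>l\<in>{l\<in>F. t \<le> g l}. f l) \<le> X * t powr - p"
  shows "(\<Sum>l\<in>F. (g l / R) powr a * f l) \<le> 2 powr a / (1 - 2 powr (a - p)) * X * R powr - p"
proof -
  let ?q = "2 powr (a - p) :: real"
  have q: "0 < ?q" "?q < 1" using a by (auto simp: powr_less_one)
  have "\<forall>l\<in>F. \<exists>n. 2 ^ n \<le> g l / R \<and> g l / R \<le> 2 ^ Suc n" using g R by (intro ballI dyadic_bracket) simp
  then obtain n where n: "\<And>l. l \<in> F \<Longrightarrow> 2 ^ n l \<le> g l / R" "\<And>l. l \<in> F \<Longrightarrow> g l / R \<le> 2 ^ Suc (n l)"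
    by (auto dest!: bchoice)
  obtain N where N: "\<And>l. l \<in> F \<Longrightarrow> n l < N"
    using finite_nat_set_iff_bounded[of "n ` F"] F by auto
  have "(\<Sum>l\<in>F. (g l / R) powr a * f l) \<le> (\<Sum>l\<in>F. \<Sum>j<N. if 2 ^ j * R \<le> g l then 2 powr a * (2 ^ j) powr a * f l else 0)"
  proof (rule sum_mono)
    fix l assume l: "l \<in> F"
    have "(g l / R) powr a \<le> (2 ^ Suc (n l)) powr a"
      using n[OF l] g[OF l] R a by (intro powr_mono2) auto
    also have "\<dots> = 2 powr a * (2 ^ n l) powr a" by (simp add: powr_mult)
    finally have "(g l / R) powr a * f l \<le> 2 powr a * (2 ^ n l) powr a * f l" by (rule mult_right_mono[OF _ f[OF l]])
    also have "\<dots> = (if 2 ^ n l * R \<le> g l then 2 powr a * (2 ^ n l) powr a * f l else 0)"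
      using n(1)[OF l] R by (simp add: pos_le_divide_eq)
    also have "\<dots> \<le> (\<Sum>j<N. if 2 ^ j * R \<le> g l then 2 powr a * (2 ^ j) powr a * f l else 0)"
      using N[OF l] f[OF l]
      by (intro member_le_sum[of "n l" "{..<N}" "\<lambda>j. if 2 ^ j * R \<le> g l then 2 powr a * (2 ^ j) powr a * f l else 0"]) auto
    finally show "(g l / R) powr a * f l
      \<le> (\<Sum>j<N. if 2 ^ j * R \<le> g l then 2 powr a * (2 ^ j) powr a * f l else 0)" .
  qed
  also have "\<dots> = (\<Sum>j<N. \<Sum>l\<in>F. if 2 ^ j * R \<le> g l then 2 powr a * (2 ^ j) powr a * f l else 0)" by (rule sum.swap)
  also have "\<dots> = (\<Sum>j<N. 2 powr a * (2 ^ j) powr a * (\<Sum>l\<in>{l\<in>F. 2 ^ j * R \<le> g l}. f l))"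
    using F by (intro sum.cong refl) (simp add: sum.inter_filter[symmetric] sum_distrib_left)
  also have "\<dots> \<le> (\<Sum>j<N. 2 powr a * X * R powr - p * ?q ^ j)"
  proof (rule sum_mono)
    fix j
    have j1: "(2::real) ^ j \<ge> 1" by simp
    have "2 ^ j * R \<ge> R" using mult_right_mono[OF j1, of R] R by simp
    then have "2 powr a * (2 ^ j) powr a * (\<Sum>l\<in>{l\<in>F. 2 ^ j * R \<le> g l}. f l)
        \<le> 2 powr a * (2 ^ j) powr a * (X * (2 ^ j * R) powr - p)"
      by (intro mult_left_mono tail) auto
    also have "\<dots> = 2 powr a * X * R powr - p * ((2 ^ j) powr a * (2 ^ j) powr - p)"
      using R by (simp add: powr_mult)
    also have "((2::real) ^ j) powr a * (2 ^ j) powr - p = ?q ^ j"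
    proof -
      have "((2::real) ^ j) powr a * (2 ^ j) powr - p = (2 powr real j) powr (a - p)"
        by (simp add: powr_diff powr_minus divide_inverse powr_realpow)
      also have "\<dots> = ?q powr real j" by (simp only: powr_powr mult.commute)
      finally show ?thesis by (simp add: powr_realpow)
    qed
    finally show "2 powr a * (2 ^ j) powr a * (\<Sum>l\<in>{l\<in>F. 2 ^ j * R \<le> g l}. f l)
        \<le> 2 powr a * X * R powr - p * ?q ^ j" .
  qed
  also have "\<dots> = 2 powr a * X * R powr - p * (\<Sum>j<N. ?q ^ j)" by (simp add: sum_distrib_left)
  also have "\<dots> \<le> 2 powr a * X * R powr - p * (1 / (1 - ?q))"
  proof (rule mult_left_mono)
    have "(\<Sum>j<N. ?q ^ j) \<le> (\<Sum>j. ?q ^ j)" using q by (intro sum_le_suminf summable_geometric) auto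
    also have "\<dots> = 1 / (1 - ?q)" using q by (intro suminf_geometric) auto
    finally show "(\<Sum>j<N. ?q ^ j) \<le> 1 / (1 - ?q)" .
  qed (use X in auto)
  finally show ?thesis by (simp add: mult_ac)
qed

lemma l2_norm_le:
  assumes "X \<ge> 0" "\<And>F. finite F \<Longrightarrow> F \<subseteq> S \<Longrightarrow> (\<Sum>x\<in>F. (f x)\<^sup>2) \<le> X\<^sup>2"
  shows "l2_norm f S \<le> X"
proof -
  have "(\<Sum>\<^sub>\<infinity>x\<in>S. (f x)\<^sup>2) \<le> X\<^sup>2" by (rule infsum_le_sum_bound(2)) (use assms(2) in auto)
  then show ?thesis unfolding l2_norm_def using assms(1) by (intro real_le_lsqrt) auto
qed

section \<open>Decay at the sites and the size of the coupling error\<close>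

context equilibrium_state
begin

lemma lattice_tail_decay:
  obtains C where "C \<ge> 0"
    "\<And>r. r \<ge> 1 \<Longrightarrow> tail_norm (lat u) r \<le> C * real_of_int r powr (- (real CARD('n) / 2))"
    "\<And>r j. r \<ge> 1 \<Longrightarrow> tail_norm (ldiff (axis j 1) (lat u)) r \<le> C * real_of_int r powr (- (real CARD('n) / 2) - 1)"
proof -
  obtain c where c: "c > 0" "\<forall>\<phi>. finsupp \<phi> \<longrightarrow> c * infsum (grad_sq \<phi>) UNIV \<le> lform S beta \<phi> \<phi>"
    using lattice_stability by blast
  obtain \<delta> K where \<delta>: "\<delta> > 0" "K \<ge> 0" "\<forall>g g' w. stn S g \<le> \<delta> \<longrightarrow> stn S g' \<le> \<delta> \<longrightarrow>
    \<bar>remN g w - remN g' w\<bar> \<le> K * (stn S g + stn S g') * stn S (\<lambda>\<rho>. g \<rho> - g' \<rho>) * stn S w"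
    using remN_lipschitz by blast
  obtain R1 where R1: "R1 \<ge> 0" "\<forall>x. x \<notin> cube R1 \<longrightarrow> stn S (\<lambda>z. ldiff z (lat u) x) \<le> \<delta>"
    using stn_small[OF u_summable \<delta>(1)] by blast
  \<comment> \<open>Outside this cube the strain is in the Lipschitz range of the remainder, and
    stencils do not reach into the core.\<close>
  define m0 where "m0 = max R1 \<lceil>(Rdef + rcut) / alo\<rceil>"
  have m0: "m0 \<ge> 0" "\<lceil>(Rdef + rcut) / alo\<rceil> \<le> m0" "cube R1 \<subseteq> (cube m0 :: (int^'n) set)"
    using R1(1) cube_mono[of R1 m0] by (auto simp: m0_def)
  have far: "norm (iota A x) \<ge> Rdef + rcut" if "x \<notin> cube m0" for x
  proof -
    have "m0 < supn x" using that supn_le_iff[of x m0] by simp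
    then have "(Rdef + rcut) / alo \<le> real_of_int (supn x)" using m0(2) by linarith
    then have "Rdef + rcut \<le> alo * real_of_int (supn x)" using alo(1) by (simp add: pos_divide_le_eq mult.commute)
    then show ?thesis using alo(2) order_trans by blast
  qed
  obtain m1 K0 where eq: "m1 \<ge> 0" "K0 \<ge> 0" "\<forall>\<phi>. finsupp \<phi> \<longrightarrow>
    \<bar>lform S beta (lat u) \<phi> + infsum (\<lambda>x. remN (\<lambda>\<rho>. ldiff \<rho> (lat u) x) (\<lambda>\<rho>. ldiff \<rho> \<phi> x)) (- cube m0)\<bar>
      \<le> K0 * (\<Sum>x\<in>cube m1. sqrt (grad_sq \<phi> x))"
    using lattice_equation[OF m0(1) far] by blast
  interpret lattice_equilibrium S beta c MH mS "lat u" remN K K0 \<delta> m0 m1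
  proof (intro lattice_equilibrium.intro lattice_form.intro lattice_equilibrium_axioms.intro)
    show "S \<subseteq> cube mS" "mS \<ge> 1" by (rule mS)+
    show "bounded_bilinear (beta \<rho> \<sigma>)" for \<rho> \<sigma> by (rule beta_bilinear)
    show "\<bar>beta \<rho> \<sigma> x y\<bar> \<le> MH * norm x * norm y" for \<rho> \<sigma> x y by (rule beta_bound)
    show "beta \<rho> \<sigma> x y = beta \<sigma> \<rho> y x" for \<rho> \<sigma> x y by (rule beta_sym)
    show "remN (\<lambda>_. 0) w = 0" for w by (rule remN_zero)
    show "remN g (\<lambda>\<rho>. w \<rho> - w' \<rho>) = remN g w - remN g w'" for g w w' by (rule remN_diff)
    show "grad_sq (lat u) summable_on UNIV" by (rule u_summable)
  qed (use c \<delta> MH(1) m0 eq R1 in auto)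
  show thesis by (rule lattice_decay) (rule that)
qed

lemma far_site:
  assumes "l \<in> \<Lambda>" "norm l \<ge> Rdef"
  obtains x where "l = iota A x" "\<R> l = \<R>h"
proof -
  obtain x where "l = iota A x" using \<Lambda>_lattice[OF assms] by (rule rangeE)
  then show thesis using that stencil_outside[OF assms] by blast
qed

lemma D1_norm_le:
  assumes "\<R> (iota A x) = \<R>h"
  shows "D1_norm \<R> u (iota A x) \<le> stn S (\<lambda>z. ldiff z (lat u) x)"
proof -
  have "D1_norm \<R> u (iota A x) = stencil_norm \<R>h (Dl (lat u) x)"
    unfolding D1_norm_def assms stencil_norm_def
    by (rule L2_set_cong[OF refl]) (simp only: site_strain_lat)
  then show ?thesis using stencil_norm_lift[of "\<lambda>z. ldiff z (lat u) x"] by simp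
qed

text \<open>Dropping the restriction to common stencil entries only adds terms, and the full product
  of stencils is a double sum over integer bonds.\<close>

lemma D2_norm_le:
  assumes "\<R> (iota A x) = \<R>h"
  shows "(D2_norm \<R> u (iota A x))\<^sup>2 \<le> (\<Sum>z\<in>S. \<Sum>z'\<in>S. (norm (ldiff z (ldiff z' (lat u)) x))\<^sup>2)"
proof -
  let ?P = "SIGMA \<rho>:\<R>h. \<R>h \<inter> \<R> (iota A x + \<rho>)"
  let ?f = "\<lambda>(\<rho>, \<sigma>). (norm (fdiff \<rho> (fdiff \<sigma> u) (iota A x)))\<^sup>2"
  have "(D2_norm \<R> u (iota A x))\<^sup>2 = sum ?f ?P"
    unfolding D2_norm_def assms L2_set_def by (simp add: sum_nonneg case_prod_beta)
  also have "\<dots> \<le> sum ?f (\<R>h \<times> \<R>h)" using finite_\<R>h by (intro sum_mono2) auto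
  also have "\<R>h \<times> \<R>h = (\<lambda>(z, z'). (iota A z, iota A z')) ` (S \<times> S)"
    by (subst (1 2) \<R>h_eq) auto
  also have "sum ?f \<dots> = (\<Sum>(z, z')\<in>S \<times> S. (norm (ldiff z (ldiff z' (lat u)) x))\<^sup>2)"
  proof (subst sum.reindex)
    show "inj_on (\<lambda>(z, z'). (iota A z, iota A z')) (S \<times> S)"
      using injD[OF iota_inj] by (auto simp: inj_on_def)
    show "sum (?f \<circ> (\<lambda>(z, z'). (iota A z, iota A z'))) (S \<times> S) = (\<Sum>(z, z')\<in>S \<times> S. (norm (ldiff z (ldiff z' (lat u)) x))\<^sup>2)"
      by (rule sum.cong[OF refl]) (auto simp: fdiff_def ldiff_def iota_add add_ac)
  qed
  also have "\<dots> = (\<Sum>z\<in>S. \<Sum>z'\<in>S. (norm (ldiff z (ldiff z' (lat u)) x))\<^sup>2)" by (rule sum.cartesian_product[symmetric])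
  finally show ?thesis .
qed

lemma site_decay:
  "\<exists>C\<ge>0. \<exists>t0\<ge>1. \<forall>t\<ge>t0. \<forall>F. finite F \<longrightarrow> F \<subseteq> \<Lambda> - ball 0 t \<longrightarrow>
    (\<Sum>l\<in>F. (D1_norm \<R> u l)\<^sup>2) \<le> (C * t powr (- (real CARD('n) / 2)))\<^sup>2 \<and>
    (\<Sum>l\<in>F. (D2_norm \<R> u l)\<^sup>2) \<le> (C * t powr (- (real CARD('n) / 2) - 1))\<^sup>2"
proof -
  let ?p1 = "- (real CARD('n) / 2)" and ?p2 = "- (real CARD('n) / 2) - 1"
  obtain C where C: "C \<ge> 0" "\<And>r. r \<ge> 1 \<Longrightarrow> tail_norm (lat u) r \<le> C * real_of_int r powr ?p1"
    "\<And>r j. r \<ge> 1 \<Longrightarrow> tail_norm (ldiff (axis j 1) (lat u)) r \<le> C * real_of_int r powr ?p2"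
    using lattice_tail_decay by metis
  let ?d = "real CARD('n)" and ?s = "real (card S)" and ?k = "path_const2 TYPE('n) mS"
  have k0: "?k \<ge> 0" by (rule path_const2_nonneg)
  \<comment> \<open>A lattice point of norm at least \<open>t\<close> has integer coordinates of sup
    norm at least \<open>2 * a * t\<close>. With \<open>r\<close> about \<open>a * t\<close>, half
    of this is left for the two margins \<open>mS\<close> of a second difference.\<close>
  define a where "a = 1 / (2 * ahi * ?d)"
  have a: "a > 0" using ahi(1) by (simp add: a_def)
  define t0 where "t0 = Max {1, Rdef, (2 * real_of_int mS + 2) / a}"
  have t0: "t0 \<ge> 1" "t0 \<ge> Rdef" "t0 \<ge> (2 * real_of_int mS + 2) / a" by (auto simp: t0_def)
  define C1 where "C1 = C * sqrt (?s * ?s * ?k) * (a / 2) powr ?p1"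
  define C2 where "C2 = C * sqrt (?s * ?s * ?k * (?d * ?k)) * (a / 2) powr ?p2"
  have C12: "C1 \<ge> 0" "C2 \<ge> 0" using C(1) k0 by (auto simp: C1_def C2_def)
  have main: "(\<Sum>l\<in>F. (D1_norm \<R> u l)\<^sup>2) \<le> (C1 * t powr ?p1)\<^sup>2 \<and> (\<Sum>l\<in>F. (D2_norm \<R> u l)\<^sup>2) \<le> (C2 * t powr ?p2)\<^sup>2"
    if t: "t \<ge> t0" and F: "finite F" "F \<subseteq> \<Lambda> - ball 0 t" for t F
  proof -
    define r where "r = \<lfloor>a * t\<rfloor>"
    have tp: "t > 0" using t t0 by linarith
    have "(2 * real_of_int mS + 2) / a \<le> t" using t t0 by linarith
    then have at: "2 * real_of_int mS + 2 \<le> a * t" using a by (simp add: pos_divide_le_eq mult.commute)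
    have r: "r \<ge> 1" "real_of_int r \<le> a * t" "a / 2 * t \<le> real_of_int r"
    proof -
      show "real_of_int r \<le> a * t" by (simp add: r_def)
      have "a * t < real_of_int r + 1" unfolding r_def by linarith
      then show "r \<ge> 1" "a / 2 * t \<le> real_of_int r" using at mS(1) by linarith+
    qed
    have powr_r: "C * real_of_int r powr p \<le> C * ((a / 2) powr p * t powr p)" if "p \<le> 0" for p
    proof -
      have "real_of_int r powr p \<le> (a / 2 * t) powr p" using r a tp that by (intro powr_mono2') auto
      also have "\<dots> = (a / 2) powr p * t powr p" by (rule powr_mult)
      finally show ?thesis using C(1) by (rule mult_left_mono)
    qed
    define X where "X = iota A -` F"
    have site: "\<exists>x. l = iota A x \<and> \<R> l = \<R>h" if "l \<in> F" for l
    proof -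
      have "l \<in> \<Lambda>" "norm l \<ge> Rdef" using that F(2) t t0(2) by auto
      then obtain x where "l = iota A x" "\<R> l = \<R>h" by (rule far_site)
      then show ?thesis by blast
    qed
    have FX: "F = iota A ` X" using site unfolding X_def by blast
    have fX: "finite X" unfolding X_def by (rule finite_vimageI[OF F(1) iota_inj])
    have inj: "inj_on (iota A) X" by (rule inj_on_subset[OF iota_inj subset_UNIV])
    have \<R>X: "\<R> (iota A x) = \<R>h" if "x \<in> X" for x using site[of "iota A x"] that by (auto simp: X_def)
    have dis: "X \<inter> cube (r + mS + mS) = {}"
    proof (rule equals0I)
      fix x assume x: "x \<in> X \<inter> cube (r + mS + mS)"
      then have "t \<le> norm (iota A x)" using F(2) by (auto simp: X_def)
      also have "\<dots> \<le> ahi * (?d * real_of_int (supn x))" by (rule norm_iota_le)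
      also have "\<dots> \<le> ahi * (?d * real_of_int (r + mS + mS))"
        using x supn_le_iff[of x "r + mS + mS"] ahi(1) by (intro mult_left_mono) auto
      also have "\<dots> = real_of_int (r + mS + mS) / (2 * a)" using ahi(1) by (simp add: a_def)
      finally have "2 * a * t \<le> real_of_int (r + mS + mS)" using a by (simp add: pos_le_divide_eq mult_ac)
      then show False using r(2) at by simp
    qed
    have dis': "X \<inter> cube (r + mS) = {}" using dis cube_mono[of "r + mS" "r + mS + mS"] mS(1) by auto
    have Scube: "z \<in> cube mS" if "z \<in> S" for z using mS(2) that by blast
    have "(\<Sum>l\<in>F. (D1_norm \<R> u l)\<^sup>2) = (\<Sum>x\<in>X. (D1_norm \<R> u (iota A x))\<^sup>2)"
      unfolding FX by (rule sum.reindex[OF inj, unfolded o_def])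
    also have "\<dots> \<le> (\<Sum>x\<in>X. ?s * (\<Sum>z\<in>S. (norm (ldiff z (lat u) x))\<^sup>2))"
    proof (rule sum_mono)
      fix x assume "x \<in> X"
      from D1_norm_le[OF \<R>X[OF this]]
      have "(D1_norm \<R> u (iota A x))\<^sup>2 \<le> (stn S (\<lambda>z. ldiff z (lat u) x))\<^sup>2"
        by (intro power_mono) (simp_all add: D1_norm_def hm.p_nonneg stencil_norm_def L2_set_nonneg)
      then show "(D1_norm \<R> u (iota A x))\<^sup>2 \<le> ?s * (\<Sum>z\<in>S. (norm (ldiff z (lat u) x))\<^sup>2)"
        by (rule order_trans) (rule stn_sq_le)
    qed
    also have "\<dots> = ?s * (\<Sum>z\<in>S. \<Sum>x\<in>X. (norm (ldiff z (lat u) x))\<^sup>2)"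
      by (subst sum.swap) (simp add: sum_distrib_left)
    also have "\<dots> \<le> ?s * (\<Sum>z\<in>S. ?k * (tail_norm (lat u) r)\<^sup>2)"
      by (intro mult_left_mono sum_mono sum_ldiff_sq_tail u_summable Scube fX dis') auto
    also have "\<dots> = ?s * ?s * ?k * (tail_norm (lat u) r)\<^sup>2" by simp
    also have "\<dots> \<le> ?s * ?s * ?k * (C * ((a / 2) powr ?p1 * t powr ?p1))\<^sup>2"
      using k0 order_trans[OF C(2)[OF r(1)] powr_r[of ?p1]]
      by (intro mult_left_mono power_mono tail_norm_nonneg) auto
    also have "\<dots> = (C1 * t powr ?p1)\<^sup>2" using k0 by (simp add: C1_def power_mult_distrib mult_ac)
    finally have D1: "(\<Sum>l\<in>F. (D1_norm \<R> u l)\<^sup>2) \<le> (C1 * t powr ?p1)\<^sup>2" .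
    define T where "T = C * ((a / 2) powr ?p2 * t powr ?p2)"
    have T: "tail_norm (ldiff (axis j 1) (lat u)) r \<le> T" for j
      unfolding T_def using order_trans[OF C(3)[OF r(1)] powr_r[of ?p2]] by simp
    have "(\<Sum>l\<in>F. (D2_norm \<R> u l)\<^sup>2) = (\<Sum>x\<in>X. (D2_norm \<R> u (iota A x))\<^sup>2)"
      unfolding FX by (rule sum.reindex[OF inj, unfolded o_def])
    also have "\<dots> \<le> (\<Sum>x\<in>X. \<Sum>z\<in>S. \<Sum>z'\<in>S. (norm (ldiff z (ldiff z' (lat u)) x))\<^sup>2)"
      by (intro sum_mono D2_norm_le \<R>X)
    also have "\<dots> = (\<Sum>z\<in>S. \<Sum>z'\<in>S. \<Sum>x\<in>X. (norm (ldiff z (ldiff z' (lat u)) x))\<^sup>2)"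
      by (subst sum.swap) (intro sum.cong refl sum.swap)
    also have "\<dots> \<le> (\<Sum>z\<in>S. \<Sum>z'\<in>S. ?k * (?d * ?k * T\<^sup>2))"
    proof (intro sum_mono)
      fix z z' assume z: "z \<in> S" "z' \<in> S"
      have "(\<Sum>x\<in>X. (norm (ldiff z (ldiff z' (lat u)) x))\<^sup>2) \<le> ?k * (tail_norm (ldiff z' (lat u)) (r + mS))\<^sup>2"
        by (intro sum_ldiff_sq_tail grad_sq_ldiff_summable u_summable Scube z fX dis)
      also have "\<dots> \<le> ?k * (?d * ?k * T\<^sup>2)"
        by (intro mult_left_mono tail_norm_ldiff u_summable Scube z T k0)
      finally show "(\<Sum>x\<in>X. (norm (ldiff z (ldiff z' (lat u)) x))\<^sup>2) \<le> ?k * (?d * ?k * T\<^sup>2)" .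
    qed
    also have "\<dots> = (C2 * t powr ?p2)\<^sup>2" using k0 by (simp add: C2_def T_def power_mult_distrib mult_ac)
    finally show ?thesis using D1 by blast
  qed
  have "(\<Sum>l\<in>F. (D1_norm \<R> u l)\<^sup>2) \<le> (max C1 C2 * t powr ?p1)\<^sup>2 \<and> (\<Sum>l\<in>F. (D2_norm \<R> u l)\<^sup>2) \<le> (max C1 C2 * t powr ?p2)\<^sup>2"
    if t: "t \<ge> t0" and F: "finite F" "F \<subseteq> \<Lambda> - ball 0 t" for t F
  proof -
    have "(C1 * t powr ?p1)\<^sup>2 \<le> (max C1 C2 * t powr ?p1)\<^sup>2" "(C2 * t powr ?p2)\<^sup>2 \<le> (max C1 C2 * t powr ?p2)\<^sup>2"
      using C12 by (auto intro!: power_mono mult_right_mono)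
    then show ?thesis using main[OF t F] by linarith
  qed
  then show ?thesis using C12(1) t0(1) by (intro exI[of _ "max C1 C2"] exI[of _ t0] conjI) auto
qed

lemma ac_bound_decay:
  fixes c2 c4 \<beta> :: real
  assumes c: "c2 > 0" "c4 > 0" and \<beta>: "\<beta> < (real CARD('n) + 2) / 2"
  obtains C R1 where "C \<ge> 0" "R1 \<ge> 1"
    "\<And>R \<omega> \<T>c Rc. R \<ge> R1 \<Longrightarrow> c2 * R powr (1 + 2 / real CARD('n)) \<le> Rc \<Longrightarrow>
      \<forall>x\<in>\<omega> - ball 0 R. \<bar>mesh_size \<T>c x\<bar> \<le> c4 * (norm x / R) powr \<beta> \<Longrightarrow>
      ac_bound \<Lambda> \<R> \<omega> \<T>c R Rc u \<le> C * R powr (- (real CARD('n) / 2) - 1)"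
proof -
  let ?d = "real CARD('n)"
  let ?p1 = "- (?d / 2)" and ?p2 = "- (?d / 2) - 1"
  obtain C t0 where C: "C \<ge> 0" and t0: "t0 \<ge> 1"
    and D: "\<And>t F. t \<ge> t0 \<Longrightarrow> finite F \<Longrightarrow> F \<subseteq> \<Lambda> - ball 0 t \<Longrightarrow> (\<Sum>l\<in>F. (D1_norm \<R> u l)\<^sup>2) \<le> (C * t powr ?p1)\<^sup>2"
      "\<And>t F. t \<ge> t0 \<Longrightarrow> finite F \<Longrightarrow> F \<subseteq> \<Lambda> - ball 0 t \<Longrightarrow> (\<Sum>l\<in>F. (D2_norm \<R> u l)\<^sup>2) \<le> (C * t powr ?p2)\<^sup>2"
    using site_decay by metis
  \<comment> \<open>A negative \<beta> may be replaced by 0, as \<open>norm l / R \<ge> 1\<close> on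
    the region. The hypothesis on \<beta> puts \<open>b\<close> below \<open>?d + 2\<close>, the
    decay rate of the squared tail of the strain gradient.\<close>
  define b where "b = 2 * max \<beta> 0"
  have b: "b \<ge> 0" "b < ?d + 2" using \<beta> by (auto simp: b_def)
  define Kd where "Kd = 2 powr b / (1 - 2 powr (b - (?d + 2)))"
  have "2 powr (b - (?d + 2)) < 1" using b by (simp add: powr_less_one)
  then have Kd: "Kd \<ge> 0" by (simp add: Kd_def)
  \<comment> \<open>Both \<open>R\<close> and \<open>c2 / 2 * R\<close>, a lower bound for
    \<open>Rc / 2\<close>, have to lie in the range of \<open>site_decay\<close>.\<close>
  define R1 where "R1 = max t0 (2 * t0 / c2)"
  define C' where "C' = c4 * C * sqrt Kd + C * (c2 / 2) powr ?p1"
  have bound: "ac_bound \<Lambda> \<R> \<omega> \<T>c R Rc u \<le> C' * R powr ?p2"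
    if R: "R \<ge> R1" and Rc: "c2 * R powr (1 + 2 / ?d) \<le> Rc"
      and h: "\<forall>x\<in>\<omega> - ball 0 R. \<bar>mesh_size \<T>c x\<bar> \<le> c4 * (norm x / R) powr \<beta>" for R \<omega> \<T>c Rc
  proof -
    have "R \<ge> t0" "2 * t0 / c2 \<le> R" using R by (simp_all add: R1_def)
    then have R': "R \<ge> t0" "R \<ge> 1" "R > 0" "2 * t0 \<le> c2 * R"
      using t0 c(1) by (simp_all add: pos_divide_le_eq mult.commute[of R])
    have "l2_norm (\<lambda>l. mesh_size \<T>c l * D2_norm \<R> u l) (\<Lambda> \<inter> (\<omega> - ball 0 R)) \<le> c4 * C * sqrt Kd * R powr ?p2"
    proof (rule l2_norm_le)
      fix F assume F: "finite F" "F \<subseteq> \<Lambda> \<inter> (\<omega> - ball 0 R)"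
      have "(\<Sum>l\<in>F. (mesh_size \<T>c l * D2_norm \<R> u l)\<^sup>2) \<le> (\<Sum>l\<in>F. c4\<^sup>2 * ((norm l / R) powr b * (D2_norm \<R> u l)\<^sup>2))"
      proof (rule sum_mono)
        fix l assume "l \<in> F"
        then have l: "l \<in> \<omega> - ball 0 R" "norm l \<ge> R" using F(2) by auto
        have "\<bar>mesh_size \<T>c l\<bar> \<le> c4 * (norm l / R) powr \<beta>" using h l(1) by blast
        also have "\<dots> \<le> c4 * (norm l / R) powr max \<beta> 0"
          using l(2) R'(3) c(2) by (intro mult_left_mono powr_mono) auto
        finally have "\<bar>mesh_size \<T>c l\<bar>\<^sup>2 \<le> (c4 * (norm l / R) powr max \<beta> 0)\<^sup>2" by (intro power_mono) auto
        also have "\<dots> = c4\<^sup>2 * (norm l / R) powr b"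
          by (simp add: power_mult_distrib b_def power2_eq_square powr_add[symmetric])
        finally show "(mesh_size \<T>c l * D2_norm \<R> u l)\<^sup>2 \<le> c4\<^sup>2 * ((norm l / R) powr b * (D2_norm \<R> u l)\<^sup>2)"
          unfolding power_mult_distrib mult.assoc[symmetric] by (intro mult_right_mono) auto
      qed
      also have "\<dots> = c4\<^sup>2 * (\<Sum>l\<in>F. (norm l / R) powr b * (D2_norm \<R> u l)\<^sup>2)" by (simp add: sum_distrib_left)
      also have "\<dots> \<le> c4\<^sup>2 * (Kd * C\<^sup>2 * R powr - (?d + 2))"
        unfolding Kd_def
      proof (intro mult_left_mono dyadic_weighted_sum F(1) R'(3) b)
        show "R \<le> norm l" if "l \<in> F" for l using that F(2) by auto
        fix t assume t: "R \<le> t"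
        have "(\<Sum>l\<in>{l\<in>F. t \<le> norm l}. (D2_norm \<R> u l)\<^sup>2) \<le> (C * t powr ?p2)\<^sup>2"
          using t R' F by (intro D(2)) auto
        also have "\<dots> = C\<^sup>2 * t powr - (?d + 2)"
        proof -
          have "?p2 + ?p2 = - (?d + 2)" by simp
          then show ?thesis by (simp only: power_mult_distrib power2_eq_square[of "t powr ?p2"] powr_add[symmetric])
        qed
        finally show "(\<Sum>l\<in>{l\<in>F. t \<le> norm l}. (D2_norm \<R> u l)\<^sup>2) \<le> C\<^sup>2 * t powr - (?d + 2)" .
      qed auto
      also have "\<dots> = (c4 * C * sqrt Kd * R powr ?p2)\<^sup>2"
      proof -
        have "?p2 + ?p2 = - (?d + 2)" by simp
        then have "(R powr ?p2)\<^sup>2 = R powr - (?d + 2)"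
          by (simp only: power2_eq_square[of "R powr ?p2"] powr_add[symmetric])
        then show ?thesis using Kd by (simp only: power_mult_distrib real_sqrt_pow2 mult_ac)
      qed
      finally show "(\<Sum>l\<in>F. (mesh_size \<T>c l * D2_norm \<R> u l)\<^sup>2) \<le> (c4 * C * sqrt Kd * R powr ?p2)\<^sup>2" .
    qed (use c C Kd in auto)
    moreover have "l2_norm (D1_norm \<R> u) (\<Lambda> - ball 0 (Rc / 2)) \<le> C * (c2 / 2) powr ?p1 * R powr ?p2"
    proof -
      let ?t = "c2 / 2 * R powr (1 + 2 / ?d)"
      have "R powr 1 \<le> R powr (1 + 2 / ?d)" using R' by (intro powr_mono) auto
      then have "c2 * R \<le> c2 * R powr (1 + 2 / ?d)" using R' c(1) by (intro mult_left_mono) auto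
      then have t: "t0 \<le> ?t" "?t \<le> Rc / 2" using R'(4) Rc by auto
      have "l2_norm (D1_norm \<R> u) (\<Lambda> - ball 0 (Rc / 2)) \<le> C * ?t powr ?p1"
        using C t by (intro l2_norm_le D(1)) auto
      also have "?t powr ?p1 = (c2 / 2) powr ?p1 * (R powr (1 + 2 / ?d)) powr ?p1"
        using c(1) by (simp only: powr_mult)
      also have "(R powr (1 + 2 / ?d)) powr ?p1 = R powr ?p2"
      proof -
        \<comment> \<open>The origin of the exponent in the choice of \<open>Rc\<close>: it balances
          the truncation of the far field against the coarsening of the mesh.\<close>
        have "(1 + 2 / ?d) * ?p1 = ?p2" by (simp add: field_simps)
        then show ?thesis by (simp only: powr_powr)
      qed
      finally show ?thesis by (simp only: mult.assoc)
    qed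
    ultimately show ?thesis unfolding ac_bound_def C'_def distrib_right by linarith
  qed
  show thesis
  proof (rule that[of C' R1])
    show "C' \<ge> 0" using c C Kd by (auto simp: C'_def)
    show "R1 \<ge> 1" using t0 by (simp add: R1_def)
  qed (rule bound)
qed

end

section \<open>The rate of convergence\<close>

theorem proposition2p10:
  fixes A :: "real^'n^'n" and Rdef rcut :: real
    and \<Lambda> :: "(real^'n) set" and \<T> :: "(real^'n) set set"
    and \<R> :: "real^'n \<Rightarrow> (real^'n) set" and \<R>h :: "(real^'n) set"
    and V :: "real^'n \<Rightarrow> (real^'n \<Rightarrow> real^'n) \<Rightarrow> real" and Vh :: "(real^'n \<Rightarrow> real^'n) \<Rightarrow> real"
    and Vi :: "real \<Rightarrow> real^'n \<Rightarrow> (real^'n \<Rightarrow> real^'n) \<Rightarrow> real"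
    and k :: nat
    and E :: "(real^'n \<Rightarrow> real^'n) \<Rightarrow> real" and u :: "real^'n \<Rightarrow> real^'n"
    and \<eta> c0 c1 c2 c3 c4 \<beta> :: real
  assumes defect: "point_defect A Rdef rcut \<Lambda> \<T> \<R> \<R>h V Vh k"
    and energy: "energy_extension \<Lambda> \<T> V k E"
    and stable: "strongly_stable \<Lambda> \<T> E u"
    and constants: "\<eta> > 0" "c0 > 0" "c1 > 0" "c2 > 0" "c3 > 0" "c4 > 0"
    and beta: "\<beta> < (real CARD('n) + 2) / 2"
  shows "\<exists>C. \<forall>(I :: real set) (Rc :: real \<Rightarrow> real)
      (\<Omega>a :: real \<Rightarrow> (real^'n) set) (\<Omega>i :: real \<Rightarrow> (real^'n) set)
      (\<omega> :: real \<Rightarrow> (real^'n) set) (\<T>c :: real \<Rightarrow> (real^'n) set set).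
    I \<subseteq> {0<..} \<longrightarrow>
    (\<forall>R\<in>I. ac_coupling \<Lambda> \<R>h k (Vi R) (\<Omega>a R) (\<Omega>i R) (\<omega> R) (\<T>c R)) \<longrightarrow>
    (\<forall>R\<in>I. ball 0 R \<inter> \<Lambda> \<subseteq> \<Omega>a R \<and> ball 0 (Rc R) \<subseteq> \<omega> R \<and> \<omega> R \<subseteq> ball 0 (c0 * Rc R)) \<longrightarrow>
    (\<forall>R\<in>I. ac_bound \<Lambda> \<R> (\<omega> R) (\<T>c R) R (Rc R) u \<le> \<eta> \<longrightarrow>
       (\<exists>uac. strongly_stable_ac (\<omega> R) (\<T>c R)
                (ac_energy \<Lambda> V Vh (Vi R) (\<Omega>a R) (\<Omega>i R) (\<T>c R)) uac \<and>
              gradient_error \<Lambda> \<T> uac u \<le> c1 * ac_bound \<Lambda> \<R> (\<omega> R) (\<T>c R) R (Rc R) u)) \<longrightarrow>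
    (\<forall>R\<in>I. c2 * R powr (1 + 2 / real CARD('n)) \<le> Rc R \<and>
       Rc R \<le> c3 * R powr (1 + 2 / real CARD('n)) \<and>
       (\<forall>x\<in>\<omega> R - ball 0 R. \<bar>mesh_size (\<T>c R) x\<bar> \<le> c4 * (norm x / R) powr \<beta>)) \<longrightarrow>
    (\<exists>R0. \<forall>R\<in>I. R0 \<le> R \<longrightarrow>
       (\<exists>uac. strongly_stable_ac (\<omega> R) (\<T>c R)
                (ac_energy \<Lambda> V Vh (Vi R) (\<Omega>a R) (\<Omega>i R) (\<T>c R)) uac \<and>
              gradient_error \<Lambda> \<T> uac u \<le> c1 * ac_bound \<Lambda> \<R> (\<omega> R) (\<T>c R) R (Rc R) u) \<and>
       (\<forall>uac. strongly_stable_ac (\<omega> R) (\<T>c R)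
                (ac_energy \<Lambda> V Vh (Vi R) (\<Omega>a R) (\<Omega>i R) (\<T>c R)) uac \<and>
              gradient_error \<Lambda> \<T> uac u \<le> c1 * ac_bound \<Lambda> \<R> (\<omega> R) (\<T>c R) R (Rc R) u \<longrightarrow>
              gradient_error \<Lambda> \<T> uac u \<le> C * R powr (- (real CARD('n) / 2) - 1)))"
proof -
  let ?p = "- (real CARD('n) / 2) - 1"
  interpret equilibrium_state A Rdef rcut \<Lambda> \<T> \<R> \<R>h V Vh k E u
    by (rule equilibrium_state.intro[OF defect equilibrium_state_axioms.intro[OF energy stable]])
  obtain C R1 where C: "C \<ge> 0" and R1: "R1 \<ge> 1"
    and bound: "\<And>R \<omega> \<T>c Rc. R \<ge> R1 \<Longrightarrow> c2 * R powr (1 + 2 / real CARD('n)) \<le> Rc \<Longrightarrow>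
      \<forall>x\<in>\<omega> - ball 0 R. \<bar>mesh_size \<T>c x\<bar> \<le> c4 * (norm x / R) powr \<beta> \<Longrightarrow>
      ac_bound \<Lambda> \<R> \<omega> \<T>c R Rc u \<le> C * R powr ?p"
    by (rule ac_bound_decay[OF constants(4,6) beta]) (rule that, assumption+)
  \<comment> \<open>The exponent is at most -1, so \<open>R \<ge> C / \<eta>\<close> brings the
    bound below \<eta> and hypothesis (b) applies.\<close>
  define R0 where "R0 = max R1 (C / \<eta>)"
  have small: "C * R powr ?p \<le> \<eta>" if "R \<ge> R0" for R
  proof -
    have R: "R \<ge> 1" "C / \<eta> \<le> R" using that R1 by (auto simp: R0_def)
    have "R powr ?p \<le> R powr - 1" using R(1) by (intro powr_mono) auto
    then have "C * R powr ?p \<le> C * inverse R" using C R(1) by (intro mult_left_mono) (auto simp: powr_minus)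
    also have "\<dots> \<le> \<eta>" using R constants(1) by (simp add: field_simps)
    finally show ?thesis .
  qed
  show ?thesis
  \<comment> \<open>The constant is fixed before the family: \<open>C\<close> comes from the fixed
    data, \<open>c2\<close>, \<open>c4\<close> and \<beta>, and is uniform over regions, domains and
    meshes.\<close>
  proof (rule exI[of _ "c1 * C"], intro allI impI)
    fix I :: "real set" and Rc :: "real \<Rightarrow> real" and \<Omega>a \<Omega>i \<omega> :: "real \<Rightarrow> (real^'n) set"
      and \<T>c :: "real \<Rightarrow> (real^'n) set set"
    assume sol: "\<forall>R\<in>I. ac_bound \<Lambda> \<R> (\<omega> R) (\<T>c R) R (Rc R) u \<le> \<eta> \<longrightarrow>
       (\<exists>uac. strongly_stable_ac (\<omega> R) (\<T>c R)
                (ac_energy \<Lambda> V Vh (Vi R) (\<Omega>a R) (\<Omega>i R) (\<T>c R)) uac \<and>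
              gradient_error \<Lambda> \<T> uac u \<le> c1 * ac_bound \<Lambda> \<R> (\<omega> R) (\<T>c R) R (Rc R) u)"
      and mesh: "\<forall>R\<in>I. c2 * R powr (1 + 2 / real CARD('n)) \<le> Rc R \<and>
       Rc R \<le> c3 * R powr (1 + 2 / real CARD('n)) \<and>
       (\<forall>x\<in>\<omega> R - ball 0 R. \<bar>mesh_size (\<T>c R) x\<bar> \<le> c4 * (norm x / R) powr \<beta>)"
    show "\<exists>R0. \<forall>R\<in>I. R0 \<le> R \<longrightarrow>
       (\<exists>uac. strongly_stable_ac (\<omega> R) (\<T>c R)
                (ac_energy \<Lambda> V Vh (Vi R) (\<Omega>a R) (\<Omega>i R) (\<T>c R)) uac \<and>
              gradient_error \<Lambda> \<T> uac u \<le> c1 * ac_bound \<Lambda> \<R> (\<omega> R) (\<T>c R) R (Rc R) u) \<and>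
       (\<forall>uac. strongly_stable_ac (\<omega> R) (\<T>c R)
                (ac_energy \<Lambda> V Vh (Vi R) (\<Omega>a R) (\<Omega>i R) (\<T>c R)) uac \<and>
              gradient_error \<Lambda> \<T> uac u \<le> c1 * ac_bound \<Lambda> \<R> (\<omega> R) (\<T>c R) R (Rc R) u \<longrightarrow>
              gradient_error \<Lambda> \<T> uac u \<le> c1 * C * R powr ?p)"
    proof (rule exI[of _ R0], intro ballI impI)
      fix R assume R: "R \<in> I" "R0 \<le> R"
      have ac: "ac_bound \<Lambda> \<R> (\<omega> R) (\<T>c R) R (Rc R) u \<le> C * R powr ?p"
        using R mesh by (intro bound) (auto simp: R0_def)
      then have "ac_bound \<Lambda> \<R> (\<omega> R) (\<T>c R) R (Rc R) u \<le> \<eta>" using small[OF R(2)] by linarith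
      then have ex: "\<exists>uac. strongly_stable_ac (\<omega> R) (\<T>c R)
                (ac_energy \<Lambda> V Vh (Vi R) (\<Omega>a R) (\<Omega>i R) (\<T>c R)) uac \<and>
              gradient_error \<Lambda> \<T> uac u \<le> c1 * ac_bound \<Lambda> \<R> (\<omega> R) (\<T>c R) R (Rc R) u"
        using sol R(1) by blast
      have "c1 * ac_bound \<Lambda> \<R> (\<omega> R) (\<T>c R) R (Rc R) u \<le> c1 * C * R powr ?p"
        using mult_left_mono[OF ac, of c1] constants(3) by (simp add: mult.assoc)
      then have "\<forall>uac. strongly_stable_ac (\<omega> R) (\<T>c R)
                (ac_energy \<Lambda> V Vh (Vi R) (\<Omega>a R) (\<Omega>i R) (\<T>c R)) uac \<and>
              gradient_error \<Lambda> \<T> uac u \<le> c1 * ac_bound \<Lambda> \<R> (\<omega> R) (\<T>c R) R (Rc R) u \<longrightarrow>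
              gradient_error \<Lambda> \<T> uac u \<le> c1 * C * R powr ?p"
        by (intro allI impI) (erule conjE, rule order_trans)
      with ex show "(\<exists>uac. strongly_stable_ac (\<omega> R) (\<T>c R)
                (ac_energy \<Lambda> V Vh (Vi R) (\<Omega>a R) (\<Omega>i R) (\<T>c R)) uac \<and>
              gradient_error \<Lambda> \<T> uac u \<le> c1 * ac_bound \<Lambda> \<R> (\<omega> R) (\<T>c R) R (Rc R) u) \<and>
       (\<forall>uac. strongly_stable_ac (\<omega> R) (\<T>c R)
                (ac_energy \<Lambda> V Vh (Vi R) (\<Omega>a R) (\<Omega>i R) (\<T>c R)) uac \<and>
              gradient_error \<Lambda> \<T> uac u \<le> c1 * ac_bound \<Lambda> \<R> (\<omega> R) (\<T>c R) R (Rc R) u \<longrightarrow>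
              gradient_error \<Lambda> \<T> uac u \<le> c1 * C * R powr ?p)" by (rule conjI)
    qed
  qed
qed

end
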